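(* With the domain $\Omega\subset\mathbb{R}^3$, the sets $\omega_k,\Omega_k$ ($k=1,2,3$), the spaces $L^2_{\Gamma,s}(\Omega)$, $H^1_{\Gamma,s}(\Omega)$, $L_\oplus$, $H^0_\oplus$, $H^C_\oplus$ and the map $\imath_\oplus\colon L^2_{\Gamma,s}(\Omega)\to L_\oplus$ defined in the context, the following properties hold: (1) $\imath_\oplus(L^2_{\Gamma,s}(\Omega))=L_\oplus$ (both for $\Gamma=\emptyset$ and for $\Gamma=\Gamma_L$); (2) $\imath_\oplus(H^1_{\Gamma,s}(\Omega))=H^C_\oplus$ if $\Gamma=\emptyset$, and $\imath_\oplus(H^1_{\Gamma,s}(\Omega))=H^0_\oplus$ if $\Gamma=\Gamma_L$.
   Context: All functions are real-valued. Let $\omega\subset\mathbb{R}^2$ be a bounded connected open set with $C^2$ boundary, let $\omega_2=\omega_3$ be an open set with $C^2$ boundary and compact closure contained in $\omega$, and let $\omega_1:=\omega\setminus\overline{\omega_2}$ (not necessarily connected). Let $h_1,h_2,h_3>0$ with $h_1>h_2+h_3$. Points of $\mathbb{R}^3$ are written $(x,y)$ with $x\in\mathbb{R}^2$, $y\in\mathbb{R}$. Define $$\Omega:=(\omega\times\,]0,h_1[)\setminus\overline{(\omega_2\times\,]h_3,h_1-h_2[)},$$ $\Omega_1:=\omega_1\times\,]0,h_1[$, $\Omega_2:=\omega_2\times\,]h_1-h_2,h_1[$, $\Omega_3:=\omega_3\times\,]0,h_3[$, and $\Gamma_L:=(\partial\omega\times[0,h_1])\cup(\partial\omega_2\times[h_3,h_1-h_2])$.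 Let $\Gamma$ be either $\emptyset$ or $\Gamma_L$. $H^1_\Gamma(\Omega)$ is the closure in $H^1(\Omega)$ of the space of all $C^1(\overline\Omega)$ functions $u$ with $u=0$ on $\Gamma$. $H^1_{\Gamma,s}(\Omega):=\{u\in H^1_\Gamma(\Omega)\mid \nabla_y u=0 \text{ a.e.}\}$, where $\nabla_y u=\partial_y u$, and $L^2_{\Gamma,s}(\Omega)$ is the closure of $H^1_{\Gamma,s}(\Omega)$ in $L^2(\Omega)$. For $k=1,2,3$ let $H^1_s(\Omega_k):=\{u\in H^1(\Omega_k)\mid\nabla_y u=0\text{ a.e.}\}$ and let $L^2_s(\Omega_k)$ be its closure in $L^2(\Omega_k)$. Every $u\in L^2_s(\Omega_k)$ is a.e. equal on $\Omega_k$ to $(x,y)\mapsto v(x)$ for a unique $v\in L^2(\omega_k)$; set $\imath_k(u):=v$. If $u\in L^2_{\Gamma,s}(\Omega)$ then $u|_{\Omega_k}\in L^2_s(\Omega_k)$, and one defines $\imath_\oplus u:=(\imath_1(u|_{\Omega_1}),\imath_2(u|_{\Omega_2}),\imath_3(u|_{\Omega_3}))$. $L_\oplus:=L^2(\omega_1)\oplus L^2(\omega_2)\oplus L^2(\omega_3)$ and $H_\oplus:=H^1(\omega_1)\oplus H^1(\omega_2)\oplus H^1(\omega_3)$; elements are written $[u]=(u_1,u_2,u_3)$. Let ${}^\tau u_k$ denote the trace of $u_k$ on $\partial\omega_k$ and $\mathcal H^1$ the one-dimensional Hausdorff measure. Define $$H^0_\oplus:=\{[u]\in H_\oplus\mid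 u_k\in H^1_0(\omega_k)\text{ for }k=1,2,3\},$$ $$H^C_\oplus:=\{[u]\in H_\oplus\mid {}^\tau u_1(x)={}^\tau u_2(x)={}^\tau u_3(x)\ \ \mathcal H^1\text{-a.e. on }\partial\omega_2\}.$$ *)

theory Defs
  imports "HOL-Analysis.Analysis"
begin

section \<open>Differentiability classes\<close>

text \<open>Only meant for open \<open>S\<close>; differentiability at each point makes continuity of the function
  itself automatic in the successor case.\<close>

primrec Ck_on :: "nat \<Rightarrow> 'a::euclidean_space set \<Rightarrow> ('a \<Rightarrow> real) \<Rightarrow> bool" where
  "Ck_on 0 S f \<longleftrightarrow> continuous_on S f"
| "Ck_on (Suc k) S f \<longleftrightarrow>
     (\<exists>G. (\<forall>x\<in>S. (f has_derivative (\<lambda>h. G x \<bullet> h)) (at x)) \<and>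
          (\<forall>b\<in>Basis. Ck_on k S (\<lambda>x. G x \<bullet> b)))"

definition test_function :: "'a::euclidean_space set \<Rightarrow> ('a \<Rightarrow> real) \<Rightarrow> bool" where
  "test_function U \<phi> \<longleftrightarrow>
     (\<forall>k. Ck_on k UNIV \<phi>) \<and> compact (closure {x. \<phi> x \<noteq> 0}) \<and> closure {x. \<phi> x \<noteq> 0} \<subseteq> U"

text \<open>$C^1(\overline U)$: functions of class $C^1$ in the open set $U$ that extend continuously to
  the closure together with their gradient. The values on the boundary are those of the extension;
  the values outside the closure are irrelevant.\<close>

definition C1_closure :: "'a::euclidean_space set \<Rightarrow> ('a \<Rightarrow> real) \<Rightarrow> bool" where
  "C1_closure U u \<longleftrightarrow> continuous_on (closure U) u \<and>
     (\<exists>G. continuous_on (closure U) G \<and>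
          (\<forall>x\<in>U. (u has_derivative (\<lambda>h. G x \<bullet> h)) (at x)))"

text \<open>Near each boundary point, in suitable Cartesian coordinates, the set is the strict epigraph
  of a $C^2$ function; in particular it lies locally on one side of its boundary.\<close>

definition C2_boundary :: "(real^2) set \<Rightarrow> bool" where
  "C2_boundary U \<longleftrightarrow>
     (\<forall>p\<in>frontier U. \<exists>r>0. \<exists>e n. \<exists>\<gamma> :: real \<Rightarrow> real.
        norm e = 1 \<and> norm n = 1 \<and> e \<bullet> n = 0 \<and> Ck_on 2 UNIV \<gamma> \<and>
        U \<inter> ball p r = {x \<in> ball p r. \<gamma> (x \<bullet> e) < x \<bullet> n})"


section \<open>Square-integrable functions modulo null sets\<close>

text \<open>Elements of $L^2$ are genuine almost-everywhere classes, represented as sets of functions on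
  the whole type; \<open>lebesgue_on U\<close> ignores the values outside \<open>U\<close>, so members of a class are
  arbitrary there.\<close>

definition ae_class :: "'a measure \<Rightarrow> ('a \<Rightarrow> real) \<Rightarrow> ('a \<Rightarrow> real) set" where
  "ae_class M f = {g \<in> borel_measurable M. AE x in M. g x = f x}"

definition L2_of :: "'a measure \<Rightarrow> ('a \<Rightarrow> real) set set" where
  "L2_of M = {ae_class M f |f. f \<in> borel_measurable M \<and> integrable M (\<lambda>x. (f x)\<^sup>2)}"

definition rep :: "('a \<Rightarrow> real) set \<Rightarrow> 'a \<Rightarrow> real" where
  "rep u = (SOME f. f \<in> u)"

text \<open>Norm of the difference of two classes.\<close>

definition L2_dist :: "'a measure \<Rightarrow> ('a \<Rightarrow> real) set \<Rightarrow> ('a \<Rightarrow> real) set \<Rightarrow> real" where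
  "L2_dist M u v = sqrt (LINT x|M. (rep u x - rep v x)\<^sup>2)"

abbreviation L2 :: "'a::euclidean_space set \<Rightarrow> ('a \<Rightarrow> real) set set" where
  "L2 U \<equiv> L2_of (lebesgue_on U)"

definition L2_closure :: "'a::euclidean_space set \<Rightarrow> ('a \<Rightarrow> real) set set \<Rightarrow> ('a \<Rightarrow> real) set set" where
  "L2_closure U S = {u \<in> L2 U. \<forall>\<epsilon>>0. \<exists>v\<in>S. L2_dist (lebesgue_on U) u v < \<epsilon>}"

definition restrict_class :: "'a::euclidean_space set \<Rightarrow> ('a \<Rightarrow> real) set \<Rightarrow> ('a \<Rightarrow> real) set" where
  "restrict_class V u = ae_class (lebesgue_on V) (rep u)"


section \<open>Sobolev spaces\<close>

definition is_weak_partial ::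
  "'a::euclidean_space set \<Rightarrow> 'a \<Rightarrow> ('a \<Rightarrow> real) set \<Rightarrow> ('a \<Rightarrow> real) set \<Rightarrow> bool" where
  "is_weak_partial U b u g \<longleftrightarrow>
     (\<forall>\<phi>. test_function U \<phi> \<longrightarrow>
        (LINT x|lebesgue_on U. rep u x * frechet_derivative \<phi> (at x) b)
          = - (LINT x|lebesgue_on U. rep g x * \<phi> x))"

definition H1 :: "'a::euclidean_space set \<Rightarrow> ('a \<Rightarrow> real) set set" where
  "H1 U = {u \<in> L2 U. \<forall>b\<in>Basis. \<exists>g\<in>L2 U. is_weak_partial U b u g}"

definition weak_partial ::
  "'a::euclidean_space set \<Rightarrow> 'a \<Rightarrow> ('a \<Rightarrow> real) set \<Rightarrow> ('a \<Rightarrow> real) set" where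
  "weak_partial U b u = (THE g. g \<in> L2 U \<and> is_weak_partial U b u g)"

definition H1_dist ::
  "'a::euclidean_space set \<Rightarrow> ('a \<Rightarrow> real) set \<Rightarrow> ('a \<Rightarrow> real) set \<Rightarrow> real" where
  "H1_dist U u v =
     sqrt ((L2_dist (lebesgue_on U) u v)\<^sup>2 +
           (\<Sum>b\<in>Basis. (L2_dist (lebesgue_on U) (weak_partial U b u) (weak_partial U b v))\<^sup>2))"

definition H1_closure :: "'a::euclidean_space set \<Rightarrow> ('a \<Rightarrow> real) set set \<Rightarrow> ('a \<Rightarrow> real) set set" where
  "H1_closure U S = {u \<in> H1 U. \<forall>\<epsilon>>0. \<exists>v\<in>S. H1_dist U u v < \<epsilon>}"

definition H1_0 :: "'a::euclidean_space set \<Rightarrow> ('a \<Rightarrow> real) set set" where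
  "H1_0 U = H1_closure U {ae_class (lebesgue_on U) \<phi> |\<phi>. test_function U \<phi>}"


section \<open>One-dimensional Hausdorff measure and boundary traces\<close>

definition hausdorff1_outer :: "'a::metric_space set \<Rightarrow> ennreal" where
  "hausdorff1_outer A =
     (SUP \<delta>\<in>{0<..}. INF C\<in>{C :: nat \<Rightarrow> 'a set.
          A \<subseteq> (\<Union>i. C i) \<and> (\<forall>i. bounded (C i) \<and> diameter (C i) \<le> \<delta>)}.
        (\<Sum>i. ennreal (diameter (C i))))"

definition hausdorff1 :: "'a::metric_space measure" where
  "hausdorff1 = measure_of UNIV (sets borel) hausdorff1_outer"

definition boundary_measure :: "(real^2) set \<Rightarrow> (real^2) measure" where
  "boundary_measure U = restrict_space hausdorff1 (frontier U)"

text \<open>The trace of $u \in H^1(U)$ is the limit in $L^2(\partial U, \mathcal{H}^1)$ of the boundary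
  values of functions in $C^1(\overline U)$ converging to $u$ in $H^1(U)$, i.e. the value at $u$ of
  the continuous extension to $H^1(U)$ of the restriction map on $C^1(\overline U)$.\<close>

definition boundary_trace :: "(real^2) set \<Rightarrow> (real^2 \<Rightarrow> real) set \<Rightarrow> (real^2 \<Rightarrow> real) set" where
  "boundary_trace U u = (THE g. g \<in> L2_of (boundary_measure U) \<and>
     (\<exists>\<phi> :: nat \<Rightarrow> real^2 \<Rightarrow> real.
        (\<forall>n. C1_closure U (\<phi> n)) \<and>
        (\<lambda>n. H1_dist U (ae_class (lebesgue_on U) (\<phi> n)) u) \<longlonglongrightarrow> 0 \<and>
        (\<lambda>n. L2_dist (boundary_measure U) (ae_class (boundary_measure U) (\<phi> n)) g) \<longlonglongrightarrow> 0))"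


section \<open>The spaces and the map of the theorem\<close>

text \<open>Points of $\mathbb{R}^3$ are pairs $(x,y)$ with $x \in \mathbb{R}^2$, $y \in \mathbb{R}$;
  the basis vector \<open>(0, 1)\<close> is the direction of $y$.\<close>

definition H1_Gamma ::
  "((real^2) \<times> real) set \<Rightarrow> ((real^2) \<times> real) set \<Rightarrow> ((real^2) \<times> real \<Rightarrow> real) set set" where
  "H1_Gamma \<Gamma> \<Omega> =
     H1_closure \<Omega> {ae_class (lebesgue_on \<Omega>) u |u. C1_closure \<Omega> u \<and> (\<forall>p\<in>\<Gamma>. u p = 0)}"

definition H1_Gamma_s ::
  "((real^2) \<times> real) set \<Rightarrow> ((real^2) \<times> real) set \<Rightarrow> ((real^2) \<times> real \<Rightarrow> real) set set" where
  "H1_Gamma_s \<Gamma> \<Omega> =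
     {u \<in> H1_Gamma \<Gamma> \<Omega>. weak_partial \<Omega> (0, 1) u = ae_class (lebesgue_on \<Omega>) (\<lambda>_. 0)}"

definition L2_Gamma_s ::
  "((real^2) \<times> real) set \<Rightarrow> ((real^2) \<times> real) set \<Rightarrow> ((real^2) \<times> real \<Rightarrow> real) set set" where
  "L2_Gamma_s \<Gamma> \<Omega> = L2_closure \<Omega> (H1_Gamma_s \<Gamma> \<Omega>)"

text \<open>For \<open>\<Omega>k\<close> a cylinder with base \<open>\<omega>k\<close>: the class \<open>v\<close> on the base with $u(x,y) = v(x)$ almost
  everywhere on the cylinder.\<close>

definition iota ::
  "(real^2) set \<Rightarrow> ((real^2) \<times> real) set \<Rightarrow> ((real^2) \<times> real \<Rightarrow> real) set \<Rightarrow> (real^2 \<Rightarrow> real) set" where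
  "iota \<omega>k \<Omega>k u =
     (THE v. v \<in> L2 \<omega>k \<and> (AE p in lebesgue_on \<Omega>k. rep u p = rep v (fst p)))"

definition iota_oplus ::
  "(real^2) set \<Rightarrow> (real^2) set \<Rightarrow> (real^2) set \<Rightarrow>
   ((real^2) \<times> real) set \<Rightarrow> ((real^2) \<times> real) set \<Rightarrow> ((real^2) \<times> real) set \<Rightarrow>
   ((real^2) \<times> real \<Rightarrow> real) set \<Rightarrow>
   (real^2 \<Rightarrow> real) set \<times> (real^2 \<Rightarrow> real) set \<times> (real^2 \<Rightarrow> real) set" where
  "iota_oplus \<omega>1 \<omega>2 \<omega>3 \<Omega>1 \<Omega>2 \<Omega>3 u =
     (iota \<omega>1 \<Omega>1 (restrict_class \<Omega>1 u),
      iota \<omega>2 \<Omega>2 (restrict_class \<Omega>2 u),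
      iota \<omega>3 \<Omega>3 (restrict_class \<Omega>3 u))"

definition L_oplus ::
  "(real^2) set \<Rightarrow> (real^2) set \<Rightarrow> (real^2) set \<Rightarrow>
   ((real^2 \<Rightarrow> real) set \<times> (real^2 \<Rightarrow> real) set \<times> (real^2 \<Rightarrow> real) set) set" where
  "L_oplus \<omega>1 \<omega>2 \<omega>3 = L2 \<omega>1 \<times> L2 \<omega>2 \<times> L2 \<omega>3"

definition H_oplus ::
  "(real^2) set \<Rightarrow> (real^2) set \<Rightarrow> (real^2) set \<Rightarrow>
   ((real^2 \<Rightarrow> real) set \<times> (real^2 \<Rightarrow> real) set \<times> (real^2 \<Rightarrow> real) set) set" where
  "H_oplus \<omega>1 \<omega>2 \<omega>3 = H1 \<omega>1 \<times> H1 \<omega>2 \<times> H1 \<omega>3"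

definition H0_oplus ::
  "(real^2) set \<Rightarrow> (real^2) set \<Rightarrow> (real^2) set \<Rightarrow>
   ((real^2 \<Rightarrow> real) set \<times> (real^2 \<Rightarrow> real) set \<times> (real^2 \<Rightarrow> real) set) set" where
  "H0_oplus \<omega>1 \<omega>2 \<omega>3 =
     {(u1, u2, u3) \<in> H_oplus \<omega>1 \<omega>2 \<omega>3. u1 \<in> H1_0 \<omega>1 \<and> u2 \<in> H1_0 \<omega>2 \<and> u3 \<in> H1_0 \<omega>3}"

definition HC_oplus ::
  "(real^2) set \<Rightarrow> (real^2) set \<Rightarrow> (real^2) set \<Rightarrow>
   ((real^2 \<Rightarrow> real) set \<times> (real^2 \<Rightarrow> real) set \<times> (real^2 \<Rightarrow> real) set) set" where
  "HC_oplus \<omega>1 \<omega>2 \<omega>3 =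
     {(u1, u2, u3) \<in> H_oplus \<omega>1 \<omega>2 \<omega>3.
        AE x in boundary_measure \<omega>2.
          rep (boundary_trace \<omega>1 u1) x = rep (boundary_trace \<omega>2 u2) x \<and>
          rep (boundary_trace \<omega>2 u2) x = rep (boundary_trace \<omega>3 u3) x}"

end

theory Submission
  imports Defs
begin

text \<open>A $y$-independent limit of $C^1$ functions is determined on each cylinder by one of its
  horizontal slices, and for a suitable height the slices of a subsequence converge in $H^1$ of
  the base. Slicing above and below the hole gives functions on all of $\omega$, whose traces on
  $\partial\omega_2$ from both sides agree; slicing at the height of the hole, where $\Gamma_L$ is
  the whole lateral boundary, makes the trace on $\partial\omega_1$ vanish. Conversely, a triple is
  lifted to $w(x) + \theta(y)\,e(x)$, where $w$ glues the first and third components, $e$ is the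
  difference of the second and third, and the cut-off $\theta$ varies only at the height of the
  hole, where the factor $e$, supported in $\overline{\omega_2}$, lies outside $\Omega$.

  The facts on Sobolev spaces rest on mollification, on Green's formula in boundary charts
  (which yields the trace inequality, gluing and the characterisation of $H^1_0$ by zero traces)
  and on the comparison of $\mathcal{H}^1$ with Lebesgue measure along a $C^1$ graph.\<close>

section \<open>Square-integrable functions\<close>

text \<open>The classes of the statement hide their members behind \<open>SOME\<close> and
  \<open>THE\<close>. The analysis therefore uses Borel functions on the whole space that vanish
  outside the set (\<open>wgrad\<close>), and returns to classes only through lemmas that evaluate
  \<open>rep\<close>, \<open>weak_partial\<close>, \<open>boundary_trace\<close> and
  \<open>iota\<close>. No trace on the boundary of \<open>\<Omega>\<close>, which has edges, is ever
  formed: boundary values enter through the C^1 approximants of an element of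
  \<open>H1_Gamma\<close>, whose horizontal slices are C^1 up to the boundary of a planar set. These
  approximants depend on the height even when their limit does not; slicing is legitimate because
  their vertical oscillation is bounded by the vertical derivative, which tends to 0 in L^2. Every
  C^1 sequence converging in H^1 has the same boundary limit, so the slices compute the trace.
  Conversely, \<open>H1_Gamma\<close> demands C^1 approximants on all of \<open>\<Omega>\<close>.
  They combine smooth approximants of \<open>w\<close> with test functions of
  \<open>\<omega>2\<close> approximating \<open>e\<close>, so that the product of the derivative of
  \<open>\<theta>\<close> with the second factor is exactly zero in \<open>\<Omega>\<close> for the
  approximants too.\<close>

definition square_int :: "'a measure => ('a => 'b::euclidean_space) => bool" where
 "square_int M f \<longleftrightarrow> f \<in> borel_measurable M \<and> integrable M (%x. (norm (f x))^2)"

definition l2norm :: "'a measure => ('a => 'b::euclidean_space) => real" where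
 "l2norm M f = sqrt (LINT x|M. (norm (f x))^2)"

abbreviation "sqint f \<equiv> square_int lborel f"

abbreviation "norm2 f \<equiv> l2norm lborel f"

abbreviation l2_tendsto :: "'a measure => (nat => 'a => 'b::euclidean_space) => ('a => 'b) => bool" where
 "l2_tendsto M F f \<equiv> (%n. l2norm M (%x. F n x - f x)) \<longlonglongrightarrow> 0"

abbreviation "l2lim F f \<equiv> l2_tendsto lborel F f"

abbreviation cut :: "'a set => ('a => 'b::real_vector) => 'a => 'b" where
 "cut U f \<equiv> %x. indicator U x *\<^sub>R f x"

abbreviation "dist2 f g \<equiv> norm2 (%x. f x - g x)"

abbreviation "Borel \<equiv> borel_measurable borel"

lemma square_int_measurable: "square_int M f ==> f \<in> borel_measurable M"
 by (simp add: square_int_def)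

lemma l2norm_nonneg: "0 \<le> l2norm M f"
 by (simp add: l2norm_def)

lemma l2norm_squeeze:
 assumes "!!n::nat. l2norm M (F n) \<le> b n" "b \<longlonglongrightarrow> 0"
 shows "(%n. l2norm M (F n)) \<longlonglongrightarrow> 0"
 by (rule Lim_null_comparison[OF always_eventually assms(2)]) (simp add: assms(1) l2norm_nonneg)

lemma l2norm_power2: "(l2norm M f)^2 = (LINT x|M. (norm (f x))^2)"
 by (simp add: l2norm_def)

lemma square_int_bound:
 assumes "f \<in> borel_measurable M" "square_int M g" "AE x in M. norm (f x) \<le> C * norm (g x)"
 shows "square_int M f"
proof -
 have "integrable M (%x. C\<^sup>2 * (norm (g x))^2)"
  using assms(2) by (auto simp: square_int_def)
 moreover have "AE x in M. norm ((norm (f x))^2) \<le> norm (C\<^sup>2 * (norm (g x))^2)"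
  using assms(3)
 proof eventually_elim
  case (elim x)
  then have "(norm (f x))^2 \<le> (C * norm (g x))^2"
   by (intro power_mono) auto
  then show ?case by (simp add: power_mult_distrib)
 qed
 moreover have "(%x. (norm (f x))^2) \<in> borel_measurable M"
  using assms(1) by measurable
 ultimately have "integrable M (%x. (norm (f x))^2)"
  by (blast intro: Bochner_Integration.integrable_bound)
 then show ?thesis using assms(1) by (simp add: square_int_def)
qed

lemma norm_add_power2_le: "(norm (a + b :: 'a::real_normed_vector))^2 \<le> 2 * (norm a)^2 + 2 * (norm b)^2"
proof -
 have "(norm (a + b))^2 \<le> (norm a + norm b)^2"
  by (intro power_mono norm_triangle_ineq) auto
 also have "... \<le> 2 * (norm a)^2 + 2 * (norm b)^2"
  using sum_squares_bound[of "norm a" "norm b"] by (simp add: power2_sum)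
 finally show ?thesis .
qed

lemma square_int_add:
 assumes "square_int M f" "square_int M g"
 shows "square_int M (%x. f x + g x)"
proof -
 have [measurable]: "f \<in> borel_measurable M" "g \<in> borel_measurable M"
  using assms by (auto simp: square_int_def)
 have "integrable M (%x. 2 * (norm (f x))^2 + 2 * (norm (g x))^2)"
  using assms by (auto simp: square_int_def)
 then have "integrable M (%x. (norm (f x + g x))^2)"
  by (rule Bochner_Integration.integrable_bound) (auto intro!: AE_I2 norm_add_power2_le)
 then show ?thesis by (auto simp: square_int_def)
qed

lemma square_int_scaleR: "square_int M f ==> square_int M (%x. c *\<^sub>R f x)"
 by (auto simp: square_int_def power_mult_distrib)

lemma square_int_mult: "square_int M f ==> square_int M (%x. c * f x :: real)"
 using square_int_scaleR[of M f c] by simp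

lemma square_int_minus: "square_int M f ==> square_int M (%x. - f x)"
 by (auto simp: square_int_def)

lemma square_int_diff:
 "square_int M f ==> square_int M g ==> square_int M (%x. f x - g x)"
 using square_int_add[of M f "%x. - g x"] by (simp add: square_int_minus)

lemma square_int_zero: "square_int M (%x. 0)"
 by (auto simp: square_int_def)

lemma square_int_sum:
 "(!!i. i \<in> I ==> square_int M (f i)) ==> square_int M (%x. \<Sum>i\<in>I. f i x)"
 by (induction I rule: infinite_finite_induct) (auto intro: square_int_add square_int_zero)

lemma square_int_bounded_mult:
 assumes "square_int M f" "c \<in> borel_measurable M" "!!x. \<bar>c x\<bar> \<le> C"
 shows "square_int M (%x. c x *\<^sub>R f x)"
proof (rule square_int_bound[where C = C])
 show "AE x in M. norm (c x *\<^sub>R f x) \<le> C * norm (f x)"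
  using assms(3) by (auto intro!: AE_I2 mult_right_mono)
qed (use assms square_int_measurable[OF assms(1)] in auto)

lemma square_int_inner_const:
 assumes "square_int M f"
 shows "square_int M (%x. f x \<bullet> v)"
proof (rule square_int_bound[OF _ assms])
 show "AE x in M. norm (f x \<bullet> v) \<le> norm v * norm (f x)"
  by (auto intro!: AE_I2 order_trans[OF Cauchy_Schwarz_ineq2])
qed (use square_int_measurable[OF assms] in auto)

lemma square_int_integrable_mult:
 assumes "square_int M f" "square_int M g"
 shows "integrable M (%x. norm (f x) * norm (g x))"
proof -
 have [measurable]: "f \<in> borel_measurable M" "g \<in> borel_measurable M"
  using assms by (auto simp: square_int_def)
 have "integrable M (%x. (norm (f x))^2 + (norm (g x))^2)"
  using assms by (auto simp: square_int_def)
 then show ?thesis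
 proof (rule Bochner_Integration.integrable_bound)
  show "AE x in M. norm (norm (f x) * norm (g x)) \<le> norm ((norm (f x))^2 + (norm (g x))^2)"
  proof (intro AE_I2)
   fix x
   have "0 \<le> norm (f x) * norm (g x)" by simp
   then have "norm (f x) * norm (g x) \<le> (norm (f x))^2 + (norm (g x))^2"
    using sum_squares_bound[of "norm (f x)" "norm (g x)"] by linarith
   then show "norm (norm (f x) * norm (g x)) \<le> norm ((norm (f x))^2 + (norm (g x))^2)"
    by simp
  qed
 qed auto
qed

lemma square_int_integrable_inner:
 assumes "square_int M f" "square_int M g"
 shows "integrable M (%x. f x \<bullet> g x)"
proof (rule Bochner_Integration.integrable_bound[OF square_int_integrable_mult[OF assms]])
 have [measurable]: "f \<in> borel_measurable M" "g \<in> borel_measurable M"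
  using assms by (auto simp: square_int_def)
 show "(%x. f x \<bullet> g x) \<in> borel_measurable M" by measurable
 show "AE x in M. norm (f x \<bullet> g x) \<le> norm (norm (f x) * norm (g x))"
  by (auto intro!: AE_I2 Cauchy_Schwarz_ineq2)
qed

lemma square_int_integrable_prod:
 fixes f g :: "'a => real"
 assumes "square_int M f" "square_int M g"
 shows "integrable M (%x. f x * g x)"
 using square_int_integrable_inner[OF assms] by simp

text \<open>Where \<open>f\<close> is nonzero, \<open>norm (f x)\<close> is at most
  \<open>1 + (norm (f x))^2\<close>, and the set carrying the \<open>1\<close> has finite
  measure.\<close>

lemma square_int_integrable_finite:
 fixes f :: "'a => 'b::euclidean_space"
 assumes "square_int M f" "emeasure M {x\<in>space M. f x \<noteq> 0} < \<infinity>"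
 shows "integrable M f"
proof -
 have [measurable]: "f \<in> borel_measurable M"
  using assms by (auto simp: square_int_def)
 let ?S = "{x\<in>space M. f x \<noteq> 0}"
 have "integrable M (%x. indicator ?S x + (norm (f x))^2 :: real)"
  using assms by (auto simp: square_int_def integrable_indicator_iff)
 then show ?thesis
 proof (rule Bochner_Integration.integrable_bound)
  show "AE x in M. norm (f x) \<le> norm (indicator ?S x + (norm (f x))^2 :: real)"
  proof (intro AE_I2)
   fix x assume "x \<in> space M"
   have "norm (f x) \<le> 1 + (norm (f x))^2"
    using sum_squares_bound[of "norm (f x)" 1] norm_ge_zero[of "f x"] by (smt (verit) mult_2 one_power2 mult.right_neutral)
   then show "norm (f x) \<le> norm (indicator ?S x + (norm (f x))^2 :: real)"
    using \<open>x \<in> space M\<close> by (auto split: split_indicator)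
  qed
 qed auto
qed

text \<open>Expanding the square of \<open>b * norm (f x) - a * norm (g x)\<close>, with
  \<open>a\<close> and \<open>b\<close> the two norms, gives a weighted Young inequality whose right
  side integrates to \<open>a * b\<close>. If a norm vanishes the weights make no sense, but then
  the integrand is zero almost everywhere.\<close>

lemma l2norm_Cauchy_Schwarz_norm:
 assumes f: "square_int M f" and g: "square_int M g"
 shows "(LINT x|M. norm (f x) * norm (g x)) \<le> l2norm M f * l2norm M g"
proof -
 have [measurable]: "f \<in> borel_measurable M" "g \<in> borel_measurable M"
  using assms by (auto simp: square_int_def)
 have f2: "integrable M (%x. (norm (f x))^2)" and g2: "integrable M (%x. (norm (g x))^2)"
  using assms by (auto simp: square_int_def)
 note fg = square_int_integrable_mult[OF f g]
 show ?thesis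
 proof (cases "l2norm M f = 0 \<or> l2norm M g = 0")
  case True
  then have "(AE x in M. (norm (f x))^2 = 0) \<or> (AE x in M. (norm (g x))^2 = 0)"
   using integral_nonneg_eq_0_iff_AE[OF f2] integral_nonneg_eq_0_iff_AE[OF g2]
   by (auto simp: l2norm_def)
  then have "AE x in M. norm (f x) * norm (g x) = 0" by auto
  then have "(LINT x|M. norm (f x) * norm (g x)) = 0"
   by (subst integral_cong_AE[where g = "%x. 0"]) auto
  with True show ?thesis by auto
 next
  case False
  define a b where "a = l2norm M f" and "b = l2norm M g"
  have ab: "a > 0" "b > 0" using False l2norm_nonneg[of M f] l2norm_nonneg[of M g] by (auto simp: a_def b_def)
  have "norm (f x) * norm (g x) \<le> (b / a) / 2 * (norm (f x))^2 + (a / b) / 2 * (norm (g x))^2" for x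
  proof -
   have "0 \<le> (b * norm (f x) - a * norm (g x))^2" by simp
   then have "2 * a * b * (norm (f x) * norm (g x)) \<le> b\<^sup>2 * (norm (f x))^2 + a\<^sup>2 * (norm (g x))^2"
    by (simp add: power2_diff power_mult_distrib algebra_simps)
   then show ?thesis using ab by (simp add: field_simps power2_eq_square)
  qed
  then have "(LINT x|M. norm (f x) * norm (g x)) \<le> (LINT x|M. (b / a) / 2 * (norm (f x))^2 + (a / b) / 2 * (norm (g x))^2)"
   using fg f2 g2 by (intro integral_mono) auto
  also have "... = (b / a) / 2 * a\<^sup>2 + (a / b) / 2 * b\<^sup>2"
   using f2 g2 by (simp add: a_def b_def l2norm_power2)
  also have "... = a * b" using ab by (simp add: power2_eq_square)
  finally show ?thesis by (simp add: a_def b_def)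
 qed
qed

lemma l2norm_Cauchy_Schwarz:
 assumes f: "square_int M f" and g: "square_int M g"
 shows "\<bar>LINT x|M. f x \<bullet> g x\<bar> \<le> l2norm M f * l2norm M g"
proof -
 have "\<bar>LINT x|M. f x \<bullet> g x\<bar> \<le> (LINT x|M. norm (f x) * norm (g x))"
  using square_int_integrable_inner[OF f g] square_int_integrable_mult[OF f g]
  by (intro order_trans[OF integral_abs_bound] integral_mono) (auto intro: Cauchy_Schwarz_ineq2)
 with l2norm_Cauchy_Schwarz_norm[OF f g] show ?thesis by linarith
qed

lemma l2norm_triangle:
 assumes f: "square_int M f" and g: "square_int M g"
 shows "l2norm M (%x. f x + g x) \<le> l2norm M f + l2norm M g"
proof -
 have "(LINT x|M. (norm (f x + g x))^2) = (LINT x|M. (norm (f x))^2 + 2 * (f x \<bullet> g x) + (norm (g x))^2)"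
  by (intro Bochner_Integration.integral_cong) (auto simp: power2_norm_eq_inner inner_add algebra_simps inner_commute)
 also have "... = (l2norm M f)^2 + 2 * (LINT x|M. f x \<bullet> g x) + (l2norm M g)^2"
  using f g square_int_integrable_inner[OF f g] by (simp add: square_int_def l2norm_power2)
 also have "... \<le> (l2norm M f + l2norm M g)^2"
  using l2norm_Cauchy_Schwarz[OF f g] by (simp add: power2_sum)
 finally show ?thesis
  unfolding l2norm_def[of M "%x. f x + g x"]
  by (intro real_le_lsqrt) (auto simp: l2norm_nonneg)
qed

lemma l2norm_minus: "l2norm M (%x. - f x) = l2norm M f"
 by (simp add: l2norm_def)

lemma l2norm_diff_commute: "l2norm M (%x. f x - g x) = l2norm M (%x. g x - f x)"
 by (simp add: l2norm_def norm_minus_commute)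

lemma l2norm_diff_triangle:
 assumes "square_int M f" "square_int M g" "square_int M h"
 shows "l2norm M (%x. f x - h x) \<le> l2norm M (%x. f x - g x) + l2norm M (%x. g x - h x)"
 using l2norm_triangle[OF square_int_diff[OF assms(1,2)] square_int_diff[OF assms(2,3)]] by simp

lemma l2norm_cong_AE:
 assumes "f \<in> borel_measurable M" "g \<in> borel_measurable M" "AE x in M. norm (f x) = norm (g x)"
 shows "l2norm M f = l2norm M g"
 unfolding l2norm_def using assms by (auto intro!: arg_cong[where f = sqrt] integral_cong_AE)

lemma square_int_cong_AE:
 assumes "f \<in> borel_measurable M" "square_int M g" "AE x in M. norm (f x) = norm (g x)"
 shows "square_int M f"
 by (rule square_int_bound[OF assms(1,2), where C = 1]) (use assms(3) in auto)

lemma l2norm_mono: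
 assumes "f \<in> borel_measurable M" "square_int M g" "AE x in M. norm (f x) \<le> norm (g x)"
 shows "l2norm M f \<le> l2norm M g"
proof -
 have "square_int M f" by (rule square_int_bound[OF assms(1,2), where C = 1]) (use assms(3) in auto)
 then show ?thesis
  unfolding l2norm_def using assms
  by (auto intro!: integral_mono_AE power_mono simp: square_int_def elim!: eventually_mono)
qed

lemma l2norm_scaleR: "l2norm M (%x. c *\<^sub>R f x) = \<bar>c\<bar> * l2norm M f"
 by (simp add: l2norm_def power_mult_distrib real_sqrt_mult)

lemma l2norm_zero: "l2norm M (%x. 0) = 0"
 by (simp add: l2norm_def)

lemma l2norm_eq_0:
 assumes "square_int M f"
 shows "l2norm M f = 0 \<longleftrightarrow> (AE x in M. f x = 0)"
 using integral_nonneg_eq_0_iff_AE[of M "%x. (norm (f x))^2"] assms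
 by (auto simp: l2norm_def square_int_def)

lemma l2norm_limit_unique:
 assumes "!!n. square_int M (f n)" "square_int M g" "square_int M h"
  and "l2_tendsto M f g" "l2_tendsto M f h"
 shows "AE x in M. g x = h x"
proof -
 have "l2norm M (%x. g x - h x) \<le> l2norm M (%x. f n x - g x) + l2norm M (%x. f n x - h x)" for n
  using l2norm_diff_triangle[OF assms(2) assms(1)[of n] assms(3)] by (simp add: l2norm_diff_commute)
 moreover have "(%n. l2norm M (%x. f n x - g x) + l2norm M (%x. f n x - h x)) \<longlonglongrightarrow> 0"
  using tendsto_add[OF assms(4,5)] by simp
 ultimately have "l2norm M (%x. g x - h x) \<le> 0"
  by (intro LIMSEQ_le_const) auto
 then have "l2norm M (%x. g x - h x) = 0" using l2norm_nonneg[of M "%x. g x - h x"] by linarith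
 then show ?thesis using l2norm_eq_0[OF square_int_diff[OF assms(2,3)]] by auto
qed

text \<open>A single estimate in \<open>[0, \<infinity>]\<close> yields both square integrability
  and the norm bound, so results of Tonelli or Fatou can be used with no integrability known
  beforehand.\<close>

lemma l2norm_le_nn_integral:
 assumes "f \<in> borel_measurable M" "(\<integral>\<^sup>+x. ennreal ((norm (f x))^2) \<partial>M) \<le> ennreal (e\<^sup>2)" "0 \<le> e"
 shows "square_int M f" "l2norm M f \<le> e"
proof -
 have *: "integrable M (%x. (norm (f x))^2)"
  using assms by (intro integrableI_nonneg) (auto simp: le_less_trans[OF _ ennreal_less_top])
 then show "square_int M f" using assms(1) by (simp add: square_int_def)
 have "ennreal (LINT x|M. (norm (f x))^2) \<le> ennreal (e\<^sup>2)"
  using assms(2) nn_integral_eq_integral[OF *] by simp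
 then have "(LINT x|M. (norm (f x))^2) \<le> e\<^sup>2" by simp
 then show "l2norm M f \<le> e" unfolding l2norm_def using assms(3) by (intro real_le_lsqrt) auto
qed

lemma l2norm_nn_integral:
 assumes "square_int M f"
 shows "(\<integral>\<^sup>+x. ennreal ((norm (f x))^2) \<partial>M) = ennreal ((l2norm M f)^2)"
 using assms by (simp add: square_int_def l2norm_power2 nn_integral_eq_integral)

text \<open>Riesz-Fischer: a subsequence with increments below \<open>(1/2)^k\<close> converges
  almost everywhere, and Fatou along it bounds the distance of every late \<open>f n\<close> to the
  pointwise limit.\<close>

lemma square_int_complete:
 fixes f :: "nat => 'a => real"
 assumes f: "!!n. square_int M (f n)"
  and cauchy: "!!e. e > 0 ==> \<exists>N. \<forall>m\<ge>N. \<forall>n\<ge>N. l2norm M (%x. f m x - f n x) < e"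
 obtains g where "square_int M g" "l2_tendsto M f g"
proof -
 have fm[measurable]: "f n \<in> borel_measurable M" for n using f by (simp add: square_int_def)
 have "\<exists>N. \<forall>m\<ge>N. \<forall>n\<ge>N. l2norm M (%x. f m x - f n x) < (1/2)^k" for k :: nat
  by (rule cauchy) simp
 then obtain N where N: "!!k m n. m \<ge> N k ==> n \<ge> N k ==> l2norm M (%x. f m x - f n x) < (1/2)^k"
  by metis
 \<comment> \<open>The sum makes \<open>r\<close> monotone and at least \<open>N\<close>; the
   summand \<open>k\<close> makes it tend to infinity.\<close>
 define r where "r k = (\<Sum>i\<le>k. N i) + k" for k
 have rN: "r k \<ge> N k" for k unfolding r_def by (simp add: trans_le_add1 member_le_sum)
 have rS: "r (Suc k) \<ge> r k" for k unfolding r_def by simp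
 have rk: "r k \<ge> k" for k unfolding r_def by simp
 \<comment> \<open>The squared increments are summed with weight \<open>2^k\<close>. The integrals
   stay summable because the squared norms are below \<open>(1/4)^k\<close>; and at a point where
   the weighted sum is a finite \<open>S\<close>, it forces
   \<open>\<bar>d k x\<bar> \<le> sqrt S * (sqrt (1/2))^k\<close>, so the increments themselves are
   summable there.\<close>
 define d where "d k x = f (r (Suc k)) x - f (r k) x" for k x
 have dm[measurable]: "d k \<in> borel_measurable M" for k unfolding d_def by measurable
 have d: "square_int M (d k)" for k unfolding d_def by (intro square_int_diff f)
 have dn: "l2norm M (d k) < (1/2)^k" for k
  unfolding d_def using N[of k "r (Suc k)" "r k"] rN rS by (meson order_trans)
 have "(\<integral>\<^sup>+x. (\<Sum>k. ennreal (2^k * (d k x)^2)) \<partial>M) = (\<Sum>k. \<integral>\<^sup>+x. ennreal (2^k * (d k x)^2) \<partial>M)"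
  by (rule nn_integral_suminf) measurable
 also have "... = (\<Sum>k. ennreal (2^k * (l2norm M (d k))^2))"
  using l2norm_nn_integral[OF d] by (simp add: ennreal_mult' nn_integral_cmult)
 also have "... \<le> (\<Sum>k. ennreal ((1/2)^k))"
 proof (intro suminf_le ennreal_leI)
  fix k :: nat
  have "(l2norm M (d k))^2 \<le> ((1/2)^k)^2"
   by (rule power_mono[OF less_imp_le[OF dn] l2norm_nonneg])
  then have "2^k * (l2norm M (d k))^2 \<le> 2^k * ((1/2)^k)^2"
   by (rule mult_left_mono) (rule zero_le_power, rule zero_le_numeral)
  also have "... = (1/2)^k" by (simp add: power2_eq_square power_divide)
  finally show "2^k * (l2norm M (d k))^2 \<le> (1/2)^k" .
 qed auto
 also have "... = ennreal (\<Sum>k. (1/2)^k)"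
  by (rule suminf_ennreal2) (auto intro: summable_geometric)
 finally have "(\<integral>\<^sup>+x. (\<Sum>k. ennreal (2^k * (d k x)^2)) \<partial>M) < \<infinity>"
  by (auto intro: le_less_trans)
 then have "AE x in M. (\<Sum>k. ennreal (2^k * (d k x)^2)) \<noteq> \<infinity>"
  by (intro nn_integral_noteq_infinite) auto
 then have ae: "AE x in M. convergent (%k. f (r k) x)"
 proof eventually_elim
  case (elim x)
  define S where "S = enn2real (\<Sum>k. ennreal (2^k * (d k x)^2))"
  have S: "(\<Sum>k. ennreal (2^k * (d k x)^2)) = ennreal S"
   using elim by (simp add: S_def less_top)
  have S0: "S \<ge> 0" by (simp add: S_def)
  have bd: "\<bar>d k x\<bar> \<le> sqrt S * (sqrt (1/2))^k" for k
  proof -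
   define F where "F k = ennreal (2^k * (d k x)^2)" for k
   have "sum F {k} \<le> suminf F"
    by (rule sum_le_suminf) (auto intro: summableI)
   then have "F k \<le> ennreal S" using S by (simp add: F_def[abs_def])
   then have "ennreal (2^k * (d k x)^2) \<le> ennreal S" by (simp only: F_def)
   then have "2^k * (d k x)^2 \<le> S" by (simp only: ennreal_le_iff[OF S0])
   then have "(d k x)^2 \<le> S * (1/2)^k" by (simp add: power_divide le_divide_eq mult.commute)
   then have "sqrt ((d k x)^2) \<le> sqrt (S * (1/2)^k)"
    by (rule real_sqrt_le_mono)
   also have "sqrt (S * (1/2)^k) = sqrt S * (sqrt (1/2))^k" by (simp add: real_sqrt_mult real_sqrt_power)
   finally show ?thesis by (simp only: real_sqrt_abs)
  qed
  have "summable (%k. sqrt S * (sqrt (1/2))^k)"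
   by (intro summable_mult summable_geometric) (simp add: real_sqrt_divide)
  then have "summable (%k. d k x)"
   by (rule summable_comparison_test') (use bd in auto)
  then have "convergent (%n. \<Sum>k<n. d k x)" by (simp add: summable_iff_convergent)
  moreover have "(\<Sum>k<n. d k x) = f (r n) x - f (r 0) x" for n
   unfolding d_def by (rule sum_lessThan_telescope)
  ultimately have "convergent (%n. f (r n) x - f (r 0) x)" by simp
  then have "convergent (%n. (f (r n) x - f (r 0) x) + f (r 0) x)"
   by (intro convergent_add convergent_const)
  then show ?case by simp
 qed
 define g where "g x = lim (%k. f (r k) x)" for x
 have gm[measurable]: "g \<in> borel_measurable M" unfolding g_def by measurable
 have lim: "AE x in M. (%k. f (r k) x) \<longlonglongrightarrow> g x"
  using ae unfolding g_def by eventually_elim (simp add: convergent_LIMSEQ_iff)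
 have main: "square_int M (%x. f n x - g x) \<and> l2norm M (%x. f n x - g x) \<le> (1/2)^k" if n: "n \<ge> N k" for n k
 proof -
  have "(\<integral>\<^sup>+x. ennreal ((norm (f n x - g x))^2) \<partial>M) = (\<integral>\<^sup>+x. liminf (%j. ennreal ((norm (f n x - f (r j) x))^2)) \<partial>M)"
  proof (rule nn_integral_cong_AE)
   show "AE x in M. ennreal ((norm (f n x - g x))^2) = liminf (%j. ennreal ((norm (f n x - f (r j) x))^2))"
    using lim
   proof eventually_elim
    case (elim x)
    then have "(%j. ennreal ((norm (f n x - f (r j) x))^2)) \<longlonglongrightarrow> ennreal ((norm (f n x - g x))^2)"
     by (intro tendsto_intros)
    then show ?case by (intro lim_imp_Liminf[symmetric]) auto
   qed
  qed
  also have "... \<le> liminf (%j. \<integral>\<^sup>+x. ennreal ((norm (f n x - f (r j) x))^2) \<partial>M)"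
   by (rule nn_integral_liminf) measurable
  also have "... \<le> ennreal (((1/2)^k)^2)"
  proof (rule order_trans[OF Liminf_le_Limsup])
   show "limsup (%j. \<integral>\<^sup>+x. ennreal ((norm (f n x - f (r j) x))^2) \<partial>M) \<le> ennreal (((1/2)^k)^2)"
   proof (rule Limsup_bounded)
    show "\<forall>\<^sub>F j in sequentially. (\<integral>\<^sup>+x. ennreal ((norm (f n x - f (r j) x))^2) \<partial>M) \<le> ennreal (((1/2)^k)^2)"
     using eventually_ge_at_top[of "N k"]
    proof eventually_elim
     case (elim j)
     then have "r j \<ge> N k" using rk[of j] by linarith
     then have "l2norm M (%x. f n x - f (r j) x) \<le> (1/2)^k" using N[OF n] by (simp add: less_imp_le)
     then show ?case
      by (subst l2norm_nn_integral) (auto intro!: ennreal_leI power_mono square_int_diff f l2norm_nonneg)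
    qed
   qed
  qed simp
  finally show ?thesis using l2norm_le_nn_integral[of "%x. f n x - g x" M "(1/2)^k"] by auto
 qed
 have "square_int M (%x. f (N 0) x - g x)"
  using main[of 0 "N 0"] by blast
 from square_int_diff[OF f[of "N 0"] this] have "square_int M g" by simp
 moreover have "l2_tendsto M f g"
 proof (rule LIMSEQ_I)
  fix e :: real assume "e > 0"
  then obtain k where "(1/2)^k < e" using real_arch_pow_inv[of e "1/2"] by auto
  then show "\<exists>no. \<forall>n\<ge>no. norm (l2norm M (%x. f n x - g x) - 0) < e"
  proof (intro exI[of _ "N k"] allI impI)
   fix n assume "N k \<le> n"
   then have "l2norm M (%x. f n x - g x) < e" using main[of k n] \<open>(1/2)^k < e\<close> by linarith
   then show "norm (l2norm M (%x. f n x - g x) - 0) < e"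
    using l2norm_nonneg[of M "%x. f n x - g x"] by simp
  qed
 qed
 ultimately show thesis by (rule that)
qed

subsection \<open>Classes and representatives\<close>

lemma rep_ae_class:
 assumes "f \<in> borel_measurable M"
 shows "rep (ae_class M f) \<in> borel_measurable M" "AE x in M. rep (ae_class M f) x = f x"
proof -
 have "f \<in> ae_class M f" using assms by (auto simp: ae_class_def)
 then have "rep (ae_class M f) \<in> ae_class M f" unfolding rep_def by (rule someI[of "%g. g \<in> ae_class M f"])
 then show "rep (ae_class M f) \<in> borel_measurable M" "AE x in M. rep (ae_class M f) x = f x"
  by (auto simp: ae_class_def)
qed

lemma ae_class_eq_iff:
 assumes "f \<in> borel_measurable M" "g \<in> borel_measurable M"
 shows "ae_class M f = ae_class M g \<longleftrightarrow> (AE x in M. f x = g x)"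
proof
 assume "ae_class M f = ae_class M g"
 then have "f \<in> ae_class M g" using assms by (auto simp: ae_class_def)
 then show "AE x in M. f x = g x" by (auto simp: ae_class_def)
next
 assume "AE x in M. f x = g x"
 then show "ae_class M f = ae_class M g"
  unfolding ae_class_def by (auto elim: AE_mp)
qed

lemma L2_of_ae_class: "square_int M f ==> ae_class M f \<in> L2_of M"
 by (auto simp: L2_of_def square_int_def)

lemma L2_of_rep:
 assumes "u \<in> L2_of M"
 shows "square_int M (rep u)" "ae_class M (rep u) = u"
proof -
 obtain f where f: "u = ae_class M f" "square_int M f"
  using assms by (auto simp: L2_of_def square_int_def)
 note r = rep_ae_class[OF square_int_measurable[OF f(2)]]
 show "square_int M (rep u)"
  using r f by (intro square_int_cong_AE[OF _ f(2)]) (auto elim: eventually_mono)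
 show "ae_class M (rep u) = u"
  using r f square_int_measurable[OF f(2)] by (simp add: ae_class_eq_iff)
qed

lemma L2_dist_ae_class:
 assumes "f \<in> borel_measurable M" "g \<in> borel_measurable M"
 shows "L2_dist M (ae_class M f) (ae_class M g) = l2norm M (%x. f x - g x)"
proof -
 have "L2_dist M (ae_class M f) (ae_class M g) = l2norm M (%x. rep (ae_class M f) x - rep (ae_class M g) x)"
  by (simp add: L2_dist_def l2norm_def)
 also have "... = l2norm M (%x. f x - g x)"
  using rep_ae_class[OF assms(1)] rep_ae_class[OF assms(2)] assms
  by (intro l2norm_cong_AE) (auto elim: AE_mp)
 finally show ?thesis .
qed

section \<open>Integrals over \<open>lebesgue_on\<close> and Borel representatives\<close>

lemma borel_measurable_lebesgue_on:
 "f \<in> Borel ==> f \<in> borel_measurable (lebesgue_on U)"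
 by (simp add: borel_measurable_if_D measurable_completion measurable_restrict_space1)

lemma AE_lebesgue_on_iff:
 assumes "U \<in> sets borel"
 shows "(AE x in lebesgue_on U. P x) \<longleftrightarrow> (AE x in lborel. x \<in> U --> P x)"
 using assms by (subst AE_restrict_space_iff) (auto simp: AE_completion_iff)

lemma integral_lebesgue_on:
 fixes f :: "'a::euclidean_space => 'b::euclidean_space"
 assumes "U \<in> sets borel" "f \<in> Borel" "!!x. x \<notin> U ==> f x = 0"
 shows "(LINT x|lebesgue_on U. f x) = (LINT x|lborel. f x)"
proof -
 have "(LINT x|lebesgue_on U. f x) = (LINT x|lebesgue. cut U f x)"
  using assms by (subst integral_restrict_space) auto
 also have "cut U f = f"
  using assms(3) by (auto simp: indicator_def fun_eq_iff)
 finally show ?thesis using assms(2) by (simp add: integral_completion)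
qed

lemma l2norm_lebesgue_on:
 assumes "U \<in> sets borel" "f \<in> Borel" "!!x. x \<notin> U ==> f x = 0"
 shows "l2norm (lebesgue_on U) f = norm2 f"
 unfolding l2norm_def using assms by (subst integral_lebesgue_on) auto

lemma square_int_lebesgue_on:
 assumes "U \<in> sets borel" "sqint f"
 shows "square_int (lebesgue_on U) f"
proof -
 have [measurable]: "f \<in> Borel" using assms by (auto simp: square_int_def)
 have "integrable lebesgue (%x. (norm (f x))^2)"
  using assms(2) by (subst integrable_completion) (auto simp: square_int_def)
 then have "integrable (lebesgue_on U) (%x. (norm (f x))^2)"
  using assms(1) integrable_real_mult_indicator[of U lebesgue "%x. (norm (f x))^2"]
  by (subst integrable_restrict_space) (auto simp: mult.commute)
 then show ?thesis by (simp add: square_int_def borel_measurable_lebesgue_on)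
qed

text \<open>Members of a class on \<open>lebesgue_on U\<close> are only Lebesgue measurable and
  arbitrary outside \<open>U\<close>; replacing them by one Borel function on the whole space lets
  all later integrals be taken over \<open>lborel\<close>.\<close>

lemma L2_borel_rep:
 assumes "U \<in> sets borel" "u \<in> L2 U"
 obtains f where "sqint f" "!!x. x \<notin> U ==> f x = 0" "u = ae_class (lebesgue_on U) f"
proof -
 note r = L2_of_rep[OF assms(2)]
 have U: "U \<inter> space lebesgue \<in> sets lebesgue" using assms(1) by auto
 have "(cut U (rep u)) \<in> borel_measurable lebesgue"
  using r(1) borel_measurable_restrict_space_iff[OF U, of "rep u"] by (auto simp: square_int_def)
 then obtain f where f: "f \<in> borel_measurable lborel" "AE x in lborel. cut U (rep u) x = f x"
  using completion_ex_borel_measurable_real by blast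
 define f' where "f' x = indicator U x * f x" for x
 have f'm[measurable]: "f' \<in> Borel" unfolding f'_def using f(1) assms(1) by measurable
 have ae: "AE x in lebesgue_on U. f' x = rep u x"
  using f(2) by (subst AE_lebesgue_on_iff[OF assms(1)]) (auto simp: f'_def elim!: eventually_mono)
 have "square_int (lebesgue_on U) f'"
  using ae by (intro square_int_cong_AE[OF _ r(1)]) (auto intro: borel_measurable_lebesgue_on elim: eventually_mono)
 then have "integrable (lebesgue_on U) (%x. (norm (f' x))^2)" by (simp add: square_int_def)
 then have "integrable lebesgue (%x. indicator U x *\<^sub>R (norm (f' x))^2)"
  using integrable_restrict_space[OF U, of "%x. (norm (f' x))^2"] by simp
 also have "(%x. indicator U x *\<^sub>R (norm (f' x))^2) = (%x. (norm (f' x))^2)"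
  by (auto simp: f'_def indicator_def fun_eq_iff)
 finally have "sqint f'" by (simp add: square_int_def integrable_completion)
 moreover have "u = ae_class (lebesgue_on U) f'"
  using ae r(1) by (subst r(2)[symmetric], subst ae_class_eq_iff)
   (auto intro: borel_measurable_lebesgue_on square_int_measurable elim: eventually_mono)
 moreover have "f' x = 0" if "x \<notin> U" for x using that by (simp add: f'_def)
 ultimately show thesis by (intro that[of f'])
qed

section \<open>Smooth functions\<close>

definition smooth :: "('a::euclidean_space => real) => bool" where
 "smooth f \<longleftrightarrow> (\<forall>k. Ck_on k UNIV f)"

lemma Ck_on_Suc_UNIV:
 "Ck_on (Suc k) UNIV f \<longleftrightarrow>
   (\<exists>G. (\<forall>x. (f has_derivative (%h. G x \<bullet> h)) (at x)) \<and> (\<forall>b\<in>Basis. Ck_on k UNIV (%x. G x \<bullet> b)))"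
 by simp

lemma Ck_on_SucD: "Ck_on (Suc k) UNIV f ==> Ck_on k UNIV f"
proof (induction k arbitrary: f)
 case 0
 then show ?case
  by (auto simp: continuous_on_eq_continuous_at intro: has_derivative_continuous)
next
 case (Suc k)
 then show ?case by (metis Ck_on_Suc_UNIV)
qed

lemma smooth_imp_continuous: "smooth f ==> continuous_on UNIV f"
 unfolding smooth_def by (metis Ck_on.simps(1))

text \<open>Once a family is closed under partial derivatives, every order of differentiability
  follows by induction on the order. This replaces formulas for higher derivatives, for instance for
  translates and mollifications.\<close>

lemma smooth_coinduct:
 assumes "f \<in> F"
  and step: "!!f. f \<in> F ==> \<exists>G. (\<forall>x. (f has_derivative (%h. G x \<bullet> h)) (at x)) \<and> (\<forall>b\<in>Basis. (%x. G x \<bullet> b) \<in> F)"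
 shows "smooth f"
proof -
 have "\<forall>f\<in>F. Ck_on k UNIV f" for k
 proof (induction k)
  case 0
  show ?case
  proof
   fix f assume "f \<in> F"
   from step[OF this] show "Ck_on 0 UNIV f"
    by (auto simp: continuous_on_eq_continuous_at intro: has_derivative_continuous)
  qed
 next
  case (Suc k)
  then show ?case using step by (metis Ck_on_Suc_UNIV)
 qed
 with assms(1) show ?thesis by (auto simp: smooth_def)
qed

text \<open>Expressed by \<open>frechet_derivative\<close>, so that it is total, needs no witness
  from \<open>Ck_on\<close>, and matches the pairing in \<open>is_weak_partial\<close>.\<close>

definition grad :: "('a::euclidean_space => real) => 'a => 'a" where
 "grad f x = (\<Sum>b\<in>Basis. frechet_derivative f (at x) b *\<^sub>R b)"

lemma grad_eqI:
 assumes "(f has_derivative (%h. G \<bullet> h)) (at x)"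
 shows "grad f x = G"
 unfolding grad_def frechet_derivative_at[OF assms, symmetric] by (simp add: euclidean_representation)

lemma Ck_const: "Ck_on k UNIV (%x. c)"
proof -
 have "smooth (%x::'a. c)"
  by (rule smooth_coinduct[where F = "range (%c x. c)"]) (auto intro!: exI[of _ "%x. 0"])
 then show ?thesis by (auto simp: smooth_def)
qed

lemma Ck_add: "Ck_on k UNIV f ==> Ck_on k UNIV g ==> Ck_on k UNIV (%x. f x + g x)"
proof (induction k arbitrary: f g)
 case 0
 then show ?case by (auto intro: continuous_on_add)
next
 case (Suc k)
 from Suc.prems obtain F G where
  F: "!!x. (f has_derivative (%h. F x \<bullet> h)) (at x)" "!!b. b \<in> Basis ==> Ck_on k UNIV (%x. F x \<bullet> b)" and
  G: "!!x. (g has_derivative (%h. G x \<bullet> h)) (at x)" "!!b. b \<in> Basis ==> Ck_on k UNIV (%x. G x \<bullet> b)"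
  unfolding Ck_on_Suc_UNIV by blast
 show ?case
  unfolding Ck_on_Suc_UNIV
 proof (intro exI[of _ "%x. F x + G x"] conjI allI ballI)
  show "((%x. f x + g x) has_derivative (%h. (F x + G x) \<bullet> h)) (at x)" for x
   using has_derivative_add[OF F(1)[of x] G(1)[of x]] by (simp add: inner_add_left)
  show "Ck_on k UNIV (%x. (F x + G x) \<bullet> b)" if "b \<in> Basis" for b
   using Suc.IH[OF F(2)[OF that] G(2)[OF that]] by (simp add: inner_add_left)
 qed
qed

lemma Ck_mult: "Ck_on k UNIV f ==> Ck_on k UNIV g ==> Ck_on k UNIV (%x. f x * g x)"
proof (induction k arbitrary: f g)
 case 0
 then show ?case by (auto intro: continuous_on_mult)
next
 case (Suc k)
 from Suc.prems obtain F G where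
  F: "!!x. (f has_derivative (%h. F x \<bullet> h)) (at x)" "!!b. b \<in> Basis ==> Ck_on k UNIV (%x. F x \<bullet> b)" and
  G: "!!x. (g has_derivative (%h. G x \<bullet> h)) (at x)" "!!b. b \<in> Basis ==> Ck_on k UNIV (%x. G x \<bullet> b)"
  unfolding Ck_on_Suc_UNIV by blast
 note fg = Ck_on_SucD[OF Suc.prems(1)] Ck_on_SucD[OF Suc.prems(2)]
 show ?case
  unfolding Ck_on_Suc_UNIV
 proof (intro exI[of _ "%x. f x *\<^sub>R G x + g x *\<^sub>R F x"] conjI allI ballI)
  show "((%x. f x * g x) has_derivative (%h. (f x *\<^sub>R G x + g x *\<^sub>R F x) \<bullet> h)) (at x)" for x
   using has_derivative_mult[OF F(1)[of x] G(1)[of x]] by (simp add: inner_add_left mult.commute)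
  show "Ck_on k UNIV (%x. (f x *\<^sub>R G x + g x *\<^sub>R F x) \<bullet> b)" if "b \<in> Basis" for b
   using Ck_add[OF Suc.IH[OF fg(1) G(2)[OF that]] Suc.IH[OF fg(2) F(2)[OF that]]]
   by (simp add: inner_add_left)
 qed
qed

lemma smooth_const: "smooth (%x. c)"
 by (simp add: smooth_def Ck_const)

lemma smooth_add: "smooth f ==> smooth g ==> smooth (%x. f x + g x)"
 by (simp add: smooth_def Ck_add)

lemma smooth_mult: "smooth f ==> smooth g ==> smooth (%x. f x * g x)"
 by (simp add: smooth_def Ck_mult)

lemma smooth_cmult: "smooth f ==> smooth (%x. c * f x)"
 by (intro smooth_mult smooth_const)

lemma smooth_diff: "smooth f ==> smooth g ==> smooth (%x. f x - g x)"
 using smooth_add[OF _ smooth_cmult, of f g "-1"] by simp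

lemma smooth_sum: "(!!i. i \<in> I ==> smooth (f i)) ==> smooth (%x. \<Sum>i\<in>I. f i x)"
 by (induction I rule: infinite_finite_induct) (auto intro: smooth_add smooth_const)

lemma smooth_grad:
 assumes "smooth f"
 shows "(f has_derivative (%h. grad f x \<bullet> h)) (at x)" "smooth (%x. grad f x \<bullet> v)"
proof -
 have gr: "(\<forall>x. (f has_derivative (%h. grad f x \<bullet> h)) (at x)) \<and> (\<forall>b\<in>Basis. Ck_on k UNIV (%x. grad f x \<bullet> b))" for k
 proof -
  have "Ck_on (Suc k) UNIV f" using assms by (simp only: smooth_def)
  then obtain G where G: "!!x. (f has_derivative (%h. G x \<bullet> h)) (at x)" "\<forall>b\<in>Basis. Ck_on k UNIV (%x. G x \<bullet> b)"
   unfolding Ck_on_Suc_UNIV by blast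
  have "grad f = G" using grad_eqI[OF G(1)] by blast
  with G show ?thesis by simp
 qed
 show "(f has_derivative (%h. grad f x \<bullet> h)) (at x)" using gr by blast
 have sb: "smooth (%x. grad f x \<bullet> b)" if "b \<in> Basis" for b using gr that by (simp add: smooth_def)
 have "(%x. grad f x \<bullet> v) = (%x. \<Sum>b\<in>Basis. (v \<bullet> b) * (grad f x \<bullet> b))"
  by (auto simp: euclidean_inner[of _ v] mult.commute)
 then show "smooth (%x. grad f x \<bullet> v)"
  by (simp add: smooth_sum smooth_cmult sb)
qed

lemma smooth_inner: "smooth (%x. x \<bullet> v)"
proof -
 have "smooth (%x. x \<bullet> v)" if "(%x. x \<bullet> v) \<in> insert (%x. x \<bullet> v) (range (%c x. c))"
  using that
 proof (rule smooth_coinduct)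
  fix f assume "f \<in> insert (%x::'a. x \<bullet> v) (range (%c x. c))"
  then consider "f = (%x. x \<bullet> v)" | c where "f = (%x. c)" by auto
  then show "\<exists>G. (\<forall>x. (f has_derivative (%h. G x \<bullet> h)) (at x)) \<and>
     (\<forall>b\<in>Basis. (%x. G x \<bullet> b) \<in> insert (%x::'a. x \<bullet> v) (range (%c x. c)))"
  proof cases
   case 1
   have "(f has_derivative (%h. v \<bullet> h)) (at x)" for x
    unfolding 1 by (subst inner_commute) (auto intro!: derivative_eq_intros)
   then show ?thesis by (intro exI[of _ "%x. v"]) auto
  next
   case 2
   then show ?thesis by (intro exI[of _ "%x. 0"]) auto
  qed
 qed
 then show ?thesis by simp
qed

text \<open>The derivative is \<open>f' (q x)\<close> times \<open>grad q x\<close>: the outer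
  function changes while \<open>q\<close> stays, so the induction on the order generalises over
  \<open>f\<close> only.\<close>

lemma smooth_compose_real:
 assumes f: "smooth (f :: real => real)" and q: "smooth (q :: 'a::euclidean_space => real)"
 shows "smooth (%x. f (q x))"
proof -
 have "Ck_on k UNIV (%x. f (q x))" if "smooth (f :: real => real)" for k f
  using that
 proof (induction k arbitrary: f)
  case 0
  then show ?case
   using continuous_on_compose2[OF smooth_imp_continuous smooth_imp_continuous[OF q]] by simp
 next
  case (Suc k)
  define f' where "f' x = grad f x \<bullet> 1" for x
  have f': "smooth f'" unfolding f'_def by (rule smooth_grad(2)[OF Suc.prems])
  show ?case
   unfolding Ck_on_Suc_UNIV
  proof (intro exI[of _ "%x. f' (q x) *\<^sub>R grad q x"] conjI allI ballI)
   fix x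
   have "((%x. f (q x)) has_derivative (%h. grad f (q x) \<bullet> (grad q x \<bullet> h))) (at x)"
    using has_derivative_compose[OF smooth_grad(1)[OF q, of x] smooth_grad(1)[OF Suc.prems, of "q x"]] .
   then show "((%x. f (q x)) has_derivative (%h. (f' (q x) *\<^sub>R grad q x) \<bullet> h)) (at x)"
    by (simp add: f'_def)
  next
   fix b :: 'a assume "b \<in> Basis"
   show "Ck_on k UNIV (%x. (f' (q x) *\<^sub>R grad q x) \<bullet> b)"
    using Ck_mult[OF Suc.IH[OF f'], of "%x. grad q x \<bullet> b"] smooth_grad(2)[OF q, of b] by (simp add: smooth_def)
  qed
 qed
 with f show ?thesis by (auto simp: smooth_def)
qed

subsection \<open>A smooth bump\<close>

text \<open>The powers of \<open>1 / t\<close> close the family under differentiation up to linear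
  combinations: order \<open>m\<close> produces the orders \<open>m + 1\<close> and
  \<open>m + 2\<close>.\<close>

definition flat_exp :: "nat => real => real" where
 "flat_exp m t = (if t > 0 then exp (- (1 / t)) * (1 / t) ^ m else 0)"

lemma flat_exp_tendsto_0: "(flat_exp m \<longlongrightarrow> 0) (at 0)"
proof -
 have "((%x::real. x ^ m / exp x) \<longlongrightarrow> 0) at_top" by (rule tendsto_power_div_exp_0)
 then have "((%t::real. inverse t ^ m / exp (inverse t)) \<longlongrightarrow> 0) (at_right 0)"
  by (rule filterlim_compose) (rule filterlim_inverse_at_top_right)
 then have "(flat_exp m \<longlongrightarrow> 0) (at_right 0)"
  by (rule Lim_transform_eventually)
   (auto simp: eventually_at_filter flat_exp_def exp_minus divide_inverse mult.commute)
 have "(flat_exp m \<longlongrightarrow> 0) (at_left 0)"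
  by (rule Lim_transform_eventually[OF tendsto_const]) (auto simp: eventually_at_filter flat_exp_def)
 then show ?thesis using \<open>(flat_exp m \<longlongrightarrow> 0) (at_right 0)\<close> by (rule filterlim_split_at)
qed

lemma flat_exp_deriv:
 "(flat_exp m has_field_derivative flat_exp (m + 2) t - real m * flat_exp (m + 1) t) (at t)"
proof -
 consider "t > 0" | "t < 0" | "t = 0" by linarith
 then show ?thesis
 proof cases
  case 1
  have D: "((%t. 1 / t) has_field_derivative - ((1 / t) ^ 2)) (at t)"
   using 1 by (auto intro!: derivative_eq_intros simp: power2_eq_square)
  have "((%t. exp (- (1 / t)) * (1 / t) ^ m) has_field_derivative
    (exp (- (1 / t)) * (1 / t) ^ 2) * (1 / t) ^ m - (real m * (1 / t) ^ (m - 1) * (1 / t) ^ 2) * exp (- (1 / t))) (at t)"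
   by (rule DERIV_cong[OF DERIV_mult[OF DERIV_fun_exp[OF DERIV_minus[OF D]] DERIV_power[OF D, of m]]]) simp
  also have "(exp (- (1 / t)) * (1 / t) ^ 2) * (1 / t) ^ m - (real m * (1 / t) ^ (m - 1) * (1 / t) ^ 2) * exp (- (1 / t))
    = flat_exp (m + 2) t - real m * flat_exp (m + 1) t"
   using 1 by (cases m) (simp_all add: flat_exp_def power_add power2_eq_square mult_ac del: power_one_over)
  finally have "((%t. exp (- (1 / t)) * (1 / t) ^ m) has_field_derivative flat_exp (m + 2) t - real m * flat_exp (m + 1) t) (at t)" .
  then show ?thesis
   by (rule has_field_derivative_transform_within_open[where S = "{0<..}"]) (use 1 in \<open>auto simp: flat_exp_def\<close>)
 next
  case 2
  have "((%t. 0) has_field_derivative flat_exp (m + 2) t - real m * flat_exp (m + 1) t) (at t)"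
   using 2 by (auto simp: flat_exp_def)
  then show ?thesis
   by (rule has_field_derivative_transform_within_open[where S = "{..<0}"]) (use 2 in \<open>auto simp: flat_exp_def\<close>)
 next
  case 3
  \<comment> \<open>The difference quotient of order \<open>m\<close> at 0 is the function of order
    \<open>m + 1\<close>, whose limit is already known.\<close>
  have "((%h. (flat_exp m (0 + h) - flat_exp m 0) / h) \<longlongrightarrow> 0) (at 0)"
   by (rule Lim_transform_eventually[OF flat_exp_tendsto_0[of "m + 1"]])
    (auto simp: eventually_at_filter flat_exp_def)
  then show ?thesis unfolding 3 DERIV_def by (simp add: flat_exp_def)
 qed
qed

lemma smooth_flat_exp: "smooth (flat_exp m)"
proof -
 have "Ck_on k UNIV (flat_exp m)" for k m
 proof (induction k arbitrary: m)
  case 0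
  show ?case
   using flat_exp_deriv[of m] by (auto simp: continuous_on_eq_continuous_at intro: DERIV_isCont)
 next
  case (Suc k)
  show ?case
   unfolding Ck_on_Suc_UNIV
  proof (intro exI[of _ "%t. flat_exp (m + 2) t - real m * flat_exp (m + 1) t"] conjI allI ballI)
   show "(flat_exp m has_derivative (%h. (flat_exp (m + 2) t - real m * flat_exp (m + 1) t) \<bullet> h)) (at t)" for t
    using flat_exp_deriv[of m t] by (simp add: has_field_derivative_def)
   have "Ck_on k UNIV (%t. flat_exp (m + 2) t + (- real m) * flat_exp (m + 1) t)"
    by (intro Ck_add Ck_mult Ck_const Suc.IH)
   then show "Ck_on k UNIV (%t. (flat_exp (m + 2) t - real m * flat_exp (m + 1) t) \<bullet> b)" if "b \<in> Basis" for b
    using that by simp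
  qed
 qed
 then show ?thesis by (auto simp: smooth_def)
qed

text \<open>The bump is \<open>flat_exp 0\<close> of \<open>r^2 - (dist p x)^2\<close>, written as a
  sum over coordinates so that its smoothness is that of a polynomial.\<close>

lemma smooth_bump_exists:
 fixes p :: "'a::euclidean_space"
 assumes "r > 0"
 obtains f where "smooth f" "!!x. 0 \<le> f x" "!!x. f x > 0 \<longleftrightarrow> x \<in> ball p r"
proof -
 define q where "q x = r\<^sup>2 - (\<Sum>b\<in>Basis. ((x - p) \<bullet> b)^2)" for x
 have q: "q x = r\<^sup>2 - (dist p x)^2" for x
  unfolding q_def dist_norm power2_norm_eq_inner norm_minus_commute[of p]
  by (simp add: euclidean_inner[of "x - p" "x - p"] power2_eq_square)
 have "smooth (%x. (x - p) \<bullet> b)" for b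
  unfolding inner_diff_left by (intro smooth_diff smooth_const smooth_inner)
 then have "smooth q"
  unfolding q_def power2_eq_square
  by (intro smooth_diff smooth_const smooth_sum smooth_mult)
 then have "smooth (%x. flat_exp 0 (q x))" by (rule smooth_compose_real[OF smooth_flat_exp])
 moreover have "flat_exp 0 (q x) > 0 \<longleftrightarrow> x \<in> ball p r" for x
 proof -
  have "flat_exp 0 (q x) > 0 \<longleftrightarrow> (dist p x)^2 < r\<^sup>2" by (simp add: flat_exp_def q)
  moreover have "r\<^sup>2 \<le> (dist p x)^2 \<longleftrightarrow> r \<le> dist p x"
   by (rule power_mono_iff) (use assms in auto)
  ultimately show ?thesis by (simp add: not_le[symmetric])
 qed
 ultimately show thesis by (intro that[of "%x. flat_exp 0 (q x)"]) (auto simp: flat_exp_def)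
qed

section \<open>Mollification\<close>

subsection \<open>Translations\<close>

lemma integral_shift:
 fixes c :: "'a::euclidean_space" and f :: "'a => 'b::euclidean_space"
 assumes [measurable]: "f \<in> Borel"
 shows "(LINT x|lborel. f (x + c)) = (LINT x|lborel. f x)"
  and "integrable lborel (%x. f (x + c)) \<longleftrightarrow> integrable lborel f"
proof -
 have "(LINT x|lborel. f x) = (LINT x|distr lborel borel ((+) c). f x)"
  by (simp add: lborel_distr_plus)
 also have "... = (LINT x|lborel. f (x + c))"
  by (subst integral_distr) (auto simp: add.commute)
 finally show "(LINT x|lborel. f (x + c)) = (LINT x|lborel. f x)" by simp
 have "integrable lborel f \<longleftrightarrow> integrable (distr lborel borel ((+) c)) f"
  by (simp add: lborel_distr_plus)
 also have "... \<longleftrightarrow> integrable lborel (%x. f (x + c))"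
  by (subst integrable_distr_eq) (auto simp: add.commute)
 finally show "integrable lborel (%x. f (x + c)) \<longleftrightarrow> integrable lborel f" by simp
qed

lemma square_int_shift:
 assumes "sqint f"
 shows "sqint (%x. f (x + c))" "norm2 (%x. f (x + c)) = norm2 f"
proof -
 have [measurable]: "f \<in> Borel" using assms by (simp add: square_int_def)
 show "sqint (%x. f (x + c))"
  using assms integral_shift(2)[of "%x. (norm (f x))^2" c] by (simp add: square_int_def)
 show "norm2 (%x. f (x + c)) = norm2 f"
  unfolding l2norm_def using integral_shift(1)[of "%x. (norm (f x))^2" c] by simp
qed

section \<open>Continuous approximation and continuity of translations in L^2\<close>

lemma square_int_truncation:
 fixes f :: "'a::euclidean_space => 'b::euclidean_space"
 assumes f: "sqint f" and S: "!!n. S n \<in> sets borel" "!!x. f x \<noteq> 0 ==> \<forall>\<^sub>F n in sequentially. x \<in> S n"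
 shows "l2lim (%n x. cut (S n) f x) f"
proof -
 have [measurable]: "f \<in> Borel" "!!n. S n \<in> sets borel" using f S by (auto simp: square_int_def)
 have "(%n. LINT x|lborel. (norm (cut (S n) f x - f x))^2) \<longlonglongrightarrow> (LINT x::'a|lborel. 0)"
 proof (rule integral_dominated_convergence)
  show "integrable lborel (%x. (norm (f x))^2)" using f by (simp add: square_int_def)
  show "AE x in lborel. (%n. (norm (cut (S n) f x - f x))^2) \<longlonglongrightarrow> 0"
  proof (rule AE_I2)
   fix x
   show "(%n. (norm (cut (S n) f x - f x))^2) \<longlonglongrightarrow> 0"
   proof (cases "f x = 0")
    case False
    have "\<forall>\<^sub>F n in sequentially. 0 = (norm (cut (S n) f x - f x))^2"
     using S(2)[OF False] by eventually_elim auto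
    then show ?thesis by (rule Lim_transform_eventually[OF tendsto_const])
   qed simp
  qed
  show "AE x in lborel. norm ((norm (cut (S n) f x - f x))^2) \<le> (norm (f x))^2" for n
   by (auto intro!: AE_I2 simp: indicator_def)
 qed auto
 then have "(%n. sqrt (LINT x|lborel. (norm (cut (S n) f x - f x))^2)) \<longlonglongrightarrow> sqrt 0"
  by (intro tendsto_real_sqrt) simp
 then show ?thesis by (simp add: l2norm_def)
qed

lemma integrable_indicator_cball:
 "integrable lborel (indicator (cball 0 r) :: 'a::euclidean_space => real)" (is "integrable _ ?I") and square_int_indicator_cball: "sqint (indicator (cball 0 r) :: 'a => real)"
proof -
 show i: "integrable lborel ?I" by (rule integrable_real_indicator[OF _ emeasure_bounded_finite[OF bounded_cball]]) simp
 have "(%x. (norm (?I x))^2) = ?I" by (auto simp: indicator_def)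
 then show "sqint ?I" using i by (simp only: square_int_def) simp
qed

text \<open>After truncation in value and in space, the function is an almost everywhere limit of
  continuous functions. These need not be uniformly bounded or compactly supported, so they are
  composed with a retraction and multiplied by a tent function; then dominated convergence
  applies.\<close>

lemma l2_continuous_approx:
 fixes f :: "'a::euclidean_space => 'b::euclidean_space"
 assumes f: "sqint f" and e: "e > 0"
 obtains h R where "continuous_on UNIV h" "!!x. x \<notin> cball 0 R ==> h x = 0" "sqint h" "dist2 h f < e"
proof -
 have fm [measurable]: "f \<in> Borel" using f by (auto simp: square_int_def)
 define S where "S n = {x \<in> space borel. norm (f x) \<le> real n} \<inter> cball 0 (real n)" for n :: nat
 have Sm [measurable]: "S n \<in> sets borel" for n unfolding S_def by measurable
 have "\<forall>\<^sub>F n in sequentially. x \<in> S n" for x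
 proof -
  obtain m where "norm (f x) + norm x \<le> real m" using real_arch_simple by blast
  then have "norm (f x) \<le> real n \<and> norm x \<le> real n" if "n \<ge> m" for n
   using that norm_ge_zero[of "f x"] norm_ge_zero[of x] of_nat_mono[OF that, where 'a = real] by linarith
  then have "x \<in> S n" if "n \<ge> m" for n using that by (simp add: S_def)
  then show ?thesis unfolding eventually_sequentially by blast
 qed
 then have "l2lim (%n x. cut (S n) f x) f"
  using square_int_truncation[OF f, of S] Sm by blast
 then have "\<forall>\<^sub>F n in sequentially. dist2 (cut (S n) f) f < e/2 \<and> n \<ge> 1"
  using e by (intro eventually_conj order_tendstoD eventually_ge_at_top) auto
 from eventually_happens'[OF sequentially_bot this]
 obtain n where n: "dist2 (cut (S n) f) f < e/2" "n \<ge> 1" by blast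
 define g where "g x = cut (S n) f x" for x
 have g: "sqint g"
  unfolding g_def by (rule square_int_bounded_mult[OF f, where C = 1]) (auto simp: indicator_def)
 have gm [measurable]: "g \<in> Borel" using g by (simp add: square_int_def)
 have gb: "norm (g x) \<le> real n" "x \<notin> cball 0 (real n) ==> g x = 0" for x by (auto simp: g_def S_def indicator_def)
 have "g measurable_on UNIV" by (rule lebesgue_measurable_imp_measurable_on) (use gm in \<open>simp_all add: measurable_completion\<close>)
 then obtain N G where N: "negligible N" and G: "!!k. continuous_on UNIV (G k)" "!!x. x \<notin> N ==> (%k. G k x) \<longlonglongrightarrow> g x"
  unfolding measurable_on_def by auto
 \<comment> \<open>Radial retraction onto the ball of radius \<open>n\<close>: it does not move the
   values of \<open>g\<close>, and \<open>n \<ge> 1\<close> keeps the denominator positive.\<close>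
 define c where "c v = (real n / max (real n) (norm v)) *\<^sub>R v" for v :: 'b
 have c: "continuous_on UNIV c" unfolding c_def using n(2) by (intro continuous_intros) (auto simp: max_def)
 have cb: "norm (c v) \<le> real n" "norm v \<le> real n ==> c v = v" for v
  using n(2) by (auto simp: c_def max_def divide_le_eq field_simps)
 define h where "h k x = max 0 (min 1 (real n + 1 - norm x)) *\<^sub>R c (G k x)" for k x
 have hc: "continuous_on UNIV (h k)" for k
  unfolding h_def by (intro continuous_intros continuous_on_compose2[OF c G(1)]) auto
 let ?B = "cball 0 (real n + 1) :: 'a set"
 have h0: "h k x = 0" if "x \<notin> ?B" for k x using that by (simp add: h_def)
 have [measurable]: "h k \<in> Borel" for k using hc by (rule borel_measurable_continuous_onI)
 have hb: "norm (h k x) \<le> real n" for k x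
  unfolding h_def norm_scaleR by (rule order_trans[OF mult_left_le_one_le cb(1)]) auto
 have i: "integrable lborel (%x::'a. indicator ?B x * (2 * real n)^2)"
  by (intro integrable_mult_left integrable_indicator_cball)
 have ae: "AE x in lborel. (%k. (norm (h k x - g x))^2) \<longlonglongrightarrow> 0"
 proof -
  have "AE x in lebesgue. x \<notin> N" by (rule AE_not_in) (use N negligible_iff_null_sets in blast)
  then have "AE x in lborel. x \<notin> N" by (simp add: AE_completion_iff)
  then show ?thesis
  proof eventually_elim
   case (elim x)
   have "(%k. c (G k x)) \<longlonglongrightarrow> c (g x)"
    by (rule continuous_on_tendsto_compose[OF c G(2)[OF elim]]) auto
   then have "(%k. c (G k x)) \<longlonglongrightarrow> g x" using cb(2)[OF gb(1)] by simp
   then have "(%k. h k x) \<longlonglongrightarrow> max 0 (min 1 (real n + 1 - norm x)) *\<^sub>R g x" unfolding h_def by (intro tendsto_intros)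
   also have "max 0 (min 1 (real n + 1 - norm x)) *\<^sub>R g x = g x" using gb(2)[of x] by (cases "norm x \<le> real n") auto
   finally show ?case using tendsto_power[OF tendsto_norm_zero[OF LIM_zero], of _ _ _ 2] by fastforce
  qed
 qed
 have bd: "norm ((norm (h k x - g x))^2) \<le> indicator ?B x * (2 * real n)^2" for k x
 proof (cases "x \<in> ?B")
  case True
  have "norm (h k x - g x) \<le> 2 * real n" using norm_triangle_ineq4[of "h k x" "g x"] hb[of k x] gb(1)[of x] by linarith
  from power_mono[OF this norm_ge_zero, of 2] show ?thesis using True by simp
 qed (use gb(2)[of x] in \<open>simp add: h0\<close>)
 have "(%k. LINT x|lborel. (norm (h k x - g x))^2) \<longlonglongrightarrow> (LINT x::'a|lborel. 0)"
  by (rule integral_dominated_convergence[OF _ _ i ae AE_I2[OF bd]]) measurable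
 from tendsto_real_sqrt[OF this] have "l2lim h g" by (simp add: l2norm_def)
 then have "\<forall>\<^sub>F k in sequentially. dist2 (h k) g < e/2" using e by (intro order_tendstoD) auto
 then obtain k where k: "dist2 (h k) g < e/2" by (meson eventually_happens trivial_limit_sequentially)
 have hs: "sqint (h k)"
 proof (rule square_int_bound[where C = "real n"])
  show "sqint (indicator ?B :: 'a => real)"
   by (rule square_int_indicator_cball)
  show "AE x in lborel. norm (h k x) \<le> real n * norm (indicator ?B x :: real)" using hb h0 by (auto simp: indicator_def)
 qed simp
 have "dist2 (h k) f < e"
  using l2norm_diff_triangle[OF hs g f] k n(1) unfolding g_def by linarith
 then show thesis using that[OF hc h0 hs] by blast
qed

lemma l2_translation_continuous:
 fixes f :: "'a::euclidean_space => 'b::euclidean_space"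
 assumes f: "sqint f" and e: "e > 0"
 obtains d where "d > 0" "!!z. norm z < d ==> norm2 (%x. f (x + z) - f x) < e"
proof -
 obtain h R where h: "continuous_on UNIV h" "!!x. x \<notin> cball 0 R ==> h x = 0" "sqint h" "dist2 h f < e/3"
  using l2_continuous_approx[OF f, of "e/3"] e by auto
 define I where "I = (indicator (cball 0 (R + 1)) :: 'a => real)"
 have I: "sqint I" unfolding I_def by (rule square_int_indicator_cball)
 \<comment> \<open>Chosen so that \<open>\<delta>\<close> times the norm of the indicator stays
   below \<open>e/3\<close>; the added 1 prevents a division by zero.\<close>
 define \<delta> where "\<delta> = e / (3 * (norm2 I + 1))"
 have n1: "norm2 I + 1 > 0" using l2norm_nonneg[of lborel I] by linarith
 then have \<delta>: "\<delta> > 0" "\<delta> * norm2 I < e/3" using e by (simp_all add: \<delta>_def field_simps)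
 \<comment> \<open>For shifts shorter than 1, radius \<open>R + 1\<close> contains the support of
   the difference and radius \<open>R + 2\<close> both arguments of \<open>h\<close>.\<close>
 have "uniformly_continuous_on (cball 0 (R + 2)) h"
  by (rule compact_uniformly_continuous[OF continuous_on_subset[OF h(1)]]) auto
 then obtain d where d: "d > 0" "!!x y. x \<in> cball 0 (R + 2) ==> y \<in> cball 0 (R + 2) ==> dist y x < d ==> dist (h y) (h x) < \<delta>"
  unfolding uniformly_continuous_on_def using \<delta>(1) by meson
 show thesis
 proof (rule that[of "min d 1"])
  fix z :: 'a assume z: "norm z < min d 1"
  have hz: "sqint (%x. h (x + z))" and fz: "sqint (%x. f (x + z))"
   using square_int_shift(1) h(3) f by auto
  have "norm (h (x + z) - h x) \<le> norm (\<delta> *\<^sub>R I x)" for x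
  proof (cases "x \<in> cball 0 (R + 1)")
   case True
   then have "x \<in> cball 0 (R + 2)" "x + z \<in> cball 0 (R + 2)" using z norm_triangle_ineq[of x z] by auto
   then show ?thesis using d(2)[of x "x + z"] z True \<delta>(1) by (simp add: I_def dist_norm)
  next
   case False
   then have "x \<notin> cball 0 R" "x + z \<notin> cball 0 R" using z norm_diff_ineq[of x z] by auto
   then show ?thesis using h(2) by simp
  qed
  then have "norm2 (%x. h (x + z) - h x) \<le> norm2 (%x. \<delta> *\<^sub>R I x)"
   by (intro l2norm_mono square_int_scaleR I square_int_measurable[OF square_int_diff[OF hz h(3)]]) auto
  also have "... < e/3" using \<delta> by (simp only: l2norm_scaleR abs_of_pos)
  finally have "norm2 (%x. h (x + z) - h x) < e/3" .
  moreover have "norm2 (%x. f (x + z) - h (x + z)) = dist2 h f"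
   using square_int_shift(2)[OF square_int_diff[OF f h(3)], of z] l2norm_diff_commute[of lborel f h] by simp
  ultimately show "norm2 (%x. f (x + z) - f x) < e"
   using l2norm_diff_triangle[OF fz hz f] l2norm_diff_triangle[OF hz h(3) f] h(4) by linarith
 qed (use d in auto)
qed

subsection \<open>Test functions\<close>

lemma test_functionI:
 assumes "smooth \<phi>" "compact K" "K \<subseteq> U" "!!x. x \<notin> K ==> \<phi> x = 0"
 shows "test_function U \<phi>"
proof -
 have "closure {x. \<phi> x \<noteq> 0} \<subseteq> K"
  using assms by (intro closure_minimal compact_imp_closed) auto
 moreover have "compact (closure {x. \<phi> x \<noteq> 0})"
  using calculation assms(2) by (meson bounded_subset closed_closure compact_eq_bounded_closed)
 ultimately show ?thesis using assms by (auto simp: test_function_def smooth_def)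
qed

lemma test_function_smooth: "test_function U \<phi> ==> smooth \<phi>"
 by (simp add: test_function_def smooth_def)

lemma grad_locally_zero:
 assumes "open S" "x \<in> S" "!!y. y \<in> S ==> f y = c"
 shows "grad f x = 0"
proof -
 have "((%y. c) has_derivative (%h. 0 \<bullet> h)) (at x)" by simp
 then have "(f has_derivative (%h. 0 \<bullet> h)) (at x)"
  by (rule has_derivative_transform_within_open[OF _ assms(1,2)]) (simp add: assms(3))
 then show ?thesis by (rule grad_eqI)
qed

lemma test_function_support:
 assumes "test_function U \<phi>"
 obtains K where "compact K" "K \<subseteq> U" "!!x. x \<notin> K ==> \<phi> x = 0" "!!x. x \<notin> K ==> grad \<phi> x = 0"
proof
 let ?K = "closure {x. \<phi> x \<noteq> 0}"
 show "compact ?K" "?K \<subseteq> U" using assms by (auto simp: test_function_def)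
 show z: "\<phi> x = 0" if "x \<notin> ?K" for x using that closure_subset[of "{x. \<phi> x \<noteq> 0}"] by auto
 show "grad \<phi> x = 0" if "x \<notin> ?K" for x
  by (rule grad_locally_zero[of "- ?K", OF _ _ z]) (use that in auto)
qed

lemma test_function_mono: "test_function U \<phi> ==> U \<subseteq> V ==> test_function V \<phi>"
 by (auto simp: test_function_def)

lemma test_function_zero: "test_function U (%x. 0)"
 by (rule test_functionI[of _ "{}"]) (auto intro: smooth_const)

lemma test_function_mult:
 assumes "test_function U \<phi>" "smooth \<psi>"
 shows "test_function U (%x. \<psi> x * \<phi> x)"
proof -
 obtain K where "compact K" "K \<subseteq> U" "!!x. x \<notin> K ==> \<phi> x = 0" using test_function_support[OF assms(1)] by metis
 then show ?thesis
  using assms by (intro test_functionI[of _ K]) (auto intro: smooth_mult test_function_smooth)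
qed

lemma test_function_mult_Int:
 assumes "test_function U \<phi>" "test_function V \<psi>"
 shows "test_function (U \<inter> V) (%x. \<psi> x * \<phi> x)"
proof -
 obtain K where "compact K" "K \<subseteq> U" "!!x. x \<notin> K ==> \<phi> x = 0" using test_function_support[OF assms(1)] by metis
 moreover obtain L where "compact L" "L \<subseteq> V" "!!x. x \<notin> L ==> \<psi> x = 0" using test_function_support[OF assms(2)] by metis
 ultimately show ?thesis
  using assms by (intro test_functionI[of _ "K \<inter> L"]) (auto intro: smooth_mult test_function_smooth)
qed

lemma test_function_add:
 assumes "test_function U \<phi>" "test_function U \<psi>"
 shows "test_function U (%x. \<phi> x + \<psi> x)"
proof -
 obtain K where "compact K" "K \<subseteq> U" "!!x. x \<notin> K ==> \<phi> x = 0" using test_function_support[OF assms(1)] by metis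
 moreover obtain L where "compact L" "L \<subseteq> U" "!!x. x \<notin> L ==> \<psi> x = 0" using test_function_support[OF assms(2)] by metis
 ultimately show ?thesis
  using assms by (intro test_functionI[of _ "K \<union> L"]) (auto intro: smooth_add test_function_smooth)
qed

lemma test_function_grad:
 assumes "test_function U \<phi>"
 shows "test_function U (%x. grad \<phi> x \<bullet> v)"
proof -
 obtain K where "compact K" "K \<subseteq> U" "!!x. x \<notin> K ==> grad \<phi> x = 0" using test_function_support[OF assms] by metis
 then show ?thesis
  using smooth_grad(2)[OF test_function_smooth[OF assms]] by (intro test_functionI[of _ K]) auto
qed

lemma smooth_grad_continuous:
 assumes "smooth f"
 shows "continuous_on UNIV (grad f)"
proof -
 have "continuous_on UNIV (%x. \<Sum>b\<in>Basis. (grad f x \<bullet> b) *\<^sub>R b)"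
  using smooth_imp_continuous[OF smooth_grad(2)[OF assms]] by (intro continuous_on_sum continuous_on_scaleR continuous_on_const)
 then show ?thesis by (simp add: euclidean_representation)
qed

lemma continuous_compact_support_bounded:
 fixes f :: "'a::euclidean_space => 'b::euclidean_space"
 assumes "continuous_on UNIV f" "compact K" "!!x. x \<notin> K ==> f x = 0"
 obtains C where "C \<ge> 0" "!!x. norm (f x) \<le> C"
proof -
 have "compact (f ` K)" using assms by (intro compact_continuous_image) (auto intro: continuous_on_subset)
 then obtain C where "!!x. x \<in> K ==> norm (f x) \<le> C"
  using compact_imp_bounded bounded_iff by (metis imageI)
 then have "norm (f x) \<le> max C 0" for x using assms(3)[of x] by (cases "x \<in> K") (auto simp: le_max_iff_disj)
 then show thesis by (intro that[of "max C 0"]) auto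
qed

lemma bounded_support_integrable:
 fixes f :: "'a::euclidean_space => 'b::euclidean_space"
 assumes f: "f \<in> Borel" and C: "!!x. norm (f x) \<le> C" and K: "bounded K" "!!x. x \<notin> K ==> f x = 0"
 shows "sqint f" "integrable lborel f"
proof -
 note [measurable] = f
 obtain R where "!!x. x \<in> K ==> norm x \<le> R" using K(1) bounded_iff by metis
 then have R: "K \<subseteq> cball 0 R" by auto
 have fin: "emeasure lborel (cball (0::'a) R) < \<infinity>" by (rule emeasure_bounded_finite) simp
 have "integrable lborel (%x::'a. C\<^sup>2 * indicator (cball 0 R) x :: real)"
  by (intro integrable_mult_right) (use fin in \<open>simp add: integrable_indicator_iff\<close>)
 then have "integrable lborel (%x. (norm (f x))^2)"
 proof (rule Bochner_Integration.integrable_bound)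
  show "AE x in lborel. norm ((norm (f x))^2) \<le> norm (C\<^sup>2 * indicator (cball 0 R) x :: real)"
  proof (rule AE_I2)
   fix x
   show "norm ((norm (f x))^2) \<le> norm (C\<^sup>2 * indicator (cball 0 R) x :: real)"
   proof (cases "x \<in> cball 0 R")
    case True
    have "(norm (f x))^2 \<le> C\<^sup>2" by (rule power_mono[OF C]) simp
    with True show ?thesis by simp
   next
    case False
    then have "x \<notin> K" using R by auto
    then have "f x = 0" by (rule K(2))
    then show ?thesis by simp
   qed
  qed
 qed auto
 then show sq: "sqint f" by (simp add: square_int_def)
 have "bounded {x. f x \<noteq> 0}" using K by (auto intro: bounded_subset)
 then show "integrable lborel f"
  by (intro square_int_integrable_finite[OF sq]) (simp add: emeasure_bounded_finite[unfolded infinity_ennreal_def])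
qed

lemma continuous_compact_support_integrable:
 fixes f :: "'a::euclidean_space => 'b::euclidean_space"
 assumes "continuous_on UNIV f" "compact K" "!!x. x \<notin> K ==> f x = 0"
 shows "sqint f" "integrable lborel f"
proof -
 obtain C where "!!x. norm (f x) \<le> C" using continuous_compact_support_bounded[OF assms] by blast
 then show "sqint f" "integrable lborel f"
  using bounded_support_integrable[OF borel_measurable_continuous_onI[OF assms(1)] _ compact_imp_bounded[OF assms(2)]] assms(3) by blast+
qed

lemma test_function_measurable:
 assumes "test_function U \<phi>"
 shows "\<phi> \<in> Borel" "grad \<phi> \<in> Borel"
 using smooth_imp_continuous[OF test_function_smooth[OF assms]] smooth_grad_continuous[OF test_function_smooth[OF assms]]
 by (auto intro: borel_measurable_continuous_onI)

lemma test_function_integrable: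
 assumes "test_function U \<phi>"
 shows "sqint \<phi>" "integrable lborel \<phi>" "sqint (grad \<phi>)" "integrable lborel (grad \<phi>)"
proof -
 obtain K where K: "compact K" "!!x. x \<notin> K ==> \<phi> x = 0" "!!x. x \<notin> K ==> grad \<phi> x = 0" using test_function_support[OF assms] by metis
 note s = test_function_smooth[OF assms]
 show "sqint \<phi>" "integrable lborel \<phi>" "sqint (grad \<phi>)" "integrable lborel (grad \<phi>)"
  using continuous_compact_support_integrable[OF smooth_imp_continuous[OF s] K(1,2)]
   continuous_compact_support_integrable[OF smooth_grad_continuous[OF s] K(1,3)] by auto
qed

lemma test_function_bounded:
 assumes "test_function U \<phi>"
 obtains C where "C \<ge> 0" "!!x. \<bar>\<phi> x\<bar> \<le> C" "!!x. norm (grad \<phi> x) \<le> C"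
proof -
 obtain K where K: "compact K" "!!x. x \<notin> K ==> \<phi> x = 0" "!!x. x \<notin> K ==> grad \<phi> x = 0" using test_function_support[OF assms] by metis
 note s = test_function_smooth[OF assms]
 obtain C1 where "C1 \<ge> 0" "!!x. norm (\<phi> x) \<le> C1"
  using continuous_compact_support_bounded[OF smooth_imp_continuous[OF s] K(1,2)] by blast
 moreover obtain C2 where "C2 \<ge> 0" "!!x. norm (grad \<phi> x) \<le> C2"
  using continuous_compact_support_bounded[OF smooth_grad_continuous[OF s] K(1,3)] by blast
 ultimately show thesis by (intro that[of "max C1 C2"]) (auto simp: le_max_iff_disj)
qed

lemma onorm_inner_le: "onorm (%h. v \<bullet> h) \<le> norm (v::'a::euclidean_space)"
 by (rule onorm_bound) (auto simp: Cauchy_Schwarz_ineq2)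

lemma test_function_lipschitz:
 assumes "test_function U \<phi>"
 obtains L where "L \<ge> 0" "!!x y. \<bar>\<phi> x - \<phi> y\<bar> \<le> L * norm (x - y)"
proof -
 obtain C where C: "C \<ge> 0" "!!x. norm (grad \<phi> x) \<le> C" using test_function_bounded[OF assms] by metis
 have "norm (\<phi> x - \<phi> y) \<le> C * norm (x - y)" for x y
  by (rule differentiable_bound[of UNIV \<phi> "%x h. grad \<phi> x \<bullet> h"])
   (auto intro: smooth_grad(1) test_function_smooth[OF assms] order_trans[OF onorm_inner_le C(2)])
 with C(1) show thesis by (intro that[of C]) auto
qed

text \<open>The mean value bound is applied to \<open>\<phi>\<close> minus its linear part, using
  that the gradient is Lipschitz. A remainder quadratic in \<open>h\<close>, uniformly in
  \<open>x\<close>, is what permits differentiation under the integral against a merely integrable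
  function.\<close>

lemma test_function_taylor:
 fixes \<phi> :: "'a::euclidean_space => real"
 assumes "test_function U \<phi>"
 obtains L where "L \<ge> 0" "!!x h. \<bar>\<phi> (x + h) - \<phi> x - grad \<phi> x \<bullet> h\<bar> \<le> L * (norm h)^2"
proof -
 have "\<exists>L. L \<ge> 0 \<and> (\<forall>x y. \<bar>grad \<phi> x \<bullet> b - grad \<phi> y \<bullet> b\<bar> \<le> L * norm (x - y))" for b
  using test_function_lipschitz[OF test_function_grad[OF assms, of b]] by metis
 then obtain L where L: "!!b. L b \<ge> 0" "!!b x y. \<bar>grad \<phi> x \<bullet> b - grad \<phi> y \<bullet> b\<bar> \<le> L b * norm (x - y)" by metis
 define M where "M = (\<Sum>b\<in>Basis. L b)"
 have M: "M \<ge> 0" unfolding M_def by (intro sum_nonneg L)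
 have gl: "norm (grad \<phi> x - grad \<phi> y) \<le> M * norm (x - y)" for x y
 proof -
  have "norm (grad \<phi> x - grad \<phi> y) \<le> (\<Sum>b\<in>Basis. \<bar>(grad \<phi> x - grad \<phi> y) \<bullet> b\<bar>)" by (rule norm_le_l1)
  also have "... \<le> (\<Sum>b\<in>Basis. L b * norm (x - y))" by (intro sum_mono) (simp add: inner_diff_left L)
  finally show ?thesis by (simp add: M_def sum_distrib_right)
 qed
 show thesis
 proof (rule that[OF M])
  fix x h :: 'a
  let ?S = "cball x (norm h)"
  have "norm ((%y. \<phi> y - grad \<phi> x \<bullet> y) (x + h) - (%y. \<phi> y - grad \<phi> x \<bullet> y) x) \<le> (M * norm h) * norm (x + h - x)"
  proof (rule differentiable_bound[of ?S _ "%y k. (grad \<phi> y - grad \<phi> x) \<bullet> k"])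
   fix y assume y: "y \<in> ?S"
   have "((%y. \<phi> y - grad \<phi> x \<bullet> y) has_derivative (%k. grad \<phi> y \<bullet> k - grad \<phi> x \<bullet> k)) (at y)"
    by (intro has_derivative_diff smooth_grad(1) test_function_smooth[OF assms] has_derivative_inner_right has_derivative_ident)
   then show "((%y. \<phi> y - grad \<phi> x \<bullet> y) has_derivative (%k. (grad \<phi> y - grad \<phi> x) \<bullet> k)) (at y within ?S)"
    by (simp add: inner_diff_left has_derivative_at_withinI)
   have "norm (grad \<phi> y - grad \<phi> x) \<le> M * norm h"
    using y by (intro order_trans[OF gl] mult_left_mono M) (auto simp: dist_norm norm_minus_commute)
   then show "onorm (%k. (grad \<phi> y - grad \<phi> x) \<bullet> k) \<le> M * norm h"
    using onorm_inner_le order_trans by blast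
  qed (auto simp: dist_norm)
  then show "\<bar>\<phi> (x + h) - \<phi> x - grad \<phi> x \<bullet> h\<bar> \<le> M * (norm h)^2"
   by (simp add: power2_eq_square inner_add_right algebra_simps)
 qed
qed

subsection \<open>Convolution with a kernel\<close>

text \<open>The kernel is reflected with respect to the usual convolution, so that only translations of
 the Lebesgue measure are needed.\<close>

definition mollify :: "('a::euclidean_space => real) => ('a => 'b::euclidean_space) => 'a => 'b" where
 "mollify \<rho> f x = (LINT y|lborel. \<rho> (y - x) *\<^sub>R f y)"

lemma mollify_integrable:
 fixes f :: "'a::euclidean_space => 'b::euclidean_space"
 assumes \<rho>: "test_function U \<rho>" and f: "integrable lborel f"
 shows "integrable lborel (%y. \<rho> (y - x) *\<^sub>R f y)" "integrable lborel (%y. (f y \<bullet> v) *\<^sub>R grad \<rho> (y - x))"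
proof -
 have [measurable]: "\<rho> \<in> Borel" "grad \<rho> \<in> Borel" "f \<in> Borel"
  using test_function_measurable[OF \<rho>] f by auto
 obtain C where C: "C \<ge> 0" "!!x. \<bar>\<rho> x\<bar> \<le> C" "!!x. norm (grad \<rho> x) \<le> C" using test_function_bounded[OF \<rho>] by metis
 have i: "integrable lborel (%y. C * norm (f y))" using f by auto
 show "integrable lborel (%y. \<rho> (y - x) *\<^sub>R f y)"
  by (rule Bochner_Integration.integrable_bound[OF i]) (auto intro!: AE_I2 mult_right_mono C simp: abs_mult C(1))
 have i2: "integrable lborel (%y. norm v * C * norm (f y))" using f by auto
 show "integrable lborel (%y. (f y \<bullet> v) *\<^sub>R grad \<rho> (y - x))"
 proof (rule Bochner_Integration.integrable_bound[OF i2])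
  show "AE y in lborel. norm ((f y \<bullet> v) *\<^sub>R grad \<rho> (y - x)) \<le> norm (norm v * C * norm (f y))"
  proof (rule AE_I2)
   fix y
   have "\<bar>f y \<bullet> v\<bar> * norm (grad \<rho> (y - x)) \<le> (norm (f y) * norm v) * C"
    by (intro mult_mono Cauchy_Schwarz_ineq2 C) auto
   then show "norm ((f y \<bullet> v) *\<^sub>R grad \<rho> (y - x)) \<le> norm (norm v * C * norm (f y))"
    using C(1) by (simp add: abs_mult mult_ac)
  qed
 qed measurable
qed

text \<open>The Taylor remainder of the kernel, integrated against \<open>\<bar>f y\<bar>\<close>,
  is at most a constant times the squared displacement. The minus sign arises because the kernel is
  evaluated at \<open>y - x\<close>.\<close>

lemma mollify_has_derivative:
 fixes f :: "'a::euclidean_space => real"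
 assumes \<rho>: "test_function U \<rho>" and f: "integrable lborel f"
 shows "(mollify \<rho> f has_derivative (%h. (LINT y|lborel. f y *\<^sub>R - grad \<rho> (y - x)) \<bullet> h)) (at x)"
proof -
 obtain L where L: "L \<ge> 0" "!!x h. \<bar>\<rho> (x + h) - \<rho> x - grad \<rho> x \<bullet> h\<bar> \<le> L * (norm h)^2"
  using test_function_taylor[OF \<rho>] by metis
 note i1 = mollify_integrable(1)[OF \<rho> f]
 have i2: "integrable lborel (%y. f y *\<^sub>R grad \<rho> (y - x))" for x
  using mollify_integrable(2)[OF \<rho> f, of 1] by simp
 let ?G = "LINT y|lborel. f y *\<^sub>R - grad \<rho> (y - x)"
 let ?N = "LINT y|lborel. \<bar>f y\<bar>"
 show ?thesis
 proof (rule has_derivativeI_sandwich[of 1])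
  show "bounded_linear (%h. ?G \<bullet> h)" by (rule bounded_linear_inner_right)
  show "((%x'. L * ?N * norm (x' - x)) \<longlongrightarrow> 0) (at x within UNIV)"
   by (auto intro!: tendsto_eq_intros)
  fix x' assume "x' \<noteq> x"
  let ?h = "x - x'"
  let ?R = "%y. \<rho> (y - x + ?h) - \<rho> (y - x) - grad \<rho> (y - x) \<bullet> ?h"
  have ii: "integrable lborel (%y. (f y *\<^sub>R grad \<rho> (y - x)) \<bullet> ?h)"
   by (intro integrable_inner_left i2)
  have i2n: "integrable lborel (%y. f y *\<^sub>R - grad \<rho> (y - x))" using i2[of x] by simp
  have "?G \<bullet> (x' - x) = (LINT y|lborel. (f y *\<^sub>R - grad \<rho> (y - x)) \<bullet> (x' - x))"
   by (rule integral_inner_left[symmetric]) (rule i2n)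
  also have "... = (LINT y|lborel. (f y *\<^sub>R grad \<rho> (y - x)) \<bullet> ?h)"
   by (intro Bochner_Integration.integral_cong refl) (simp add: inner_diff_right algebra_simps)
  finally have "mollify \<rho> f x' - mollify \<rho> f x - ?G \<bullet> (x' - x) = (LINT y|lborel. f y * ?R y)"
   unfolding mollify_def using i1[of x] i1[of x'] ii
   by (simp add: algebra_simps flip: Bochner_Integration.integral_diff)
  also have "norm ... \<le> (LINT y|lborel. (L * (norm ?h)^2) * \<bar>f y\<bar>)"
  proof (rule order_trans[OF integral_norm_bound], rule integral_mono_AE')
   show "integrable lborel (%y. (L * (norm ?h)^2) * \<bar>f y\<bar>)" using f by auto
   show "AE y in lborel. norm (f y * ?R y) \<le> (L * (norm ?h)^2) * \<bar>f y\<bar>"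
   proof (rule AE_I2)
    fix y
    have "\<bar>f y\<bar> * \<bar>?R y\<bar> \<le> \<bar>f y\<bar> * (L * (norm ?h)^2)" by (rule mult_left_mono[OF L(2)]) simp
    then show "norm (f y * ?R y) \<le> (L * (norm ?h)^2) * \<bar>f y\<bar>" by (simp only: real_norm_def abs_mult mult.commute)
   qed
  qed (use L(1) in auto)
  also have "... = L * ?N * norm (x' - x) * norm (x' - x)"
   by (simp add: power2_eq_square norm_minus_commute)
  finally show "norm (mollify \<rho> f x' - mollify \<rho> f x - ?G \<bullet> (x' - x)) / norm (x' - x) \<le> L * ?N * norm (x' - x)"
   using \<open>x' \<noteq> x\<close> by (simp add: pos_divide_le_eq)
 qed simp
qed

lemma grad_mollify:
 fixes f :: "'a::euclidean_space => real"
 assumes \<rho>: "test_function U \<rho>" and f: "integrable lborel f"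
 shows "grad (mollify \<rho> f) x \<bullet> v = mollify (%y. - (grad \<rho> y \<bullet> v)) f x"
proof -
 have i2: "integrable lborel (%y. f y *\<^sub>R - grad \<rho> (y - x))"
  using mollify_integrable(2)[OF \<rho> f, of 1] by simp
 show ?thesis
  unfolding grad_eqI[OF mollify_has_derivative[OF assms]] mollify_def
  using i2 by (simp add: integral_inner_left[symmetric] mult.commute)
qed

text \<open>A partial derivative of a mollification is the mollification with another test function
  as kernel, so all mollifications of \<open>f\<close> form a family closed under partial
  derivatives.\<close>

lemma smooth_mollify:
 fixes f :: "'a::euclidean_space => real"
 assumes \<rho>: "test_function U \<rho>" and f: "integrable lborel f"
 shows "smooth (mollify \<rho> f)"
proof (rule smooth_coinduct[of _ "{mollify \<rho> f |\<rho>. test_function U \<rho>}"])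
 show "mollify \<rho> f \<in> {mollify \<rho> f |\<rho>. test_function U \<rho>}" using \<rho> by auto
 fix F assume "F \<in> {mollify \<rho> f |\<rho>. test_function U \<rho>}"
 then obtain \<rho>' where r: "F = mollify \<rho>' f" "test_function U \<rho>'" by auto
 have "test_function U (%y. - (grad \<rho>' y \<bullet> b))" for b
  using test_function_grad[OF r(2), of "-b"] by simp
 moreover have "(%x. grad F x \<bullet> b) = mollify (%y. - (grad \<rho>' y \<bullet> b)) f" for b
  unfolding r(1) using grad_mollify[OF r(2) f] by auto
 ultimately have "\<forall>b\<in>Basis. (%x. grad F x \<bullet> b) \<in> {mollify \<rho> f |\<rho>. test_function U \<rho>}" by auto
 moreover have "(F has_derivative (%h. grad F x \<bullet> h)) (at x)" for x
  using mollify_has_derivative[OF r(2) f, of x] grad_eqI[OF mollify_has_derivative[OF r(2) f, of x]] by (simp add: r(1))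
 ultimately show "\<exists>G. (\<forall>x. (F has_derivative (%h. G x \<bullet> h)) (at x)) \<and> (\<forall>b\<in>Basis. (%x. G x \<bullet> b) \<in> {mollify \<rho> f |\<rho>. test_function U \<rho>})"
  by (intro exI[of _ "grad F"]) auto
qed

definition mollifier :: "real => ('a::euclidean_space => real) => bool" where
 "mollifier d \<rho> \<longleftrightarrow> test_function (ball 0 d) \<rho> \<and> (\<forall>x. 0 \<le> \<rho> x) \<and> (LINT x|lborel. \<rho> x) = 1"

lemma mollifier_zero: "mollifier d \<rho> ==> norm x \<ge> d ==> \<rho> x = 0"
 unfolding mollifier_def by (metis test_function_support mem_ball_0 not_le subset_iff)

lemma mollifier_exists:
 assumes "d > 0"
 obtains \<rho> :: "'a::euclidean_space => real" where "mollifier d \<rho>"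
proof -
 obtain f :: "'a => real" where f: "smooth f" "!!x. 0 \<le> f x" "!!x. f x > 0 \<longleftrightarrow> x \<in> ball 0 (d/2)"
  using smooth_bump_exists[of "d/2" 0] assms by auto
 have t: "test_function (ball 0 d) f"
 proof (rule test_functionI[OF f(1), of "cball 0 (d/2)"])
  show "f x = 0" if "x \<notin> cball 0 (d/2)" for x
   using f(2)[of x] f(3)[of x] that by (auto simp: less_le)
 qed (use assms in auto)
 note i = test_function_integrable(2)[OF t]
 define I where "I = (LINT x|lborel. f x)"
 have "I \<noteq> 0"
 proof
  assume "I = 0"
  then have "AE x in lborel. f x = 0"
   using integral_nonneg_eq_0_iff_AE[OF i] f(2) by (simp add: I_def)
  then have "AE x in lborel. x \<notin> ball (0::'a) (d/2)"
  proof eventually_elim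
   case (elim x)
   then show ?case using f(3)[of x] by simp
  qed
  then have "ball (0::'a) (d/2) \<in> null_sets lborel" by (subst AE_iff_null_sets) auto
  then have "emeasure lborel (ball (0::'a) (d/2)) = 0" by (rule null_setsD1)
  moreover have "emeasure lborel (ball (0::'a) (d/2)) \<noteq> 0"
   using content_ball_pos[of "d/2" "0::'a"] assms by (auto simp: measure_def)
  ultimately show False by simp
 qed
 moreover have "I \<ge> 0" unfolding I_def using f(2) by (intro integral_nonneg_AE) auto
 ultimately have "I > 0" by simp
 have "test_function (ball 0 d) (%x. (1 / I) * f x)" by (intro test_function_mult[OF t] smooth_const)
 then have "mollifier d (%x. (1 / I) * f x)"
  unfolding mollifier_def using \<open>I > 0\<close> f(2) by (simp add: I_def[symmetric])
 then show thesis by (rule that)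
qed

lemma mollify_zero:
 assumes "mollifier d \<rho>" "!!y. dist x y < d ==> f y = 0"
 shows "mollify \<rho> f x = 0"
proof -
 have z: "\<rho> (y - x) *\<^sub>R f y = 0" for y
  using mollifier_zero[OF assms(1), of "y - x"] assms(2)[of y] by (cases "dist x y < d") (auto simp: dist_norm norm_minus_commute)
 show ?thesis unfolding mollify_def z by simp
qed

lemma mollify_const:
 assumes "mollifier d \<rho>" "!!y. dist x y < d ==> f y = c"
 shows "mollify \<rho> f x = c"
proof -
 have [measurable]: "\<rho> \<in> Borel" and i: "integrable lborel \<rho>"
  using assms(1) test_function_measurable test_function_integrable(2) by (auto simp: mollifier_def)
 have z: "\<rho> (y - x) *\<^sub>R f y = \<rho> (y + - x) *\<^sub>R c" for y
  using mollifier_zero[OF assms(1), of "y - x"] assms(2)[of y] by (cases "dist x y < d") (auto simp: dist_norm norm_minus_commute)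
 have "mollify \<rho> f x = (LINT y|lborel. \<rho> (y + - x) *\<^sub>R c)" unfolding mollify_def z by (rule refl)
 also have "... = c"
  using integral_shift[of \<rho> "- x"] i assms(1) by (simp add: mollifier_def)
 finally show ?thesis .
qed

text \<open>Jensen's inequality for the probability density \<open>\<rho>\<close> bounds the squared
  error at \<open>x\<close> by an average of squared translation differences; Tonelli exchanges this
  average with the integral over \<open>x\<close>. Only shifts shorter than \<open>d\<close> carry
  weight.\<close>

lemma mollify_l2:
 fixes f :: "'a::euclidean_space => 'b::euclidean_space"
 assumes \<rho>: "mollifier d \<rho>" and f: "sqint f" "integrable lborel f"
  and e: "!!z. norm z < d ==> norm2 (%x. f (x + z) - f x) \<le> e" and "e \<ge> 0"
 shows "sqint (mollify \<rho> f)" "dist2 (mollify \<rho> f) f \<le> e"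
proof -
 have t: "test_function (ball 0 d) \<rho>" and \<rho>0: "!!x. 0 \<le> \<rho> x" and \<rho>1: "(LINT x|lborel. \<rho> x) = 1"
  using \<rho> by (auto simp: mollifier_def)
 have [measurable]: "\<rho> \<in> Borel" "f \<in> Borel"
  using test_function_measurable[OF t] f by auto
 have mm[measurable]: "mollify \<rho> f \<in> Borel"
  unfolding mollify_def by measurable
 note i\<rho> = test_function_integrable(2)[OF t]
 obtain C where C: "C \<ge> 0" "!!x. \<bar>\<rho> x\<bar> \<le> C" using test_function_bounded[OF t] by metis
 let ?D = "%x z. f (x + z) - f x"
 have pt: "ennreal ((norm (mollify \<rho> f x - f x))^2) \<le> (\<integral>\<^sup>+z. ennreal (\<rho> z * (norm (?D x z))^2) \<partial>lborel)" for x
 proof -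
  have j1: "integrable lborel (%z. \<rho> z *\<^sub>R f (x + z))" and
     j1': "mollify \<rho> f x = (LINT z|lborel. \<rho> z *\<^sub>R f (x + z))"
   using mollify_integrable(1)[OF t f(2), of x] integral_shift[of "%y. \<rho> (y - x) *\<^sub>R f y" x]
   by (auto simp: mollify_def add.commute)
  have j2: "integrable lborel (%z. \<rho> z *\<^sub>R f x)" using i\<rho> by auto
  have j3: "integrable lborel (%z. \<rho> z *\<^sub>R ?D x z)" using j1 j2 by (simp add: scaleR_diff_right)
  have m: "mollify \<rho> f x - f x = (LINT z|lborel. \<rho> z *\<^sub>R ?D x z)"
   using j1 j2 \<rho>1 i\<rho> by (simp add: scaleR_diff_right j1')
  let ?m = "mollify \<rho> f x - f x"
  have "integrable lborel (%z. C * (2 * (norm (f (x + z)))^2) + \<rho> z * (2 * (norm (f x))^2))"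
   using f(1) i\<rho> integral_shift(2)[of "%z. (norm (f z))^2" x] by (auto simp: square_int_def add.commute)
  then have j4: "integrable lborel (%z. \<rho> z * (norm (?D x z))^2)"
  proof (rule Bochner_Integration.integrable_bound)
   show "AE z in lborel. norm (\<rho> z * (norm (?D x z))^2) \<le> norm (C * (2 * (norm (f (x + z)))^2) + \<rho> z * (2 * (norm (f x))^2))"
   proof (rule AE_I2)
    fix z
    have "(norm (?D x z))^2 \<le> 2 * (norm (f (x + z)))^2 + 2 * (norm (f x))^2"
     using norm_add_power2_le[of "f (x + z)" "- f x"] by simp
    from mult_left_mono[OF this \<rho>0[of z]]
    have "\<rho> z * (norm (?D x z))^2 \<le> \<rho> z * (2 * (norm (f (x + z)))^2) + \<rho> z * (2 * (norm (f x))^2)"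
     by (simp only: distrib_left)
    moreover have "\<rho> z * (2 * (norm (f (x + z)))^2) \<le> C * (2 * (norm (f (x + z)))^2)"
     using C(2)[of z] by (intro mult_right_mono) auto
    ultimately have "\<rho> z * (norm (?D x z))^2 \<le> C * (2 * (norm (f (x + z)))^2) + \<rho> z * (2 * (norm (f x))^2)" by linarith
    then show "norm (\<rho> z * (norm (?D x z))^2) \<le> norm (C * (2 * (norm (f (x + z)))^2) + \<rho> z * (2 * (norm (f x))^2))"
     using \<rho>0[of z] C(1) by simp
   qed
  qed measurable
  \<comment> \<open>Jensen in the form that a variance is nonnegative: the second moment about the
    mean \<open>?m\<close> is expanded.\<close>
  have "0 \<le> (LINT z|lborel. \<rho> z * (norm (?D x z - ?m))^2)" using \<rho>0 by (intro integral_nonneg_AE) auto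
  also have "(LINT z|lborel. \<rho> z * (norm (?D x z - ?m))^2)
    = (LINT z|lborel. \<rho> z * (norm (?D x z))^2 - 2 * ((\<rho> z *\<^sub>R ?D x z) \<bullet> ?m) + \<rho> z * (norm ?m)^2)"
   by (intro Bochner_Integration.integral_cong refl)
    (simp only: power2_norm_eq_inner inner_diff inner_commute inner_scaleR_left, simp add: algebra_simps inner_commute)
  also have "... = (LINT z|lborel. \<rho> z * (norm (?D x z))^2) - 2 * (?m \<bullet> ?m) + (norm ?m)^2"
  proof -
   have "integrable lborel (%z. (\<rho> z *\<^sub>R ?D x z) \<bullet> ?m)" by (intro integrable_inner_left j3)
   moreover have "(LINT z|lborel. (\<rho> z *\<^sub>R ?D x z) \<bullet> ?m) = ?m \<bullet> ?m"
    using integral_inner_left[OF j3, of ?m] by (simp only: m[symmetric])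
   ultimately show ?thesis using j4 i\<rho> \<rho>1 by (simp only: Bochner_Integration.integral_add Bochner_Integration.integral_diff integrable_mult_right Bochner_Integration.integrable_diff integral_mult_right_zero integral_mult_left_zero integrable_mult_left mult_1)
  qed
  finally have "(norm ?m)^2 \<le> (LINT z|lborel. \<rho> z * (norm (?D x z))^2)"
   by (simp add: power2_norm_eq_inner)
  then show ?thesis
   using nn_integral_eq_integral[OF j4] \<rho>0 by (simp add: ennreal_leI)
 qed
 have "(\<integral>\<^sup>+x. ennreal ((norm (mollify \<rho> f x - f x))^2) \<partial>lborel) \<le> (\<integral>\<^sup>+x. \<integral>\<^sup>+z. ennreal (\<rho> z * (norm (?D x z))^2) \<partial>lborel \<partial>lborel)"
  by (intro nn_integral_mono pt)
 also have "... = (\<integral>\<^sup>+z. \<integral>\<^sup>+x. ennreal (\<rho> z * (norm (?D x z))^2) \<partial>lborel \<partial>lborel)"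
  by (rule lborel_pair.Fubini') measurable
 also have "... \<le> (\<integral>\<^sup>+z. ennreal (\<rho> z) * ennreal (e\<^sup>2) \<partial>lborel)"
 proof (rule nn_integral_mono)
  fix z
  have "(\<integral>\<^sup>+x. ennreal (\<rho> z * (norm (?D x z))^2) \<partial>lborel) = ennreal (\<rho> z) * (\<integral>\<^sup>+x. ennreal ((norm (?D x z))^2) \<partial>lborel)"
   using \<rho>0 by (simp add: ennreal_mult nn_integral_cmult)
  also have "... \<le> ennreal (\<rho> z) * ennreal (e\<^sup>2)"
  proof (cases "norm z < d")
   case True
   have "(\<integral>\<^sup>+x. ennreal ((norm (?D x z))^2) \<partial>lborel) = ennreal ((norm2 (%x. ?D x z))^2)"
    by (intro l2norm_nn_integral square_int_diff f(1) square_int_shift)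
   also have "... \<le> ennreal (e\<^sup>2)" by (intro ennreal_leI power_mono e True l2norm_nonneg)
   finally show ?thesis by (rule mult_left_mono) simp
  next
   case False
   then show ?thesis using mollifier_zero[OF \<rho>, of z] by simp
  qed
  finally show "(\<integral>\<^sup>+x. ennreal (\<rho> z * (norm (?D x z))^2) \<partial>lborel) \<le> ennreal (\<rho> z) * ennreal (e\<^sup>2)" .
 qed
 also have "... = ennreal (e\<^sup>2)"
  using nn_integral_eq_integral[OF i\<rho>] \<rho>0 \<rho>1 by (simp add: nn_integral_multc)
 finally have *: "(\<integral>\<^sup>+x. ennreal ((norm (mollify \<rho> f x - f x))^2) \<partial>lborel) \<le> ennreal (e\<^sup>2)" .
 show "dist2 (mollify \<rho> f) f \<le> e"
  by (rule l2norm_le_nn_integral(2)[OF _ * \<open>e \<ge> 0\<close>]) simp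
 have "sqint (%x. mollify \<rho> f x - f x)"
  by (rule l2norm_le_nn_integral(1)[OF _ * \<open>e \<ge> 0\<close>]) simp
 from square_int_add[OF this f(1)] show "sqint (mollify \<rho> f)" by simp
qed

lemma test_function_mollify:
 fixes f :: "'a::euclidean_space => real"
 assumes \<rho>: "mollifier d \<rho>" and f: "integrable lborel f" and K: "compact K" "!!x. x \<notin> K ==> f x = 0"
  and U: "(\<Union>x\<in>K. ball x \<epsilon>) \<subseteq> U" and d: "0 < d" "d < \<epsilon>"
 shows "test_function U (mollify \<rho> f)"
proof (cases "K = {}")
 case True
 then have "mollify \<rho> f = (%x. 0)" using K(2) by (auto simp: mollify_def)
 then show ?thesis by (simp add: test_function_zero)
next
 case False
 have t: "test_function (ball 0 d) \<rho>" using \<rho> by (simp add: mollifier_def)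
 show ?thesis
 proof (rule test_functionI[OF smooth_mollify[OF t f]])
  show "compact {x. infdist x K \<le> d}" by (rule compact_infdist_le[OF False K(1) d(1)])
  show "{x. infdist x K \<le> d} \<subseteq> U"
  proof
   fix x assume "x \<in> {x. infdist x K \<le> d}"
   then have "infdist x K \<le> d" by simp
   moreover obtain k where "k \<in> K" "infdist x K = dist x k"
    using infdist_attains_inf[OF compact_imp_closed[OF K(1)] False] by metis
   ultimately have "x \<in> ball k \<epsilon>" using d(2) by (simp add: dist_commute)
   then show "x \<in> U" using U \<open>k \<in> K\<close> by blast
  qed
  fix x assume x: "x \<notin> {x. infdist x K \<le> d}"
  show "mollify \<rho> f x = 0"
  proof (rule mollify_zero[OF \<rho>])
   fix y assume "dist x y < d"
   then have "y \<notin> K" using x infdist_le[of y K x] by force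
   then show "f y = 0" by (rule K(2))
  qed
 qed
qed

text \<open>Mollifying the indicator of the closed \<open>2 * d\<close>-neighbourhood of
  \<open>K\<close> with a radius of at most \<open>d\<close> gives 1 within distance
  \<open>d\<close> of \<open>K\<close>; \<open>d\<close> is a third of the room available in
  \<open>U\<close>.\<close>

lemma smooth_cutoff:
 fixes K :: "'a::euclidean_space set"
 assumes K: "compact K" and U: "open U" "K \<subseteq> U"
 obtains \<eta> V where "test_function U \<eta>" "!!x. 0 \<le> \<eta> x" "!!x. \<eta> x \<le> 1" "open V" "K \<subseteq> V" "!!x. x \<in> V ==> \<eta> x = 1"
proof (cases "K = {}")
 case True
 show thesis by (rule that[of "%x. 0" "{}"]) (auto simp: True test_function_zero)
next
 case False
 obtain \<epsilon> where \<epsilon>: "\<epsilon> > 0" "(\<Union>x\<in>K. ball x \<epsilon>) \<subseteq> U"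
  using compact_subset_open_imp_ball_epsilon_subset[OF K U] .
 define d where "d = \<epsilon> / 3"
 have d: "d > 0" using \<epsilon> by (simp add: d_def)
 define L where "L = {x. infdist x K \<le> 2 * d}"
 have L: "compact L" unfolding L_def using compact_infdist_le[OF False K, of "2 * d"] d by simp
 have LU: "L \<subseteq> U"
 proof
  fix x assume "x \<in> L"
  then have "infdist x K \<le> 2 * d" by (simp add: L_def)
  moreover obtain k where "k \<in> K" "infdist x K = dist x k"
   using infdist_attains_inf[OF compact_imp_closed[OF K] False] by metis
  ultimately have "x \<in> ball k \<epsilon>" using \<epsilon>(1) by (simp add: dist_commute d_def)
  then show "x \<in> U" using \<epsilon>(2) \<open>k \<in> K\<close> by blast
 qed
 obtain \<epsilon>' where \<epsilon>': "\<epsilon>' > 0" "(\<Union>x\<in>L. ball x \<epsilon>') \<subseteq> U"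
  using compact_subset_open_imp_ball_epsilon_subset[OF L U(1) LU] .
 define d' where "d' = min d (\<epsilon>' / 2)"
 have d': "d' > 0" "d' \<le> d" "d' < \<epsilon>'" using \<epsilon>' d by (auto simp: d'_def min_def)
 obtain \<rho> :: "'a => real" where \<rho>: "mollifier d' \<rho>" using mollifier_exists[OF d'(1)] .
 let ?f = "indicator L :: 'a => real"
 have [measurable]: "L \<in> sets borel" using L by (auto intro: borel_compact)
 have fi: "integrable lborel ?f"
  using emeasure_bounded_finite[OF compact_imp_bounded[OF L]] by (simp add: integrable_indicator_iff)
 have t: "test_function (ball 0 d') \<rho>" and \<rho>0: "!!x. 0 \<le> \<rho> x" using \<rho> by (auto simp: mollifier_def)
 have [measurable]: "\<rho> \<in> Borel" using test_function_measurable[OF t] by simp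
 show thesis
 proof (rule that[of "mollify \<rho> ?f" "\<Union>x\<in>K. ball x d"])
  show "test_function U (mollify \<rho> ?f)"
   by (rule test_function_mollify[OF \<rho> fi L _ \<epsilon>'(2) d'(1,3)]) simp
  show "0 \<le> mollify \<rho> ?f x" for x
   unfolding mollify_def using \<rho>0 by (intro integral_nonneg_AE) auto
  show "mollify \<rho> ?f x \<le> 1" for x
  proof -
   have "mollify \<rho> ?f x \<le> mollify \<rho> (%y. 1) x"
    unfolding mollify_def
   proof (rule integral_mono_AE')
    show "integrable lborel (%y. \<rho> (y - x) *\<^sub>R (1::real))"
     using integral_shift(2)[of \<rho> "- x"] test_function_integrable(2)[OF t] by simp
   qed (auto simp: \<rho>0 indicator_def)
   also have "... = 1" by (rule mollify_const[OF \<rho>]) simp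
   finally show ?thesis .
  qed
  show "open (\<Union>x\<in>K. ball x d)" by auto
  show "K \<subseteq> (\<Union>x\<in>K. ball x d)" using d by auto
  fix x assume "x \<in> (\<Union>x\<in>K. ball x d)"
  then obtain k where k: "k \<in> K" "dist k x < d" by auto
  show "mollify \<rho> ?f x = 1"
  proof (rule mollify_const[OF \<rho>])
   fix y assume "dist x y < d'"
   then have "dist y k \<le> 2 * d" using k d'(2) dist_triangle[of y k x] by (simp add: dist_commute)
   then have "y \<in> L" unfolding L_def using infdist_le[OF k(1), of y] by simp
   then show "?f y = 1" by simp
  qed
 qed
qed

text \<open>Finitely many cut-offs \<open>\<xi> i\<close>, each equal to 1 on a member of a cover,
  are combined as \<open>\<xi> i\<close> times the product of the earlier
  \<open>1 - \<xi> j\<close>. The sum telescopes to 1 minus the full product, and that product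
  vanishes on \<open>K\<close>.\<close>

lemma smooth_partition_of_unity:
 fixes K :: "'a::euclidean_space set"
 assumes K: "compact K" and cov: "!!x. x \<in> K ==> \<exists>U\<in>\<U>. open U \<and> x \<in> U"
 obtains N :: nat and \<eta> :: "nat => 'a => real" where
  "!!i. i < N ==> \<exists>U\<in>\<U>. test_function U (\<eta> i)" "!!i x. 0 \<le> \<eta> i x" "!!x. x \<in> K ==> (\<Sum>i<N. \<eta> i x) = 1"
proof -
 have "\<exists>U \<zeta> V. U \<in> \<U> \<and> test_function U \<zeta> \<and> (\<forall>y. 0 \<le> \<zeta> y \<and> \<zeta> y \<le> 1) \<and> open V \<and> x \<in> V \<and> (\<forall>y\<in>V. \<zeta> y = 1)"
  if x: "x \<in> K" for x
 proof -
  obtain U where U: "U \<in> \<U>" "open U" "x \<in> U" using cov[OF x] by blast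
  obtain \<zeta> V where "test_function U \<zeta>" "!!x. 0 \<le> \<zeta> x" "!!x. \<zeta> x \<le> 1" "open V" "{x} \<subseteq> V" "!!x. x \<in> V ==> \<zeta> x = 1"
   using smooth_cutoff[of "{x}" U] U by auto
  with U show ?thesis by blast
 qed
 then obtain U \<zeta> V where z: "!!x. x \<in> K ==> U x \<in> \<U> \<and> test_function (U x) (\<zeta> x) \<and> (\<forall>y. 0 \<le> \<zeta> x y \<and> \<zeta> x y \<le> 1) \<and> open (V x) \<and> x \<in> V x \<and> (\<forall>y\<in>V x. \<zeta> x y = (1::real))"
  by metis
 then have "!!x. x \<in> K ==> open (V x)" "K \<subseteq> (\<Union>x\<in>K. V x)" by blast+
 then obtain F where F: "F \<subseteq> K" "finite F" "K \<subseteq> (\<Union>x\<in>F. V x)"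
  using compactE_image[OF K, of K V] by metis
 obtain f where f: "bij_betw f {..<card F} F" using bij_betw_from_nat_into_finite[OF F(2)] by (metis bij_betw_def)
 have fF: "f i \<in> K" if "i < card F" for i using f F(1) that by (auto simp: bij_betw_def)
 define \<xi> where "\<xi> i = (if i < card F then \<zeta> (f i) else (%x. 0))" for i
 have x0: "0 \<le> \<xi> i x" and x1: "\<xi> i x \<le> 1" for i x using z[OF fF] by (auto simp: \<xi>_def)
 have xs: "smooth (\<xi> i)" for i using z[OF fF] by (auto simp: \<xi>_def smooth_const intro: test_function_smooth)
 define P where "P i x = (\<Prod>j<i. 1 - \<xi> j x)" for i x
 have P: "smooth (P i)" for i
  unfolding P_def by (induction i) (auto intro!: smooth_const smooth_mult smooth_diff xs)
 have P0: "0 \<le> P i x" for i x unfolding P_def using x1 by (auto intro!: prod_nonneg)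
 have S: "(\<Sum>i<n. P i x * \<xi> i x) = 1 - P n x" for n x
  by (induction n) (auto simp: P_def algebra_simps)
 show thesis
 proof (rule that[of "card F" "%i x. P i x * \<xi> i x"])
  fix i assume "i < card F"
  then have "U (f i) \<in> \<U>" "test_function (U (f i)) (\<xi> i)" using z[OF fF] by (auto simp: \<xi>_def)
  then show "\<exists>U\<in>\<U>. test_function U (%x. P i x * \<xi> i x)"
   using test_function_mult[OF _ P] by blast
 next
  fix x assume "x \<in> K"
  then obtain y where y: "y \<in> F" "x \<in> V y" using F by auto
  have "y \<in> f ` {..<card F}" using y(1) f by (simp add: bij_betw_def)
  then obtain i where i: "i < card F" "f i = y" by auto
  have "\<xi> i x = 1" using z[OF fF[OF i(1)]] y i by (auto simp: \<xi>_def)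
  then have "P (card F) x = 0" unfolding P_def using i(1) by (intro prod_zero) auto
  then show "(\<Sum>i<card F. P i x * \<xi> i x) = 1" by (simp add: S)
 qed (auto simp: P0 x0)
qed

subsection \<open>Density of test functions\<close>

text \<open>Cutting off to a member of a compact exhaustion leaves room for a mollification whose
  support stays inside \<open>U\<close>.\<close>

lemma test_function_dense:
 fixes f :: "'a::euclidean_space => real"
 assumes U: "open U" and f: "sqint f" "!!x. x \<notin> U ==> f x = 0" and e: "e > 0"
 obtains \<phi> where "test_function U \<phi>" "dist2 \<phi> f < e"
proof -
 obtain C where C: "!!n. compact (C n)" "!!n. C n \<subseteq> U" "!!n. C n \<subseteq> interior (C (Suc n))" "\<Union>(range C) = U"
  using open_Union_compact_subsets[OF U] by metis
 have inc: "C m \<subseteq> C n" if "m \<le> n" for m n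
  by (rule lift_Suc_mono_le[OF _ that]) (use C(3) interior_subset in blast)
 have Cb: "C n \<in> sets borel" for n using C(1) by (auto intro: borel_compact)
 have "\<forall>\<^sub>F n in sequentially. x \<in> C n" if "f x \<noteq> 0" for x
 proof -
  have "x \<in> U" using f(2) that by blast
  then obtain m where "x \<in> C m" using C(4) by blast
  then show ?thesis using inc unfolding eventually_sequentially by blast
 qed
 then have "l2lim (%n x. cut (C n) f x) f"
  using square_int_truncation[OF f(1), of C] Cb by blast
 then have "\<forall>\<^sub>F n in sequentially. dist2 (cut (C n) f) f < e/2"
  using e by (intro order_tendstoD) auto
 then obtain n where n: "dist2 (cut (C n) f) f < e/2"
  by (meson eventually_happens trivial_limit_sequentially)
 define g where "g x = cut (C n) f x" for x
 have g: "sqint g" unfolding g_def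
  by (rule square_int_bounded_mult[OF f(1), where C = 1]) (use Cb in \<open>auto simp: indicator_def\<close>)
 have g0: "g x = 0" if "x \<notin> C n" for x using that by (simp add: g_def)
 have "bounded {x. g x \<noteq> 0}" using g0 C(1)[of n] by (auto intro: bounded_subset[OF compact_imp_bounded])
 then have gi: "integrable lborel g"
  by (intro square_int_integrable_finite[OF g]) (simp add: emeasure_bounded_finite[unfolded infinity_ennreal_def])
 obtain \<epsilon> where \<epsilon>: "\<epsilon> > 0" "(\<Union>x\<in>C n. ball x \<epsilon>) \<subseteq> U"
  using compact_subset_open_imp_ball_epsilon_subset[OF C(1) U C(2)] .
 obtain d where d: "d > 0" "!!z. norm z < d ==> norm2 (%x. g (x + z) - g x) < e/2"
  using l2_translation_continuous[OF g, of "e/2"] e by auto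
 define d' where "d' = min d (\<epsilon>/2)"
 have d': "0 < d'" "d' \<le> d" "d' < \<epsilon>" using d \<epsilon> by (auto simp: d'_def min_def)
 obtain \<rho> :: "'a => real" where \<rho>: "mollifier d' \<rho>" using mollifier_exists[OF d'(1)] .
 have dl: "norm2 (%x. g (x + z) - g x) \<le> e/2" if "norm z < d'" for z
  using d(2)[of z] d'(2) that by simp
 have m: "sqint (mollify \<rho> g)" "dist2 (mollify \<rho> g) g \<le> e/2"
  using mollify_l2[OF \<rho> g gi dl] e by auto
 show thesis
 proof (rule that)
  show "test_function U (mollify \<rho> g)"
   by (rule test_function_mollify[OF \<rho> gi C(1) g0 \<epsilon>(2) d'(1,3)])
  show "dist2 (mollify \<rho> g) f < e"
   using l2norm_diff_triangle[OF m(1) g f(1)] m(2) n unfolding g_def[symmetric] by linarith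
 qed
qed

text \<open>The test functions are approximations \<open>\<phi>\<close> of \<open>h\<close> itself:
  \<open>h\<close> is orthogonal to \<open>\<phi>\<close>, so its squared norm equals its inner
  product with \<open>h - \<phi>\<close>, which is small.\<close>

lemma fundamental_lemma:
 fixes h :: "'a::euclidean_space => real"
 assumes U: "open U" and h: "sqint h" "!!x. x \<notin> U ==> h x = 0"
  and 0: "!!\<phi>. test_function U \<phi> ==> (LINT x|lborel. h x * \<phi> x) = 0"
 shows "AE x in lborel. h x = 0"
proof -
 have "(norm2 h)^2 \<le> norm2 h * e" if e: "e > 0" for e
 proof -
  obtain \<phi> where \<phi>: "test_function U \<phi>" "dist2 \<phi> h < e"
   using test_function_dense[OF U h e] .
  note s = test_function_integrable(1)[OF \<phi>(1)]
  have "(norm2 h)^2 = (LINT x|lborel. h x * h x)"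
   by (subst l2norm_power2) (simp add: power2_eq_square)
  also have "... = (LINT x|lborel. h x * h x) - (LINT x|lborel. h x * \<phi> x)" using 0[OF \<phi>(1)] by simp
  also have "... = (LINT x|lborel. h x \<bullet> (h x - \<phi> x))"
   using square_int_integrable_prod[OF h(1) h(1)] square_int_integrable_prod[OF h(1) s]
   by (simp add: right_diff_distrib)
  also have "... \<le> norm2 h * dist2 h \<phi>"
   using l2norm_Cauchy_Schwarz[OF h(1) square_int_diff[OF h(1) s]] by linarith
  also have "... \<le> norm2 h * e"
   using \<phi>(2) l2norm_diff_commute[of lborel \<phi> h] by (intro mult_left_mono l2norm_nonneg) linarith
  finally show ?thesis .
 qed
 then have "norm2 h \<le> e" if "e > 0" for e
  using that l2norm_nonneg[of lborel h]
  by (cases "norm2 h = 0") (auto simp: power2_eq_square)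
 then have "norm2 h \<le> 0" by (rule field_le_epsilon[of _ 0, simplified])
 then have "norm2 h = 0" using l2norm_nonneg[of lborel h] by linarith
 then show ?thesis using l2norm_eq_0[OF h(1)] by simp
qed

section \<open>Weak gradients\<close>

text \<open>Elements of $H^1(U)$ together with their gradient, as Borel functions on the whole space that
 vanish outside \<open>U\<close>.\<close>

definition wgrad :: "'a::euclidean_space set => ('a => real) => ('a => 'a) => bool" where
 "wgrad U f g \<longleftrightarrow> sqint f \<and> sqint g \<and> (\<forall>x. x \<notin> U --> f x = 0 \<and> g x = 0) \<and>
   (\<forall>\<phi> v. test_function U \<phi> --> (LINT x|lborel. f x * (grad \<phi> x \<bullet> v)) = - (LINT x|lborel. (g x \<bullet> v) * \<phi> x))"

lemma wgradD:
 assumes "wgrad U f g"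
 shows "sqint f" "sqint g" "!!x. x \<notin> U ==> f x = 0" "!!x. x \<notin> U ==> g x = 0"
  "!!\<phi> v. test_function U \<phi> ==> (LINT x|lborel. f x * (grad \<phi> x \<bullet> v)) = - (LINT x|lborel. (g x \<bullet> v) * \<phi> x)"
  "f \<in> Borel" "g \<in> Borel"
 using assms by (auto simp: wgrad_def square_int_def)

lemma wgrad_integrable:
 assumes "sqint f" "sqint g" "test_function U \<phi>"
 shows "integrable lborel (%x. f x * (grad \<phi> x \<bullet> v))" "integrable lborel (%x. (g x \<bullet> v) * \<phi> x)"
proof -
 note t = test_function_integrable[OF assms(3)]
 show "integrable lborel (%x. f x * (grad \<phi> x \<bullet> v))"
  by (rule square_int_integrable_prod[OF assms(1) square_int_inner_const[OF t(3)]])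
 show "integrable lborel (%x. (g x \<bullet> v) * \<phi> x)"
  by (rule square_int_integrable_prod[OF square_int_inner_const[OF assms(2)] t(1)])
qed

lemma wgrad_zero: "wgrad U (%x. 0) (%x. 0)"
 by (auto simp: wgrad_def square_int_zero)

lemma wgrad_add:
 assumes "wgrad U f g" "wgrad U f' g'"
 shows "wgrad U (%x. f x + f' x) (%x. g x + g' x)"
proof -
 note a = wgradD[OF assms(1)] and b = wgradD[OF assms(2)]
 show ?thesis
  unfolding wgrad_def
 proof (intro conjI allI impI)
  fix \<phi> v assume t: "test_function U \<phi>"
  note i = wgrad_integrable[OF a(1,2) t, of v] wgrad_integrable[OF b(1,2) t, of v]
  show "(LINT x|lborel. (f x + f' x) * (grad \<phi> x \<bullet> v)) = - (LINT x|lborel. ((g x + g' x) \<bullet> v) * \<phi> x)"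
   using i a(5)[OF t, of v] b(5)[OF t, of v] by (simp add: distrib_right inner_add_left)
 qed (use a b in \<open>auto intro: square_int_add\<close>)
qed

lemma wgrad_cmult:
 assumes "wgrad U f g"
 shows "wgrad U (%x. c * f x) (%x. c *\<^sub>R g x)"
proof -
 note a = wgradD[OF assms(1)]
 show ?thesis
  unfolding wgrad_def
 proof (intro conjI allI impI)
  fix \<phi> v assume t: "test_function U \<phi>"
  show "(LINT x|lborel. c * f x * (grad \<phi> x \<bullet> v)) = - (LINT x|lborel. ((c *\<^sub>R g x) \<bullet> v) * \<phi> x)"
   using a(5)[OF t, of v] by (simp add: mult.assoc)
 qed (use a in \<open>auto intro: square_int_mult square_int_scaleR\<close>)
qed

lemma wgrad_diff:
 "wgrad U f g ==> wgrad U f' g' ==> wgrad U (%x. f x - f' x) (%x. g x - g' x)"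
 using wgrad_add[of U f g "%x. - f' x" "%x. - g' x"] wgrad_cmult[of U f' g' "-1"] by simp

lemma wgrad_unique_dir:
 assumes U: "open U" and g: "sqint g" "!!x. x \<notin> U ==> g x = 0"
  and h: "sqint h" "!!x. x \<notin> U ==> h x = 0"
  and eq: "!!\<phi>. test_function U \<phi> ==> (LINT x|lborel. g x * \<phi> x) = (LINT x|lborel. h x * \<phi> x :: real)"
 shows "AE x in lborel. g x = h x"
proof -
 have "AE x in lborel. g x - h x = 0"
 proof (rule fundamental_lemma[OF U square_int_diff[OF g(1) h(1)]])
  fix \<phi> assume t: "test_function U \<phi>"
  note s = test_function_integrable(1)[OF t]
  show "(LINT x|lborel. (g x - h x) * \<phi> x) = 0"
   using square_int_integrable_prod[OF g(1) s] square_int_integrable_prod[OF h(1) s] eq[OF t]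
   by (simp add: left_diff_distrib)
 qed (use g h in auto)
 then show ?thesis by auto
qed

text \<open>For a fixed test function both sides of the defining identity are continuous in L^2 by
  Cauchy-Schwarz; the weak gradient is a closed operator.\<close>

lemma wgrad_limit:
 assumes w: "!!n. wgrad U (F n) (G n)" and f: "sqint f" "!!x. x \<notin> U ==> f x = 0"
  and g: "sqint g" "!!x. x \<notin> U ==> g x = 0"
  and F: "l2lim F f"
  and G: "l2lim G g"
 shows "wgrad U f g"
 unfolding wgrad_def
proof (intro conjI allI impI)
 fix \<phi> v assume t: "test_function U \<phi>"
 note a = wgradD[OF w]
 have s1: "sqint (%x. grad \<phi> x \<bullet> v)"
  by (rule square_int_inner_const[OF test_function_integrable(3)[OF t]])
 have s2: "sqint (%x. \<phi> x *\<^sub>R v)"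
  by (rule square_int_bound[OF _ test_function_integrable(1)[OF t], where C = "norm v"])
   (use test_function_measurable[OF t] in \<open>auto simp: mult.commute\<close>)
 have A: "(%n. LINT x|lborel. F n x * (grad \<phi> x \<bullet> v)) \<longlonglongrightarrow> (LINT x|lborel. f x * (grad \<phi> x \<bullet> v))"
 proof (rule LIM_zero_cancel, rule Lim_null_comparison)
  show "(%n. dist2 (F n) f * norm2 (%x. grad \<phi> x \<bullet> v)) \<longlonglongrightarrow> 0"
   using tendsto_mult_right[OF F] by simp
  show "\<forall>\<^sub>F n in sequentially. norm ((LINT x|lborel. F n x * (grad \<phi> x \<bullet> v)) - (LINT x|lborel. f x * (grad \<phi> x \<bullet> v)))
   \<le> dist2 (F n) f * norm2 (%x. grad \<phi> x \<bullet> v)"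
  proof (intro always_eventually allI)
   fix n
   have "(LINT x|lborel. F n x * (grad \<phi> x \<bullet> v)) - (LINT x|lborel. f x * (grad \<phi> x \<bullet> v)) = (LINT x|lborel. (F n x - f x) \<bullet> (grad \<phi> x \<bullet> v))"
    using square_int_integrable_prod[OF a(1)[of n] s1] square_int_integrable_prod[OF f(1) s1] by (simp add: left_diff_distrib)
   then show "norm ((LINT x|lborel. F n x * (grad \<phi> x \<bullet> v)) - (LINT x|lborel. f x * (grad \<phi> x \<bullet> v)))
    \<le> dist2 (F n) f * norm2 (%x. grad \<phi> x \<bullet> v)"
    using l2norm_Cauchy_Schwarz[OF square_int_diff[OF a(1)[of n] f(1)] s1] by simp
  qed
 qed
 have B: "(LINT x|lborel. F n x * (grad \<phi> x \<bullet> v)) = - (LINT x|lborel. (G n x \<bullet> v) * \<phi> x)" for n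
  by (rule a(5)[OF t])
 have C: "(%n. LINT x|lborel. (G n x \<bullet> v) * \<phi> x) \<longlonglongrightarrow> (LINT x|lborel. (g x \<bullet> v) * \<phi> x)"
 proof (rule LIM_zero_cancel, rule Lim_null_comparison)
  show "(%n. dist2 (G n) g * norm2 (%x. \<phi> x *\<^sub>R v)) \<longlonglongrightarrow> 0"
   using tendsto_mult_right[OF G] by simp
  show "\<forall>\<^sub>F n in sequentially. norm ((LINT x|lborel. (G n x \<bullet> v) * \<phi> x) - (LINT x|lborel. (g x \<bullet> v) * \<phi> x))
   \<le> dist2 (G n) g * norm2 (%x. \<phi> x *\<^sub>R v)"
  proof (intro always_eventually allI)
   fix n
   have "(LINT x|lborel. (G n x \<bullet> v) * \<phi> x) - (LINT x|lborel. (g x \<bullet> v) * \<phi> x) = (LINT x|lborel. (G n x - g x) \<bullet> (\<phi> x *\<^sub>R v))"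
    using square_int_integrable_inner[OF a(2)[of n] s2] square_int_integrable_inner[OF g(1) s2]
    by (simp add: inner_diff_left right_diff_distrib mult.commute)
   then show "norm ((LINT x|lborel. (G n x \<bullet> v) * \<phi> x) - (LINT x|lborel. (g x \<bullet> v) * \<phi> x))
    \<le> dist2 (G n) g * norm2 (%x. \<phi> x *\<^sub>R v)"
    using l2norm_Cauchy_Schwarz[OF square_int_diff[OF a(2)[of n] g(1)] s2] by simp
  qed
 qed
 show "(LINT x|lborel. f x * (grad \<phi> x \<bullet> v)) = - (LINT x|lborel. (g x \<bullet> v) * \<phi> x)"
  by (rule LIMSEQ_unique[OF A[unfolded B] tendsto_minus[OF C]])
qed (use f g in auto)

section \<open>Restriction, products and localisation of weak gradients\<close>

lemma test_function_outside:
 "test_function V \<phi> ==> x \<notin> V ==> \<phi> x = 0 \<and> grad \<phi> x = 0"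
 by (metis test_function_support subsetD)

lemma wgrad_restrict:
 assumes w: "wgrad U f g" and V: "V \<subseteq> U" "V \<in> sets borel"
 shows "wgrad V (%x. indicator V x * f x) (cut V g)"
proof -
 note a = wgradD[OF w]
 have sq: "sqint (cut V f)" "sqint (cut V g)"
  by (rule square_int_bounded_mult[OF a(1), where C = 1] square_int_bounded_mult[OF a(2), where C = 1];
    use V(2) in \<open>auto simp: indicator_def\<close>)+
 show ?thesis
  unfolding wgrad_def
 proof (intro conjI allI impI)
  fix \<phi> v assume t: "test_function V \<phi>"
  have e: "indicator V x * f x * (grad \<phi> x \<bullet> v) = f x * (grad \<phi> x \<bullet> v)"
   "((cut V g x) \<bullet> v) * \<phi> x = (g x \<bullet> v) * \<phi> x" for x
   using test_function_outside[OF t, of x] by (auto simp: indicator_def)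
  show "(LINT x|lborel. indicator V x * f x * (grad \<phi> x \<bullet> v)) = - (LINT x|lborel. ((cut V g x) \<bullet> v) * \<phi> x)"
   unfolding e by (rule a(5)[OF test_function_mono[OF t V(1)]])
 qed (use sq in auto)
qed

lemma grad_mult:
 assumes "smooth f" "smooth g"
 shows "grad (%x. f x * g x) x = f x *\<^sub>R grad g x + g x *\<^sub>R grad f x"
proof (rule grad_eqI)
 show "((%x. f x * g x) has_derivative (%h. (f x *\<^sub>R grad g x + g x *\<^sub>R grad f x) \<bullet> h)) (at x)"
  using has_derivative_mult[OF smooth_grad(1)[OF assms(1), of x] smooth_grad(1)[OF assms(2), of x]]
  by (simp add: inner_add_left mult.commute)
qed

text \<open>The factor \<open>\<eta>\<close> makes everything outside \<open>S\<close> irrelevant,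
  so the product may be read on any \<open>V\<close> that agrees with \<open>U\<close> inside
  \<open>S\<close>. This is how a function is transplanted to the whole space or to an
  epigraph.\<close>

lemma wgrad_mult:
 assumes w: "wgrad U f g" and \<eta>: "test_function S \<eta>" and UV: "U \<inter> S = V \<inter> S"
 shows "wgrad V (%x. \<eta> x * f x) (%x. \<eta> x *\<^sub>R g x + f x *\<^sub>R grad \<eta> x)"
proof -
 note a = wgradD[OF w]
 obtain C where C: "C \<ge> 0" "!!x. \<bar>\<eta> x\<bar> \<le> C" "!!x. norm (grad \<eta> x) \<le> C" using test_function_bounded[OF \<eta>] by metis
 have [measurable]: "f \<in> Borel" "g \<in> Borel" "\<eta> \<in> Borel" "grad \<eta> \<in> Borel"
  using a test_function_measurable[OF \<eta>] by auto
 have s1: "sqint (%x. \<eta> x *\<^sub>R f x)" and s2: "sqint (%x. \<eta> x *\<^sub>R g x)"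
  by (rule square_int_bounded_mult[OF a(1), where C = C] square_int_bounded_mult[OF a(2), where C = C];
    use C in simp)+
 have s3: "sqint (%x. f x *\<^sub>R grad \<eta> x)"
 proof (rule square_int_bound[OF _ a(1), where C = C])
  show "AE x in lborel. norm (f x *\<^sub>R grad \<eta> x) \<le> C * norm (f x)"
   using C(3) by (auto intro!: AE_I2 simp: mult.commute[of C] mult_left_mono)
 qed measurable
 show ?thesis
  unfolding wgrad_def
 proof (intro conjI allI impI)
  show "sqint (%x. \<eta> x * f x)" using s1 by simp
  show "sqint (%x. \<eta> x *\<^sub>R g x + f x *\<^sub>R grad \<eta> x)" using s2 s3 by (rule square_int_add)
  fix x assume "x \<notin> V"
  then have "x \<notin> S \<or> x \<notin> U" using UV by blast
  then show "\<eta> x * f x = 0" "\<eta> x *\<^sub>R g x + f x *\<^sub>R grad \<eta> x = 0"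
   using test_function_outside[OF \<eta>, of x] a(3)[of x] a(4)[of x] by auto
 next
  fix \<phi> v assume t: "test_function V \<phi>"
  have t': "test_function U (%x. \<eta> x * \<phi> x)"
   by (rule test_function_mono[OF test_function_mult_Int[OF t \<eta>]]) (use UV in blast)
  note sm = test_function_smooth[OF t] test_function_smooth[OF \<eta>]
  note tI = test_function_integrable[OF t]
  have i1: "integrable lborel (%x. (\<eta> x *\<^sub>R f x) * (grad \<phi> x \<bullet> v))"
   by (rule square_int_integrable_prod[OF s1 square_int_inner_const[OF tI(3)]])
  have i2: "integrable lborel (%x. ((f x *\<^sub>R grad \<eta> x) \<bullet> v) * \<phi> x)"
   by (rule square_int_integrable_prod[OF square_int_inner_const[OF s3] tI(1)])
  have i3: "integrable lborel (%x. ((\<eta> x *\<^sub>R g x) \<bullet> v) * \<phi> x)"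
   by (rule square_int_integrable_prod[OF square_int_inner_const[OF s2] tI(1)])
  have "(LINT x|lborel. (\<eta> x *\<^sub>R f x) * (grad \<phi> x \<bullet> v)) + (LINT x|lborel. ((f x *\<^sub>R grad \<eta> x) \<bullet> v) * \<phi> x)
    = (LINT x|lborel. f x * (grad (%x. \<eta> x * \<phi> x) x \<bullet> v))"
   unfolding grad_mult[OF sm(2,1)]
   using i1 i2 by (subst Bochner_Integration.integral_add[symmetric]) (auto intro!: Bochner_Integration.integral_cong simp: inner_add_left algebra_simps)
  also have "... = - (LINT x|lborel. ((\<eta> x *\<^sub>R g x) \<bullet> v) * \<phi> x)"
   using a(5)[OF t', of v] by (simp add: mult_ac)
  finally show "(LINT x|lborel. \<eta> x * f x * (grad \<phi> x \<bullet> v)) = - (LINT x|lborel. ((\<eta> x *\<^sub>R g x + f x *\<^sub>R grad \<eta> x) \<bullet> v) * \<phi> x)"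
   using i2 i3 by (simp add: inner_add_left distrib_right)
 qed
qed

text \<open>A partition of unity on the support splits a test function of \<open>W\<close> into test
  functions lying in the good neighbourhoods, and their gradients add up to the full
  gradient.\<close>

lemma wgrad_local:
 assumes f: "sqint f" "!!x. x \<notin> W ==> f x = 0"
  and g: "sqint g" "!!x. x \<notin> W ==> g x = 0"
  and loc: "!!p. p \<in> W ==> \<exists>S. open S \<and> p \<in> S \<and> (\<forall>\<xi> v. test_function S \<xi> --> test_function W \<xi> -->
    (LINT x|lborel. f x * (grad \<xi> x \<bullet> v)) = - (LINT x|lborel. (g x \<bullet> v) * \<xi> x))"
 shows "wgrad W f g"
 unfolding wgrad_def
proof (intro conjI allI impI)
 fix \<phi> v assume t: "test_function W \<phi>"
 obtain K where K: "compact K" "K \<subseteq> W" "!!x. x \<notin> K ==> \<phi> x = 0" "!!x. x \<notin> K ==> grad \<phi> x = 0"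
  using test_function_support[OF t] by metis
 define \<U> where "\<U> = {S. open S \<and> (\<forall>\<xi> v. test_function S \<xi> --> test_function W \<xi> -->
    (LINT x|lborel. f x * (grad \<xi> x \<bullet> v)) = - (LINT x|lborel. (g x \<bullet> v) * \<xi> x))}"
 have "\<exists>U\<in>\<U>. open U \<and> x \<in> U" if "x \<in> K" for x using loc[of x] K(2) that unfolding \<U>_def by blast
 from smooth_partition_of_unity[OF K(1) this] obtain N :: nat and \<eta> :: "nat => 'a => real" where
  \<eta>: "!!i. i < N ==> \<exists>U\<in>\<U>. test_function U (\<eta> i)" "!!x. x \<in> K ==> (\<Sum>i<N. \<eta> i x) = 1"
  by metis
 define \<xi> where "\<xi> i x = \<eta> i x * \<phi> x" for i x
 have tW: "test_function W (\<xi> i)" if "i < N" for i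
  unfolding \<xi>_def using \<eta>(1)[OF that] by (blast intro: test_function_mult[OF t] test_function_smooth)
 have I: "(LINT x|lborel. f x * (grad (\<xi> i) x \<bullet> v)) = - (LINT x|lborel. (g x \<bullet> v) * \<xi> i x)" if i: "i < N" for i
 proof -
  obtain U where U: "U \<in> \<U>" "test_function U (\<eta> i)" using \<eta>(1)[OF i] by blast
  have "test_function U (%x. \<phi> x * \<eta> i x)" by (rule test_function_mult[OF U(2) test_function_smooth[OF t]])
  moreover have "\<xi> i = (%x. \<phi> x * \<eta> i x)" by (simp add: \<xi>_def fun_eq_iff)
  ultimately have "test_function U (\<xi> i)" by simp
  with U(1) tW[OF i] show ?thesis unfolding \<U>_def by blast
 qed
 have sum: "\<phi> x = (\<Sum>i<N. \<xi> i x)" for x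
  using K(3)[of x] \<eta>(2)[of x] by (cases "x \<in> K") (auto simp: \<xi>_def sum_distrib_right[symmetric])
 have sumg: "grad \<phi> x = (\<Sum>i<N. grad (\<xi> i) x)" for x
 proof (rule grad_eqI)
  have "((%x. \<Sum>i<N. \<xi> i x) has_derivative (%h. \<Sum>i<N. grad (\<xi> i) x \<bullet> h)) (at x)"
   by (intro has_derivative_sum smooth_grad(1)) (use tW test_function_smooth in blast)
  moreover have "\<phi> = (%x. \<Sum>i<N. \<xi> i x)" using sum by blast
  ultimately show "(\<phi> has_derivative (%h. (\<Sum>i<N. grad (\<xi> i) x) \<bullet> h)) (at x)"
   by (simp add: inner_sum_left)
 qed
 have "(LINT x|lborel. f x * (grad \<phi> x \<bullet> v)) = (LINT x|lborel. (\<Sum>i<N. f x * (grad (\<xi> i) x \<bullet> v)))"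
  by (simp add: sumg inner_sum_left sum_distrib_left)
 also have "... = (\<Sum>i<N. (LINT x|lborel. f x * (grad (\<xi> i) x \<bullet> v)))"
  by (rule Bochner_Integration.integral_sum) (use wgrad_integrable(1)[OF f(1) g(1) tW] in auto)
 also have "... = (- (\<Sum>i<N. (LINT x|lborel. (g x \<bullet> v) * \<xi> i x)))"
  unfolding sum_negf[symmetric] by (intro sum.cong refl I) auto
 also have "(\<Sum>i<N. (LINT x|lborel. (g x \<bullet> v) * \<xi> i x)) = (LINT x|lborel. (\<Sum>i<N. (g x \<bullet> v) * \<xi> i x))"
  by (rule Bochner_Integration.integral_sum[symmetric]) (use wgrad_integrable(2)[OF f(1) g(1) tW] in auto)
 also have "... = (LINT x|lborel. (g x \<bullet> v) * \<phi> x)"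
  by (simp add: sum sum_distrib_left)
 finally show "(LINT x|lborel. f x * (grad \<phi> x \<bullet> v)) = - (LINT x|lborel. (g x \<bullet> v) * \<phi> x)" .
qed (use f g in auto)

text \<open>The difference quotients of \<open>H\<close> have integral zero by translation
  invariance and converge dominatedly to the directional derivative.\<close>

lemma integral_derivative_compact_support:
 fixes H :: "'a::euclidean_space => real"
 assumes H: "!!x. (H has_derivative (%h. D x \<bullet> h)) (at x)" and D: "continuous_on UNIV D"
  and K: "compact K" "!!x. x \<notin> K ==> H x = 0" "!!x. x \<notin> K ==> D x = 0"
 shows "(LINT x|lborel. D x \<bullet> v) = 0"
proof -
 have Hc: "continuous_on UNIV H"
  using H by (auto simp: continuous_on_eq_continuous_at intro: has_derivative_continuous)
 have [measurable]: "H \<in> Borel" "D \<in> Borel"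
  using Hc D by (auto intro: borel_measurable_continuous_onI)
 note Hi = continuous_compact_support_integrable(2)[OF Hc K(1,2)]
 obtain C where C: "C \<ge> 0" "!!x. norm (D x) \<le> C" using continuous_compact_support_bounded[OF D K(1,3)] by blast
 obtain R where "!!x. x \<in> K ==> norm x \<le> R" using compact_imp_bounded[OF K(1)] bounded_iff by metis
 then have R: "H x = 0" "D x = 0" if "norm x > R" for x using K that by (meson not_le)+
 define t where "t n = 1 / real (Suc n)" for n
 have t: "t n > 0" "t n \<le> 1" for n by (auto simp: t_def)
 have t0: "t \<longlonglongrightarrow> 0" unfolding t_def by (rule lim_1_over_n[THEN LIMSEQ_Suc])
 define Q where "Q n x = (H (x + t n *\<^sub>R v) - H x) / t n" for n x
 have [measurable]: "Q n \<in> Borel" for n unfolding Q_def by measurable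
 have Q0: "(LINT x|lborel. Q n x) = 0" for n
  unfolding Q_def using integral_shift[of H "t n *\<^sub>R v"] Hi by simp
 have "(%n. LINT x|lborel. Q n x) \<longlonglongrightarrow> (LINT x|lborel. D x \<bullet> v)"
 proof (rule integral_dominated_convergence[where w = "%x. (C * norm v) * indicator (cball 0 (R + norm v)) x"])
  have "emeasure lborel (cball (0::'a) (R + norm v)) < \<infinity>" by (rule emeasure_bounded_finite) simp
  then show "integrable lborel (%x::'a. (C * norm v) * indicator (cball 0 (R + norm v)) x)"
   by (intro integrable_mult_right) (simp add: integrable_indicator_iff)
  show "AE x in lborel. (%n. Q n x) \<longlonglongrightarrow> D x \<bullet> v"
  proof (rule AE_I2)
   fix x
   have "((%s. H (x + s *\<^sub>R v)) has_derivative (%s. D x \<bullet> (s *\<^sub>R v))) (at 0)"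
    by (rule has_derivative_compose[of "%s. x + s *\<^sub>R v" _ _ _ H]) (auto intro!: derivative_eq_intros H)
   then have "((%s. H (x + s *\<^sub>R v)) has_field_derivative D x \<bullet> v) (at 0)"
    by (simp add: has_field_derivative_def mult.commute[of _ "D x \<bullet> v"])
   then have "((%s. (H (x + s *\<^sub>R v) - H x) / s) \<longlongrightarrow> D x \<bullet> v) (at 0)"
    by (simp add: DERIV_def)
   moreover have "filterlim t (at 0) sequentially"
    using t0 t(1) by (auto simp: filterlim_at intro!: always_eventually) (metis less_irrefl)
   ultimately show "(%n. Q n x) \<longlonglongrightarrow> D x \<bullet> v"
    unfolding Q_def by (rule filterlim_compose)
  qed
  fix n
  show "AE x in lborel. norm (Q n x) \<le> (C * norm v) * indicator (cball 0 (R + norm v)) x"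
  proof (rule AE_I2)
   fix x
   show "norm (Q n x) \<le> (C * norm v) * indicator (cball 0 (R + norm v)) x"
   proof (cases "x \<in> cball 0 (R + norm v)")
    case True
    have "norm (H (x + t n *\<^sub>R v) - H x) \<le> C * norm (x + t n *\<^sub>R v - x)"
     by (rule differentiable_bound[of UNIV H "%x h. D x \<bullet> h", OF _ H order_trans[OF onorm_inner_le C(2)]]) auto
    then have "norm (Q n x) \<le> C * norm v"
     using t(1)[of n] by (simp add: Q_def pos_divide_le_eq mult_ac)
    with True show ?thesis by simp
   next
    case False
    have "norm (t n *\<^sub>R v) \<le> norm v" using t[of n] by (simp add: mult_left_le_one_le)
    moreover have "norm x \<le> norm (x + t n *\<^sub>R v) + norm (t n *\<^sub>R v)"
     using norm_triangle_ineq4[of "x + t n *\<^sub>R v" "t n *\<^sub>R v"] by simp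
    moreover have "norm x > R + norm v" using False by simp
    ultimately have "norm (x + t n *\<^sub>R v) > R" "norm x > R" using norm_ge_zero[of v] by linarith+
    then have "H (x + t n *\<^sub>R v) = 0" "H x = 0" by (auto intro: R(1))
    then show ?thesis using False by (simp add: Q_def)
   qed
  qed
 qed measurable
 then show ?thesis unfolding Q0 LIMSEQ_const_iff by simp
qed

text \<open>The existential gradient of \<open>C1_closure\<close> made explicit, since limits of
  gradients and Green's formula have to name it.\<close>

definition C1_grad :: "'a::euclidean_space set => ('a => real) => ('a => 'a) => bool" where
 "C1_grad U u G \<longleftrightarrow> continuous_on (closure U) u \<and> continuous_on (closure U) G \<and>
   (\<forall>x\<in>U. (u has_derivative (%h. G x \<bullet> h)) (at x))"

lemma C1_closure_iff: "C1_closure U u \<longleftrightarrow> (\<exists>G. C1_grad U u G)"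
 by (auto simp: C1_closure_def C1_grad_def)

lemma C1_grad_indicator:
 fixes h :: "'a::euclidean_space => 'b::euclidean_space"
 assumes U: "open U" "bounded U" and h: "continuous_on (closure U) h"
 shows "sqint (cut U h)"
proof -
 have "compact (closure U)" using U by (simp add: compact_closure)
 then have "compact (h ` closure U)" using h by (rule compact_continuous_image[rotated])
 then obtain C where C: "!!x. x \<in> closure U ==> norm (h x) \<le> C" using compact_imp_bounded bounded_iff by (metis imageI)
 have "cut U h \<in> Borel"
  by (rule borel_measurable_continuous_on_indicator) (use U continuous_on_subset[OF h closure_subset] in auto)
 then show ?thesis
 proof (rule bounded_support_integrable(1)[OF _ _ U(2)])
  fix x show "norm (cut U h x) \<le> max C 0"
   using C[of x] closure_subset[of U] by (auto simp: indicator_def le_max_iff_disj)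
 qed auto
qed

text \<open>The product of \<open>u\<close> with a test function, extended by zero, is C^1 on the
  whole space with compact support, so its derivative integrates to zero. Regularity is checked on
  the two open sets \<open>U\<close> and \<open>- K\<close>, which cover the space.\<close>

lemma wgrad_C1:
 assumes U: "open U" "bounded U" and u: "C1_grad U u G"
 shows "wgrad U (%x. indicator U x * u x) (cut U G)"
proof -
 have uc: "continuous_on (closure U) u" "continuous_on (closure U) G" "!!x. x \<in> U ==> (u has_derivative (%h. G x \<bullet> h)) (at x)"
  using u by (auto simp: C1_grad_def)
 note s1 = C1_grad_indicator[OF U uc(1)] and s2 = C1_grad_indicator[OF U uc(2)]
 show ?thesis
  unfolding wgrad_def
 proof (intro conjI allI impI)
  fix \<phi> v assume t: "test_function U \<phi>"
  obtain K where K: "compact K" "K \<subseteq> U" "!!x. x \<notin> K ==> \<phi> x = 0" "!!x. x \<notin> K ==> grad \<phi> x = 0"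
   using test_function_support[OF t] by metis
  note sm = test_function_smooth[OF t] note tI = test_function_integrable[OF t]
  define H where "H x = (indicator U x * u x) * \<phi> x" for x
  define D where "D x = (indicator U x * u x) *\<^sub>R grad \<phi> x + \<phi> x *\<^sub>R (cut U G x)" for x
  have z: "H x = 0" "D x = 0" if "x \<notin> K" for x using K(3,4)[OF that] by (auto simp: H_def D_def)
  have opK: "open (- K)" using compact_imp_closed[OF K(1)] by auto
  have "(H has_derivative (%h. D x \<bullet> h)) (at x)" for x
  proof (cases "x \<in> U")
   case True
   have "((%x. u x * \<phi> x) has_derivative (%h. D x \<bullet> h)) (at x)"
    using has_derivative_mult[OF uc(3)[OF True] smooth_grad(1)[OF sm]] True
    by (simp add: D_def inner_add_left mult.commute)
   then show ?thesis
    by (rule has_derivative_transform_within_open[OF _ U(1) True]) (simp add: H_def)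
  next
   case False
   then have x: "x \<in> - K" using K(2) by blast
   have "((%x. 0) has_derivative (%h. D x \<bullet> h)) (at x)" using z(2)[of x] x by simp
   then show ?thesis
    by (rule has_derivative_transform_within_open[OF _ opK x]) (simp add: z(1))
  qed
  moreover have "continuous_on UNIV D"
  proof -
   have cU: "continuous_on U D"
   proof -
    have "continuous_on U (%x. u x *\<^sub>R grad \<phi> x + \<phi> x *\<^sub>R G x)"
     using uc(1,2) smooth_imp_continuous[OF sm] smooth_grad_continuous[OF sm] closure_subset[of U]
     by (intro continuous_intros) (auto intro: continuous_on_subset)
    then show ?thesis by (rule continuous_on_eq) (simp add: D_def)
   qed
   have "continuous_on (- K) D" by (rule continuous_on_eq[of _ "%x. 0"]) (use z(2) in auto)
   then have "continuous_on (U \<union> - K) D" by (rule continuous_on_open_Un[OF U(1) opK cU])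
   moreover have "U \<union> - K = UNIV" using K(2) by blast
   ultimately show ?thesis by simp
  qed
  ultimately have "(LINT x|lborel. D x \<bullet> v) = 0"
   by (rule integral_derivative_compact_support[OF _ _ K(1) z])
  moreover have "integrable lborel (%x. (cut U u x) * (grad \<phi> x \<bullet> v))"
   "integrable lborel (%x. ((cut U G x) \<bullet> v) * \<phi> x)"
   by (intro wgrad_integrable[OF s1 s2 t])+
  ultimately show "(LINT x|lborel. indicator U x * u x * (grad \<phi> x \<bullet> v)) = - (LINT x|lborel. ((cut U G x) \<bullet> v) * \<phi> x)"
   by (simp add: D_def inner_add_left mult_ac)
 qed (use s1 s2 in auto)
qed

subsection \<open>Mollification of weakly differentiable functions\<close>

lemma smooth_shift:
 assumes "smooth f"
 shows "smooth (%y. f (y + c))"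
proof (rule smooth_coinduct[of _ "{%y. f (y + c) |f. smooth f}"])
 fix F assume "F \<in> {%y. f (y + c) |f. smooth f}"
 then obtain f where f: "F = (%y. f (y + c))" "smooth f" by auto
 show "\<exists>G. (\<forall>x. (F has_derivative (%h. G x \<bullet> h)) (at x)) \<and> (\<forall>b\<in>Basis. (%x. G x \<bullet> b) \<in> {%y. f (y + c) |f. smooth f})"
 proof (intro exI[of _ "%x. grad f (x + c)"] conjI allI ballI)
  show "(F has_derivative (%h. grad f (x + c) \<bullet> h)) (at x)" for x
   unfolding f(1) by (rule has_derivative_compose[of "%y. y + c" "%h. h" x UNIV f])
    (auto intro!: derivative_eq_intros smooth_grad(1)[OF f(2)])
  show "(%x. grad f (x + c) \<bullet> b) \<in> {%y. f (y + c) |f. smooth f}" for b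
   unfolding mem_Collect_eq
   by (rule exI[of _ "%x. grad f x \<bullet> b"]) (simp add: smooth_grad(2)[OF f(2)])
 qed
qed (use assms in blast)

lemma grad_shift:
 assumes "smooth f"
 shows "grad (%y. f (y + c)) x = grad f (x + c)"
 by (rule grad_eqI, rule has_derivative_compose[of "%y. y + c" "%h. h" x UNIV f])
  (auto intro!: derivative_eq_intros smooth_grad(1)[OF assms])

text \<open>Once the ball around \<open>x\<close> fits into \<open>U\<close>, the kernel shifted to
  \<open>x\<close> is itself a test function of \<open>U\<close>, and the weak identity can be
  tested with it.\<close>

lemma grad_mollify_wgrad:
 assumes w: "wgrad U f g" and i: "integrable lborel f" "integrable lborel g" and \<rho>: "mollifier d \<rho>" and x: "ball x d \<subseteq> U"
 shows "grad (mollify \<rho> f) x = mollify \<rho> g x"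
proof (rule euclidean_eqI)
 fix v :: 'a
 have t: "test_function (ball 0 d) \<rho>" using \<rho> by (simp add: mollifier_def)
 obtain K where K: "compact K" "K \<subseteq> ball 0 d" "!!x. x \<notin> K ==> \<rho> x = 0" using test_function_support[OF t] by metis
 have "test_function U (%y. \<rho> (y + - x))"
 proof (rule test_functionI[OF smooth_shift[OF test_function_smooth[OF t]]])
  show "compact ((+) x ` K)" by (rule compact_translation[OF K(1)])
  show "(+) x ` K \<subseteq> U" using K(2) x by (auto simp: subset_iff dist_norm)
  fix y assume "y \<notin> (+) x ` K"
  then have "y + - x \<notin> K" by (metis add.commute add_minus_cancel image_eqI minus_add_cancel)
  then show "\<rho> (y + - x) = 0" by (rule K(3))
 qed
 from wgradD(5)[OF w this, of v]
 have "(LINT y|lborel. f y * (grad \<rho> (y - x) \<bullet> v)) = - (LINT y|lborel. (g y \<bullet> v) * \<rho> (y - x))"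
  by (simp add: grad_shift[OF test_function_smooth[OF t], of "- x", simplified])
 moreover have "grad (mollify \<rho> f) x \<bullet> v = - (LINT y|lborel. f y * (grad \<rho> (y - x) \<bullet> v))"
  unfolding grad_mollify[OF t i(1)] by (simp add: mollify_def mult.commute)
 moreover have "mollify \<rho> g x \<bullet> v = (LINT y|lborel. (g y \<bullet> v) * \<rho> (y - x))"
  unfolding mollify_def using mollify_integrable(1)[OF t i(2), of x]
  by (subst integral_inner_left[symmetric]) (auto simp: mult.commute)
 ultimately show "grad (mollify \<rho> f) x \<bullet> v = mollify \<rho> g x \<bullet> v" by simp
qed

lemma square_int_bounded_support_integrable:
 fixes f :: "'a::euclidean_space => 'b::euclidean_space"
 assumes "sqint f" "bounded K" "!!x. x \<notin> K ==> f x = 0"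
 shows "integrable lborel f"
proof (rule square_int_integrable_finite[OF assms(1)])
 have "bounded {x. f x \<noteq> 0}" using assms by (auto intro: bounded_subset)
 then show "emeasure lborel {x \<in> space lborel. f x \<noteq> 0} < \<infinity>"
  using emeasure_bounded_finite by simp
qed

text \<open>The radius lies below the translation moduli of both functions, so a single kernel
  approximates a function together with its gradient.\<close>

lemma mollifier_approx:
 fixes f :: "'a::euclidean_space => real" and g :: "'a => 'a"
 assumes f: "sqint f" "integrable lborel f" and g: "sqint g" "integrable lborel g"
  and e: "e > 0" "\<epsilon> > 0"
 obtains d \<rho> where "0 < d" "d < \<epsilon>" "mollifier d \<rho>"
  "sqint (mollify \<rho> f)" "dist2 (mollify \<rho> f) f \<le> e"
  "sqint (mollify \<rho> g)" "dist2 (mollify \<rho> g) g \<le> e"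
proof -
 obtain d1 where d1: "d1 > 0" "!!z. norm z < d1 ==> norm2 (%x. f (x + z) - f x) < e"
  using l2_translation_continuous[OF f(1) e(1)] by blast
 obtain d2 where d2: "d2 > 0" "!!z. norm z < d2 ==> norm2 (%x. g (x + z) - g x) < e"
  using l2_translation_continuous[OF g(1) e(1)] by blast
 define d where "d = min (min d1 d2) (\<epsilon>/2)"
 have d: "0 < d" "d \<le> d1" "d \<le> d2" "d < \<epsilon>" using d1 d2 e by (auto simp: d_def min_def)
 obtain \<rho> :: "'a => real" where \<rho>: "mollifier d \<rho>" using mollifier_exists[OF d(1)] .
 have l1: "norm2 (%x. f (x + z) - f x) \<le> e" if "norm z < d" for z using d1(2)[of z] d(2) that by simp
 have l2: "norm2 (%x. g (x + z) - g x) \<le> e" if "norm z < d" for z using d2(2)[of z] d(3) that by simp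
 show thesis
  using mollify_l2[OF \<rho> f l1] mollify_l2[OF \<rho> g l2] e d \<rho> by (intro that[of d \<rho>]) auto
qed

lemma wgrad_approx_test:
 fixes f :: "'a::euclidean_space => real"
 assumes w: "wgrad UNIV f g" and K: "compact K" "!!x. x \<notin> K ==> f x = 0" "!!x. x \<notin> K ==> g x = 0"
  and U: "open U" "K \<subseteq> U" and e: "e > 0"
 obtains \<phi> where "test_function U \<phi>" "dist2 \<phi> f \<le> e" "dist2 (grad \<phi>) g \<le> e"
proof -
 note a = wgradD[OF w]
 have fi: "integrable lborel f" using square_int_bounded_support_integrable[OF a(1) compact_imp_bounded[OF K(1)]] K(2) by blast
 have gi: "integrable lborel g" using square_int_bounded_support_integrable[OF a(2) compact_imp_bounded[OF K(1)]] K(3) by blast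
 obtain \<epsilon> where \<epsilon>: "\<epsilon> > 0" "(\<Union>x\<in>K. ball x \<epsilon>) \<subseteq> U"
  using compact_subset_open_imp_ball_epsilon_subset[OF K(1) U] .
 obtain d \<rho> where d: "0 < d" "d < \<epsilon>" "mollifier d \<rho>"
  "dist2 (mollify \<rho> f) f \<le> e" "dist2 (mollify \<rho> g) g \<le> e"
  using mollifier_approx[OF a(1) fi a(2) gi e \<epsilon>(1)] by metis
 have "grad (mollify \<rho> f) x = mollify \<rho> g x" for x by (rule grad_mollify_wgrad[OF w fi gi d(3)]) simp
 then show thesis
  using d(4,5) test_function_mollify[OF d(3) fi K(1,2) \<epsilon>(2) d(1,2)] by (intro that[of "mollify \<rho> f"]) auto
qed

section \<open>One-dimensional Hausdorff measure\<close>

text \<open>The inner infimum of \<open>hausdorff1_outer\<close>, isolated so that covering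
  arguments at a fixed scale are separated from the supremum over scales.\<close>

definition hausdorff1_pre :: "real => 'a::metric_space set => ennreal" where
 "hausdorff1_pre \<delta> A = (INF C\<in>{C :: nat => 'a set.
     A \<subseteq> (\<Union>i. C i) \<and> (\<forall>i. bounded (C i) \<and> diameter (C i) \<le> \<delta>)}.
    (\<Sum>i. ennreal (diameter (C i))))"

lemma hausdorff1_outer_eq: "hausdorff1_outer A = (SUP \<delta>\<in>{0<..}. hausdorff1_pre \<delta> A)"
 by (simp add: hausdorff1_outer_def hausdorff1_pre_def)

lemma hausdorff1_pre_le:
 assumes "A \<subseteq> (\<Union>i. C i)" "!!i. bounded (C i)" "!!i. diameter (C i) \<le> \<delta>"
 shows "hausdorff1_pre \<delta> A \<le> (\<Sum>i. ennreal (diameter (C i)))"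
 unfolding hausdorff1_pre_def by (rule INF_lower) (use assms in auto)

lemma hausdorff1_pre_le_outer: "\<delta> > 0 ==> hausdorff1_pre \<delta> A \<le> hausdorff1_outer A"
 unfolding hausdorff1_outer_eq by (rule SUP_upper) auto

lemma hausdorff1_pre_less:
 assumes "hausdorff1_pre \<delta> A < x"
 obtains C where "A \<subseteq> (\<Union>i. C i)" "!!i. bounded (C i)" "!!i. diameter (C i) \<le> \<delta>"
  "(\<Sum>i. ennreal (diameter (C i))) < x"
 using assms unfolding hausdorff1_pre_def INF_less_iff by auto

lemma hausdorff1_pre_mono: "A \<subseteq> B ==> hausdorff1_pre \<delta> A \<le> hausdorff1_pre \<delta> B"
 unfolding hausdorff1_pre_def by (rule INF_superset_mono) auto

lemma hausdorff1_pre_antimono: "\<delta> \<le> \<delta>' ==> hausdorff1_pre \<delta>' A \<le> hausdorff1_pre \<delta> A"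
 unfolding hausdorff1_pre_def by (rule INF_superset_mono) (auto intro: order_trans)

lemma hausdorff1_outer_mono: "A \<subseteq> B ==> hausdorff1_outer A \<le> hausdorff1_outer B"
 unfolding hausdorff1_outer_eq by (rule SUP_mono) (auto intro: hausdorff1_pre_mono)

lemma hausdorff1_outer_empty: "hausdorff1_outer {} = 0"
proof -
 have "hausdorff1_pre \<delta> ({}::'a set) \<le> 0" if "\<delta> > 0" for \<delta>
  using hausdorff1_pre_le[of "{}::'a set" "%i. {}" \<delta>] that by (simp add: diameter_def)
 then show ?thesis unfolding hausdorff1_outer_eq by (auto intro!: antisym SUP_least)
qed

text \<open>Covers that are optimal up to \<open>e * (1/2)^Suc i\<close> are merged into one
  sequence by the pairing function on the naturals.\<close>

lemma hausdorff1_outer_subadditive: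
 fixes A :: "nat => 'a::metric_space set"
 shows "hausdorff1_outer (\<Union>i. A i) \<le> (\<Sum>i. hausdorff1_outer (A i))"
 unfolding hausdorff1_outer_eq[of "\<Union>i. A i"]
proof (rule SUP_least)
 fix \<delta> :: real assume "\<delta> \<in> {0<..}"
 then have \<delta>: "\<delta> > 0" by simp
 show "hausdorff1_pre \<delta> (\<Union>i. A i) \<le> (\<Sum>i. hausdorff1_outer (A i))"
 proof (rule ennreal_le_epsilon)
  fix e :: real assume fin: "(\<Sum>i. hausdorff1_outer (A i)) < top" and e: "0 < e"
  have "hausdorff1_pre \<delta> (A i) < hausdorff1_outer (A i) + ennreal (e * (1/2)^Suc i)" for i
  proof -
   have "hausdorff1_outer (A i) \<le> (\<Sum>i. hausdorff1_outer (A i))"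
    using sum_le_suminf[OF summableI, of "{i}" "%i. hausdorff1_outer (A i)"] by simp
   then have f: "hausdorff1_outer (A i) < top" using fin by (rule le_less_trans)
   have "0 < ennreal (e * (1/2)^Suc i)"
    using e by simp
   then have "hausdorff1_outer (A i) + 0 < hausdorff1_outer (A i) + ennreal (e * (1/2)^Suc i)"
    using f by (subst ennreal_add_left_cancel_less) auto
   then show ?thesis using hausdorff1_pre_le_outer[OF \<delta>, of "A i"] by (metis add.right_neutral le_less_trans)
  qed
  then have "\<exists>C. A i \<subseteq> (\<Union>j. C j) \<and> (\<forall>j. bounded (C j)) \<and> (\<forall>j. diameter (C j) \<le> \<delta>) \<and>
   (\<Sum>j. ennreal (diameter (C j))) < hausdorff1_outer (A i) + ennreal (e * (1/2)^Suc i)" for i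
   using hausdorff1_pre_less by metis
  then obtain C where C: "!!i. A i \<subseteq> (\<Union>j. C i j)" "!!i j. bounded (C i j)" "!!i j. diameter (C i j) \<le> \<delta>"
   "!!i. (\<Sum>j. ennreal (diameter (C i j))) < hausdorff1_outer (A i) + ennreal (e * (1/2)^Suc i)"
   by metis
  define D where "D k = (case prod_decode k of (i, j) => C i j)" for k
  have "hausdorff1_pre \<delta> (\<Union>i. A i) \<le> (\<Sum>k. ennreal (diameter (D k)))"
  proof (rule hausdorff1_pre_le)
   show "(\<Union>i. A i) \<subseteq> (\<Union>k. D k)"
   proof
    fix x assume "x \<in> (\<Union>i. A i)"
    then obtain i j where "x \<in> C i j" using C(1) by blast
    then have "x \<in> D (prod_encode (i, j))" by (simp add: D_def)
    then show "x \<in> (\<Union>k. D k)" by blast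
   qed
  qed (auto simp: D_def C split: prod.split)
  also have "... = (\<Sum>k. (%(i, j). ennreal (diameter (C i j))) (prod_decode k))"
   by (simp add: D_def case_prod_unfold)
  also have "... = (\<Sum>i. \<Sum>j. ennreal (diameter (C i j)))"
   by (rule suminf_ennreal_2dimen) simp
  also have "... \<le> (\<Sum>i. hausdorff1_outer (A i) + ennreal (e * (1/2)^Suc i))"
   by (intro suminf_le less_imp_le C(4) summableI)
  also have "... = (\<Sum>i. hausdorff1_outer (A i)) + (\<Sum>i. ennreal (e * (1/2)^Suc i))"
   by (rule suminf_add[symmetric]) (auto intro: summableI)
  also have "(\<Sum>i. ennreal (e * (1/2)^Suc i)) = ennreal e"
   using sums_mult[OF power_half_series, of e] e by (intro suminf_ennreal_eq) auto
  finally show "hausdorff1_pre \<delta> (\<Union>i. A i) \<le> (\<Sum>i. hausdorff1_outer (A i)) + ennreal e" .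
 qed
qed

lemma hausdorff1_outer_Un: "hausdorff1_outer (A \<union> B) \<le> hausdorff1_outer A + hausdorff1_outer B"
proof -
 define F where "F i = (if i = 0 then A else if i = 1 then B else {})" for i :: nat
 have "A \<union> B = (\<Union>i. F i)" unfolding F_def by (auto split: if_splits)
 then have "hausdorff1_outer (A \<union> B) \<le> (\<Sum>i. hausdorff1_outer (F i))"
  using hausdorff1_outer_subadditive[of F] by simp
 also have "... = (\<Sum>i\<in>{0,1}. hausdorff1_outer (F i))"
  by (rule suminf_finite) (auto simp: F_def hausdorff1_outer_empty)
 finally show ?thesis by (simp add: F_def)
qed

text \<open>A set of diameter below \<open>d\<close> cannot meet both parts, so each fine cover
  splits into a cover of \<open>A\<close> and a cover of \<open>B\<close>; coarser scales are
  reduced to this case by monotonicity.\<close>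

lemma hausdorff1_outer_separated:
 fixes A B :: "'a::metric_space set"
 assumes d: "d > 0" "!!a b. a \<in> A ==> b \<in> B ==> d \<le> dist a b"
 shows "hausdorff1_outer A + hausdorff1_outer B \<le> hausdorff1_outer (A \<union> B)"
proof -
 have pre: "hausdorff1_pre \<delta> A + hausdorff1_pre \<delta> B \<le> hausdorff1_pre \<delta> (A \<union> B)" if \<delta>: "0 < \<delta>" "\<delta> < d" for \<delta>
  unfolding hausdorff1_pre_def[of \<delta> "A \<union> B"]
 proof (rule INF_greatest)
  fix C :: "nat => 'a set"
  assume "C \<in> {C. A \<union> B \<subseteq> (\<Union>i. C i) \<and> (\<forall>i. bounded (C i) \<and> diameter (C i) \<le> \<delta>)}"
  then have C: "A \<union> B \<subseteq> (\<Union>i. C i)" "!!i. bounded (C i)" "!!i. diameter (C i) \<le> \<delta>" by auto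
  define CA where "CA i = (if C i \<inter> A = {} then {} else C i)" for i
  define CB where "CB i = (if C i \<inter> B = {} then {} else C i)" for i
  have dis: "C i \<inter> A = {} \<or> C i \<inter> B = {}" for i
  proof (rule ccontr)
   assume "\<not> ?thesis"
   then obtain a b where ab: "a \<in> C i" "a \<in> A" "b \<in> C i" "b \<in> B" by blast
   have "dist a b \<le> diameter (C i)" by (rule diameter_bounded_bound[OF C(2) ab(1,3)])
   then show False using d(2)[OF ab(2,4)] C(3)[of i] \<delta> by linarith
  qed
  have "hausdorff1_pre \<delta> A \<le> (\<Sum>i. ennreal (diameter (CA i)))"
  proof (rule hausdorff1_pre_le)
   show "A \<subseteq> (\<Union>i. CA i)"
   proof
    fix x assume "x \<in> A"
    then obtain i where "x \<in> C i" using C(1) by blast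
    then have "x \<in> CA i" using \<open>x \<in> A\<close> by (auto simp: CA_def)
    then show "x \<in> (\<Union>i. CA i)" by blast
   qed
  qed (use C \<delta> in \<open>auto simp: CA_def\<close>)
  moreover have "hausdorff1_pre \<delta> B \<le> (\<Sum>i. ennreal (diameter (CB i)))"
  proof (rule hausdorff1_pre_le)
   show "B \<subseteq> (\<Union>i. CB i)"
   proof
    fix x assume "x \<in> B"
    then obtain i where "x \<in> C i" using C(1) by blast
    then have "x \<in> CB i" using \<open>x \<in> B\<close> by (auto simp: CB_def)
    then show "x \<in> (\<Union>i. CB i)" by blast
   qed
  qed (use C \<delta> in \<open>auto simp: CB_def\<close>)
  ultimately have "hausdorff1_pre \<delta> A + hausdorff1_pre \<delta> B \<le> (\<Sum>i. ennreal (diameter (CA i))) + (\<Sum>i. ennreal (diameter (CB i)))"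
   by (rule add_mono)
  also have "... = (\<Sum>i. ennreal (diameter (CA i)) + ennreal (diameter (CB i)))"
   by (rule suminf_add) (auto intro: summableI)
  also have "... \<le> (\<Sum>i. ennreal (diameter (C i)))"
  proof (rule suminf_le)
   fix i
   show "ennreal (diameter (CA i)) + ennreal (diameter (CB i)) \<le> ennreal (diameter (C i))"
    using dis[of i] unfolding CA_def CB_def by auto
  qed (auto intro: summableI)
  finally show "hausdorff1_pre \<delta> A + hausdorff1_pre \<delta> B \<le> (\<Sum>i. ennreal (diameter (C i)))" .
 qed
 have "hausdorff1_pre \<delta>1 A + hausdorff1_pre \<delta>2 B \<le> hausdorff1_outer (A \<union> B)" if "\<delta>1 > 0" "\<delta>2 > 0" for \<delta>1 \<delta>2
 proof -
  define \<delta> where "\<delta> = min (min \<delta>1 \<delta>2) (d/2)"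
  have \<delta>: "0 < \<delta>" "\<delta> < d" "\<delta> \<le> \<delta>1" "\<delta> \<le> \<delta>2" using that d(1) by (auto simp: \<delta>_def min_def)
  have "hausdorff1_pre \<delta>1 A + hausdorff1_pre \<delta>2 B \<le> hausdorff1_pre \<delta> A + hausdorff1_pre \<delta> B"
   by (intro add_mono hausdorff1_pre_antimono \<delta>)
  also have "... \<le> hausdorff1_outer (A \<union> B)" using pre[OF \<delta>(1,2)] hausdorff1_pre_le_outer[OF \<delta>(1)] by (rule order_trans)
  finally show ?thesis .
 qed
 then have "hausdorff1_pre \<delta>1 A + hausdorff1_outer B \<le> hausdorff1_outer (A \<union> B)" if "\<delta>1 > 0" for \<delta>1
  unfolding hausdorff1_outer_eq[of B] using that by (subst ennreal_SUP_add_right) (auto intro!: SUP_least)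
 then show ?thesis
  unfolding hausdorff1_outer_eq[of A] by (subst ennreal_SUP_add_left[symmetric]) (auto intro!: SUP_least)
qed

text \<open>Caratheodory's criterion for metric outer measures. The part of \<open>A\<close> off
  \<open>F\<close> is exhausted by the sets \<open>E n\<close> at distance at least
  \<open>1 / (n + 1)\<close> from \<open>F\<close>, each separated from \<open>A \<inter> F\<close>.
  The layers \<open>D k\<close> between consecutive ones have summable measure, so what lies outside
  \<open>E n\<close> becomes negligible.\<close>

lemma hausdorff1_closed_measurable:
 fixes F A :: "'a::metric_space set"
 assumes "closed F"
 shows "hausdorff1_outer (A \<inter> F) + hausdorff1_outer (A - F) \<le> hausdorff1_outer A"
proof (cases "F = {} \<or> hausdorff1_outer A = top")
 case True
 then show ?thesis by (auto simp: hausdorff1_outer_empty)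
next
 case False
 then have F: "F \<noteq> {}" and fin: "hausdorff1_outer A \<noteq> top" by auto
 let ?H = "hausdorff1_outer :: 'a set => ennreal"
 define E where "E n = {x \<in> A - F. infdist x F \<ge> 1 / real (n + 1)}" for n
 define D where "D n = {x \<in> A - F. infdist x F \<ge> 1 / real (n + 2) \<and> infdist x F < 1 / real (n + 1)}" for n
 have pos: "infdist x F > 0" if "x \<in> A - F" for x
  using that F assms infdist_nonneg[of x F] in_closed_iff_infdist_zero[OF assms F] by (metis DiffD2 less_eq_real_def)
 have sep: "?H S + ?H T \<le> ?H A"
  if "S \<subseteq> A" "T \<subseteq> A" "b < a" "!!x. x \<in> S ==> a \<le> infdist x F" "!!x. x \<in> T ==> infdist x F \<le> b" for S T a b
 proof -
  have "?H S + ?H T \<le> ?H (S \<union> T)"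
  proof (rule hausdorff1_outer_separated)
   show "0 < a - b" using that by simp
   fix x y assume "x \<in> S" "y \<in> T"
   then show "a - b \<le> dist x y"
    using that(4)[of x] that(5)[of y] infdist_triangle[of x F y] by linarith
  qed
  also have "... \<le> ?H A" using that by (intro hausdorff1_outer_mono) auto
  finally show ?thesis .
 qed
 have sepU: "?H S + ?H T \<le> ?H (S \<union> T)"
  if "b < a" "!!x. x \<in> S ==> a \<le> infdist x F" "!!x. x \<in> T ==> infdist x F \<le> b" for S T a b
 proof (rule hausdorff1_outer_separated)
  show "0 < a - b" using that by simp
  fix x y assume "x \<in> S" "y \<in> T"
  then show "a - b \<le> dist x y"
   using that(2)[of x] that(3)[of y] infdist_triangle[of x F y] by linarith
 qed
 \<comment> \<open>Layers whose indices differ by two or more are at positive distance, so their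
   measures add up. The offset \<open>p\<close> is used with 0 and 1, for the even and the odd
   layers.\<close>
 have part: "(\<Sum>k<n. ?H (D (2 * k + p))) \<le> ?H (\<Union>k<n. D (2 * k + p))" for n p
 proof (induction n)
  case (Suc n)
  have "(\<Sum>k<Suc n. ?H (D (2 * k + p))) \<le> ?H (\<Union>k<n. D (2 * k + p)) + ?H (D (2 * n + p))"
   using Suc by (auto intro: add_mono)
  also have "... \<le> ?H ((\<Union>k<n. D (2 * k + p)) \<union> D (2 * n + p))"
  proof (cases "n = 0")
   case False
   show ?thesis
   proof (rule sepU)
    show "1 / real (2 * n + p + 1) < 1 / real (2 * n + p)" using False by (intro divide_strict_left_mono) auto
    show "infdist x F \<le> 1 / real (2 * n + p + 1)" if "x \<in> D (2 * n + p)" for x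
     using that by (simp add: D_def)
    show "1 / real (2 * n + p) \<le> infdist x F" if x: "x \<in> (\<Union>k<n. D (2 * k + p))" for x
    proof -
     obtain k where k: "k < n" "x \<in> D (2 * k + p)" using x by auto
     have "1 / real (2 * n + p) \<le> 1 / real (2 * k + p + 2)"
      using k by (intro divide_left_mono) auto
     then show ?thesis using k(2) by (simp add: D_def)
    qed
   qed
  qed (simp add: hausdorff1_outer_empty)
  also have "(\<Union>k<n. D (2 * k + p)) \<union> D (2 * n + p) = (\<Union>k<Suc n. D (2 * k + p))"
   by (auto simp: less_Suc_eq)
  finally show ?case .
 qed (simp add: hausdorff1_outer_empty)
 have DA: "(\<Union>k<n. D (2 * k + p)) \<subseteq> A" for n p by (auto simp: D_def)
 have "(\<Sum>k<2*n. ?H (D k)) = (\<Sum>k<n. ?H (D (2 * k + 0))) + (\<Sum>k<n. ?H (D (2 * k + 1)))" for n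
  by (induction n) (simp_all add: ac_simps)
 moreover have "(\<Sum>k<n. ?H (D (2 * k + p))) \<le> ?H A" for n p
  by (rule order_trans[OF part hausdorff1_outer_mono[OF DA]])
 ultimately have "(\<Sum>k<2*n. ?H (D k)) \<le> ?H A + ?H A" for n
  by (simp only: add_mono)
 moreover have "(\<Sum>k<n. ?H (D k)) \<le> (\<Sum>k<2*n. ?H (D k))" for n by (rule sum_mono2) auto
 ultimately have "(\<Sum>k<n. ?H (D k)) \<le> ?H A + ?H A" for n by (meson order_trans)
 then have "(\<Sum>k. ?H (D k)) \<le> ?H A + ?H A" by (intro suminf_le_const summableI)
 also have "... < top" using fin by (simp add: less_top[symmetric])
 finally have sfin: "(\<Sum>k. ?H (D k)) < top" .
 have HDfin: "?H (D k) < top" for k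
  using hausdorff1_outer_mono[of "D k" A] fin by (auto simp: D_def less_top[symmetric] top_unique)
 define r where "r k = enn2real (?H (D k))" for k
 have r: "?H (D k) = ennreal (r k)" for k unfolding r_def using HDfin[of k] by simp
 have rs: "summable r"
 proof (rule summable_suminf_not_top)
  show "0 \<le> r i" for i by (simp add: r_def)
  show "(\<Sum>i. ennreal (r i)) \<noteq> top" unfolding r[symmetric] using sfin by simp
 qed
 show ?thesis
 proof (rule ennreal_le_epsilon)
  fix e :: real assume e: "0 < e"
  obtain n where n: "norm (\<Sum>i. r (i + n)) < e" using suminf_exist_split[OF e rs] by blast
  have "A - F \<subseteq> E n \<union> (\<Union>k. D (k + n))"
  proof
   fix x assume x: "x \<in> A - F"
   show "x \<in> E n \<union> (\<Union>k. D (k + n))"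
   proof (cases "x \<in> E n")
    case False
    then have lt: "infdist x F < 1 / real (n + 1)" using x by (auto simp: E_def)
    obtain m where m: "1 / real (Suc m) < infdist x F" using pos[OF x] by (metis inverse_eq_divide reals_Archimedean)
    define P where "P m \<longleftrightarrow> 1 / real (m + 2) \<le> infdist x F" for m
    have "1 / real (m + 2) \<le> 1 / real (Suc m)" by (intro divide_left_mono) auto
    then have Pm: "P m" using m by (simp add: P_def)
    \<comment> \<open>The layer of \<open>x\<close> is the first whose inner radius does not exceed
      the distance of \<open>x\<close> from \<open>F\<close>. That \<open>x\<close> is not in
      \<open>E n\<close> gives \<open>k \<ge> n\<close>; the outer bound comes from minimality, or
      from the same fact if \<open>k = n\<close>.\<close>
    define k where "k = (LEAST m. P m)"
    have Pk: "P k" unfolding k_def using Pm by (rule LeastI[of P])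
    have ge: "k \<ge> n"
    proof (rule ccontr)
     assume "\<not> k \<ge> n"
     then have "1 / real (n + 1) \<le> 1 / real (k + 2)" by (intro divide_left_mono) auto
     then show False using Pk lt by (simp add: P_def)
    qed
    have "infdist x F < 1 / real (k + 1)"
    proof (cases "k = n")
     case False
     then have "k - 1 < k" using ge by simp
     then have "\<not> P (k - 1)" unfolding k_def by (rule not_less_Least)
     moreover have "k - 1 + 2 = k + 1" using False ge by simp
     ultimately show ?thesis by (simp add: P_def)
    qed (use lt in simp)
    then have "x \<in> D k" using x Pk by (auto simp: D_def P_def)
    then have "x \<in> D ((k - n) + n)" using ge by simp
    then show ?thesis by blast
   qed simp
  qed
  then have "?H (A - F) \<le> ?H (E n \<union> (\<Union>k. D (k + n)))" by (rule hausdorff1_outer_mono)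
  also have "... \<le> ?H (E n) + ?H (\<Union>k. D (k + n))" by (rule hausdorff1_outer_Un)
  also have "... \<le> ?H (E n) + (\<Sum>k. ?H (D (k + n)))" by (intro add_left_mono hausdorff1_outer_subadditive)
  also have "(\<Sum>k. ?H (D (k + n))) = ennreal (\<Sum>k. r (k + n))"
   unfolding r
  proof (rule suminf_ennreal2)
   show "0 \<le> r (i + n)" for i by (simp add: r_def)
   show "summable (%i. r (i + n))" using rs by (simp add: summable_iff_shift)
  qed
  also have "... \<le> ennreal e" using n by (intro ennreal_leI) auto
  finally have "?H (A \<inter> F) + ?H (A - F) \<le> ?H (A \<inter> F) + (?H (E n) + ennreal e)" by (simp add: add_left_mono)
  also have "... = (?H (E n) + ?H (A \<inter> F)) + ennreal e" by (simp add: ac_simps)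
  also have "... \<le> ?H A + ennreal e"
  proof (rule add_right_mono, rule sep)
   show "infdist x F \<le> 0" if "x \<in> A \<inter> F" for x using that by simp
   show "1 / real (n + 1) \<le> infdist x F" if "x \<in> E n" for x using that by (simp add: E_def)
  qed (auto simp: E_def)
  finally show "?H (A \<inter> F) + ?H (A - F) \<le> ?H A + ennreal e" .
 qed
qed

lemma sets_hausdorff1: "sets hausdorff1 = sets borel" "space hausdorff1 = UNIV"
 unfolding hausdorff1_def by (simp_all add: sets.sigma_sets_eq[of borel, simplified])

text \<open>\<open>measure_of\<close> returns the given set function only if that is a measure on
  the generated sigma-algebra. The Caratheodory sets contain all closed sets, hence all Borel sets,
  and there the outer measure is countably additive.\<close>

lemma emeasure_hausdorff1:
 fixes A :: "'a::metric_space set"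
 assumes "A \<in> sets borel"
 shows "emeasure hausdorff1 A = hausdorff1_outer A"
proof -
 have pos: "positive (UNIV :: 'a set set) hausdorff1_outer" by (simp add: positive_def hausdorff1_outer_empty)
 have oms: "outer_measure_space (UNIV :: 'a set set) hausdorff1_outer"
  unfolding outer_measure_space_def
  using pos by (auto simp: increasing_def countably_subadditive_def hausdorff1_outer_mono hausdorff1_outer_subadditive)
 interpret sigma_algebra "UNIV :: 'a set" "UNIV :: 'a set set"
  using sigma_algebra_Pow[of "UNIV :: 'a set"] by simp
 define L where "L = lambda_system (UNIV :: 'a set) UNIV hausdorff1_outer"
 have ms: "measure_space (UNIV :: 'a set) L hausdorff1_outer"
  unfolding L_def by (rule caratheodory_lemma[OF oms])
 have "F \<in> L" if "closed F" for F
 proof -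
  have "hausdorff1_outer (A \<inter> F) + hausdorff1_outer (A - F) = hausdorff1_outer A" for A
  proof (rule antisym[OF hausdorff1_closed_measurable[OF that]])
   show "hausdorff1_outer A \<le> hausdorff1_outer (A \<inter> F) + hausdorff1_outer (A - F)"
    using hausdorff1_outer_Un[of "A \<inter> F" "A - F"] by (simp add: Int_Diff_Un)
  qed
  then show ?thesis unfolding L_def lambda_system_eq by auto
 qed
 then have "Collect closed \<subseteq> L" by auto
 moreover have "sigma_algebra UNIV L" using ms by (simp add: measure_space_def)
 ultimately have "sigma_sets UNIV (Collect closed) \<subseteq> L"
  using sigma_algebra.sigma_sets_subset by blast
 then have sub: "sets borel \<subseteq> L"
  by (simp add: borel_eq_closed)
 have "positive (sets borel) (hausdorff1_outer :: 'a set => ennreal)" by (simp add: positive_def hausdorff1_outer_empty)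
 moreover have "countably_additive (sets borel) (hausdorff1_outer :: 'a set => ennreal)"
  using ms sub unfolding measure_space_def countably_additive_def by (meson sub subset_trans subsetD)
 ultimately show ?thesis
  unfolding hausdorff1_def
  by (intro emeasure_measure_of_sigma assms) (use sets.sigma_algebra_axioms[of borel] in simp_all)
qed

subsection \<open>Comparison with the Lebesgue measure on a Lipschitz graph\<close>

text \<open>A projection that does not increase distances sends each covering set into an interval
  no longer than its diameter. The scale \<open>\<delta> = 1\<close> already gives the
  bound.\<close>

lemma hausdorff1_lower_bound:
 fixes p :: "'a::metric_space => real"
 assumes p: "!!x y. \<bar>p x - p y\<bar> \<le> dist x y" and S: "S \<in> sets borel" "S \<subseteq> p ` A"
 shows "emeasure lborel S \<le> hausdorff1_outer A"
proof -
 have "emeasure lborel S \<le> hausdorff1_pre 1 A"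
  unfolding hausdorff1_pre_def
 proof (rule INF_greatest)
  fix C :: "nat => 'a set"
  assume "C \<in> {C. A \<subseteq> (\<Union>i. C i) \<and> (\<forall>i. bounded (C i) \<and> diameter (C i) \<le> 1)}"
  then have C: "A \<subseteq> (\<Union>i. C i)" "!!i. bounded (C i)" by auto
  define I where "I i = (if C i = {} then {} else {Inf (p ` C i)..Sup (p ` C i)})" for i
  have d: "\<bar>p x - p y\<bar> \<le> diameter (C i)" if "x \<in> C i" "y \<in> C i" for x y i
   using p[of x y] diameter_bounded_bound[OF C(2) that] by linarith
  have bdd: "bdd_below (p ` C i)" "bdd_above (p ` C i)" for i
  proof -
   have "\<exists>m M. \<forall>x\<in>C i. m \<le> p x \<and> p x \<le> M"
   proof (cases "C i = {}")
    case False
    then obtain c where "c \<in> C i" by blast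
    have "p c - diameter (C i) \<le> p x \<and> p x \<le> p c + diameter (C i)" if "x \<in> C i" for x
     using d[OF that \<open>c \<in> C i\<close>] by linarith
    then show ?thesis by blast
   qed simp
   then show "bdd_below (p ` C i)" "bdd_above (p ` C i)" by (auto simp: bdd_below_def bdd_above_def)
  qed
  have "S \<subseteq> (\<Union>i. I i)"
  proof
   fix s assume "s \<in> S"
   then obtain x where "x \<in> A" "s = p x" using S(2) by auto
   then obtain i where i: "x \<in> C i" using C(1) by blast
   then have "s \<in> I i" using bdd[of i] \<open>s = p x\<close> by (auto simp: I_def intro: cInf_lower cSup_upper)
   then show "s \<in> (\<Union>i. I i)" by blast
  qed
  then have "emeasure lborel S \<le> emeasure lborel (\<Union>i. I i)" by (intro emeasure_mono) (auto simp: I_def)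
  also have "... \<le> (\<Sum>i. emeasure lborel (I i))"
   by (rule emeasure_subadditive_countably) (auto simp: I_def)
  also have "... \<le> (\<Sum>i. ennreal (diameter (C i)))"
  proof (rule suminf_le)
   fix i
   show "emeasure lborel (I i) \<le> ennreal (diameter (C i))"
   proof (cases "C i = {}")
    case False
    have le: "Inf (p ` C i) \<le> Sup (p ` C i)" using False bdd[of i] by (intro cInf_le_cSup) auto
    have "Sup (p ` C i) \<le> Inf (p ` C i) + diameter (C i)"
    proof (rule cSup_least)
     fix s assume "s \<in> p ` C i"
     then obtain x where x: "x \<in> C i" "s = p x" by auto
     have "s - diameter (C i) \<le> Inf (p ` C i)"
     proof (rule cInf_greatest)
      fix t assume "t \<in> p ` C i"
      then show "s - diameter (C i) \<le> t" using d[OF x(1)] x(2) by force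
     qed (use False in auto)
     then show "s \<le> Inf (p ` C i) + diameter (C i)" by linarith
    qed (use False in auto)
    then show ?thesis using False le by (simp add: I_def)
   qed (simp add: I_def)
  qed (auto intro: summableI)
  finally show "emeasure lborel S \<le> (\<Sum>i. ennreal (diameter (C i)))" .
 qed
 also have "... \<le> hausdorff1_outer A" by (rule hausdorff1_pre_le_outer) simp
 finally show ?thesis .
qed

text \<open>\<open>S\<close> is covered by non-overlapping short intervals inside an open set of
  nearly the same measure. Each image has diameter at most \<open>L\<close> times the length, and
  disjoint interiors let the lengths be summed without counting anything twice.\<close>

lemma hausdorff1_upper_bound:
 fixes g :: "real => 'a::metric_space"
 assumes g: "!!s t. dist (g s) (g t) \<le> L * \<bar>s - t\<bar>" and L: "L > 0" and S: "S \<in> sets borel" "bounded S"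
 shows "hausdorff1_outer (g ` S) \<le> ennreal L * emeasure lborel S"
 unfolding hausdorff1_outer_eq
proof (rule SUP_least)
 fix \<delta> :: real assume "\<delta> \<in> {0<..}"
 then have \<delta>: "\<delta> > 0" by simp
 show "hausdorff1_pre \<delta> (g ` S) \<le> ennreal L * emeasure lborel S"
 proof (rule ennreal_le_epsilon)
  fix \<epsilon> :: real assume \<epsilon>: "0 < \<epsilon>"
  have SL: "S \<in> sets lebesgue" using S by auto
  obtain U where U: "open U" "S \<subseteq> U" "emeasure lebesgue (U - S) < ennreal (\<epsilon> / L)"
   using sets_lebesgue_outer_open[OF SL, of "\<epsilon> / L"] \<epsilon> L by (metis divide_pos_pos)
  obtain R where R: "!!x. x \<in> S ==> \<bar>x\<bar> \<le> R" using S(2) unfolding bounded_iff by auto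
  define R' where "R' = max R 1"
  have R': "S \<subseteq> cbox (-R') R'" "box (-R') R' \<noteq> {}" using R by (force simp: R'_def)+
  \<comment> \<open>The gauge confines each interval to \<open>U\<close> and to length at most
    \<open>\<delta> / L\<close>.\<close>
  define \<gamma> where "\<gamma> x = (if x \<in> U then U else UNIV) \<inter> ball x (\<delta> / (2 * L))" for x
  have "gauge \<gamma>" unfolding gauge_def \<gamma>_def using U(1) \<delta> L by auto
  from covering_lemma[OF R' this] obtain \<D> where D: "countable \<D>"
   "!!K. K \<in> \<D> ==> interior K \<noteq> {} \<and> (\<exists>c d. K = cbox c d)"
   "pairwise (%A B. interior A \<inter> interior B = {}) \<D>"
   "!!K. K \<in> \<D> ==> \<exists>x \<in> S \<inter> K. K \<subseteq> \<gamma> x" "S \<subseteq> \<Union>\<D>" by metis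
  \<comment> \<open>Turns the countable family into a sequence: \<open>C i\<close> is the member
    with number \<open>i\<close>, or empty if there is none.\<close>
  define C where "C i = \<Union>{K \<in> \<D>. to_nat_on \<D> K = i}" for i
  have inj: "inj_on (to_nat_on \<D>) \<D>" using D(1) by (rule inj_on_to_nat_on)
  have Ccase: "C i = {} \<or> C i \<in> \<D> \<and> to_nat_on \<D> (C i) = i" for i
  proof (cases "\<exists>K\<in>\<D>. to_nat_on \<D> K = i")
   case True
   then obtain K where K: "K \<in> \<D>" "to_nat_on \<D> K = i" by blast
   then have "{K \<in> \<D>. to_nat_on \<D> K = i} = {K}" using inj by (auto dest: inj_onD)
   then have "C i = K" by (simp add: C_def)
   then show ?thesis using K by blast
  next
   case False
   then have "{K \<in> \<D>. to_nat_on \<D> K = i} = {}" by blast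
   then have "C i = {}" unfolding C_def by (simp only: Union_empty)
   then show ?thesis by blast
  qed
  have SC: "S \<subseteq> (\<Union>i. C i)"
  proof
   fix x assume "x \<in> S"
   then obtain K where "K \<in> \<D>" "x \<in> K" using D(5) by blast
   then have "x \<in> C (to_nat_on \<D> K)" by (auto simp: C_def)
   then show "x \<in> (\<Union>i. C i)" by blast
  qed
  have Cprop: "bounded (g ` C i) \<and> diameter (g ` C i) \<le> \<delta> \<and>
    ennreal (diameter (g ` C i)) \<le> ennreal L * emeasure lborel (interior (C i)) \<and> interior (C i) \<subseteq> U" for i
  proof (cases "C i = {}")
   case False
   then have Ci: "C i \<in> \<D>" using Ccase by blast
   then obtain c d where cd: "C i = {c..d}" using D(2)[OF Ci] by (auto simp: cbox_interval)
   then have "c \<le> d" using False by auto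
   obtain x where x: "x \<in> S" "C i \<subseteq> \<gamma> x" using D(4)[OF Ci] by blast
   have bd: "dist (g s) (g t) \<le> L * (d - c)" if "s \<in> C i" "t \<in> C i" for s t
    using that cd L by (intro order_trans[OF g] mult_left_mono) auto
   have dl: "diameter (g ` C i) \<le> L * (d - c)"
    unfolding diameter_def using False bd by (auto intro!: cSUP_least)
   have "c \<in> ball x (\<delta> / (2 * L))" "d \<in> ball x (\<delta> / (2 * L))" using x(2) cd \<open>c \<le> d\<close> by (auto simp: \<gamma>_def)
   then have "d - c \<le> \<delta> / (2 * L) + \<delta> / (2 * L)" by (auto simp: dist_real_def)
   then have "L * (d - c) \<le> L * (\<delta> / L)" using L by (intro mult_left_mono) (auto simp: field_simps)
   then have 2: "L * (d - c) \<le> \<delta>" using L by simp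
   have "bounded (g ` C i)" unfolding bounded_def
    using bd \<open>c \<le> d\<close> cd by (intro exI[of _ "g c"] exI[of _ "L * (d - c)"]) auto
   moreover have "emeasure lborel (interior (C i)) = ennreal (d - c)" using \<open>c \<le> d\<close> by (simp add: cd)
   ultimately show ?thesis
    using dl 2 x U(2) L interior_subset[of "C i"] by (auto simp: \<gamma>_def ennreal_mult'[symmetric] intro!: ennreal_leI split: if_splits)
  qed (use \<delta> in \<open>simp add: diameter_def\<close>)
  have "hausdorff1_pre \<delta> (g ` S) \<le> (\<Sum>i. ennreal (diameter (g ` C i)))"
  proof (rule hausdorff1_pre_le)
   show "g ` S \<subseteq> (\<Union>i. g ` C i)" using SC by blast
  qed (use Cprop in auto)
  also have "... \<le> (\<Sum>i. ennreal L * emeasure lborel (interior (C i)))"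
   using Cprop by (intro suminf_le) (auto intro: summableI)
  also have "... = ennreal L * (\<Sum>i. emeasure lborel (interior (C i)))" by simp
  also have "(\<Sum>i. emeasure lborel (interior (C i))) = emeasure lborel (\<Union>i. interior (C i))"
  proof (rule suminf_emeasure)
   show "disjoint_family (%i. interior (C i))"
    unfolding disjoint_family_on_def
   proof (intro ballI impI)
    fix i j :: nat assume "i \<noteq> j"
    show "interior (C i) \<inter> interior (C j) = {}"
    proof (cases "C i = {} \<or> C j = {}")
     case False
     then have "C i \<in> \<D>" "C j \<in> \<D>" "C i \<noteq> C j" using Ccase[of i] Ccase[of j] \<open>i \<noteq> j\<close> by auto
     then show ?thesis using D(3) by (auto simp: pairwise_def)
    qed auto
   qed
  qed auto
  also have "... \<le> emeasure lborel U" using Cprop U(1) by (intro emeasure_mono) auto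
  also have "emeasure lborel U \<le> emeasure lborel S + emeasure lborel (U - S)"
   using U S(1) by (subst plus_emeasure) (auto simp: Un_absorb1 intro!: emeasure_mono)
  also have "... \<le> emeasure lborel S + ennreal (\<epsilon> / L)"
   using U S(1) by (intro add_left_mono) (auto simp: less_imp_le)
  finally have "hausdorff1_pre \<delta> (g ` S) \<le> ennreal L * (emeasure lborel S + ennreal (\<epsilon> / L))"
   by (simp add: mult_left_mono)
  also have "... = ennreal L * emeasure lborel S + ennreal \<epsilon>"
   using L \<epsilon> by (simp add: distrib_left ennreal_mult'[symmetric])
  finally show "hausdorff1_pre \<delta> (g ` S) \<le> ennreal L * emeasure lborel S + ennreal \<epsilon>" .
 qed
qed

text \<open>The two bounds for sets say that the push-forward \<open>M\<close> of Lebesgue measure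
  along \<open>g\<close> and the restriction \<open>N\<close> of Hausdorff measure to the graph
  satisfy \<open>M \<le> N\<close> and \<open>N \<le> L * M\<close> as Borel measures; integrals
  compare accordingly.\<close>

lemma hausdorff1_graph:
 fixes g :: "real => 'a::euclidean_space" and F :: "'a => ennreal"
 assumes g: "!!s t. dist (g s) (g t) \<le> L * \<bar>s - t\<bar>" and L: "L > 0"
  and p: "!!x y. \<bar>p x - p y\<bar> \<le> dist x y" "!!s. p (g s) = s" and F: "F \<in> Borel"
 shows "(\<integral>\<^sup>+x. F x * indicator (g ` {a..b}) x \<partial>hausdorff1) \<le> ennreal L * (\<integral>\<^sup>+s. F (g s) * indicator {a..b} s \<partial>lborel)"
  and "(\<integral>\<^sup>+s. F (g s) * indicator {a..b} s \<partial>lborel) \<le> (\<integral>\<^sup>+x. F x * indicator (g ` {a..b}) x \<partial>hausdorff1)"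
proof -
 have gc: "continuous_on UNIV g"
 proof (rule continuous_onI)
  fix x e :: real assume e: "e > 0"
  show "\<exists>d>0. \<forall>x'\<in>UNIV. dist x' x < d --> dist (g x') (g x) \<le> e"
  proof (intro exI[of _ "e / L"] conjI ballI impI)
   fix x' assume "dist x' x < e / L"
   then show "dist (g x') (g x) \<le> e" using g[of x' x] L by (simp add: dist_real_def field_simps)
  qed (use e L in simp)
 qed
 then have [measurable]: "g \<in> Borel" by (rule borel_measurable_continuous_onI)
 let ?G = "g ` {a..b}"
 have "compact ?G" using gc by (intro compact_continuous_image) (auto intro: continuous_on_subset)
 then have Gb: "?G \<in> sets borel" by (rule borel_compact)
 note [measurable] = F Gb
 define N where "N = density hausdorff1 (indicator ?G :: 'a => ennreal)"
 define M where "M = distr (density lborel (indicator {a..b} :: real => ennreal)) borel g"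
 have sN: "sets N = sets borel" by (simp add: N_def sets_hausdorff1)
 have sM: "sets M = sets borel" by (simp add: M_def)
 have Gm: "?G \<in> sets hausdorff1" by (simp add: sets_hausdorff1 Gb)
 have mh: "h \<in> Borel ==> h \<in> borel_measurable hausdorff1" for h :: "'a => ennreal"
  using measurable_cong_sets[OF sets_hausdorff1(1) refl, of borel] by blast
 have eN: "emeasure N A = hausdorff1_outer (g ` (g -` A \<inter> {a..b}))" if A: "A \<in> sets borel" for A
 proof -
  have "emeasure N A = emeasure hausdorff1 (?G \<inter> A)"
   unfolding N_def using A Gm by (subst emeasure_density)
    (auto simp: sets_hausdorff1 indicator_inter_arith[symmetric] intro!: mh)
  also have "... = hausdorff1_outer (?G \<inter> A)" using A Gb by (intro emeasure_hausdorff1) auto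
  also have "?G \<inter> A = g ` (g -` A \<inter> {a..b})" by auto
  finally show ?thesis .
 qed
 have eM: "emeasure M A = emeasure lborel (g -` A \<inter> {a..b})" if A[measurable]: "A \<in> sets borel" for A
 proof -
  have vA: "g -` A \<in> sets borel" using measurable_sets[of g borel borel A] by simp
  have "emeasure M A = emeasure (density lborel (indicator {a..b} :: real => ennreal)) (g -` A)"
   unfolding M_def by (subst emeasure_distr) auto
  also have "... = emeasure lborel ({a..b} \<inter> g -` A)"
   using vA by (subst emeasure_density) (auto simp: indicator_inter_arith[symmetric])
  finally show ?thesis by (simp add: Int_commute)
 qed
 have pre: "g -` A \<inter> {a..b} \<in> sets borel" if [measurable]: "A \<in> sets borel" for A
  using measurable_sets[of g borel borel A] by auto
 have up: "emeasure N A \<le> ennreal L * emeasure M A" if "A \<in> sets borel" for A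
  unfolding eN[OF that] eM[OF that] by (rule hausdorff1_upper_bound[OF g L pre[OF that]]) auto
 have lo: "emeasure M A \<le> emeasure N A" if "A \<in> sets borel" for A
  unfolding eN[OF that] eM[OF that]
  by (rule hausdorff1_lower_bound[OF p(1) pre[OF that]]) (auto simp: image_image p(2))
 have IN: "(\<integral>\<^sup>+x. F x \<partial>N) = (\<integral>\<^sup>+x. F x * indicator ?G x \<partial>hausdorff1)"
  unfolding N_def using Gm by (subst nn_integral_density) (auto simp: mult.commute intro!: mh)
 have IM: "(\<integral>\<^sup>+x. F x \<partial>M) = (\<integral>\<^sup>+s. F (g s) * indicator {a..b} s \<partial>lborel)"
  unfolding M_def by (subst nn_integral_distr, simp, simp, subst nn_integral_density) (auto simp: mult.commute)
 have "M \<le> N" by (subst le_measure) (auto simp: sN sM lo)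
 then have "(\<integral>\<^sup>+x. F x \<partial>M) \<le> (\<integral>\<^sup>+x. F x \<partial>N)" by (rule nn_integral_mono_measure[rotated]) (simp add: sN sM)
 then show "(\<integral>\<^sup>+s. F (g s) * indicator {a..b} s \<partial>lborel) \<le> (\<integral>\<^sup>+x. F x * indicator ?G x \<partial>hausdorff1)"
  by (simp only: IN IM)
 let ?M = "density M (%_. ennreal L)"
 have "N \<le> ?M" using up by (subst le_measure) (auto simp: sN sM emeasure_density nn_integral_cmult_indicator)
 then have "(\<integral>\<^sup>+x. F x \<partial>N) \<le> (\<integral>\<^sup>+x. F x \<partial>?M)" by (rule nn_integral_mono_measure[rotated]) (simp add: sN sM)
 also have "... = ennreal L * (\<integral>\<^sup>+x. F x \<partial>M)"
  using F sM by (subst nn_integral_density) (auto simp: nn_integral_cmult measurable_cong_sets[OF sM refl])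
 finally show "(\<integral>\<^sup>+x. F x * indicator ?G x \<partial>hausdorff1) \<le> ennreal L * (\<integral>\<^sup>+s. F (g s) * indicator {a..b} s \<partial>lborel)"
  by (simp only: IN IM)
qed

section \<open>Boundary charts in the plane\<close>

definition orthonormal2 :: "real^2 => real^2 => bool" where
 "orthonormal2 e n \<longleftrightarrow> norm e = 1 \<and> norm n = 1 \<and> e \<bullet> n = 0"

lemma orthonormal2D:
 assumes "orthonormal2 e n"
 shows "e \<bullet> e = 1" "n \<bullet> n = 1" "e \<bullet> n = 0" "n \<bullet> e = 0"
 using assms by (auto simp: orthonormal2_def norm_eq_1 inner_commute)

lemma orthonormal2_expand:
 assumes "orthonormal2 e n"
 shows "(x \<bullet> e) *\<^sub>R e + (x \<bullet> n) *\<^sub>R n = x"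
proof -
 note o = orthonormal2D[OF assms]
 have ne: "e \<noteq> n" using o by auto
 have po: "pairwise orthogonal {e, n}" using o by (auto simp: pairwise_def orthogonal_def)
 have "0 \<notin> {e, n}" using o by auto
 then have ind: "independent {e, n}" by (rule pairwise_orthogonal_independent[OF po])
 have "UNIV \<subseteq> span {e, n}"
  by (rule card_ge_dim_independent[OF _ ind]) (use ne in auto)
 then have "(\<Sum>i\<in>{e, n}. (x \<bullet> i) *\<^sub>R i) = x"
  using assms by (intro orthonormal_basis_expand po) (auto simp: orthonormal2_def)
 then show ?thesis using ne by simp
qed

abbreviation coord2 :: "real^2 => real^2 => real => real => real^2" where
 "coord2 e n s t \<equiv> s *\<^sub>R e + t *\<^sub>R n"

lemma coord2_inner:
 assumes "orthonormal2 e n"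
 shows "coord2 e n s t \<bullet> e = s" "coord2 e n s t \<bullet> n = t"
 using orthonormal2D[OF assms] by (auto simp: inner_add_left)

lemma coord2_measurable [measurable]:
 "(%z::real\<times>real. coord2 e n (fst z) (snd z)) \<in> Borel"
 by (intro borel_measurable_continuous_onI continuous_intros)

lemma Basis_real2: "(Basis :: (real^2) set) = {axis 1 1, axis 2 1}"
proof -
 have "(Basis :: (real^2) set) = (%i. axis i 1) ` UNIV" by (auto simp: Basis_vec_def)
 then show ?thesis by (simp add: UNIV_2)
qed

lemma orthonormal2_axis: "orthonormal2 (axis 1 1) (axis 2 1)"
 by (auto simp: orthonormal2_def inner_axis_axis)

lemma lborel_real2:
 "(lborel :: (real^2) measure) = distr lborel borel (%z::real\<times>real. coord2 (axis 1 1) (axis 2 1) (fst z) (snd z))"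
proof (rule lborel_eqI)
 let ?F = "%z::real\<times>real. coord2 (axis 1 1) (axis 2 1 :: real^2) (fst z) (snd z)"
 fix l u :: "real^2" assume le: "!!b. b \<in> Basis ==> l \<bullet> b \<le> u \<bullet> b"
 then have le': "l $ 1 \<le> u $ 1" "l $ 2 \<le> u $ 2" using le[of "axis 1 1"] le[of "axis 2 1"] by (auto simp: inner_axis)
 have pre: "?F -` box l u = {l $ 1<..<u $ 1} \<times> {l $ 2<..<u $ 2}"
  by (auto simp: mem_box_cart forall_2 axis_def)
 have "emeasure (distr lborel borel ?F) (box l u) = emeasure lborel (?F -` box l u \<inter> space lborel)"
  by (rule emeasure_distr) auto
 also have "... = emeasure (lborel \<Otimes>\<^sub>M lborel) ({l $ 1<..<u $ 1} \<times> {l $ 2<..<u $ 2})"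
  by (simp add: pre lborel_prod)
 also have "... = emeasure lborel {l $ 1<..<u $ 1} * emeasure lborel {l $ 2<..<u $ 2}"
  by (rule lborel.emeasure_pair_measure_Times) auto
 also have "... = ennreal ((u $ 1 - l $ 1) * (u $ 2 - l $ 2))"
  using le' by (simp add: ennreal_mult)
 also have "(u $ 1 - l $ 1) * (u $ 2 - l $ 2) = (\<Prod>b\<in>Basis. (u - l) \<bullet> b)"
  by (simp add: Basis_real2 inner_axis axis_eq_axis)
 finally show "emeasure (distr lborel borel ?F) (box l u) = ennreal (\<Prod>b\<in>Basis. (u - l) \<bullet> b)" .
qed simp

text \<open>Charts come in rotated coordinates. The standard axes are settled by computing boxes;
  the map \<open>R\<close> from the axes to \<open>e\<close>, \<open>n\<close> has the orthogonal
  inverse \<open>S\<close>, and orthogonal maps preserve Lebesgue measure.\<close>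

lemma lborel_coord2:
 assumes "orthonormal2 e n"
 shows "(lborel :: (real^2) measure) = distr lborel borel (%z::real\<times>real. coord2 e n (fst z) (snd z))"
proof -
 note o = orthonormal2D[OF assms] and ex = orthonormal2_expand[OF assms]
 let ?a = "axis 1 1 :: real^2" and ?b = "axis 2 1 :: real^2"
 note oa = orthonormal2D[OF orthonormal2_axis] and exa = orthonormal2_expand[OF orthonormal2_axis]
 define R where "R x = coord2 e n (x \<bullet> ?a) (x \<bullet> ?b)" for x :: "real^2"
 define S where "S x = coord2 ?a ?b (x \<bullet> e) (x \<bullet> n)" for x :: "real^2"
 have RS: "R (S x) = x" for x
  unfolding R_def S_def coord2_inner[OF orthonormal2_axis] by (rule ex)
 have SR: "S (R x) = x" for x
  unfolding R_def S_def coord2_inner[OF assms] by (rule exa)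
 have lS: "linear S" unfolding S_def by (auto intro!: linearI simp: algebra_simps inner_add_left)
 have dot: "S x \<bullet> S y = x \<bullet> y" for x y
 proof -
  have "S x \<bullet> S y = (x \<bullet> e) * (y \<bullet> e) + (x \<bullet> n) * (y \<bullet> n)"
   using oa by (simp add: S_def inner_add_left inner_add_right)
  also have "... = x \<bullet> (coord2 e n (y \<bullet> e) (y \<bullet> n))" by (simp add: inner_add_right mult.commute)
  finally show ?thesis by (simp add: ex)
 qed
 have oS: "orthogonal_transformation S" using lS dot by (simp add: orthogonal_transformation_def)
 have [measurable]: "R \<in> Borel" unfolding R_def by measurable
 have "lborel = distr lborel borel R"
 proof (rule lborel_eqI)
  fix l u :: "real^2" assume le: "!!b. b \<in> Basis ==> l \<bullet> b \<le> u \<bullet> b"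
  have pre: "R -` box l u = S ` box l u"
  proof
   show "R -` box l u \<subseteq> S ` box l u" using SR by (metis image_eqI subsetI vimageD)
   show "S ` box l u \<subseteq> R -` box l u" using RS by auto
  qed
  have lm: "box l u \<in> lmeasurable" by simp
  have "emeasure (distr lborel borel R) (box l u) = emeasure lborel (S ` box l u)"
   by (subst emeasure_distr) (auto simp: pre)
  also have "... = emeasure lebesgue (S ` box l u)"
  proof -
   have "R -` box l u \<in> sets borel" using measurable_sets[of R borel borel "box l u"] by simp
   then show ?thesis unfolding pre by simp
  qed
  also have "... = ennreal (measure lebesgue (S ` box l u))"
   using measurable_orthogonal_image[OF oS lm] by (simp add: emeasure_eq_measure2)
  also have "... = ennreal (measure lebesgue (box l u))"
   by (simp only: measure_orthogonal_image[OF oS lm])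
  also have "... = ennreal (\<Prod>b\<in>Basis. (u - l) \<bullet> b)"
   using le by (simp add: measure_lborel_box_eq)
  finally show "emeasure (distr lborel borel R) (box l u) = ennreal (\<Prod>b\<in>Basis. (u - l) \<bullet> b)" .
 qed simp
 also have "... = distr (distr lborel borel (%z::real\<times>real. coord2 ?a ?b (fst z) (snd z))) borel R"
  by (simp add: lborel_real2[symmetric])
 also have "... = distr lborel borel (R \<circ> (%z::real\<times>real. coord2 ?a ?b (fst z) (snd z)))"
  by (rule distr_distr) auto
 also have "R \<circ> (%z::real\<times>real. coord2 ?a ?b (fst z) (snd z)) = (%z. coord2 e n (fst z) (snd z))"
  by (auto simp: R_def coord2_inner[OF orthonormal2_axis])
 finally show ?thesis .
qed

lemma integral_coord2:
 fixes f :: "real^2 => real"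
 assumes o: "orthonormal2 e n" and f: "integrable lborel f"
 shows "integrable lborel (%s. LINT t|lborel. f (coord2 e n s t))"
  "(LINT x|lborel. f x) = (LINT s|lborel. LINT t|lborel. f (coord2 e n s t))"
proof -
 let ?F = "%z::real\<times>real. coord2 e n (fst z) (snd z)"
 have [measurable]: "f \<in> Borel" using f by simp
 have i: "integrable (lborel \<Otimes>\<^sub>M lborel) (%z. f (?F z))"
  using f unfolding lborel_prod by (subst (asm) lborel_coord2[OF o]) (simp add: integrable_distr_eq)
 have "(LINT x|lborel. f x) = integral\<^sup>L (lborel \<Otimes>\<^sub>M lborel) (%z. f (?F z))"
  unfolding lborel_prod by (subst lborel_coord2[OF o]) (simp add: integral_distr)
 also have "... = (LINT s|lborel. LINT t|lborel. f (coord2 e n s t))"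
  using lborel_pair.integral_fst'[OF i] by simp
 finally show "(LINT x|lborel. f x) = (LINT s|lborel. LINT t|lborel. f (coord2 e n s t))" .
 show "integrable lborel (%s. LINT t|lborel. f (coord2 e n s t))"
  using lborel_pair.integrable_fst'[OF i] by simp
qed

section \<open>Green's formula over an epigraph\<close>

lemma FTC_lebesgue:
 fixes f :: "real => real"
 assumes "a \<le> b" "continuous_on {a..b} f" "continuous_on {a..b} f'"
  "!!t. a < t ==> t < b ==> (f has_real_derivative f' t) (at t)"
 shows "(LINT t|lborel. indicator {a..b} t * f' t) = f b - f a"
proof -
 have "(f' has_integral f b - f a) {a..b}"
  using assms by (intro fundamental_theorem_of_calculus_interior) (auto simp: has_real_derivative_iff_has_vector_derivative)
 moreover have "set_integrable lborel {a..b} f'" by (rule borel_integrable_atLeastAtMost'[OF assms(3)])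
 ultimately have "(LINT t:{a..b}|lborel. f' t) = f b - f a"
  using set_borel_integral_eq_integral(2) by (metis integral_unique)
 then show ?thesis by (simp add: set_lebesgue_integral_def)
qed

text \<open>The shear $(s,t) \mapsto (s, \gamma(s)+t)$ reduces the tangential direction to the fundamental
 theorem of calculus along the translates of the graph.\<close>

lemma epigraph_green:
 fixes F :: "real^2 => real" and D :: "real^2 => real^2"
 assumes o: "orthonormal2 e n"
  and \<gamma>: "!!s. (\<gamma> has_real_derivative \<gamma>' s) (at s)" and \<gamma>': "continuous_on UNIV \<gamma>'"
  and Fc: "continuous_on {x. \<gamma> (x \<bullet> e) \<le> x \<bullet> n} F" and Dc: "continuous_on {x. \<gamma> (x \<bullet> e) \<le> x \<bullet> n} D"
  and der: "!!x. \<gamma> (x \<bullet> e) < x \<bullet> n ==> (F has_derivative (%h. D x \<bullet> h)) (at x)"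
  and R: "!!x. norm x > R ==> F x = 0" "!!x. norm x > R ==> D x = 0"
 shows "(LINT x|lborel. indicator {x. \<gamma> (x \<bullet> e) < x \<bullet> n} x * (D x \<bullet> v))
  = (LINT s|lborel. ((v \<bullet> e) * \<gamma>' s - v \<bullet> n) * F (coord2 e n s (\<gamma> s)))"
  and "integrable lborel (%s. F (coord2 e n s (\<gamma> s)))"
proof -
 let ?E = "{x. \<gamma> (x \<bullet> e) < x \<bullet> n}" and ?C = "{x. \<gamma> (x \<bullet> e) \<le> x \<bullet> n}"
 note on = orthonormal2D[OF o] and ci = coord2_inner[OF o]
 define g where "g s = coord2 e n s (\<gamma> s)" for s
 have \<gamma>c: "continuous_on UNIV \<gamma>" using \<gamma> by (auto simp: continuous_on_eq_continuous_at intro: DERIV_isCont)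
 have \<gamma>i: "continuous_on S (%x. \<gamma> (h x))" if "continuous_on S h" for S :: "'b::topological_space set" and h
  using continuous_on_compose2[OF \<gamma>c that] by simp
 have \<gamma>'i: "continuous_on S (%x. \<gamma>' (h x))" if "continuous_on S h" for S :: "'b::topological_space set" and h
  using continuous_on_compose2[OF \<gamma>' that] by simp
 have opE: "open ?E" by (intro open_Collect_less \<gamma>i continuous_intros)
 have clC: "closed ?C" by (intro closed_Collect_le \<gamma>i continuous_intros)
 have big: "norm (coord2 e n s t) > R" if "\<bar>s\<bar> > R \<or> \<bar>t\<bar> > R" for s t
 proof -
  have "\<bar>s\<bar> \<le> norm (coord2 e n s t)" "\<bar>t\<bar> \<le> norm (coord2 e n s t)"
   using Cauchy_Schwarz_ineq2[of "coord2 e n s t" e] Cauchy_Schwarz_ineq2[of "coord2 e n s t" n] ci o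
   by (auto simp: orthonormal2_def)
  with that show ?thesis by linarith
 qed
 have "compact (?C \<inter> cball 0 R)" using clC by (simp add: closed_Int_compact)
 then have "compact (D ` (?C \<inter> cball 0 R))" by (intro compact_continuous_image continuous_on_subset[OF Dc]) auto
 then obtain B where "!!x. x \<in> ?C \<inter> cball 0 R ==> norm (D x) \<le> B"
  using compact_imp_bounded bounded_iff by (metis (no_types, lifting) imageI)
 then have B: "norm (D x) \<le> max B 0" if "x \<in> ?C" for x
  using that R(2)[of x] by (cases "norm x > R") (auto simp: le_max_iff_disj)
 define d where "d x = cut ?E D x" for x
 have dB: "norm (d x) \<le> max B 0" for x using B[of x] by (auto simp: d_def indicator_def)
 have dR: "d x = 0" if "norm x > R" for x using R(2)[OF that] by (simp add: d_def)
 have [measurable]: "d \<in> Borel"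
  unfolding d_def by (rule borel_measurable_continuous_on_indicator) (use opE in \<open>auto intro: continuous_on_subset[OF Dc]\<close>)
 have di: "integrable lborel d"
  by (rule bounded_support_integrable(2)[OF _ dB, where K = "cball 0 R"]) (auto simp: dR)
 have dvi: "integrable lborel (%x. d x \<bullet> w)" for w by (intro integrable_inner_left di)
 have dline: "integrable lborel (%t. d (coord2 e n s t))" for s
 proof (rule bounded_support_integrable(2)[OF _ dB, where K = "cball 0 R"])
  show "d (coord2 e n s t) = 0" if "t \<notin> cball 0 R" for t
   by (rule dR, rule big) (use that in auto)
 qed auto
 have gC: "g s \<in> ?C" for s by (simp add: g_def ci)
 have Fgc: "continuous_on UNIV (%s. F (g s))"
  by (rule continuous_on_compose2[OF Fc]) (use gC in \<open>auto simp: g_def intro!: continuous_intros \<gamma>i\<close>)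
 have Fg0: "F (g s) = 0" if "s \<notin> {-R..R}" for s
  unfolding g_def by (rule R(1), rule big) (use that in auto)
 have Fgi: "integrable lborel (%s. F (g s))"
  by (rule continuous_compact_support_integrable(2)[OF Fgc compact_Icc Fg0])
 have Fgi': "integrable lborel (%s. \<gamma>' s * F (g s))"
  by (rule continuous_compact_support_integrable(2)[OF _ compact_Icc[of "-R" R]])
   (auto intro!: continuous_intros Fgc \<gamma>' simp: Fg0)
 \<comment> \<open>Normal direction: on a vertical line the fundamental theorem leaves only the
   value on the graph, since the upper end \<open>b\<close> lies beyond the support.\<close>
 have line_n: "(LINT t|lborel. d (coord2 e n s t) \<bullet> n) = - F (g s)" for s
 proof -
  define b where "b = max (\<gamma> s) R + 1"
  have b: "\<gamma> s \<le> b" "R < b" by (auto simp: b_def)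
  have sub: "(%t. coord2 e n s t) ` {\<gamma> s..b} \<subseteq> ?C" by (auto simp: ci)
  have c1: "continuous_on {\<gamma> s..b} (%t. F (coord2 e n s t))"
   by (rule continuous_on_compose2[OF Fc _ sub]) (intro continuous_intros)
  have "continuous_on {\<gamma> s..b} (%t. D (coord2 e n s t))"
   by (rule continuous_on_compose2[OF Dc _ sub]) (intro continuous_intros)
  then have c2: "continuous_on {\<gamma> s..b} (%t. D (coord2 e n s t) \<bullet> n)" by (intro continuous_intros)
  have "((%t. F (coord2 e n s t)) has_real_derivative D (coord2 e n s t) \<bullet> n) (at t)" if "\<gamma> s < t" for t
  proof -
   have "((%t. F (coord2 e n s t)) has_derivative (%h. D (coord2 e n s t) \<bullet> (h *\<^sub>R n))) (at t)"
    by (rule has_derivative_compose[of "%t. coord2 e n s t" _ _ _ F])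
     (use that in \<open>auto intro!: derivative_eq_intros der simp: ci\<close>)
   then show ?thesis by (simp add: has_field_derivative_def mult_commute_abs)
  qed
  from FTC_lebesgue[OF b(1) c1 c2 this]
  have I: "(LINT t|lborel. indicator {\<gamma> s..b} t * (D (coord2 e n s t) \<bullet> n)) = F (coord2 e n s b) - F (g s)"
   by (simp add: g_def)
  have "F (coord2 e n s b) = 0" by (rule R(1), rule big) (use b in auto)
  moreover have "(LINT t|lborel. d (coord2 e n s t) \<bullet> n) = (LINT t|lborel. indicator {\<gamma> s..b} t * (D (coord2 e n s t) \<bullet> n))"
  proof (rule integral_cong_AE)
   show "(%t. indicator {\<gamma> s..b} t * (D (coord2 e n s t) \<bullet> n)) \<in> borel_measurable lborel"
    using borel_integrable_atLeastAtMost'[OF c2] by (simp add: set_integrable_def)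
   have "AE t in lborel. t \<noteq> \<gamma> s" by (rule AE_lborel_singleton)
   then show "AE t in lborel. d (coord2 e n s t) \<bullet> n = indicator {\<gamma> s..b} t * (D (coord2 e n s t) \<bullet> n)"
   proof eventually_elim
    case (elim t)
    show ?case
    proof (cases "t > b")
     case True
     have "norm (coord2 e n s t) > R" by (rule big) (use True b in auto)
     then show ?thesis by (simp add: d_def R(2))
    qed (use elim in \<open>auto simp: d_def ci indicator_def\<close>)
   qed
  qed measurable
  ultimately show ?thesis using I by simp
 qed
 \<comment> \<open>\<open>e + \<gamma>' s *\<^sub>R n\<close> is tangent to the graph, so for
   \<open>\<tau> > 0\<close> the function \<open>P s \<tau>\<close> is the derivative of
   \<open>F\<close> along the graph translated by \<open>\<tau>\<close>.\<close>
 define P where "P s \<tau> = d (coord2 e n s (\<gamma> s + \<tau>)) \<bullet> (e + \<gamma>' s *\<^sub>R n)" for s \<tau>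
 have [measurable]: "\<gamma> \<in> Borel" "\<gamma>' \<in> Borel"
  using \<gamma>c \<gamma>' by (auto intro: borel_measurable_continuous_onI)
 have bdI: "\<exists>M. \<forall>s\<in>{-R..R}. \<bar>h s\<bar> \<le> M" if "continuous_on UNIV h" for h :: "real => real"
 proof -
  have "compact (h ` {-R..R})" by (intro compact_continuous_image continuous_on_subset[OF that]) auto
  then show ?thesis using compact_imp_bounded bounded_iff by (metis (no_types, lifting) imageI real_norm_def)
 qed
 obtain M1 where M1: "!!s. s \<in> {-R..R} ==> \<bar>\<gamma> s\<bar> \<le> M1" using bdI[OF \<gamma>c] by blast
 obtain M2 where M2: "!!s. s \<in> {-R..R} ==> \<bar>\<gamma>' s\<bar> \<le> M2" using bdI[OF \<gamma>'] by blast
 have P0: "P s \<tau> = 0" if "s \<notin> {-R..R} \<or> \<bar>\<tau>\<bar> > R + M1" for s \<tau>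
 proof -
  have "norm (coord2 e n s (\<gamma> s + \<tau>)) > R"
  proof (rule big)
   show "\<bar>s\<bar> > R \<or> \<bar>\<gamma> s + \<tau>\<bar> > R"
   proof (cases "s \<in> {-R..R}")
    case True
    then show ?thesis using M1[OF True] that by linarith
   qed auto
  qed
  then show ?thesis by (simp add: P_def dR)
 qed
 have Pi: "integrable (lborel \<Otimes>\<^sub>M lborel) (%(s, \<tau>). P s \<tau>)"
  unfolding lborel_prod
 proof (rule bounded_support_integrable(2)[where C = "max B 0 * (1 + max M2 0)" and K = "{-R..R} \<times> {-(R+M1)..R+M1}"])
  show "(%(s, \<tau>). P s \<tau>) \<in> Borel"
  proof -
   have "continuous_on UNIV (%z::real\<times>real. coord2 e n (fst z) (\<gamma> (fst z) + snd z))"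
    by (intro continuous_intros \<gamma>i)
   then have m1: "(%z::real\<times>real. d (coord2 e n (fst z) (\<gamma> (fst z) + snd z))) \<in> Borel"
    by (intro measurable_compose[OF borel_measurable_continuous_onI[of "%z::real\<times>real. coord2 e n (fst z) (\<gamma> (fst z) + snd z)"]]) simp_all
   have m2: "(%z::real\<times>real. e + \<gamma>' (fst z) *\<^sub>R n) \<in> Borel"
    by (intro borel_measurable_continuous_onI continuous_intros \<gamma>'i)
   show ?thesis
    unfolding P_def case_prod_beta using m1 m2 by (rule borel_measurable_inner)
  qed
  show "bounded ({-R..R} \<times> {-(R+M1)..R+M1})" by (intro bounded_Times) auto
  fix z :: "real \<times> real"
  obtain s \<tau> where z: "z = (s, \<tau>)" by (cases z)
  show "norm (case z of (s, \<tau>) => P s \<tau>) \<le> max B 0 * (1 + max M2 0)"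
  proof (cases "s \<in> {-R..R}")
   case True
   have "norm (e + \<gamma>' s *\<^sub>R n) \<le> norm e + norm (\<gamma>' s *\<^sub>R n)" by (rule norm_triangle_ineq)
   also have "... \<le> 1 + max M2 0" using o M2[OF True] by (auto simp: orthonormal2_def)
   finally have 1: "norm (e + \<gamma>' s *\<^sub>R n) \<le> 1 + max M2 0" .
   have "\<bar>P s \<tau>\<bar> \<le> norm (d (coord2 e n s (\<gamma> s + \<tau>))) * norm (e + \<gamma>' s *\<^sub>R n)"
    unfolding P_def by (rule Cauchy_Schwarz_ineq2)
   also have "... \<le> max B 0 * (1 + max M2 0)" by (intro mult_mono dB 1) auto
   finally show ?thesis by (simp add: z)
  next
   case False
   then have "P s \<tau> = 0" using P0 by blast
   then show ?thesis by (simp add: z)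
  qed
  show "z \<notin> {-R..R} \<times> {-(R+M1)..R+M1} ==> (case z of (s, \<tau>) => P s \<tau>) = 0"
   using P0[of s \<tau>] by (auto simp: z not_le abs_if)
 qed
 \<comment> \<open>Integration along a translate gives zero by compact support; on and below the
   graph the integrand itself is zero.\<close>
 have col: "(LINT s|lborel. P s \<tau>) = 0" for \<tau>
 proof (cases "\<tau> > 0")
  case False
  then have "P s \<tau> = 0" for s by (simp add: P_def d_def ci)
  then show ?thesis by simp
 next
  case True
  let ?h = "%s. coord2 e n s (\<gamma> s + \<tau>)"
  have hE: "?h s \<in> ?E" for s using True by (simp add: ci)
  have P: "P s \<tau> = D (?h s) \<bullet> (e + \<gamma>' s *\<^sub>R n)" for s using hE by (simp add: P_def d_def)
  have hC: "?h ` UNIV \<subseteq> ?C" using True by (auto simp: ci)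
  have "continuous_on UNIV (%s. D (?h s))"
   by (rule continuous_on_compose2[OF Dc _ hC]) (intro continuous_intros \<gamma>c)
  then have c: "continuous_on UNIV (%s. P s \<tau>)" unfolding P by (intro continuous_intros \<gamma>')
  have "((%s. F (?h s)) has_derivative (%k. P s \<tau> \<bullet> k)) (at s)" for s
  proof -
   have "(?h has_derivative (%k. k *\<^sub>R e + (\<gamma>' s * k) *\<^sub>R n)) (at s)"
    using \<gamma>[of s] by (auto intro!: derivative_eq_intros simp: has_field_derivative_def)
   then have "((%s. F (?h s)) has_derivative (%k. D (?h s) \<bullet> (k *\<^sub>R e + (\<gamma>' s * k) *\<^sub>R n))) (at s)"
    by (rule has_derivative_compose) (rule der, use hE in simp)
   then show ?thesis by (simp add: P inner_add_right algebra_simps)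
  qed
  then have "(LINT s|lborel. P s \<tau> \<bullet> 1) = 0"
  proof (rule integral_derivative_compact_support[OF _ c compact_Icc[of "-R" R]])
   show "F (?h s) = 0" if "s \<notin> {-R..R}" for s
    by (rule R(1), rule big) (use that in auto)
  qed (use P0 in blast)
  then show ?thesis by simp
 qed
 define A where "A s = (LINT t|lborel. d (coord2 e n s t) \<bullet> e)" for s
 \<comment> \<open>In the other order of integration the vertical lines reappear; Fubini and
   \<open>col\<close> then determine the tangential component \<open>A\<close>.\<close>
 have row: "(LINT \<tau>|lborel. P s \<tau>) = A s - \<gamma>' s * F (g s)" for s
 proof -
  have i1: "integrable lborel (%t. d (coord2 e n s t) \<bullet> w)" for w by (intro integrable_inner_left dline)
  have "(LINT \<tau>|lborel. P s \<tau>) = (LINT \<tau>|lborel. (%t. d (coord2 e n s t) \<bullet> (e + \<gamma>' s *\<^sub>R n)) (\<tau> + \<gamma> s))"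
   by (simp add: P_def add.commute)
  also have "... = (LINT t|lborel. d (coord2 e n s t) \<bullet> (e + \<gamma>' s *\<^sub>R n))"
   by (rule integral_shift(1)) measurable
  also have "... = A s + \<gamma>' s * (LINT t|lborel. d (coord2 e n s t) \<bullet> n)"
   using i1 by (simp add: inner_add_right A_def)
  finally show ?thesis by (simp add: line_n)
 qed
 have "(LINT s|lborel. (A s - \<gamma>' s * F (g s))) = (LINT \<tau>|lborel. LINT s|lborel. P s \<tau>)"
  using lborel_pair.Fubini_integral[OF Pi] by (simp add: row)
 also have "... = 0" by (simp add: col)
 finally have "(LINT s|lborel. A s) = (LINT s|lborel. \<gamma>' s * F (g s))"
  using integral_coord2(1)[OF o dvi[of e]] Fgi' by (simp add: A_def)
 moreover have "(LINT x|lborel. d x \<bullet> e) = (LINT s|lborel. A s)"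
  using integral_coord2(2)[OF o dvi[of e]] by (simp add: A_def)
 moreover have "(LINT x|lborel. d x \<bullet> n) = - (LINT s|lborel. F (g s))"
  using integral_coord2(2)[OF o dvi[of n]] by (simp add: line_n)
 moreover have "(LINT x|lborel. d x \<bullet> v) = (v \<bullet> e) * (LINT x|lborel. d x \<bullet> e) + (v \<bullet> n) * (LINT x|lborel. d x \<bullet> n)"
 proof -
  have "d x \<bullet> v = (v \<bullet> e) * (d x \<bullet> e) + (v \<bullet> n) * (d x \<bullet> n)" for x
   by (subst orthonormal2_expand[OF o, of v, symmetric]) (simp add: inner_add_right)
  then show ?thesis using dvi by simp
 qed
 moreover have "(LINT s|lborel. ((v \<bullet> e) * \<gamma>' s - v \<bullet> n) * F (g s)) = (v \<bullet> e) * (LINT s|lborel. \<gamma>' s * F (g s)) - (v \<bullet> n) * (LINT s|lborel. F (g s))"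
  using Fgi Fgi' by (simp add: left_diff_distrib mult.assoc)
 ultimately show "(LINT x|lborel. indicator ?E x * (D x \<bullet> v))
   = (LINT s|lborel. ((v \<bullet> e) * \<gamma>' s - v \<bullet> n) * F (coord2 e n s (\<gamma> s)))"
  by (simp add: d_def g_def)
 show "integrable lborel (%s. F (coord2 e n s (\<gamma> s)))" using Fgi by (simp add: g_def)
qed

text \<open>\<open>n\<close> points into \<open>U\<close>. The derivative \<open>\<gamma>'\<close>
  is a parameter because it occurs in the boundary integrals.\<close>

definition bchart :: "(real^2) set => real^2 => real => real^2 => real^2 => (real => real) => (real => real) => bool" where
 "bchart U p r e n \<gamma> \<gamma>' \<longleftrightarrow> r > 0 \<and> orthonormal2 e n \<and> (\<forall>s. (\<gamma> has_real_derivative \<gamma>' s) (at s)) \<and>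
   continuous_on UNIV \<gamma>' \<and> U \<inter> ball p r = {x \<in> ball p r. \<gamma> (x \<bullet> e) < x \<bullet> n}"

definition has_bcharts :: "(real^2) set => bool" where
 "has_bcharts U \<longleftrightarrow> (\<forall>p\<in>frontier U. \<exists>r e n \<gamma> \<gamma>'. bchart U p r e n \<gamma> \<gamma>')"

lemma bchartD:
 assumes "bchart U p r e n \<gamma> \<gamma>'"
 shows "r > 0" "orthonormal2 e n" "!!s. (\<gamma> has_real_derivative \<gamma>' s) (at s)" "continuous_on UNIV \<gamma>'"
  "U \<inter> ball p r = {x \<in> ball p r. \<gamma> (x \<bullet> e) < x \<bullet> n}" "continuous_on UNIV \<gamma>"
 using assms by (auto simp: bchart_def continuous_on_eq_continuous_at intro: DERIV_isCont)

lemma C2_boundary_has_bcharts: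
 assumes "C2_boundary U"
 shows "has_bcharts U"
 unfolding has_bcharts_def
proof
 fix p assume "p \<in> frontier U"

 from bspec[OF assms[unfolded C2_boundary_def] this] obtain r e n \<gamma> where *: "r > 0" "norm e = 1" "norm n = 1" "e \<bullet> n = 0" "Ck_on 2 UNIV (\<gamma> :: real => real)"
  "U \<inter> ball p r = {x \<in> ball p r. \<gamma> (x \<bullet> e) < x \<bullet> n}"
  by (elim exE conjE) blast
 from *(5) obtain G where G: "!!s. (\<gamma> has_derivative (%h. G s \<bullet> h)) (at s)" "!!b. b \<in> Basis ==> Ck_on (Suc 0) UNIV (%x. G x \<bullet> b)"
  unfolding numeral_2_eq_2 Ck_on_Suc_UNIV by blast
 have "continuous_on UNIV G"
  using Ck_on_SucD[OF G(2)[of 1]] by simp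
 moreover have "(\<gamma> has_real_derivative G s) (at s)" for s using G(1)[of s] by (simp add: has_field_derivative_def)
 ultimately have "bchart U p r e n \<gamma> G" using * by (simp add: bchart_def orthonormal2_def)
 then show "\<exists>r e n \<gamma> \<gamma>'. bchart U p r e n \<gamma> \<gamma>'" by blast
qed

lemma bchart_shrink:
 assumes "bchart U p r e n \<gamma> \<gamma>'" "0 < r'" "r' \<le> r"
 shows "bchart U p r' e n \<gamma> \<gamma>'"
proof -
 have "ball p r' \<subseteq> ball p r" using assms(3) by auto
 then show ?thesis using assms unfolding bchart_def by blast
qed

lemma bchart_cong:
 assumes "bchart U p r e n \<gamma> \<gamma>'" "U \<inter> ball p r = V \<inter> ball p r"
 shows "bchart V p r e n \<gamma> \<gamma>'"
 using assms by (simp add: bchart_def)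

text \<open>A point on the graph is approached from inside by moving a small distance along
  \<open>n\<close>.\<close>

lemma bchart_closure:
 assumes ch: "bchart U p r e n \<gamma> \<gamma>'"
 shows "closure U \<inter> ball p r = {x \<in> ball p r. \<gamma> (x \<bullet> e) \<le> x \<bullet> n}"
proof -
 note c = bchartD[OF ch] and on = orthonormal2D[OF bchartD(2)[OF ch]]
 have cont: "continuous_on UNIV (%x. \<gamma> (x \<bullet> e))"
  by (rule continuous_on_compose2[OF c(6)]) (auto intro!: continuous_intros)
 show ?thesis
 proof (intro equalityI subsetI)
  fix x assume x: "x \<in> closure U \<inter> ball p r"
  have "x \<in> closure (ball p r \<inter> U)" using open_Int_closure_subset[of "ball p r" U] x by blast
  moreover have "closure (ball p r \<inter> U) \<subseteq> {x. \<gamma> (x \<bullet> e) \<le> x \<bullet> n}"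
  proof (rule closure_minimal)
   show "ball p r \<inter> U \<subseteq> {x. \<gamma> (x \<bullet> e) \<le> x \<bullet> n}" using c(5) less_imp_le by blast
   show "closed {x. \<gamma> (x \<bullet> e) \<le> x \<bullet> n}" by (intro closed_Collect_le cont continuous_intros)
  qed
  ultimately show "x \<in> {x \<in> ball p r. \<gamma> (x \<bullet> e) \<le> x \<bullet> n}" using x by auto
 next
  fix x assume x: "x \<in> {x \<in> ball p r. \<gamma> (x \<bullet> e) \<le> x \<bullet> n}"
  define \<delta> where "\<delta> = r - dist p x"
  have \<delta>: "\<delta> > 0" using x by (simp add: \<delta>_def)
  have "x \<in> closure U"
   unfolding closure_approachable
  proof (intro allI impI)
   fix \<epsilon> :: real assume \<epsilon>: "\<epsilon> > 0"
   define t where "t = min \<epsilon> \<delta> / 2"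
   have t: "0 < t" "t < \<epsilon>" "t < \<delta>" using \<epsilon> \<delta> by (auto simp: t_def min_def)
   let ?y = "x + t *\<^sub>R n"
   have d: "dist x ?y = t" using t c(2) by (simp add: dist_norm orthonormal2_def)
   then have "dist p ?y < r" using dist_triangle[of p ?y x] t by (simp add: \<delta>_def)
   moreover have "?y \<bullet> e = x \<bullet> e" "?y \<bullet> n = x \<bullet> n + t" using on by (auto simp: inner_add_left)
   ultimately have "?y \<in> {x \<in> ball p r. \<gamma> (x \<bullet> e) < x \<bullet> n}" using x t(1) by simp
   then have "?y \<in> U" using c(5) by blast
   then show "\<exists>y\<in>U. dist y x < \<epsilon>" using d t(2) by (metis dist_commute)
  qed
  then show "x \<in> closure U \<inter> ball p r" using x by simp
 qed
qed

lemma bchart_frontier: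
 assumes ch: "bchart U p r e n \<gamma> \<gamma>'" and U: "open U"
 shows "frontier U \<inter> ball p r = {x \<in> ball p r. \<gamma> (x \<bullet> e) = x \<bullet> n}"
proof -
 have "frontier U \<inter> ball p r = (closure U \<inter> ball p r) - (U \<inter> ball p r)"
  using U by (auto simp: frontier_def interior_open)
 also have "... = {x \<in> ball p r. \<gamma> (x \<bullet> e) = x \<bullet> n}"
  unfolding bchart_closure[OF ch] bchartD(5)[OF ch] by auto
 finally show ?thesis .
qed

text \<open>The exterior lies on the other side of the same graph and is an epigraph for the
  reversed normal. The two charts parametrise one curve and give boundary terms of opposite
  sign.\<close>

lemma bchart_complement:
 assumes ch: "bchart U p r e n \<gamma> \<gamma>'"
 shows "bchart (- closure U) p r e (- n) (%s. - \<gamma> s) (%s. - \<gamma>' s)"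
proof -
 note c = bchartD[OF ch]
 have "orthonormal2 e (- n)" using c(2) by (simp add: orthonormal2_def)
 moreover have "- closure U \<inter> ball p r = {x \<in> ball p r. - \<gamma> (x \<bullet> e) < x \<bullet> - n}"
 proof -
  have "- closure U \<inter> ball p r = ball p r - (closure U \<inter> ball p r)" by blast
  also have "... = {x \<in> ball p r. - \<gamma> (x \<bullet> e) < x \<bullet> - n}"
   unfolding bchart_closure[OF ch] by (auto simp: not_le)
  finally show ?thesis .
 qed
 ultimately show ?thesis
  using c by (auto simp: bchart_def intro!: DERIV_minus continuous_intros)
qed

text \<open>Since \<open>\<psi>\<close> vanishes outside a compact part of the ball, the product
  with \<open>u\<close> extends by zero to the whole closed epigraph, where
  \<open>epigraph_green\<close> applies.\<close>

lemma bchart_green: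
 assumes ch: "bchart U p r e n \<gamma> \<gamma>'" and U: "open U" and u: "C1_grad U u G" and \<psi>: "test_function (ball p r) \<psi>"
 shows "(LINT x|lborel. indicator U x * ((\<psi> x *\<^sub>R G x + u x *\<^sub>R grad \<psi> x) \<bullet> v))
  = (LINT s|lborel. ((v \<bullet> e) * \<gamma>' s - v \<bullet> n) * (\<psi> (coord2 e n s (\<gamma> s)) * u (coord2 e n s (\<gamma> s))))"
  and "integrable lborel (%s. \<psi> (coord2 e n s (\<gamma> s)) * u (coord2 e n s (\<gamma> s)))"
proof -
 note c = bchartD[OF ch]
 obtain K where K: "compact K" "K \<subseteq> ball p r" "!!x. x \<notin> K ==> \<psi> x = 0" "!!x. x \<notin> K ==> grad \<psi> x = 0"
  using test_function_support[OF \<psi>] by metis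
 obtain R where "!!x. x \<in> K ==> norm x \<le> R" using compact_imp_bounded[OF K(1)] bounded_iff by metis
 then have R: "x \<notin> K" if "norm x > R" for x using that by (meson not_le)
 note sm = test_function_smooth[OF \<psi>]
 have uc: "continuous_on (closure U) u" "continuous_on (closure U) G" "!!x. x \<in> U ==> (u has_derivative (%h. G x \<bullet> h)) (at x)"
  using u by (auto simp: C1_grad_def)
 let ?C = "{x. \<gamma> (x \<bullet> e) \<le> x \<bullet> n}" and ?E = "{x. \<gamma> (x \<bullet> e) < x \<bullet> n}"
 define F where "F x = \<psi> x * u x" for x
 define D where "D x = \<psi> x *\<^sub>R G x + u x *\<^sub>R grad \<psi> x" for x
 have z: "F x = 0" "D x = 0" if "x \<notin> K" for x using K(3,4)[OF that] by (auto simp: F_def D_def)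
 have opK: "open (- K)" using compact_imp_closed[OF K(1)] by auto
 have split: "?C = (?C \<inter> ball p r) \<union> (?C - K)" using K(2) by blast
 have patch: "continuous_on ?C f" if "continuous_on (?C \<inter> ball p r) f" "!!x. x \<notin> K ==> f x = 0"
  for f :: "real^2 => 'z::real_normed_vector"
 proof -
  have "continuous_on (?C - K) f" by (rule continuous_on_eq[of _ "%x. 0"]) (use that(2) in auto)
  with that(1) have "continuous_on ((?C \<inter> ball p r) \<union> (?C - K)) f"
  proof (rule continuous_on_Un_local_open[rotated 2])
   show "openin (top_of_set ((?C \<inter> ball p r) \<union> (?C - K))) (?C \<inter> ball p r)"
    unfolding split[symmetric] by (rule openin_open_Int) simp
   show "openin (top_of_set ((?C \<inter> ball p r) \<union> (?C - K))) (?C - K)"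
    unfolding split[symmetric] unfolding Diff_eq by (rule openin_open_Int[OF opK])
  qed
  then show ?thesis unfolding split[symmetric] .
 qed
 have sub: "?C \<inter> ball p r \<subseteq> closure U" using bchart_closure[OF ch] by blast
 have Fc: "continuous_on ?C F"
  by (rule patch[OF _ z(1)]) (auto simp: F_def intro!: continuous_intros continuous_on_subset[OF uc(1) sub] continuous_on_subset[OF smooth_imp_continuous[OF sm]])
 have Dc: "continuous_on ?C D"
  by (rule patch[OF _ z(2)]) (auto simp: D_def intro!: continuous_intros continuous_on_subset[OF uc(1) sub] continuous_on_subset[OF uc(2) sub]
    continuous_on_subset[OF smooth_imp_continuous[OF sm]] continuous_on_subset[OF smooth_grad_continuous[OF sm]])
 have der: "(F has_derivative (%h. D x \<bullet> h)) (at x)" if x: "\<gamma> (x \<bullet> e) < x \<bullet> n" for x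
 proof (cases "x \<in> ball p r")
  case True
  then have "x \<in> U" using c(5) x by blast
  show ?thesis
   unfolding F_def D_def
   using has_derivative_mult[OF smooth_grad(1)[OF sm] uc(3)[OF \<open>x \<in> U\<close>]] by (simp add: inner_add_left mult.commute)
 next
  case False
  then have x: "x \<in> - K" using K(2) by blast
  have "((%x. 0) has_derivative (%h. D x \<bullet> h)) (at x)" using z(2)[of x] x by simp
  then show ?thesis
   by (rule has_derivative_transform_within_open[OF _ opK x]) (simp add: z(1))
 qed
 have zR: "F x = 0" "D x = 0" if "norm x > R" for x using z[OF R[OF that]] by auto
 note E = epigraph_green[OF c(2,3,4) Fc Dc der zR]
 have ind: "indicator ?E x * (D x \<bullet> v) = indicator U x * (D x \<bullet> v)" for x
 proof (cases "x \<in> ball p r")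
  case True
  then have "x \<in> ?E \<longleftrightarrow> x \<in> U" using c(5) by blast
  then show ?thesis by (simp add: indicator_def)
 next
  case False
  then have "D x = 0" using z(2) K(2) by blast
  then show ?thesis by simp
 qed
 show "(LINT x|lborel. indicator U x * ((\<psi> x *\<^sub>R G x + u x *\<^sub>R grad \<psi> x) \<bullet> v))
  = (LINT s|lborel. ((v \<bullet> e) * \<gamma>' s - v \<bullet> n) * (\<psi> (coord2 e n s (\<gamma> s)) * u (coord2 e n s (\<gamma> s))))"
  using E(1)[where v = v] unfolding ind unfolding D_def F_def .
 show "integrable lborel (%s. \<psi> (coord2 e n s (\<gamma> s)) * u (coord2 e n s (\<gamma> s)))"
  using E(2) unfolding F_def .
qed

text \<open>Only the values of \<open>\<gamma>\<close> on the projection of the ball matter;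
  clamping the argument to that interval makes the function globally Lipschitz.\<close>

lemma bchart_lipschitz:
 assumes ch: "bchart U p r e n \<gamma> \<gamma>'"
 obtains \<gamma>c M where "M \<ge> 0" "!!s t. \<bar>\<gamma>c s - \<gamma>c t\<bar> \<le> M * \<bar>s - t\<bar>" "!!s. s \<in> {p \<bullet> e - r..p \<bullet> e + r} ==> \<gamma>c s = \<gamma> s"
proof -
 note c = bchartD[OF ch]
 define a where "a = p \<bullet> e - r"
 define b where "b = p \<bullet> e + r"
 have ab: "a \<le> b" using c(1) by (simp add: a_def b_def)
 have "compact (\<gamma>' ` {a..b})" by (intro compact_continuous_image continuous_on_subset[OF c(4)]) auto
 then obtain M where "!!s. s \<in> {a..b} ==> \<bar>\<gamma>' s\<bar> \<le> M"
  using compact_imp_bounded bounded_iff by (metis (no_types, lifting) imageI real_norm_def)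
 then have M: "\<bar>\<gamma>' s\<bar> \<le> max M 0" if "s \<in> {a..b}" for s using that by (simp add: le_max_iff_disj)
 have lip: "norm (\<gamma> s - \<gamma> t) \<le> max M 0 * norm (s - t)" if "s \<in> {a..b}" "t \<in> {a..b}" for s t
  by (rule field_differentiable_bound[of "{a..b}" \<gamma> \<gamma>'])
   (use that c(3) M in \<open>auto intro: has_field_derivative_at_within\<close>)
 define cl where "cl s = max a (min b s)" for s
 have cl: "cl s \<in> {a..b}" "\<bar>cl s - cl t\<bar> \<le> \<bar>s - t\<bar>" for s t using ab by (auto simp: cl_def max_def min_def)
 show thesis
 proof (rule that[of "max M 0" "%s. \<gamma> (cl s)"])
  show "\<bar>\<gamma> (cl s) - \<gamma> (cl t)\<bar> \<le> max M 0 * \<bar>s - t\<bar>" for s t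
   using lip[OF cl(1) cl(1), of s t] mult_left_mono[OF cl(2)[of s t], of "max M 0"] by simp
  show "\<gamma> (cl s) = \<gamma> s" if "s \<in> {p \<bullet> e - r..p \<bullet> e + r}" for s
   using that by (simp add: cl_def a_def b_def)
 qed simp
qed

lemma ball_inner_bound:
 assumes "norm (e::'a::euclidean_space) = 1" "x \<in> ball p r"
 shows "x \<bullet> e \<in> {p \<bullet> e - r..p \<bullet> e + r}"
proof -
 have "\<bar>(x - p) \<bullet> e\<bar> \<le> norm (x - p) * norm e" by (rule Cauchy_Schwarz_ineq2)
 then show ?thesis using assms by (auto simp: dist_norm norm_minus_commute inner_diff_left)
qed

text \<open>The graph comparison is applied to the globally Lipschitz replacement of
  \<open>\<gamma>\<close>. It agrees with the chart over the projection of the ball, and the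
  indicator of the ball removes the rest.\<close>

lemma bchart_hausdorff:
 assumes ch: "bchart U p r e n \<gamma> \<gamma>'" and U: "open U"
 shows "\<exists>L>0. \<forall>f :: real^2 => ennreal. f \<in> Borel -->
   (\<integral>\<^sup>+x. f x * indicator (frontier U \<inter> ball p r) x \<partial>hausdorff1)
    \<le> ennreal L * (\<integral>\<^sup>+s. f (coord2 e n s (\<gamma> s)) * indicator (ball p r) (coord2 e n s (\<gamma> s)) \<partial>lborel) \<and>
   (\<integral>\<^sup>+s. f (coord2 e n s (\<gamma> s)) * indicator (ball p r) (coord2 e n s (\<gamma> s)) \<partial>lborel)
    \<le> (\<integral>\<^sup>+x. f x * indicator (frontier U \<inter> ball p r) x \<partial>hausdorff1)"
proof -
 note c = bchartD[OF ch] and ci = coord2_inner[OF bchartD(2)[OF ch]]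
 have ne: "norm e = 1" "norm n = 1" using c(2) by (auto simp: orthonormal2_def)
 obtain \<gamma>c M where M: "M \<ge> 0" "!!s t. \<bar>\<gamma>c s - \<gamma>c t\<bar> \<le> M * \<bar>s - t\<bar>" "!!s. s \<in> {p \<bullet> e - r..p \<bullet> e + r} ==> \<gamma>c s = \<gamma> s"
  using bchart_lipschitz[OF ch] by metis
 let ?I = "{p \<bullet> e - r..p \<bullet> e + r}"
 define g where "g s = coord2 e n s (\<gamma>c s)" for s
 have gl: "dist (g s) (g t) \<le> (1 + M) * \<bar>s - t\<bar>" for s t
 proof -
  have "g s - g t = (s - t) *\<^sub>R e + (\<gamma>c s - \<gamma>c t) *\<^sub>R n" by (simp add: g_def algebra_simps)
  then have "dist (g s) (g t) \<le> norm ((s - t) *\<^sub>R e) + norm ((\<gamma>c s - \<gamma>c t) *\<^sub>R n)"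
   by (simp only: dist_norm norm_triangle_ineq)
  also have "... \<le> \<bar>s - t\<bar> + M * \<bar>s - t\<bar>" using ne M(2) by simp
  finally show ?thesis by (simp add: algebra_simps)
 qed
 have pl: "\<bar>x \<bullet> e - y \<bullet> e\<bar> \<le> dist x y" for x y
  using Cauchy_Schwarz_ineq2[of "x - y" e] ne by (simp add: inner_diff_left dist_norm)
 have pg: "g s \<bullet> e = s" for s by (simp add: g_def ci)
 have L: "1 + M > 0" using M(1) by simp
 have i1: "indicator (ball p r) x * indicator (g ` ?I) x = (indicator (frontier U \<inter> ball p r) x :: ennreal)" for x
 proof -
  have "x \<in> ball p r \<and> x \<in> g ` ?I \<longleftrightarrow> x \<in> frontier U \<inter> ball p r"
  proof
   assume x: "x \<in> ball p r \<and> x \<in> g ` ?I"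
   then obtain s where "s \<in> ?I" "x = g s" by auto
   then have "\<gamma> (x \<bullet> e) = x \<bullet> n" using M(3) by (simp add: g_def ci)
   then show "x \<in> frontier U \<inter> ball p r" using bchart_frontier[OF ch U] x by blast
  next
   assume x: "x \<in> frontier U \<inter> ball p r"
   then have xn: "\<gamma> (x \<bullet> e) = x \<bullet> n" using bchart_frontier[OF ch U] by blast
   have s: "x \<bullet> e \<in> ?I" using ball_inner_bound[OF ne(1)] x by blast
   have "g (x \<bullet> e) = x" unfolding g_def M(3)[OF s] xn by (rule orthonormal2_expand[OF c(2)])
   then show "x \<in> ball p r \<and> x \<in> g ` ?I" using s x by (metis IntD2 image_eqI)
  qed
  then show ?thesis by (auto simp: indicator_def simp del: mem_ball)
 qed
 have i2: "f (g s) * indicator (ball p r) (g s) * indicator ?I s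
   = f (coord2 e n s (\<gamma> s)) * indicator (ball p r) (coord2 e n s (\<gamma> s))" for f :: "real^2 => ennreal" and s
 proof (cases "s \<in> ?I")
  case True
  then show ?thesis using M(3)[OF True] by (simp add: g_def)
 next
  case False
  have "coord2 e n s (\<gamma> s) \<notin> ball p r" using ball_inner_bound[OF ne(1), of "coord2 e n s (\<gamma> s)" p r] False ci by metis
  then show ?thesis using False by (simp add: indicator_def)
 qed
 show ?thesis
 proof (intro exI[of _ "1 + M"] conjI allI impI L)
  fix f :: "real^2 => ennreal" assume [measurable]: "f \<in> Borel"
  have [measurable]: "ball p r \<in> sets borel" by simp
  have m: "(%x. f x * indicator (ball p r) x) \<in> Borel" by measurable
  note H = hausdorff1_graph[OF gl L, of "%x. x \<bullet> e", OF pl pg m, of "p \<bullet> e - r" "p \<bullet> e + r"]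
  show "(\<integral>\<^sup>+x. f x * indicator (frontier U \<inter> ball p r) x \<partial>hausdorff1)
    \<le> ennreal (1 + M) * (\<integral>\<^sup>+s. f (coord2 e n s (\<gamma> s)) * indicator (ball p r) (coord2 e n s (\<gamma> s)) \<partial>lborel)"
   using H(1) unfolding i2 by (simp only: mult.assoc i1)
  show "(\<integral>\<^sup>+s. f (coord2 e n s (\<gamma> s)) * indicator (ball p r) (coord2 e n s (\<gamma> s)) \<partial>lborel)
    \<le> (\<integral>\<^sup>+x. f x * indicator (frontier U \<inter> ball p r) x \<partial>hausdorff1)"
   using H(2) unfolding i2 by (simp only: mult.assoc i1)
 qed
qed

section \<open>The trace inequality\<close>

lemma C1_grad_square:
 assumes "C1_grad U u G"
 shows "C1_grad U (%x. (u x)^2) (%x. (2 * u x) *\<^sub>R G x)"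
 unfolding C1_grad_def
proof (intro conjI ballI)
 fix x assume "x \<in> U"
 then have d: "(u has_derivative (%h. G x \<bullet> h)) (at x)" using assms by (simp add: C1_grad_def)
 show "((%x. (u x)^2) has_derivative (%h. ((2 * u x) *\<^sub>R G x) \<bullet> h)) (at x)"
  using has_derivative_mult[OF d d] by (simp add: power2_eq_square mult_ac)
qed (use assms in \<open>auto simp: C1_grad_def intro!: continuous_intros\<close>)

text \<open>Green's formula for the square of \<open>u\<close> with \<open>v = - n\<close>: the
  boundary density \<open>(v \<bullet> e) * \<gamma>' s - v \<bullet> n\<close> becomes 1, and the
  volume term is quadratic in \<open>u\<close> and \<open>G\<close>.\<close>

lemma trace_inequality_local:
 assumes ch: "bchart U p r e n \<gamma> \<gamma>'" and U: "open U" "bounded U" and \<zeta>: "test_function (ball p r) \<zeta>" "!!x. 0 \<le> \<zeta> x"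
 obtains C where "C \<ge> 0" "!!u G. C1_grad U u G ==>
   (\<integral>\<^sup>+x. ennreal (\<zeta> x * (u x)^2) * indicator (frontier U) x \<partial>hausdorff1)
    \<le> ennreal (C * ((norm2 (cut U u))^2 + (norm2 (cut U G))^2))"
proof -
 note c = bchartD[OF ch] and ci = coord2_inner[OF bchartD(2)[OF ch]]
 obtain L where L: "L > 0" "!!f :: real^2 => ennreal. f \<in> Borel ==>
   (\<integral>\<^sup>+x. f x * indicator (frontier U \<inter> ball p r) x \<partial>hausdorff1)
    \<le> ennreal L * (\<integral>\<^sup>+s. f (coord2 e n s (\<gamma> s)) * indicator (ball p r) (coord2 e n s (\<gamma> s)) \<partial>lborel)"
  using bchart_hausdorff[OF ch U(1)] by blast
 obtain C where C: "C \<ge> 0" "!!x. \<bar>\<zeta> x\<bar> \<le> C" "!!x. norm (grad \<zeta> x) \<le> C" using test_function_bounded[OF \<zeta>(1)] by metis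
 \<comment> \<open>\<open>L\<close> compares Hausdorff measure with the parameter of the graph;
   \<open>2 * C\<close> bounds the volume integrand, where \<open>C\<close> dominates
   \<open>\<zeta>\<close> and its gradient.\<close>
 show thesis
 proof (rule that[of "L * (2 * C)"])
  fix u G assume u: "C1_grad U u G"
  have uc: "continuous_on (closure U) u" "continuous_on (closure U) G" using u by (auto simp: C1_grad_def)
  define a where "a x = cut U u x" for x
  define b where "b x = cut U G x" for x
  have a: "sqint a" unfolding a_def by (rule C1_grad_indicator[OF U uc(1)])
  have b: "sqint b" unfolding b_def by (rule C1_grad_indicator[OF U uc(2)])
  \<comment> \<open>\<open>u\<close> is arbitrary outside the closure; \<open>w\<close> is a Borel
    function with the same boundary values.\<close>
  define w where "w x = cut (closure U) u x" for x
  have wm[measurable]: "w \<in> Borel"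
   unfolding w_def by (rule borel_measurable_continuous_on_indicator) (use uc in auto)
  have [measurable]: "\<zeta> \<in> Borel" using test_function_measurable[OF \<zeta>(1)] by simp
  have \<zeta>0: "\<zeta> x = 0" if "x \<notin> ball p r" for x using test_function_outside[OF \<zeta>(1) that] by simp
  let ?g = "%s. coord2 e n s (\<gamma> s)"
  have fc: "frontier U \<subseteq> closure U" by (simp add: frontier_def)
  have "(\<integral>\<^sup>+x. ennreal (\<zeta> x * (u x)^2) * indicator (frontier U) x \<partial>hausdorff1)
   = (\<integral>\<^sup>+x. ennreal (\<zeta> x * (w x)^2) * indicator (frontier U \<inter> ball p r) x \<partial>hausdorff1)"
   by (intro nn_integral_cong) (use fc \<zeta>0 in \<open>auto simp: w_def indicator_def\<close>)
  also have "... \<le> ennreal L * (\<integral>\<^sup>+s. ennreal (\<zeta> (?g s) * (w (?g s))^2) * indicator (ball p r) (?g s) \<partial>lborel)"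
   by (rule L(2)) measurable
  also have "(\<integral>\<^sup>+s. ennreal (\<zeta> (?g s) * (w (?g s))^2) * indicator (ball p r) (?g s) \<partial>lborel)
    = (\<integral>\<^sup>+s. ennreal (\<zeta> (?g s) * (u (?g s))^2) \<partial>lborel)"
  proof (rule nn_integral_cong)
   fix s
   have "?g s \<in> closure U" if "?g s \<in> ball p r"
   proof -
    have "\<gamma> (?g s \<bullet> e) \<le> ?g s \<bullet> n" by (simp add: ci)
    then show ?thesis using bchart_closure[OF ch] that by blast
   qed
   then show "ennreal (\<zeta> (?g s) * (w (?g s))^2) * indicator (ball p r) (?g s) = ennreal (\<zeta> (?g s) * (u (?g s))^2)"
    using \<zeta>0[of "?g s"] by (auto simp: w_def indicator_def simp del: mem_ball)
  qed
  also have "... = ennreal (LINT s|lborel. \<zeta> (?g s) * (u (?g s))^2)"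
   by (rule nn_integral_eq_integral[OF bchart_green(2)[OF ch U(1) C1_grad_square[OF u] \<zeta>(1)]]) (use \<zeta>(2) in auto)
  also have "(LINT s|lborel. \<zeta> (?g s) * (u (?g s))^2)
   \<le> 2 * C * ((norm2 a)^2 + (norm2 b)^2)"
  proof -
   have "(LINT s|lborel. \<zeta> (?g s) * (u (?g s))^2)
    = (LINT x|lborel. indicator U x * ((\<zeta> x *\<^sub>R (2 * u x) *\<^sub>R G x + (u x)^2 *\<^sub>R grad \<zeta> x) \<bullet> - n))"
    using bchart_green(1)[OF ch U(1) C1_grad_square[OF u] \<zeta>(1), of "- n"] orthonormal2D[OF c(2)] by simp
   also have "... \<le> (LINT x|lborel. 2 * C * ((norm (a x))^2 + (norm (b x))^2))"
   proof (rule integral_mono_AE')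
    show "integrable lborel (%x. 2 * C * ((norm (a x))^2 + (norm (b x))^2))"
     using a b by (auto simp: square_int_def)
    show "AE x in lborel. indicator U x * ((\<zeta> x *\<^sub>R (2 * u x) *\<^sub>R G x + (u x)^2 *\<^sub>R grad \<zeta> x) \<bullet> - n)
     \<le> 2 * C * ((norm (a x))^2 + (norm (b x))^2)"
    proof (rule AE_I2)
     fix x
     show "indicator U x * ((\<zeta> x *\<^sub>R (2 * u x) *\<^sub>R G x + (u x)^2 *\<^sub>R grad \<zeta> x) \<bullet> - n)
      \<le> 2 * C * ((norm (a x))^2 + (norm (b x))^2)"
     proof (cases "x \<in> U")
      case True
      have "(\<zeta> x *\<^sub>R (2 * u x) *\<^sub>R G x + (u x)^2 *\<^sub>R grad \<zeta> x) \<bullet> - n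
        \<le> norm (\<zeta> x *\<^sub>R (2 * u x) *\<^sub>R G x + (u x)^2 *\<^sub>R grad \<zeta> x) * norm (- n)" by (rule norm_cauchy_schwarz)
      also have "... \<le> norm (\<zeta> x *\<^sub>R (2 * u x) *\<^sub>R G x) + norm ((u x)^2 *\<^sub>R grad \<zeta> x)"
       using c(2) norm_triangle_ineq[of "\<zeta> x *\<^sub>R (2 * u x) *\<^sub>R G x" "(u x)^2 *\<^sub>R grad \<zeta> x"]
       by (simp add: orthonormal2_def del: scaleR_scaleR)
      also have "... = \<bar>\<zeta> x\<bar> * (2 * \<bar>u x\<bar> * norm (G x)) + norm (grad \<zeta> x) * (u x)^2" by (simp add: abs_mult)
      also have "... \<le> C * ((u x)^2 + (norm (G x))^2) + C * (u x)^2"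
      proof (intro add_mono mult_mono C)
       show "2 * \<bar>u x\<bar> * norm (G x) \<le> (u x)^2 + (norm (G x))^2"
        using sum_squares_bound[of "\<bar>u x\<bar>" "norm (G x)"] by simp
      qed auto
      also have "... \<le> 2 * C * ((u x)^2 + (norm (G x))^2)"
       using mult_nonneg_nonneg[OF C(1), of "(norm (G x))^2"] by (simp add: algebra_simps)
      finally show ?thesis using True by (simp add: a_def b_def)
     qed (use C(1) in simp)
    qed
    show "AE x in lborel. 0 \<le> 2 * C * ((norm (a x))^2 + (norm (b x))^2)" using C(1) by auto
   qed
   also have "... = 2 * C * ((norm2 a)^2 + (norm2 b)^2)"
    using a b by (simp add: square_int_def l2norm_power2)
   finally show ?thesis .
  qed
  finally have "(\<integral>\<^sup>+x. ennreal (\<zeta> x * (u x)^2) * indicator (frontier U) x \<partial>hausdorff1)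
   \<le> ennreal L * ennreal (2 * C * ((norm2 a)^2 + (norm2 b)^2))"
   by (simp add: ennreal_leI mult_left_mono)
  then show "(\<integral>\<^sup>+x. ennreal (\<zeta> x * (u x)^2) * indicator (frontier U) x \<partial>hausdorff1)
    \<le> ennreal (L * (2 * C) * ((norm2 (cut U u))^2 + (norm2 (cut U G))^2))"
   using L(1) by (simp add: a_def[abs_def] b_def[abs_def] ennreal_mult'[symmetric] mult.assoc)
 qed (use L(1) C(1) in simp)
qed

lemma boundary_measure_measurable:
 fixes f :: "real^2 => 'b::topological_space"
 assumes "continuous_on (frontier U) f"
 shows "f \<in> borel_measurable (boundary_measure U)"
proof -
 have "sets (boundary_measure U) = sets (restrict_space borel (frontier U))"
  unfolding boundary_measure_def by (rule sets_restrict_space_cong) (simp add: sets_hausdorff1)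
 then show ?thesis
  using borel_measurable_continuous_on_restrict[OF assms] measurable_cong_sets by blast
qed

lemma nn_integral_boundary_measure:
 "(\<integral>\<^sup>+x. f x \<partial>boundary_measure U) = (\<integral>\<^sup>+x. f x * indicator (frontier U) x \<partial>hausdorff1)"
 unfolding boundary_measure_def by (rule nn_integral_restrict_space) (simp add: sets_hausdorff1)

text \<open>The boundary is compact, so finitely many chart balls cover it and the local estimates
  are added through a partition of unity.\<close>

lemma trace_inequality:
 assumes U: "open U" "bounded U" "has_bcharts U"
 obtains C where "C \<ge> 0" "!!u G. C1_grad U u G ==> square_int (boundary_measure U) u"
  "!!u G. C1_grad U u G ==> l2norm (boundary_measure U) u
    \<le> C * (norm2 (cut U u) + norm2 (cut U G))"
proof -
 have K: "compact (frontier U)" using U(2) by (simp add: compact_frontier_bounded)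
 define \<U> where "\<U> = {ball p r |p r. \<exists>e n \<gamma> \<gamma>'. bchart U p r e n \<gamma> \<gamma>'}"
 have "\<exists>B\<in>\<U>. open B \<and> x \<in> B" if "x \<in> frontier U" for x
 proof -
  from bspec[OF U(3)[unfolded has_bcharts_def] that]
  obtain r e n \<gamma> \<gamma>' where ch: "bchart U x r e n \<gamma> \<gamma>'" by blast
  then have "ball x r \<in> \<U>" unfolding \<U>_def by blast
  then show ?thesis using bchartD(1)[OF ch] by (intro bexI[of _ "ball x r"]) auto
 qed
 from smooth_partition_of_unity[OF K this] obtain N :: nat and \<eta> :: "nat => real^2 => real" where
  \<eta>: "!!i. i < N ==> \<exists>B\<in>\<U>. test_function B (\<eta> i)" "!!i x. 0 \<le> \<eta> i x" "!!x. x \<in> frontier U ==> (\<Sum>i<N. \<eta> i x) = 1"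
  by metis
 define Q where "Q i C \<longleftrightarrow> C \<ge> 0 \<and> (\<forall>u G. C1_grad U u G --> (\<integral>\<^sup>+x. ennreal (\<eta> i x * (u x)^2) * indicator (frontier U) x \<partial>hausdorff1)
    \<le> ennreal (C * ((norm2 (cut U u))^2 + (norm2 (cut U G))^2)))"
  for i and C :: real
 have "\<exists>C. Q i C" if i: "i < N" for i
 proof -
  obtain p r e n \<gamma> \<gamma>' where ch: "bchart U p r e n \<gamma> \<gamma>'" "test_function (ball p r) (\<eta> i)"
   using \<eta>(1)[OF i] unfolding \<U>_def by blast
  show ?thesis
  proof (rule trace_inequality_local[OF ch(1) U(1,2) ch(2) \<eta>(2)])
   fix C :: real
   assume "C \<ge> 0" "!!u G. C1_grad U u G ==> (\<integral>\<^sup>+x. ennreal (\<eta> i x * (u x)^2) * indicator (frontier U) x \<partial>hausdorff1)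
    \<le> ennreal (C * ((norm2 (cut U u))^2 + (norm2 (cut U G))^2))"
   then have "Q i C" unfolding Q_def by blast
   then show ?thesis ..
  qed
 qed
 then obtain C where Q: "!!i. i < N ==> Q i (C i)" by metis
 have C: "!!i. i < N ==> C i \<ge> 0"
  "!!i u G. i < N ==> C1_grad U u G ==> (\<integral>\<^sup>+x. ennreal (\<eta> i x * (u x)^2) * indicator (frontier U) x \<partial>hausdorff1)
    \<le> ennreal (C i * ((norm2 (cut U u))^2 + (norm2 (cut U G))^2))"
  using Q unfolding Q_def by blast+
 define C' where "C' = (\<Sum>i<N. C i)"
 have C'0: "C' \<ge> 0" unfolding C'_def using C(1) by (intro sum_nonneg) auto
 have main: "square_int (boundary_measure U) u \<and> l2norm (boundary_measure U) u
    \<le> sqrt C' * (norm2 (cut U u) + norm2 (cut U G))"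
  if u: "C1_grad U u G" for u G
 proof -
  define a where "a = norm2 (cut U u)"
  define b where "b = norm2 (cut U G)"
  have ab: "a \<ge> 0" "b \<ge> 0" by (auto simp: a_def b_def l2norm_nonneg)
  have ucl: "continuous_on (closure U) u" using u by (simp add: C1_grad_def)
  have uf: "continuous_on (frontier U) u" by (rule continuous_on_subset[OF ucl]) (simp add: frontier_def)
  note um = boundary_measure_measurable[OF uf]
  define w where "w x = cut (frontier U) u x" for x
  have wm[measurable]: "w \<in> Borel"
   unfolding w_def by (rule borel_measurable_continuous_on_indicator) (use uf in auto)
  have em: "\<eta> i \<in> Borel" if "i < N" for i using \<eta>(1)[OF that] test_function_measurable by blast
  have "(\<integral>\<^sup>+x. ennreal ((norm (u x))^2) \<partial>boundary_measure U) = (\<integral>\<^sup>+x. (\<Sum>i<N. ennreal (\<eta> i x * (w x)^2)) \<partial>hausdorff1)"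
   unfolding nn_integral_boundary_measure
  proof (rule nn_integral_cong)
   fix x
   show "ennreal ((norm (u x))^2) * indicator (frontier U) x = (\<Sum>i<N. ennreal (\<eta> i x * (w x)^2))"
   proof (cases "x \<in> frontier U")
    case True
    have "(\<Sum>i<N. ennreal (\<eta> i x * (w x)^2)) = ennreal (\<Sum>i<N. \<eta> i x * (w x)^2)"
     using \<eta>(2) by (intro sum_ennreal) auto
    also have "(\<Sum>i<N. \<eta> i x * (w x)^2) = (w x)^2" using \<eta>(3)[OF True] by (simp add: sum_distrib_right[symmetric])
    finally show ?thesis using True by (simp add: w_def)
   qed (simp add: w_def)
  qed
  also have "... = (\<Sum>i<N. \<integral>\<^sup>+x. ennreal (\<eta> i x * (w x)^2) \<partial>hausdorff1)"
  proof (rule nn_integral_sum)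
   fix i assume "i \<in> {..<N}"
   then have [measurable]: "\<eta> i \<in> Borel" using em by simp
   have "(%x. ennreal (\<eta> i x * (w x)^2)) \<in> Borel" by measurable
   then show "(%x. ennreal (\<eta> i x * (w x)^2)) \<in> borel_measurable hausdorff1"
    using measurable_cong_sets[OF sets_hausdorff1(1) refl] by blast
  qed
  also have "... \<le> (\<Sum>i<N. ennreal (C i * (a\<^sup>2 + b\<^sup>2)))"
  proof (rule sum_mono)
   fix i assume "i \<in> {..<N}"
   then have "(\<integral>\<^sup>+x. ennreal (\<eta> i x * (u x)^2) * indicator (frontier U) x \<partial>hausdorff1) \<le> ennreal (C i * (a\<^sup>2 + b\<^sup>2))"
    using C(2)[OF _ u] by (simp add: a_def b_def)
   moreover have "(\<integral>\<^sup>+x. ennreal (\<eta> i x * (u x)^2) * indicator (frontier U) x \<partial>hausdorff1) = (\<integral>\<^sup>+x. ennreal (\<eta> i x * (w x)^2) \<partial>hausdorff1)"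
    by (intro nn_integral_cong) (auto simp: w_def indicator_def)
   ultimately show "(\<integral>\<^sup>+x. ennreal (\<eta> i x * (w x)^2) \<partial>hausdorff1) \<le> ennreal (C i * (a\<^sup>2 + b\<^sup>2))" by simp
  qed
  also have "... = ennreal (C' * (a\<^sup>2 + b\<^sup>2))"
   using C(1) by (subst sum_ennreal) (auto simp: C'_def sum_distrib_right)
  also have "... \<le> ennreal ((sqrt C' * (a + b))^2)"
  proof (rule ennreal_leI)
   have "a\<^sup>2 + b\<^sup>2 \<le> (a + b)^2" using ab by (simp add: power2_sum)
   then show "C' * (a\<^sup>2 + b\<^sup>2) \<le> (sqrt C' * (a + b))^2" using C'0 by (simp add: power_mult_distrib mult_left_mono)
  qed
  finally have *: "(\<integral>\<^sup>+x. ennreal ((norm (u x))^2) \<partial>boundary_measure U) \<le> ennreal ((sqrt C' * (a + b))^2)" .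
  show ?thesis
   using l2norm_le_nn_integral[OF um *] C'0 ab by (simp add: a_def b_def)
 qed
 show thesis by (rule that[of "sqrt C'"]) (use C'0 main in auto)
qed

section \<open>Gluing across a boundary\<close>

lemma l2_weak_limit:
 fixes F :: "nat => 'a => 'b::euclidean_space"
 assumes F: "!!n. square_int M (F n)" and f: "square_int M f" and h: "square_int M h"
  and lim: "l2_tendsto M F f"
 shows "(%n. LINT x|M. F n x \<bullet> h x) \<longlonglongrightarrow> (LINT x|M. f x \<bullet> h x)"
proof (rule LIM_zero_cancel, rule Lim_null_comparison)
 show "(%n. l2norm M (%x. F n x - f x) * l2norm M h) \<longlonglongrightarrow> 0"
  using tendsto_mult_right[OF lim] by simp
 show "\<forall>\<^sub>F n in sequentially. norm ((LINT x|M. F n x \<bullet> h x) - (LINT x|M. f x \<bullet> h x)) \<le> l2norm M (%x. F n x - f x) * l2norm M h"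
 proof (intro always_eventually allI)
  fix n
  have "(LINT x|M. F n x \<bullet> h x) - (LINT x|M. f x \<bullet> h x) = (LINT x|M. (F n x - f x) \<bullet> h x)"
   using square_int_integrable_inner[OF F h] square_int_integrable_inner[OF f h] by (simp add: inner_diff_left)
  then show "norm ((LINT x|M. F n x \<bullet> h x) - (LINT x|M. f x \<bullet> h x)) \<le> l2norm M (%x. F n x - f x) * l2norm M h"
   using l2norm_Cauchy_Schwarz[OF square_int_diff[OF F f] h] by simp
 qed
qed

text \<open>\<open>\<phi>\<close> may be nonzero on the boundary of \<open>U\<close>. The limit is
  then the boundary defect of integration by parts, which is zero for test functions of
  \<open>U\<close>.\<close>

lemma wgrad_approx_identity:
 assumes w: "wgrad U f g" and t: "test_function S \<phi>"
  and F: "!!k::nat. sqint (cut U (u k))" "!!k. sqint (cut U (G k))"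
  and lim: "l2lim (%k. cut U (u k)) f"
   "l2lim (%k. cut U (G k)) g"
 shows "(%k. LINT x|lborel. indicator U x * ((\<phi> x *\<^sub>R G k x + u k x *\<^sub>R grad \<phi> x) \<bullet> v))
  \<longlonglongrightarrow> (LINT x|lborel. f x * (grad \<phi> x \<bullet> v)) + (LINT x|lborel. (g x \<bullet> v) * \<phi> x)"
proof -
 note a = wgradD[OF w]
 have s1: "sqint (%x. grad \<phi> x \<bullet> v)"
  by (rule square_int_inner_const[OF test_function_integrable(3)[OF t]])
 have s2: "sqint (%x. \<phi> x *\<^sub>R v)"
  by (rule square_int_bound[OF _ test_function_integrable(1)[OF t], where C = "norm v"])
   (use test_function_measurable[OF t] in \<open>auto simp: mult.commute\<close>)
 have A: "(%k. LINT x|lborel. (cut U (u k) x) \<bullet> (grad \<phi> x \<bullet> v)) \<longlonglongrightarrow> (LINT x|lborel. f x \<bullet> (grad \<phi> x \<bullet> v))"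
  by (rule l2_weak_limit[OF F(1) a(1) s1 lim(1)])
 have B: "(%k. LINT x|lborel. (cut U (G k) x) \<bullet> (\<phi> x *\<^sub>R v)) \<longlonglongrightarrow> (LINT x|lborel. g x \<bullet> (\<phi> x *\<^sub>R v))"
  by (rule l2_weak_limit[OF F(2) a(2) s2 lim(2)])
 have "(LINT x|lborel. indicator U x * ((\<phi> x *\<^sub>R G k x + u k x *\<^sub>R grad \<phi> x) \<bullet> v))
  = (LINT x|lborel. (cut U (u k) x) \<bullet> (grad \<phi> x \<bullet> v)) + (LINT x|lborel. (cut U (G k) x) \<bullet> (\<phi> x *\<^sub>R v))" for k
  using square_int_integrable_inner[OF F(1) s1] square_int_integrable_inner[OF F(2) s2]
  by (subst Bochner_Integration.integral_add[symmetric]) (auto intro!: Bochner_Integration.integral_cong simp: inner_add_left algebra_simps)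
 then show ?thesis using tendsto_add[OF A B] by (simp add: mult.commute)
qed

text \<open>At an interface point Green's formula on the two sides yields integrals over the same
  graph with opposite signs, so the defects combine to an integral of \<open>u1 k - u2 k\<close>,
  which tends to zero in L^2 of the boundary. Elsewhere the weak identity of one side
  suffices.\<close>

lemma wgrad_glue:
 fixes u1 u2 :: "nat => real^2 => real"
 assumes op: "open U1" "open U2" "U1 \<inter> U2 = {}" "U1 \<subseteq> W" "U2 \<subseteq> W"
  and cov: "!!p. p \<in> W ==> p \<in> U1 \<or> p \<in> U2 \<or>
   (\<exists>r e n \<gamma> \<gamma>'. bchart U1 p r e n \<gamma> \<gamma>' \<and> bchart U2 p r e (- n) (%s. - \<gamma> s) (%s. - \<gamma>' s))"
  and w: "wgrad U1 f1 g1" "wgrad U2 f2 g2"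
  and u1: "!!k. C1_grad U1 (u1 k) (G1 k)" "!!k. sqint (cut U1 (u1 k))" "!!k. sqint (cut U1 (G1 k))"
   "l2lim (%k. cut U1 (u1 k)) f1" "l2lim (%k. cut U1 (G1 k)) g1"
  and u2: "!!k. C1_grad U2 (u2 k) (G2 k)" "!!k. sqint (cut U2 (u2 k))" "!!k. sqint (cut U2 (G2 k))"
   "l2lim (%k. cut U2 (u2 k)) f2" "l2lim (%k. cut U2 (G2 k)) g2"
  and tr: "!!k. square_int (boundary_measure U1) (%x. u1 k x - u2 k x)" "(%k. l2norm (boundary_measure U1) (%x. u1 k x - u2 k x)) \<longlonglongrightarrow> 0"
 shows "wgrad W (%x. f1 x + f2 x) (%x. g1 x + g2 x)"
proof -
 note a1 = wgradD[OF w(1)] and a2 = wgradD[OF w(2)]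
 have split: "(LINT x|lborel. (f1 x + f2 x) * (grad \<phi> x \<bullet> v)) + (LINT x|lborel. ((g1 x + g2 x) \<bullet> v) * \<phi> x)
   = ((LINT x|lborel. f1 x * (grad \<phi> x \<bullet> v)) + (LINT x|lborel. (g1 x \<bullet> v) * \<phi> x))
   + ((LINT x|lborel. f2 x * (grad \<phi> x \<bullet> v)) + (LINT x|lborel. (g2 x \<bullet> v) * \<phi> x))" if t: "test_function S \<phi>" for S \<phi> v
  using wgrad_integrable[OF a1(1,2) t, of v] wgrad_integrable[OF a2(1,2) t, of v]
  by (simp add: distrib_right inner_add_left)
 have zero: "f x = 0 \<or> \<phi> x = 0 \<and> grad \<phi> x = 0" "g x = 0 \<or> \<phi> x = 0"
  if "wgrad V f g" "test_function V' \<phi>" "V \<inter> V' = {}" for V V' :: "(real^2) set" and f g \<phi> x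
  using test_function_outside[OF that(2), of x] wgradD(3,4)[OF that(1), of x] that(3) by blast+
 show ?thesis
 proof (rule wgrad_local)
  fix p assume p: "p \<in> W"
  show "\<exists>S. open S \<and> p \<in> S \<and> (\<forall>\<xi> v. test_function S \<xi> --> test_function W \<xi> -->
    (LINT x|lborel. (f1 x + f2 x) * (grad \<xi> x \<bullet> v)) = - (LINT x|lborel. ((g1 x + g2 x) \<bullet> v) * \<xi> x))"
  proof (cases "p \<in> U1 \<or> p \<in> U2")
   case True
   then show ?thesis
   proof
    assume "p \<in> U1"
    have "(LINT x|lborel. (f1 x + f2 x) * (grad \<xi> x \<bullet> v)) = - (LINT x|lborel. ((g1 x + g2 x) \<bullet> v) * \<xi> x)"
     if t: "test_function U1 \<xi>" for \<xi> v
    proof -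
     have z: "f2 x * (grad \<xi> x \<bullet> v) = 0" "(g2 x \<bullet> v) * \<xi> x = 0" for x
      using zero[OF w(2) t, of x] op(3) by (auto simp: Int_commute)
     have "(LINT x|lborel. f2 x * (grad \<xi> x \<bullet> v)) = 0" "(LINT x|lborel. (g2 x \<bullet> v) * \<xi> x) = 0"
      unfolding z by simp_all
     then show ?thesis using split[OF t, of v] a1(5)[OF t, of v] by linarith
    qed
    then show ?thesis using \<open>p \<in> U1\<close> op(1) by blast
   next
    assume "p \<in> U2"
    have "(LINT x|lborel. (f1 x + f2 x) * (grad \<xi> x \<bullet> v)) = - (LINT x|lborel. ((g1 x + g2 x) \<bullet> v) * \<xi> x)"
     if t: "test_function U2 \<xi>" for \<xi> v
    proof -
     have z: "f1 x * (grad \<xi> x \<bullet> v) = 0" "(g1 x \<bullet> v) * \<xi> x = 0" for x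
      using zero[OF w(1) t, of x] op(3) by (auto simp: Int_commute)
     have "(LINT x|lborel. f1 x * (grad \<xi> x \<bullet> v)) = 0" "(LINT x|lborel. (g1 x \<bullet> v) * \<xi> x) = 0"
      unfolding z by simp_all
     then show ?thesis using split[OF t, of v] a2(5)[OF t, of v] by linarith
    qed
    then show ?thesis using \<open>p \<in> U2\<close> op(2) by blast
   qed
  next
   case False
   then obtain r e n \<gamma> \<gamma>' where ch1: "bchart U1 p r e n \<gamma> \<gamma>'" and ch2: "bchart U2 p r e (- n) (%s. - \<gamma> s) (%s. - \<gamma>' s)"
    using cov[OF p] by blast
   note c = bchartD[OF ch1] and ci = coord2_inner[OF bchartD(2)[OF ch1]]
   let ?g = "%s. coord2 e n s (\<gamma> s)"
   have gc: "continuous_on UNIV ?g" by (intro continuous_intros c(6))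
   obtain L where L: "!!f :: real^2 => ennreal. f \<in> Borel ==>
    (\<integral>\<^sup>+s. f (?g s) * indicator (ball p r) (?g s) \<partial>lborel) \<le> (\<integral>\<^sup>+x. f x * indicator (frontier U1 \<inter> ball p r) x \<partial>hausdorff1)"
    using bchart_hausdorff[OF ch1 op(1)] by blast
   have "(LINT x|lborel. (f1 x + f2 x) * (grad \<xi> x \<bullet> v)) + (LINT x|lborel. ((g1 x + g2 x) \<bullet> v) * \<xi> x) = 0"
    if t: "test_function (ball p r) \<xi>" for \<xi> v
   proof -
    \<comment> \<open>\<open>k\<close> is the boundary density of Green's formula times the test
      function; \<open>h j\<close> below is the jump of the approximants along the graph.\<close>
    define k where "k s = ((v \<bullet> e) * \<gamma>' s - v \<bullet> n) * \<xi> (?g s)" for s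
    have \<xi>0: "\<xi> x = 0" if "x \<notin> ball p r" for x using test_function_outside[OF t that] by simp
    have kc: "continuous_on UNIV k"
     unfolding k_def
     by (intro continuous_intros c(4) continuous_on_compose2[OF smooth_imp_continuous[OF test_function_smooth[OF t]] gc]) auto
    have ks: "sqint k"
    proof (rule continuous_compact_support_integrable(1)[OF kc compact_Icc[of "p \<bullet> e - r" "p \<bullet> e + r"]])
     fix s assume s: "s \<notin> {p \<bullet> e - r..p \<bullet> e + r}"
     have "?g s \<notin> ball p r"
      using ball_inner_bound[of e "?g s" p r] s ci c(2) unfolding orthonormal2_def by metis
     then show "k s = 0" by (simp add: k_def \<xi>0)
    qed
    define w where "w j x = indicator (frontier U1) x *\<^sub>R (u1 j x - u2 j x)" for j x
    define h where "h j s = indicator (ball p r) (?g s) * w j (?g s)" for j s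
    have fr: "?g s \<in> frontier U1" "?g s \<in> closure U2" if "?g s \<in> ball p r" for s
    proof -
     show "?g s \<in> frontier U1" using bchart_frontier[OF ch1 op(1)] that ci by (auto simp: set_eq_iff)
     show "?g s \<in> closure U2" using bchart_closure[OF ch2] that ci by (auto simp: set_eq_iff)
    qed
    have I: "(LINT x|lborel. indicator U1 x * ((\<xi> x *\<^sub>R G1 j x + u1 j x *\<^sub>R grad \<xi> x) \<bullet> v))
     + (LINT x|lborel. indicator U2 x * ((\<xi> x *\<^sub>R G2 j x + u2 j x *\<^sub>R grad \<xi> x) \<bullet> v)) = (LINT s|lborel. k s \<bullet> h j s)" for j
    proof -
     \<comment> \<open>Reversing both the normal and the graph function gives the same
       parametrisation.\<close>
     have c2: "coord2 e (- n) s (- \<gamma> s) = ?g s" for s by simp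
     note i1 = bchart_green(2)[OF ch1 op(1) u1(1) t, of j] and i2 = bchart_green(2)[OF ch2 op(2) u2(1) t, of j, unfolded c2]
     have cc: "integrable lborel (%s. ((v \<bullet> e) * \<gamma>' s - v \<bullet> n) * (\<xi> (?g s) * y (?g s)))"
      if i: "integrable lborel (%s. \<xi> (?g s) * y (?g s))" for y :: "real^2 => real"
     proof -
      have "compact {p \<bullet> e - r..p \<bullet> e + r}" by simp
      then have "compact ((%s. (v \<bullet> e) * \<gamma>' s - v \<bullet> n) ` {p \<bullet> e - r..p \<bullet> e + r})"
       by (intro compact_continuous_image continuous_intros continuous_on_subset[OF c(4)]) auto
      then obtain B where B: "!!s. s \<in> {p \<bullet> e - r..p \<bullet> e + r} ==> \<bar>(v \<bullet> e) * \<gamma>' s - v \<bullet> n\<bar> \<le> B"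
       using compact_imp_bounded bounded_iff by (metis (no_types, lifting) imageI real_norm_def)
      have [measurable]: "\<gamma>' \<in> Borel" using c(4) by (rule borel_measurable_continuous_onI)
      have [measurable]: "(%s. \<xi> (?g s) * y (?g s)) \<in> Borel" using i by simp
      have "integrable lborel (%s. B * (\<xi> (?g s) * y (?g s)))" using i by simp
      then show ?thesis
      proof (rule Bochner_Integration.integrable_bound)
       show "AE s in lborel. norm (((v \<bullet> e) * \<gamma>' s - v \<bullet> n) * (\<xi> (?g s) * y (?g s))) \<le> norm (B * (\<xi> (?g s) * y (?g s)))"
       proof (rule AE_I2)
        fix s
        show "norm (((v \<bullet> e) * \<gamma>' s - v \<bullet> n) * (\<xi> (?g s) * y (?g s))) \<le> norm (B * (\<xi> (?g s) * y (?g s)))"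
        proof (cases "?g s \<in> ball p r")
         case True
         then have "s \<in> {p \<bullet> e - r..p \<bullet> e + r}"
          using ball_inner_bound[of e "?g s" p r] ci c(2) unfolding orthonormal2_def by metis
         from B[OF this] have "\<bar>(v \<bullet> e) * \<gamma>' s - v \<bullet> n\<bar> * \<bar>\<xi> (?g s) * y (?g s)\<bar> \<le> \<bar>B\<bar> * \<bar>\<xi> (?g s) * y (?g s)\<bar>"
          by (intro mult_right_mono) auto
         then show ?thesis by (simp only: real_norm_def abs_mult)
        next
         case False
         then show ?thesis using \<xi>0[OF False] by simp
        qed
       qed
      qed measurable
     qed
     have "(LINT x|lborel. indicator U1 x * ((\<xi> x *\<^sub>R G1 j x + u1 j x *\<^sub>R grad \<xi> x) \<bullet> v))
       = (LINT s|lborel. ((v \<bullet> e) * \<gamma>' s - v \<bullet> n) * (\<xi> (?g s) * u1 j (?g s)))"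
      by (rule bchart_green(1)[OF ch1 op(1) u1(1) t])
     moreover have "(LINT x|lborel. indicator U2 x * ((\<xi> x *\<^sub>R G2 j x + u2 j x *\<^sub>R grad \<xi> x) \<bullet> v))
       = (LINT s|lborel. - (((v \<bullet> e) * \<gamma>' s - v \<bullet> n) * (\<xi> (?g s) * u2 j (?g s))))"
      using bchart_green(1)[OF ch2 op(2) u2(1) t, of j v] unfolding c2 by (simp add: algebra_simps)
     moreover have "(LINT s|lborel. k s \<bullet> h j s) = (LINT s|lborel. ((v \<bullet> e) * \<gamma>' s - v \<bullet> n) * (\<xi> (?g s) * u1 j (?g s))
       - ((v \<bullet> e) * \<gamma>' s - v \<bullet> n) * (\<xi> (?g s) * u2 j (?g s)))"
     proof (rule Bochner_Integration.integral_cong[OF refl])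
      fix s
      show "k s \<bullet> h j s = ((v \<bullet> e) * \<gamma>' s - v \<bullet> n) * (\<xi> (?g s) * u1 j (?g s))
       - ((v \<bullet> e) * \<gamma>' s - v \<bullet> n) * (\<xi> (?g s) * u2 j (?g s))"
      proof (cases "?g s \<in> ball p r")
       case True
       then have hj: "h j s = u1 j (?g s) - u2 j (?g s)" using fr(1)[OF True] by (simp add: h_def w_def del: mem_ball)
       show ?thesis unfolding k_def hj inner_real_def by (simp only: algebra_simps)
      next
       case False
       then show ?thesis using \<xi>0[OF False] by (simp add: k_def)
      qed
     qed
     ultimately show ?thesis using cc[OF i1] cc[OF i2] by simp
    qed
    have hw: "sqint (h j) \<and> norm2 (h j) \<le> l2norm (boundary_measure U1) (%x. u1 j x - u2 j x)" for j
    proof -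
     have cf: "continuous_on (frontier U1 \<inter> ball p r) (%x. u1 j x - u2 j x)"
     proof (intro continuous_intros)
      have "frontier U1 \<inter> ball p r \<subseteq> closure U1" by (auto simp: frontier_def)
      moreover have "frontier U1 \<inter> ball p r \<subseteq> closure U2"
      proof
       fix x assume "x \<in> frontier U1 \<inter> ball p r"
       then have "x \<in> ball p r" "\<gamma> (x \<bullet> e) = x \<bullet> n" using bchart_frontier[OF ch1 op(1)] by blast+
       then have "x \<in> {x \<in> ball p r. - \<gamma> (x \<bullet> e) \<le> x \<bullet> - n}" by simp
       then show "x \<in> closure U2" using bchart_closure[OF ch2] by blast
      qed
      ultimately show "continuous_on (frontier U1 \<inter> ball p r) (u1 j)" "continuous_on (frontier U1 \<inter> ball p r) (u2 j)"
       using u1(1)[of j] u2(1)[of j] by (auto simp: C1_grad_def intro: continuous_on_subset)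
     qed
     define q where "q x = indicator (frontier U1 \<inter> ball p r) x *\<^sub>R (u1 j x - u2 j x)" for x
     have [measurable]: "q \<in> Borel"
      unfolding q_def by (rule borel_measurable_continuous_on_indicator) (use cf in auto)
     have hq: "h j s = q (?g s)" for s by (auto simp: h_def w_def q_def indicator_def)
     have [measurable]: "?g \<in> Borel" using gc by (rule borel_measurable_continuous_onI)
     have hm: "h j \<in> borel_measurable lborel" unfolding hq[abs_def] by measurable
     have "(\<integral>\<^sup>+s. ennreal ((norm (h j s))^2) \<partial>lborel) = (\<integral>\<^sup>+s. ennreal ((q (?g s))^2) * indicator (ball p r) (?g s) \<partial>lborel)"
      by (intro nn_integral_cong) (auto simp: hq q_def indicator_def)
     also have "... \<le> (\<integral>\<^sup>+x. ennreal ((q x)^2) * indicator (frontier U1 \<inter> ball p r) x \<partial>hausdorff1)"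
      by (rule L) measurable
     also have "... \<le> (\<integral>\<^sup>+x. ennreal ((norm (u1 j x - u2 j x))^2) \<partial>boundary_measure U1)"
      unfolding nn_integral_boundary_measure by (intro nn_integral_mono) (auto simp: q_def indicator_def)
     also have "... = ennreal ((l2norm (boundary_measure U1) (%x. u1 j x - u2 j x))^2)"
      by (rule l2norm_nn_integral[OF tr(1)])
     finally show ?thesis using l2norm_le_nn_integral[OF hm _ l2norm_nonneg] by blast
    qed
    have "(%j. LINT s|lborel. k s \<bullet> h j s) \<longlonglongrightarrow> 0"
    proof (rule Lim_null_comparison)
     show "(%j. norm2 k * l2norm (boundary_measure U1) (%x. u1 j x - u2 j x)) \<longlonglongrightarrow> 0"
      using tendsto_mult_left[OF tr(2)] by simp
     show "\<forall>\<^sub>F j in sequentially. norm (LINT s|lborel. k s \<bullet> h j s) \<le> norm2 k * l2norm (boundary_measure U1) (%x. u1 j x - u2 j x)"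
     proof (intro always_eventually allI)
      fix j
      have "norm (LINT s|lborel. k s \<bullet> h j s) \<le> norm2 k * norm2 (h j)"
       using l2norm_Cauchy_Schwarz[OF ks, of "h j"] hw by simp
      also have "... \<le> norm2 k * l2norm (boundary_measure U1) (%x. u1 j x - u2 j x)"
       using hw by (intro mult_left_mono l2norm_nonneg) auto
      finally show "norm (LINT s|lborel. k s \<bullet> h j s) \<le> norm2 k * l2norm (boundary_measure U1) (%x. u1 j x - u2 j x)" .
     qed
    qed
    moreover have "(%j. LINT s|lborel. k s \<bullet> h j s) \<longlonglongrightarrow>
     ((LINT x|lborel. f1 x * (grad \<xi> x \<bullet> v)) + (LINT x|lborel. (g1 x \<bullet> v) * \<xi> x))
     + ((LINT x|lborel. f2 x * (grad \<xi> x \<bullet> v)) + (LINT x|lborel. (g2 x \<bullet> v) * \<xi> x))"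
     unfolding I[symmetric]
     by (intro tendsto_add wgrad_approx_identity[OF w(1) t u1(2-5)] wgrad_approx_identity[OF w(2) t u2(2-5)])
    ultimately show ?thesis unfolding split[OF t] using LIMSEQ_unique by blast
   qed
   then show ?thesis
    using c(1) by (intro exI[of _ "ball p r"]) (auto simp: eq_neg_iff_add_eq_0)
  qed
 next
  fix p assume "p \<notin> W"
  then have "p \<notin> U1" "p \<notin> U2" using op(4,5) by auto
  then show "f1 p + f2 p = 0" "g1 p + g2 p = 0" using a1(3,4)[of p] a2(3,4)[of p] by auto
 qed (intro square_int_add a1(1,2) a2(1,2))+
qed

section \<open>Approximation in $H^1$\<close>

lemma l2norm_sum_le:
 assumes "!!i. i \<in> I ==> square_int M (F i)"
 shows "l2norm M (%x. \<Sum>i\<in>I. F i x) \<le> (\<Sum>i\<in>I. l2norm M (F i))"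
 using assms
proof (induction I rule: infinite_finite_induct)
 case (insert i I)
 have "l2norm M (%x. F i x + (\<Sum>i\<in>I. F i x)) \<le> l2norm M (F i) + l2norm M (%x. \<Sum>i\<in>I. F i x)"
  using insert by (intro l2norm_triangle square_int_sum) auto
 then show ?case using insert by simp
qed (auto simp: l2norm_zero)

lemma wgrad_shift:
 assumes w: "wgrad U f g"
 shows "wgrad {x. x + c \<in> U} (%x. f (x + c)) (%x. g (x + c))"
proof -
 note a = wgradD[OF w]
 show ?thesis
  unfolding wgrad_def
 proof (intro conjI allI impI)
  show "sqint (%x. f (x + c))" "sqint (%x. g (x + c))"
   using square_int_shift(1) a(1,2) by blast+
  fix \<phi> v assume t: "test_function {x. x + c \<in> U} \<phi>"
  obtain K where K: "compact K" "K \<subseteq> {x. x + c \<in> U}" "!!x. x \<notin> K ==> \<phi> x = 0" using test_function_support[OF t] by metis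
  note sm = test_function_smooth[OF t]
  have t': "test_function U (%y. \<phi> (y + - c))"
  proof (rule test_functionI[OF smooth_shift[OF sm]])
   show "compact ((%x. x + c) ` K)" by (intro compact_continuous_image K(1) continuous_intros)
   show "(%x. x + c) ` K \<subseteq> U" using K(2) by auto
   fix x assume "x \<notin> (%x. x + c) ` K"
   moreover have "x = (%x. x + c) (x + - c)" by simp
   ultimately have "x + - c \<notin> K" by blast
   then show "\<phi> (x + - c) = 0" by (rule K(3))
  qed
  have [measurable]: "f \<in> Borel" "g \<in> Borel" "\<phi> \<in> Borel" "grad \<phi> \<in> Borel"
   using a test_function_measurable[OF t] by auto
  have "(LINT x|lborel. f (x + c) * (grad \<phi> x \<bullet> v)) = (LINT x|lborel. f x * (grad \<phi> (x + - c) \<bullet> v))"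
   using integral_shift(1)[of "%x. f x * (grad \<phi> (x + - c) \<bullet> v)" c] by simp
  also have "... = - (LINT x|lborel. (g x \<bullet> v) * \<phi> (x + - c))"
   using a(5)[OF t', of v] unfolding grad_shift[OF sm] .
  also have "(LINT x|lborel. (g x \<bullet> v) * \<phi> (x + - c)) = (LINT x|lborel. (g (x + c) \<bullet> v) * \<phi> x)"
   using integral_shift(1)[of "%x. (g x \<bullet> v) * \<phi> (x + - c)" c] by simp
  finally show "(LINT x|lborel. f (x + c) * (grad \<phi> x \<bullet> v)) = - (LINT x|lborel. (g (x + c) \<bullet> v) * \<phi> x)" .
 qed (use a in auto)
qed

definition local_piece :: "(real^2) set => (real^2 => real) => bool" where
 "local_piece U \<eta> \<longleftrightarrow> test_function U \<eta> \<or> (\<exists>p r e n \<gamma> \<gamma>'. bchart U p r e n \<gamma> \<gamma>' \<and> test_function (ball p r) \<eta>)"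

text \<open>Besides the sum 1, the gradients must cancel on \<open>U\<close>, so that the
  product-rule terms \<open>f x *\<^sub>R grad (\<eta> i) x\<close> disappear when the localised
  gradients are added.\<close>

lemma local_piece_partition:
 assumes U: "open U" "bounded U" "has_bcharts U"
 obtains N :: nat and \<eta> where "!!i. i < N ==> local_piece U (\<eta> i)"
  "!!x. x \<in> U ==> (\<Sum>i<N. \<eta> i x) = 1" "!!x. x \<in> U ==> (\<Sum>i<N. grad (\<eta> i) x) = 0"
proof -
 have K: "compact (closure U)" using U(2) by (simp add: compact_closure)
 define \<U> where "\<U> = insert U {ball p r |p r. \<exists>e n \<gamma> \<gamma>'. bchart U p r e n \<gamma> \<gamma>'}"
 have "\<exists>B\<in>\<U>. open B \<and> x \<in> B" if x: "x \<in> closure U" for x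
 proof (cases "x \<in> U")
  case True
  then show ?thesis using U(1) by (intro bexI[of _ U]) (auto simp: \<U>_def)
 next
  case False
  then have "x \<in> frontier U" using x U(1) by (simp add: frontier_def interior_open)
  from bspec[OF U(3)[unfolded has_bcharts_def] this]
  obtain r e n \<gamma> \<gamma>' where ch: "bchart U x r e n \<gamma> \<gamma>'" by blast
  then have "ball x r \<in> \<U>" unfolding \<U>_def by blast
  then show ?thesis using bchartD(1)[OF ch] by (intro bexI[of _ "ball x r"]) auto
 qed
 from smooth_partition_of_unity[OF K this] obtain N :: nat and \<eta> :: "nat => real^2 => real" where
  \<eta>: "!!i. i < N ==> \<exists>B\<in>\<U>. test_function B (\<eta> i)" "!!x. x \<in> closure U ==> (\<Sum>i<N. \<eta> i x) = 1"
  by metis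
 have sm: "smooth (\<eta> i)" if "i < N" for i using \<eta>(1)[OF that] test_function_smooth by blast
 have 1: "(\<Sum>i<N. \<eta> i x) = 1" if "x \<in> U" for x using \<eta>(2)[of x] closure_subset[of U] that by blast
 show thesis
 proof (rule that[of N \<eta>])
  show "local_piece U (\<eta> i)" if "i < N" for i
   using \<eta>(1)[OF that] unfolding \<U>_def local_piece_def by blast
  fix x assume x: "x \<in> U"
  show "(\<Sum>i<N. \<eta> i x) = 1" by (rule 1[OF x])
  have "((%x. \<Sum>i<N. \<eta> i x) has_derivative (%h. \<Sum>i<N. grad (\<eta> i) x \<bullet> h)) (at x)"
   by (intro has_derivative_sum smooth_grad(1) sm) auto
  then have "grad (%x. \<Sum>i<N. \<eta> i x) x = (\<Sum>i<N. grad (\<eta> i) x)"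
   by (intro grad_eqI) (simp add: inner_sum_left)
  moreover have "grad (%x. \<Sum>i<N. \<eta> i x) x = 0" by (rule grad_locally_zero[OF U(1) x 1])
  ultimately show "(\<Sum>i<N. grad (\<eta> i) x) = 0" by simp
 qed
qed

text \<open>Common frame of two density results: test functions with \<open>A = UNIV\<close>, and
  smooth functions compared only on \<open>A = U\<close>. As \<open>P\<close> is closed under
  addition, it suffices to approximate each localised function.\<close>

lemma wgrad_approx_pieces:
 fixes P :: "(real^2 => real) => bool" and A :: "(real^2) set"
 assumes U: "open U" "bounded U" "has_bcharts U" and w: "wgrad U f g" and e: "e > 0"
  and A: "A \<in> sets borel"
  and Psm: "!!\<phi>. P \<phi> ==> smooth \<phi> \<and> sqint (cut A \<phi>) \<and> sqint (cut A (grad \<phi>))"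
  and P0: "P (%x. 0)" and Padd: "!!\<phi> \<psi>. P \<phi> ==> P \<psi> ==> P (%x. \<phi> x + \<psi> x)"
  and piece: "!!\<eta> e. local_piece U \<eta> ==> e > 0 ==> \<exists>\<phi>. P \<phi> \<and> norm2 (%x. cut A \<phi> x - \<eta> x * f x) \<le> e \<and>
    norm2 (%x. cut A (grad \<phi>) x - (\<eta> x *\<^sub>R g x + f x *\<^sub>R grad \<eta> x)) \<le> e"
 shows "\<exists>\<phi>. P \<phi> \<and> dist2 (cut A \<phi>) f \<le> e \<and> dist2 (cut A (grad \<phi>)) g \<le> e"
proof -
 note a = wgradD[OF w]
 obtain N :: nat and \<eta> where \<eta>: "!!i. i < N ==> local_piece U (\<eta> i)"
  "!!x. x \<in> U ==> (\<Sum>i<N. \<eta> i x) = 1" "!!x. x \<in> U ==> (\<Sum>i<N. grad (\<eta> i) x) = 0"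
  using local_piece_partition[OF U] by metis
 \<comment> \<open>\<open>N + 1\<close> instead of \<open>N\<close>, since the partition may be
   empty.\<close>
 define e' where "e' = e / (real N + 1)"
 have e': "e' > 0" "real N * e' \<le> e" using e by (auto simp: e'_def field_simps)
 define Q where "Q i \<phi> \<longleftrightarrow> P \<phi> \<and> norm2 (%x. cut A \<phi> x - \<eta> i x * f x) \<le> e' \<and>
    norm2 (%x. cut A (grad \<phi>) x - (\<eta> i x *\<^sub>R g x + f x *\<^sub>R grad (\<eta> i) x)) \<le> e'" for i \<phi>
 have "\<exists>\<phi>. Q i \<phi>" if "i < N" for i unfolding Q_def by (rule piece[OF \<eta>(1)[OF that] e'(1)])
 then obtain \<phi> where "!!i. i < N ==> Q i (\<phi> i)" by metis
 then have \<phi>: "!!i. i < N ==> P (\<phi> i)" "!!i. i < N ==> norm2 (%x. cut A (\<phi> i) x - \<eta> i x * f x) \<le> e'"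
  "!!i. i < N ==> norm2 (%x. cut A (grad (\<phi> i)) x - (\<eta> i x *\<^sub>R g x + f x *\<^sub>R grad (\<eta> i) x)) \<le> e'"
  unfolding Q_def by auto
 define \<Phi> where "\<Phi> x = (\<Sum>i<N. \<phi> i x)" for x
 have sP: "P (%x. \<Sum>i<m. \<phi> i x)" if "m \<le> N" for m
  using that
 proof (induction m)
  case (Suc m)
  then show ?case using Padd[OF Suc.IH \<phi>(1)[of m]] by simp
 qed (simp add: P0)
 have gr: "grad \<Phi> x = (\<Sum>i<N. grad (\<phi> i) x)" for x
 proof (rule grad_eqI)
  have "((%x. \<Sum>i<N. \<phi> i x) has_derivative (%h. \<Sum>i<N. grad (\<phi> i) x \<bullet> h)) (at x)"
   by (intro has_derivative_sum smooth_grad(1)) (use Psm[OF \<phi>(1)] in auto)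
  then show "(\<Phi> has_derivative (%h. (\<Sum>i<N. grad (\<phi> i) x) \<bullet> h)) (at x)"
   by (simp add: \<Phi>_def[abs_def] inner_sum_left)
 qed
 have fs: "f x = (\<Sum>i<N. \<eta> i x * f x)" for x
  using a(3)[of x] \<eta>(2)[of x] by (cases "x \<in> U") (auto simp: sum_distrib_right[symmetric])
 have gs: "g x = (\<Sum>i<N. \<eta> i x *\<^sub>R g x + f x *\<^sub>R grad (\<eta> i) x)" for x
  using a(3)[of x] a(4)[of x] \<eta>(2)[of x] \<eta>(3)[of x]
  by (cases "x \<in> U") (auto simp: sum.distrib scaleR_sum_left[symmetric] scaleR_sum_right[symmetric])
 have sm: "test_function UNIV (\<eta> i)" if "i < N" for i
  using \<eta>(1)[OF that] unfolding local_piece_def by (blast intro: test_function_mono)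
 have s12: "sqint (%x. \<eta> i x * f x)" "sqint (%x. \<eta> i x *\<^sub>R g x + f x *\<^sub>R grad (\<eta> i) x)" if "i < N" for i
  using wgradD(1,2)[OF wgrad_mult[OF w sm[OF that], of U]] by auto
 have "dist2 (cut A \<Phi>) f = norm2 (%x. \<Sum>i<N. cut A (\<phi> i) x - \<eta> i x * f x)"
  by (subst fs) (simp add: \<Phi>_def sum_subtractf sum_distrib_left)
 also have "... \<le> (\<Sum>i<N. norm2 (%x. cut A (\<phi> i) x - \<eta> i x * f x))"
  by (rule l2norm_sum_le) (use Psm[OF \<phi>(1)] s12 in \<open>auto intro!: square_int_diff\<close>)
 also have "... \<le> (\<Sum>i<N. e')" by (intro sum_mono \<phi>(2)) auto
 also have "... \<le> e" using e'(2) by simp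
 finally have 1: "dist2 (cut A \<Phi>) f \<le> e" .
 have "dist2 (cut A (grad \<Phi>)) g
   = norm2 (%x. \<Sum>i<N. cut A (grad (\<phi> i)) x - (\<eta> i x *\<^sub>R g x + f x *\<^sub>R grad (\<eta> i) x))"
  by (subst gs) (simp add: gr sum_subtractf scaleR_sum_right)
 also have "... \<le> (\<Sum>i<N. norm2 (%x. cut A (grad (\<phi> i)) x - (\<eta> i x *\<^sub>R g x + f x *\<^sub>R grad (\<eta> i) x)))"
  by (rule l2norm_sum_le) (use Psm[OF \<phi>(1)] s12 in \<open>auto intro!: square_int_diff\<close>)
 also have "... \<le> (\<Sum>i<N. e')" by (intro sum_mono \<phi>(3)) auto
 also have "... \<le> e" using e'(2) by simp
 finally have 2: "dist2 (cut A (grad \<Phi>)) g \<le> e" .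
 have "P \<Phi>" using sP[of N] by (simp add: \<Phi>_def[abs_def])
 with 1 2 show ?thesis by blast
qed

lemma wgrad_approx_interior:
 assumes w: "wgrad U f g" and \<eta>: "test_function U \<eta>" and U: "open U" and e: "e > 0"
 obtains \<phi> where "test_function U \<phi>" "norm2 (%x. \<phi> x - \<eta> x * f x) \<le> e"
  "norm2 (%x. grad \<phi> x - (\<eta> x *\<^sub>R g x + f x *\<^sub>R grad \<eta> x)) \<le> e"
proof -
 obtain K where K: "compact K" "K \<subseteq> U" "!!x. x \<notin> K ==> \<eta> x = 0" "!!x. x \<notin> K ==> grad \<eta> x = 0"
  using test_function_support[OF \<eta>] by metis
 have "wgrad UNIV (%x. \<eta> x * f x) (%x. \<eta> x *\<^sub>R g x + f x *\<^sub>R grad \<eta> x)"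
  by (rule wgrad_mult[OF w \<eta>]) simp
 then show thesis
  by (rule wgrad_approx_test[OF _ K(1) _ _ U K(2) e]) (use K that in auto)
qed

text \<open>A function whose extension by zero is weakly differentiable on the plane can be pushed
  into the domain: shifted along the inner direction of a chart, its localised piece has compact
  support in \<open>U\<close> and can be mollified to a test function.\<close>

lemma wgrad_approx_H0:
 assumes U: "open U" "bounded U" "has_bcharts U" and w: "wgrad UNIV f g"
  and f0: "!!x. x \<notin> U ==> f x = 0" and g0: "!!x. x \<notin> U ==> g x = 0" and e: "e > 0"
 shows "\<exists>\<phi>. test_function U \<phi> \<and> dist2 \<phi> f \<le> e \<and> dist2 (grad \<phi>) g \<le> e"
proof -
 have wU: "wgrad U f g"
  using wgradD[OF w] f0 g0 unfolding wgrad_def by (blast intro: test_function_mono)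
 have "\<exists>\<phi>. test_function U \<phi> \<and> dist2 (cut UNIV \<phi>) f \<le> e \<and> dist2 (cut UNIV (grad \<phi>)) g \<le> e"
 proof (rule wgrad_approx_pieces[OF U wU e])
  fix \<phi> assume t: "test_function U \<phi>"
  show "smooth \<phi> \<and> sqint (cut UNIV \<phi>) \<and> sqint (cut UNIV (grad \<phi>))"
   using test_function_smooth[OF t] test_function_integrable[OF t] by simp
 next
  fix \<eta> :: "real^2 => real" and e :: real assume \<eta>: "local_piece U \<eta>" and e: "e > 0"
  have "\<exists>\<phi>. test_function U \<phi> \<and> norm2 (%x. \<phi> x - \<eta> x * f x) \<le> e \<and>
    norm2 (%x. grad \<phi> x - (\<eta> x *\<^sub>R g x + f x *\<^sub>R grad \<eta> x)) \<le> e"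
  proof (cases "test_function U \<eta>")
   case True
   show ?thesis by (rule wgrad_approx_interior[OF wU True U(1) e]) blast
  next
   case False
   then obtain p r q n \<gamma> \<gamma>' where ch: "bchart U p r q n \<gamma> \<gamma>'" and t: "test_function (ball p r) \<eta>"
    using \<eta> unfolding local_piece_def by blast
   note c = bchartD[OF ch] and on = orthonormal2D[OF bchartD(2)[OF ch]]
   obtain K where K: "compact K" "K \<subseteq> ball p r" "!!x. x \<notin> K ==> \<eta> x = 0" "!!x. x \<notin> K ==> grad \<eta> x = 0"
    using test_function_support[OF t] by metis
   define F where "F x = \<eta> x * f x" for x
   define G where "G x = \<eta> x *\<^sub>R g x + f x *\<^sub>R grad \<eta> x" for x
   have wF: "wgrad UNIV F G" unfolding F_def G_def by (rule wgrad_mult[OF w t]) simp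
   note aF = wgradD[OF wF]
   obtain \<epsilon> where \<epsilon>: "\<epsilon> > 0" "(\<Union>x\<in>K. ball x \<epsilon>) \<subseteq> ball p r"
    using compact_subset_open_imp_ball_epsilon_subset[OF K(1) open_ball K(2)] by blast
   have e2: "e/2 > 0" using e by simp
   obtain d1 where d1: "d1 > 0" "!!z. norm z < d1 ==> norm2 (%x. F (x + z) - F x) < e/2"
    using l2_translation_continuous[OF aF(1) e2] by blast
   obtain d2 where d2: "d2 > 0" "!!z. norm z < d2 ==> norm2 (%x. G (x + z) - G x) < e/2"
    using l2_translation_continuous[OF aF(2) e2] by blast
   define \<tau> where "\<tau> = min (min d1 d2) \<epsilon> / 2"
   have \<tau>: "\<tau> > 0" "\<tau> < d1" "\<tau> < d2" "\<tau> < \<epsilon>" using d1(1) d2(1) \<epsilon>(1) by (auto simp: \<tau>_def min_def)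
   \<comment> \<open>With \<open>x + z\<close> as argument and \<open>z\<close> pointing outward,
     the support moves inward by \<open>\<tau> *\<^sub>R n\<close>.\<close>
   define z where "z = - (\<tau> *\<^sub>R n)"
   have nz: "norm z = \<tau>" using \<tau>(1) c(2) by (simp add: z_def orthonormal2_def)
   define K' where "K' = (%x. x - z) ` (K \<inter> closure U)"
   have K'c: "compact K'" unfolding K'_def
    by (intro compact_continuous_image continuous_intros compact_Int_closed K(1)) auto
   have K'U: "K' \<subseteq> U"
   proof
    fix y assume "y \<in> K'"
    then obtain x where x: "x \<in> K" "x \<in> closure U" "y = x - z" by (auto simp: K'_def)
    have "\<gamma> (x \<bullet> q) \<le> x \<bullet> n" using bchart_closure[OF ch] x K(2) by blast
    then have "\<gamma> (y \<bullet> q) < y \<bullet> n" using on \<tau>(1) by (simp add: x(3) z_def inner_add_left inner_diff_left)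
    moreover have "y \<in> ball x \<epsilon>" using nz \<tau>(4) by (simp add: x(3) dist_norm)
    then have "y \<in> ball p r" using \<epsilon>(2) x(1) by blast
    ultimately show "y \<in> U" using c(5) by blast
   qed
   have z0: "F (x + z) = 0" "G (x + z) = 0" if "x \<notin> K'" for x
   proof -
    have "x + z \<notin> K \<or> x + z \<notin> closure U" using that unfolding K'_def by (metis IntI add_diff_cancel image_eqI)
    then have "x + z \<notin> K \<or> x + z \<notin> U" using closure_subset[of U] by blast
    then show "F (x + z) = 0" "G (x + z) = 0"
     using K(3,4)[of "x + z"] f0[of "x + z"] g0[of "x + z"] by (auto simp: F_def G_def)
   qed
   have wz: "wgrad UNIV (%x. F (x + z)) (%x. G (x + z))" using wgrad_shift[OF wF, of z] by simp
   obtain \<phi> where \<phi>: "test_function U \<phi>" "norm2 (%x. \<phi> x - F (x + z)) \<le> e/2" "norm2 (%x. grad \<phi> x - G (x + z)) \<le> e/2"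
    using wgrad_approx_test[OF wz K'c z0 U(1) K'U e2] by blast
   note tI = test_function_integrable[OF \<phi>(1)] and sz = square_int_shift(1)[OF aF(1), of z] square_int_shift(1)[OF aF(2), of z]
   have "dist2 \<phi> F \<le> e"
    using l2norm_diff_triangle[OF tI(1) sz(1) aF(1)] \<phi>(2) d1(2)[of z] nz \<tau> by linarith
   moreover have "dist2 (grad \<phi>) G \<le> e"
    using l2norm_diff_triangle[OF tI(3) sz(2) aF(2)] \<phi>(3) d2(2)[of z] nz \<tau> by linarith
   ultimately show ?thesis using \<phi>(1) unfolding F_def G_def by blast
  qed
  then show "\<exists>\<phi>. test_function U \<phi> \<and> norm2 (%x. cut UNIV \<phi> x - \<eta> x * f x) \<le> e \<and>
    norm2 (%x. cut UNIV (grad \<phi>) x - (\<eta> x *\<^sub>R g x + f x *\<^sub>R grad \<eta> x)) \<le> e" by simp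
 qed (auto intro: test_function_zero test_function_add)
 then show ?thesis by simp
qed

lemma smooth_C1_grad:
 assumes "smooth \<phi>"
 shows "C1_grad U \<phi> (grad \<phi>)"
 using smooth_imp_continuous[OF assms] smooth_grad_continuous[OF assms] smooth_grad(1)[OF assms]
 by (auto simp: C1_grad_def intro: continuous_on_subset)

text \<open>Near the boundary, the function is first translated into the domain, so that its
 mollification only uses values inside.\<close>

lemma wgrad_approx_smooth:
 assumes U: "open U" "bounded U" "has_bcharts U" and w: "wgrad U f g" and e: "e > 0"
 shows "\<exists>\<phi>. smooth \<phi> \<and> dist2 (cut U \<phi>) f \<le> e \<and> dist2 (cut U (grad \<phi>)) g \<le> e"
proof (rule wgrad_approx_pieces[OF U w e])
 show "U \<in> sets borel" using U(1) by simp
 fix \<phi> :: "real^2 => real" assume s: "smooth \<phi>"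
 note C = smooth_C1_grad[OF s, of U]
 show "smooth \<phi> \<and> sqint (cut U \<phi>) \<and> sqint (cut U (grad \<phi>))"
  using s C1_grad_indicator[OF U(1,2), of \<phi>] C1_grad_indicator[OF U(1,2), of "grad \<phi>"] C unfolding C1_grad_def by blast
next
 fix \<eta> :: "real^2 => real" and e :: real assume \<eta>: "local_piece U \<eta>" and e: "e > 0"
 show "\<exists>\<phi>. smooth \<phi> \<and> norm2 (%x. cut U \<phi> x - \<eta> x * f x) \<le> e \<and>
    norm2 (%x. cut U (grad \<phi>) x - (\<eta> x *\<^sub>R g x + f x *\<^sub>R grad \<eta> x)) \<le> e"
 proof (cases "test_function U \<eta>")
  case True
  obtain \<phi> where \<phi>: "test_function U \<phi>" "norm2 (%x. \<phi> x - \<eta> x * f x) \<le> e"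
   "norm2 (%x. grad \<phi> x - (\<eta> x *\<^sub>R g x + f x *\<^sub>R grad \<eta> x)) \<le> e"
   using wgrad_approx_interior[OF w True U(1) e] by blast
  have ind: "cut U \<phi> x = \<phi> x" "cut U (grad \<phi>) x = grad \<phi> x" for x
   using test_function_outside[OF \<phi>(1), of x] by (auto simp: indicator_def)
  have "smooth \<phi> \<and> norm2 (%x. cut U \<phi> x - \<eta> x * f x) \<le> e \<and>
    norm2 (%x. cut U (grad \<phi>) x - (\<eta> x *\<^sub>R g x + f x *\<^sub>R grad \<eta> x)) \<le> e"
   unfolding ind using \<phi> test_function_smooth[OF \<phi>(1)] by blast
  then show ?thesis by blast
 next
  case False
  then obtain p r q n \<gamma> \<gamma>' where ch: "bchart U p r q n \<gamma> \<gamma>'" and t: "test_function (ball p r) \<eta>"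
   using \<eta> unfolding local_piece_def by blast
  note c = bchartD[OF ch] and on = orthonormal2D[OF bchartD(2)[OF ch]]
  have nq: "norm q = 1" "norm n = 1" using c(2) by (auto simp: orthonormal2_def)
  obtain \<gamma>c M where M: "M \<ge> 0" "!!s t. \<bar>\<gamma>c s - \<gamma>c t\<bar> \<le> M * \<bar>s - t\<bar>" "!!s. s \<in> {p \<bullet> q - r..p \<bullet> q + r} ==> \<gamma>c s = \<gamma> s"
   using bchart_lipschitz[OF ch] by metis
  \<comment> \<open>The same set as \<open>U\<close> inside the ball, but with a globally Lipschitz
    graph, whose constant \<open>M\<close> limits the mollification radius below.\<close>
  define E where "E = {x. \<gamma>c (x \<bullet> q) < x \<bullet> n}"
  have UE: "U \<inter> ball p r = E \<inter> ball p r"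
  proof -
   have "\<gamma>c (x \<bullet> q) = \<gamma> (x \<bullet> q)" if "x \<in> ball p r" for x using M(3)[OF ball_inner_bound[OF nq(1) that]] .
   then have "E \<inter> ball p r = {x \<in> ball p r. \<gamma> (x \<bullet> q) < x \<bullet> n}" unfolding E_def by auto
   then show ?thesis using c(5) by simp
  qed
  obtain K where K: "compact K" "K \<subseteq> ball p r" "!!x. x \<notin> K ==> \<eta> x = 0" "!!x. x \<notin> K ==> grad \<eta> x = 0"
   using test_function_support[OF t] by metis
  define F where "F x = \<eta> x * f x" for x
  define G where "G x = \<eta> x *\<^sub>R g x + f x *\<^sub>R grad \<eta> x" for x
  have wF: "wgrad E F G" unfolding F_def G_def by (rule wgrad_mult[OF w t UE])
  note aF = wgradD[OF wF]
  have F0: "F x = 0" "G x = 0" if "x \<notin> K" for x using K(3,4)[OF that] by (auto simp: F_def G_def)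
  have FU: "F x = 0" "G x = 0" if "x \<notin> U" for x
   using wgradD(3,4)[OF w, of x] that by (auto simp: F_def G_def)
  obtain \<epsilon> where \<epsilon>: "\<epsilon> > 0" "(\<Union>x\<in>K. ball x \<epsilon>) \<subseteq> ball p r"
   using compact_subset_open_imp_ball_epsilon_subset[OF K(1) open_ball K(2)] by blast
  have e2: "e/2 > 0" using e by simp
  obtain d1 where d1: "d1 > 0" "!!z. norm z < d1 ==> norm2 (%x. F (x + z) - F x) < e/2"
   using l2_translation_continuous[OF aF(1) e2] by blast
  obtain d2 where d2: "d2 > 0" "!!z. norm z < d2 ==> norm2 (%x. G (x + z) - G x) < e/2"
   using l2_translation_continuous[OF aF(2) e2] by blast
  define \<tau> where "\<tau> = min (min d1 d2) (\<epsilon> / 2) / 2"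
  have \<tau>: "\<tau> > 0" "\<tau> < d1" "\<tau> < d2" "\<tau> < \<epsilon> / 2" using d1(1) d2(1) \<epsilon>(1) by (auto simp: \<tau>_def min_def)
  \<comment> \<open>Opposite sign to \<open>wgrad_approx_H0\<close>: the value at \<open>x\<close>
    is taken from further inside, so the shifted epigraph contains a ball of fixed radius around
    each point of \<open>U\<close> in the chart.\<close>
  define z where "z = \<tau> *\<^sub>R n"
  have nz: "norm z = \<tau>" using \<tau>(1) nq by (simp add: z_def)
  define Fz where "Fz x = F (x + z)" for x
  define Gz where "Gz x = G (x + z)" for x
  define Kz where "Kz = (%x. x - z) ` K"
  have Kzc: "compact Kz" unfolding Kz_def by (intro compact_continuous_image continuous_intros K(1))
  have Fz0: "Fz x = 0" "Gz x = 0" if "x \<notin> Kz" for x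
  proof -
   have "x + z \<notin> K" using that unfolding Kz_def by (metis add_diff_cancel image_eqI)
   then show "Fz x = 0" "Gz x = 0" using F0 by (auto simp: Fz_def Gz_def)
  qed
  have Kzb: "(\<Union>x\<in>Kz. ball x (\<epsilon>/2)) \<subseteq> ball p r"
  proof
   fix y assume "y \<in> (\<Union>x\<in>Kz. ball x (\<epsilon>/2))"
   then obtain x where x: "x \<in> K" "dist (x - z) y < \<epsilon>/2" by (auto simp: Kz_def)
   have "dist x (x - z) = \<tau>" using nz by (simp add: dist_norm)
   then have "dist x y < \<epsilon>" using dist_triangle[of x y "x - z"] x(2) \<tau>(4) by linarith
   then have "y \<in> ball x \<epsilon>" by simp
   then show "y \<in> ball p r" using \<epsilon>(2) x(1) by blast
  qed
  have sz: "sqint Fz" "sqint Gz"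
   unfolding Fz_def Gz_def using square_int_shift(1) aF(1,2) by blast+
  have wz: "wgrad {x. x + z \<in> E} Fz Gz" unfolding Fz_def Gz_def by (rule wgrad_shift[OF wF])
  have iz: "integrable lborel Fz" "integrable lborel Gz"
   using square_int_bounded_support_integrable[OF sz(1) compact_imp_bounded[OF Kzc]] square_int_bounded_support_integrable[OF sz(2) compact_imp_bounded[OF Kzc]] Fz0 by blast+
  \<comment> \<open>A displacement shorter than \<open>d\<close> lowers the height above the graph
    by at most \<open>d + M * d\<close>, which is less than \<open>\<tau>\<close> if
    \<open>d\<close> is below \<open>\<tau> / (1 + M)\<close>. Below \<open>\<epsilon>/2\<close> the
    mollified support stays in the ball.\<close>
  have "min (\<epsilon>/2) (\<tau> / (1 + M)) > 0" using \<epsilon>(1) \<tau>(1) M(1) by simp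
  from mollifier_approx[OF sz(1) iz(1) sz(2) iz(2) e2 this]
  obtain d \<rho> where d: "0 < d" "d < min (\<epsilon>/2) (\<tau> / (1 + M))" "mollifier d \<rho>"
   "sqint (mollify \<rho> Fz)" "dist2 (mollify \<rho> Fz) Fz \<le> e/2"
   "sqint (mollify \<rho> Gz)" "dist2 (mollify \<rho> Gz) Gz \<le> e/2" by blast
  have d\<epsilon>: "d < \<epsilon>/2" and dM: "d * (1 + M) < \<tau>" using d(2) M(1) by (auto simp: pos_less_divide_eq)
  define \<phi> where "\<phi> = mollify \<rho> Fz"
  have t\<phi>: "test_function (ball p r) \<phi>"
   unfolding \<phi>_def by (rule test_function_mollify[OF d(3) iz(1) Kzc Fz0(1) Kzb d(1) d\<epsilon>])
  have gr: "grad \<phi> x = mollify \<rho> Gz x" if x: "x \<in> U" for x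
  proof (cases "x \<in> ball p r")
   case True
   then have "x \<in> E" using UE x by blast
   have "ball x d \<subseteq> {x. x + z \<in> E}"
   proof
    fix y assume "y \<in> ball x d"
    then have xy: "norm (x - y) < d" by (simp add: dist_norm)
    have 1: "\<bar>(y - x) \<bullet> q\<bar> \<le> d" "\<bar>(y - x) \<bullet> n\<bar> \<le> d"
     using Cauchy_Schwarz_ineq2[of "y - x" q] Cauchy_Schwarz_ineq2[of "y - x" n] xy nq by (auto simp: norm_minus_commute)
    have "\<gamma>c (y \<bullet> q) \<le> \<gamma>c (x \<bullet> q) + M * \<bar>y \<bullet> q - x \<bullet> q\<bar>" using M(2)[of "y \<bullet> q" "x \<bullet> q"] by linarith
    also have "M * \<bar>y \<bullet> q - x \<bullet> q\<bar> \<le> M * d" using 1(1) M(1) by (intro mult_left_mono) (auto simp: inner_diff_left)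
    finally have "\<gamma>c (y \<bullet> q) \<le> \<gamma>c (x \<bullet> q) + M * d" by simp
    moreover have "\<gamma>c (x \<bullet> q) < x \<bullet> n" using \<open>x \<in> E\<close> by (simp add: E_def)
    moreover have "x \<bullet> n \<le> y \<bullet> n + d" using 1(2) by (simp add: inner_diff_left)
    ultimately have "\<gamma>c (y \<bullet> q) < y \<bullet> n + \<tau>" using dM by (simp add: algebra_simps)
    then show "y \<in> {x. x + z \<in> E}" using on by (simp add: E_def z_def inner_add_left)
   qed
   then show ?thesis unfolding \<phi>_def by (rule grad_mollify_wgrad[OF wz iz d(3)])
  next
   case False
   have "mollify \<rho> Gz x = 0"
   proof (rule mollify_zero[OF d(3)])
    fix y assume y: "dist x y < d"
    have "y \<notin> Kz"
    proof
     assume "y \<in> Kz"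
     then have "x \<in> (\<Union>x\<in>Kz. ball x (\<epsilon>/2))" using y d\<epsilon> by (force simp: dist_commute)
     then show False using Kzb False by blast
    qed
    then show "Gz y = 0" by (rule Fz0)
   qed
   then show ?thesis using test_function_outside[OF t\<phi> False] by simp
  qed
  have [measurable]: "U \<in> sets borel" "\<phi> \<in> Borel" "grad \<phi> \<in> Borel"
   "F \<in> Borel" "G \<in> Borel"
   using U(1) aF(6,7) test_function_measurable[OF t\<phi>] by auto
  have m1: "dist2 (cut U \<phi>) F \<le> dist2 \<phi> F"
  proof (rule l2norm_mono)
   show "sqint (%x. \<phi> x - F x)" using d(4) aF(1) unfolding \<phi>_def by (rule square_int_diff)
   show "(%x. cut U \<phi> x - F x) \<in> borel_measurable lborel"
    by measurable
   show "AE x in lborel. norm (cut U \<phi> x - F x) \<le> norm (\<phi> x - F x)"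
    using FU(1) by (auto simp: indicator_def)
  qed
  have m2: "dist2 (cut U (grad \<phi>)) G \<le> dist2 (mollify \<rho> Gz) G"
  proof (rule l2norm_mono)
   show "sqint (%x. mollify \<rho> Gz x - G x)" using d(6) aF(2) by (rule square_int_diff)
   show "(%x. cut U (grad \<phi>) x - G x) \<in> borel_measurable lborel"
    by measurable
   show "AE x in lborel. norm (cut U (grad \<phi>) x - G x) \<le> norm (mollify \<rho> Gz x - G x)"
    using FU(2) gr by (auto simp: indicator_def)
  qed
  have "dist2 \<phi> F \<le> dist2 \<phi> Fz + dist2 Fz F"
   using l2norm_diff_triangle[OF d(4) sz(1) aF(1)] by (simp add: \<phi>_def)
  also have "... \<le> e/2 + e/2" using d(5) d1(2)[of z] nz \<tau> by (intro add_mono) (auto simp: \<phi>_def Fz_def)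
  finally have 1: "dist2 (cut U \<phi>) F \<le> e" using m1 by simp
  have "dist2 (mollify \<rho> Gz) G \<le> dist2 (mollify \<rho> Gz) Gz + dist2 Gz G"
   by (rule l2norm_diff_triangle[OF d(6) sz(2) aF(2)])
  also have "... \<le> e/2 + e/2" using d(7) d2(2)[of z] nz \<tau> by (intro add_mono) (auto simp: Gz_def)
  finally have 2: "dist2 (cut U (grad \<phi>)) G \<le> e" using m2 by simp
  show ?thesis using 1 2 test_function_smooth[OF t\<phi>] unfolding F_def G_def by blast
 qed
qed (auto intro: smooth_const smooth_add)

section \<open>Sobolev classes\<close>

abbreviation cls :: "'a::euclidean_space set => ('a => real) => ('a => real) set" where
 "cls U f \<equiv> ae_class (lebesgue_on U) f"

abbreviation "tr U f \<equiv> rep (boundary_trace U (cls U f))"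

text \<open>Members of a class are arbitrary outside \<open>U\<close>, so cutting off changes
  nothing; this links functions in \<open>wgrad\<close> form with the classes of the
  definitions.\<close>

lemma cls_indicator: "cls U (%x. indicator U x * u x) = cls U u"
proof -
 have "(AE x in lebesgue_on U. g x = indicator U x * u x) \<longleftrightarrow> (AE x in lebesgue_on U. g x = u x)" for g
  by (rule AE_cong) (simp add: indicator_def)
 then show ?thesis by (simp add: ae_class_def)
qed

lemma rep_cls:
 fixes f :: "'a::euclidean_space => real"
 assumes "f \<in> Borel"
 shows "rep (cls U f) \<in> borel_measurable (lebesgue_on U)" "AE x in lebesgue_on U. rep (cls U f) x = f x"
 using rep_ae_class[OF borel_measurable_lebesgue_on[OF assms]] .

lemma cls_eq_iff:
 fixes f g :: "'a::euclidean_space => real"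
 assumes "U \<in> sets borel" "f \<in> Borel" "g \<in> Borel"
 shows "cls U f = cls U g \<longleftrightarrow> (AE x in lborel. x \<in> U --> f x = g x)"
 using assms by (simp add: ae_class_eq_iff borel_measurable_lebesgue_on AE_lebesgue_on_iff)

lemma cls_L2:
 assumes "U \<in> sets borel" "sqint f"
 shows "cls U f \<in> L2 U"
 using square_int_lebesgue_on[OF assms] by (rule L2_of_ae_class)

lemma L2_dist_cls:
 fixes f g :: "'a::euclidean_space => real"
 assumes "U \<in> sets borel" "f \<in> Borel" "g \<in> Borel" "!!x. x \<notin> U ==> f x = g x"
 shows "L2_dist (lebesgue_on U) (cls U f) (cls U g) = dist2 f g"
proof -
 have "L2_dist (lebesgue_on U) (cls U f) (cls U g) = l2norm (lebesgue_on U) (%x. f x - g x)"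
  using assms(2,3) by (intro L2_dist_ae_class borel_measurable_lebesgue_on)
 also have "... = dist2 f g"
  using assms by (intro l2norm_lebesgue_on) auto
 finally show ?thesis .
qed

lemma integral_rep_cls:
 fixes f h :: "'a::euclidean_space => real"
 assumes U: "U \<in> sets borel" and f: "f \<in> Borel" "!!x. x \<notin> U ==> f x = 0" and h: "h \<in> Borel"
 shows "(LINT x|lebesgue_on U. rep (cls U f) x * h x) = (LINT x|lborel. f x * h x)"
proof -
 note [measurable] = rep_cls(1)[OF f(1), of U] borel_measurable_lebesgue_on[OF f(1), of U] borel_measurable_lebesgue_on[OF h, of U]
 have "(LINT x|lebesgue_on U. rep (cls U f) x * h x) = (LINT x|lebesgue_on U. f x * h x)"
  by (rule integral_cong_AE, measurable) (use rep_cls(2)[OF f(1), of U] in \<open>auto elim: eventually_mono\<close>)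
 also have "... = (LINT x|lborel. f x * h x)"
  by (rule integral_lebesgue_on[OF U]) (use f h in auto)
 finally show ?thesis .
qed

lemma is_weak_partial_cls:
 fixes f h :: "'a::euclidean_space => real"
 assumes U: "U \<in> sets borel" and f: "f \<in> Borel" "!!x. x \<notin> U ==> f x = 0"
  and h: "h \<in> Borel" "!!x. x \<notin> U ==> h x = 0"
 shows "is_weak_partial U b (cls U f) (cls U h) \<longleftrightarrow>
  (\<forall>\<phi>. test_function U \<phi> --> (LINT x|lborel. f x * (grad \<phi> x \<bullet> b)) = - (LINT x|lborel. h x * \<phi> x))"
proof -
 have "((LINT x|lebesgue_on U. rep (cls U f) x * frechet_derivative \<phi> (at x) b) = - (LINT x|lebesgue_on U. rep (cls U h) x * \<phi> x))
  \<longleftrightarrow> (LINT x|lborel. f x * (grad \<phi> x \<bullet> b)) = - (LINT x|lborel. h x * \<phi> x)" if t: "test_function U \<phi>" for \<phi>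
 proof -
  have [measurable]: "\<phi> \<in> Borel" "grad \<phi> \<in> Borel" using test_function_measurable[OF t] by auto
  have "frechet_derivative \<phi> (at x) b = grad \<phi> x \<bullet> b" for x
   using frechet_derivative_at[OF smooth_grad(1)[OF test_function_smooth[OF t]], of x] by metis
  moreover have "(LINT x|lebesgue_on U. rep (cls U f) x * (grad \<phi> x \<bullet> b)) = (LINT x|lborel. f x * (grad \<phi> x \<bullet> b))"
   by (rule integral_rep_cls[OF U f]) measurable
  moreover have "(LINT x|lebesgue_on U. rep (cls U h) x * \<phi> x) = (LINT x|lborel. h x * \<phi> x)"
   by (rule integral_rep_cls[OF U h]) measurable
  ultimately show ?thesis by simp
 qed
 then show ?thesis unfolding is_weak_partial_def by blast
qed

text \<open>Uniqueness of weak derivatives, from the fundamental lemma, evaluates the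
  \<open>THE\<close> in \<open>weak_partial\<close>.\<close>

lemma weak_partial_eqI:
 fixes f h :: "'a::euclidean_space => real"
 assumes U: "open U" and f: "f \<in> Borel" "!!x. x \<notin> U ==> f x = 0"
  and h: "sqint h" "!!x. x \<notin> U ==> h x = 0"
  and eq: "!!\<phi>. test_function U \<phi> ==> (LINT x|lborel. f x * (grad \<phi> x \<bullet> b)) = - (LINT x|lborel. h x * \<phi> x)"
 shows "weak_partial U b (cls U f) = cls U h"
 unfolding weak_partial_def
proof (rule the_equality)
 have Ub: "U \<in> sets borel" using U by simp
 note hm = square_int_measurable[OF h(1), simplified]
 show "cls U h \<in> L2 U \<and> is_weak_partial U b (cls U f) (cls U h)"
  using cls_L2[OF Ub h(1)] eq is_weak_partial_cls[OF Ub f hm h(2)] by blast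
 fix k assume k: "k \<in> L2 U \<and> is_weak_partial U b (cls U f) k"
 obtain h' where h': "sqint h'" "!!x. x \<notin> U ==> h' x = 0" "k = cls U h'"
  using L2_borel_rep[OF Ub] k by blast
 note hm' = square_int_measurable[OF h'(1), simplified]
 have "AE x in lborel. h' x = h x"
 proof (rule wgrad_unique_dir[OF U h'(1,2) h])
  fix \<phi> assume t: "test_function U \<phi>"
  have "(LINT x|lborel. f x * (grad \<phi> x \<bullet> b)) = - (LINT x|lborel. h' x * \<phi> x)"
   using is_weak_partial_cls[OF Ub f hm' h'(2)] k t unfolding h'(3) by blast
  then show "(LINT x|lborel. h' x * \<phi> x) = (LINT x|lborel. h x * \<phi> x)" using eq[OF t] by simp
 qed
 then show "k = cls U h" unfolding h'(3) using cls_eq_iff[OF Ub hm' hm] by (auto elim: eventually_mono)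
qed

lemma weak_partial_cls:
 assumes "open U" "wgrad U f g"
 shows "weak_partial U b (cls U f) = cls U (%x. g x \<bullet> b)"
 using wgradD[OF assms(2)] by (intro weak_partial_eqI[OF assms(1)]) (auto intro: square_int_inner_const)

lemma H1_cls:
 assumes U: "open U" and w: "wgrad U f g"
 shows "cls U f \<in> H1 U"
proof -
 have Ub: "U \<in> sets borel" using U by simp
 note a = wgradD[OF w]
 have "cls U (%x. g x \<bullet> b) \<in> L2 U \<and> is_weak_partial U b (cls U f) (cls U (%x. g x \<bullet> b))" for b
 proof
  show "cls U (%x. g x \<bullet> b) \<in> L2 U" by (rule cls_L2[OF Ub square_int_inner_const[OF a(2)]])
  have "(%x. g x \<bullet> b) \<in> Borel" using a(7) by measurable
  then show "is_weak_partial U b (cls U f) (cls U (%x. g x \<bullet> b))"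
   using a by (subst is_weak_partial_cls[OF Ub]) auto
 qed
 then show ?thesis unfolding H1_def using cls_L2[OF Ub a(1)] by blast
qed

text \<open>The partial derivatives are given as classes, one basis vector at a time; they are
  assembled into one vector field, and linearity extends the identity to every direction
  \<open>v\<close>.\<close>

lemma H1_borel_rep:
 assumes U: "open U" and u: "u \<in> H1 U"
 obtains f g where "wgrad U f g" "u = cls U f"
proof -
 have Ub: "U \<in> sets borel" using U by simp
 have "u \<in> L2 U" using u by (simp add: H1_def)
 then obtain f where f: "sqint f" "!!x. x \<notin> U ==> f x = 0" "u = cls U f"
  using L2_borel_rep[OF Ub] by blast
 note fm = square_int_measurable[OF f(1), simplified]
 define Q where "Q b h \<longleftrightarrow> sqint h \<and> (\<forall>x. x \<notin> U --> h x = 0) \<and>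
  (\<forall>\<phi>. test_function U \<phi> --> (LINT x|lborel. f x * (grad \<phi> x \<bullet> b)) = - (LINT x|lborel. h x * \<phi> x))" for b :: 'a and h
 have "\<exists>h. Q b h" if b: "b \<in> Basis" for b
 proof -
  obtain k where k: "k \<in> L2 U" "is_weak_partial U b u k" using u b unfolding H1_def by blast
  obtain h where h: "sqint h" "!!x. x \<notin> U ==> h x = 0" "k = cls U h"
   using L2_borel_rep[OF Ub k(1)] by blast
  have "Q b h" unfolding Q_def
   using h k(2) is_weak_partial_cls[OF Ub fm f(2) square_int_measurable[OF h(1), simplified] h(2)] f(3) by blast
  then show ?thesis by blast
 qed
 then obtain h where "!!b. b \<in> Basis ==> Q b (h b)" by metis
 then have h: "!!b. b \<in> Basis ==> sqint (h b)" "!!b x. b \<in> Basis ==> x \<notin> U ==> h b x = 0"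
  "!!b \<phi>. b \<in> Basis ==> test_function U \<phi> ==> (LINT x|lborel. f x * (grad \<phi> x \<bullet> b)) = - (LINT x|lborel. h b x * \<phi> x)"
  unfolding Q_def by blast+
 define g where "g x = (\<Sum>b\<in>Basis. h b x *\<^sub>R b)" for x
 have s: "sqint (%x. h b x *\<^sub>R b)" if "b \<in> Basis" for b
  by (rule square_int_bound[OF _ h(1)[OF that], where C = 1])
   (use square_int_measurable[OF h(1)[OF that]] that in auto)
 have gs: "sqint g" unfolding g_def by (rule square_int_sum[OF s])
 have "wgrad U f g"
  unfolding wgrad_def
 proof (intro conjI allI impI)
  fix \<phi> v assume t: "test_function U \<phi>"
  note tI = test_function_integrable[OF t]
  have i1: "integrable lborel (%x. f x * (grad \<phi> x \<bullet> b))" for b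
   by (rule square_int_integrable_prod[OF f(1) square_int_inner_const[OF tI(3)]])
  have i2: "integrable lborel (%x. h b x * \<phi> x)" if "b \<in> Basis" for b
   by (rule square_int_integrable_prod[OF h(1)[OF that] tI(1)])
  have "f x * (grad \<phi> x \<bullet> v) = (\<Sum>b\<in>Basis. (v \<bullet> b) * (f x * (grad \<phi> x \<bullet> b)))" for x
   by (subst euclidean_inner[of _ v]) (simp add: sum_distrib_left mult_ac)
  then have "(LINT x|lborel. f x * (grad \<phi> x \<bullet> v)) = (\<Sum>b\<in>Basis. (v \<bullet> b) * (LINT x|lborel. f x * (grad \<phi> x \<bullet> b)))"
   using i1 by simp
  also have "... = (\<Sum>b\<in>Basis. (v \<bullet> b) * - (LINT x|lborel. h b x * \<phi> x))"
   by (intro sum.cong refl) (simp add: h(3)[OF _ t])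
  also have "... = - (\<Sum>b\<in>Basis. (LINT x|lborel. (v \<bullet> b) * (h b x * \<phi> x)))" by (simp add: sum_negf)
  also have "(\<Sum>b\<in>Basis. (LINT x|lborel. (v \<bullet> b) * (h b x * \<phi> x))) = (LINT x|lborel. (\<Sum>b\<in>Basis. (v \<bullet> b) * (h b x * \<phi> x)))"
   using i2 by (intro Bochner_Integration.integral_sum[symmetric]) auto
  also have "(%x. \<Sum>b\<in>Basis. (v \<bullet> b) * (h b x * \<phi> x)) = (%x. (g x \<bullet> v) * \<phi> x)"
  proof (rule ext)
   fix x
   have "(g x \<bullet> v) * \<phi> x = (\<Sum>b\<in>Basis. (h b x * (b \<bullet> v)) * \<phi> x)"
    unfolding g_def inner_sum_left sum_distrib_right by simp
   also have "... = (\<Sum>b\<in>Basis. (v \<bullet> b) * (h b x * \<phi> x))"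
    by (rule sum.cong) (simp_all add: inner_commute mult_ac)
   finally show "(\<Sum>b\<in>Basis. (v \<bullet> b) * (h b x * \<phi> x)) = (g x \<bullet> v) * \<phi> x" by simp
  qed
  finally show "(LINT x|lborel. f x * (grad \<phi> x \<bullet> v)) = - (LINT x|lborel. (g x \<bullet> v) * \<phi> x)" .
 qed (use f gs h in \<open>auto simp: g_def\<close>)
 then show thesis using that f(3) by blast
qed

lemma l2norm_euclidean:
 fixes g :: "'a => 'b::euclidean_space"
 assumes "square_int M g"
 shows "(l2norm M g)^2 = (\<Sum>b\<in>Basis. (l2norm M (%x. g x \<bullet> b))^2)"
proof -
 have "integrable M (%x. (g x \<bullet> b)^2)" for b
  using square_int_inner_const[OF assms, of b] by (simp add: square_int_def)
 then have "(\<Sum>b\<in>Basis. (l2norm M (%x. g x \<bullet> b))^2) = (LINT x|M. (\<Sum>b\<in>Basis. (g x \<bullet> b)^2))"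
  by (simp add: l2norm_power2)
 also have "... = (l2norm M g)^2"
  unfolding l2norm_power2 power2_norm_eq_inner by (subst euclidean_inner) (simp add: power2_eq_square)
 finally show ?thesis by simp
qed

lemma H1_dist_cls:
 assumes U: "open U" and w: "wgrad U f g" "wgrad U f' g'"
 shows "H1_dist U (cls U f) (cls U f') = sqrt ((dist2 f f')^2 + (dist2 g g')^2)"
proof -
 have Ub: "U \<in> sets borel" using U by simp
 note a = wgradD[OF w(1)] and b = wgradD[OF w(2)]
 have "L2_dist (lebesgue_on U) (cls U (%x. g x \<bullet> c)) (cls U (%x. g' x \<bullet> c)) = norm2 (%x. (g x - g' x) \<bullet> c)" for c
  unfolding inner_diff_left using a b by (intro L2_dist_cls[OF Ub]) auto
 moreover have "L2_dist (lebesgue_on U) (cls U f) (cls U f') = dist2 f f'"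
  using a b by (intro L2_dist_cls[OF Ub]) auto
 ultimately show ?thesis
  unfolding H1_dist_def weak_partial_cls[OF U w(1)] weak_partial_cls[OF U w(2)]
  using l2norm_euclidean[OF square_int_diff[OF a(2) b(2)]] by simp
qed

lemma H1_dist_bounds:
 assumes U: "open U" and w: "wgrad U f g" "wgrad U f' g'"
 shows "dist2 f f' \<le> H1_dist U (cls U f) (cls U f')"
  "dist2 g g' \<le> H1_dist U (cls U f) (cls U f')"
  "H1_dist U (cls U f) (cls U f') \<le> dist2 f f' + dist2 g g'"
  "0 \<le> H1_dist U (cls U f) (cls U f')"
 unfolding H1_dist_cls[OF assms]
 using sqrt_sum_squares_le_sum[OF l2norm_nonneg l2norm_nonneg, of lborel "%x. f x - f' x" lborel "%x. g x - g' x"]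
 by (auto intro!: real_le_rsqrt simp: l2norm_nonneg)

lemma H1_dist_tendsto:
 assumes U: "open U" and w: "!!n::nat. wgrad U (F n) (G n)" "wgrad U f g"
 shows "(%n. H1_dist U (cls U (F n)) (cls U f)) \<longlonglongrightarrow> 0 \<longleftrightarrow>
  l2lim F f \<and> l2lim G g"
proof
 note b = H1_dist_bounds[OF U w(1) w(2)]
 assume l: "(%n. H1_dist U (cls U (F n)) (cls U f)) \<longlonglongrightarrow> 0"
 show "l2lim F f \<and> l2lim G g"
  by (intro conjI; intro Lim_null_comparison[OF _ l] always_eventually allI;
    simp only: real_norm_def abs_of_nonneg[OF l2norm_nonneg] b)
next
 note b = H1_dist_bounds[OF U w(1) w(2)]
 assume l: "l2lim F f \<and> l2lim G g"
 have s: "(%n. dist2 (F n) f + dist2 (G n) g) \<longlonglongrightarrow> 0"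
  using tendsto_add[OF conjunct1[OF l] conjunct2[OF l]] by simp
 show "(%n. H1_dist U (cls U (F n)) (cls U f)) \<longlonglongrightarrow> 0"
  by (intro Lim_null_comparison[OF _ s] always_eventually allI; simp only: real_norm_def abs_of_nonneg[OF b(4)] b)
qed

lemma H1_closure_cls:
 assumes U: "open U" and w: "wgrad U f g" and S: "!!n::nat. cls U (F n) \<in> S" and F: "!!n. wgrad U (F n) (G n)"
  and lim: "l2lim F f" "l2lim G g"
 shows "cls U f \<in> H1_closure U S"
 unfolding H1_closure_def
proof (intro CollectI conjI allI impI H1_cls[OF U w])
 fix e :: real assume e: "e > 0"
 have l: "(%n. dist2 f (F n)) \<longlonglongrightarrow> 0" "(%n. dist2 g (G n)) \<longlonglongrightarrow> 0"
  using lim l2norm_diff_commute[of lborel f] l2norm_diff_commute[of lborel g] by simp_all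
 have "(%n. dist2 f (F n) + dist2 g (G n)) \<longlonglongrightarrow> 0"
  using tendsto_add[OF l] by simp
 then have "\<forall>\<^sub>F n in sequentially. dist2 f (F n) + dist2 g (G n) < e"
  using e by (intro order_tendstoD) auto
 then obtain n where "dist2 f (F n) + dist2 g (G n) < e"
  by (meson eventually_happens trivial_limit_sequentially)
 then have "H1_dist U (cls U f) (cls U (F n)) < e" using H1_dist_bounds(3)[OF U w F[of n]] by linarith
 then show "\<exists>v\<in>S. H1_dist U (cls U f) v < e" using S by blast
qed

text \<open>The parameter \<open>p\<close> carries whatever must be remembered about members of
  \<open>S\<close> (a gradient, vanishing on \<open>\<Gamma>\<close>, being a test function), so
  that the extracted sequence keeps it.\<close>

lemma H1_closure_sequence:
 assumes U: "open U" and u: "u \<in> H1_closure U S" and S: "!!v. v \<in> S ==> \<exists>p. P p \<and> wgrad U (A p) (B p) \<and> v = cls U (A p)"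
 obtains f g p where "wgrad U f g" "u = cls U f" "\<forall>n::nat. P (p n)"
  "l2lim (%n x. A (p n) x) f" "l2lim (%n x. B (p n) x) g"
proof -
 have "u \<in> H1 U" and appr: "!!e. e > 0 ==> \<exists>v\<in>S. H1_dist U u v < e" using u by (auto simp: H1_closure_def)
 then obtain f g where w: "wgrad U f g" "u = cls U f" using H1_borel_rep[OF U] by blast
 have "\<exists>p. P p \<and> wgrad U (A p) (B p) \<and> H1_dist U u (cls U (A p)) < 1 / real (Suc n)" for n
 proof -
  obtain v where "v \<in> S" "H1_dist U u v < 1 / real (Suc n)" using appr[of "1 / real (Suc n)"] by auto
  then show ?thesis using S[of v] by blast
 qed
 then obtain p where p: "!!n. P (p n)" "!!n. wgrad U (A (p n)) (B (p n))" "!!n. H1_dist U u (cls U (A (p n))) < 1 / real (Suc n)"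
  by metis
 have l0: "(%n. 1 / real (Suc n)) \<longlonglongrightarrow> 0" by (rule lim_1_over_n[THEN LIMSEQ_Suc])
 have "dist2 (A (p n)) f \<le> 1 / real (Suc n)" "dist2 (B (p n)) g \<le> 1 / real (Suc n)" for n
  using H1_dist_bounds(1,2)[OF U w(1) p(2)[of n]] p(3)[of n] l2norm_diff_commute[of lborel "A (p n)" f]
   l2norm_diff_commute[of lborel "B (p n)" g] unfolding w(2) by linarith+
 then have l: "l2lim (%n x. A (p n) x) f" "l2lim (%n x. B (p n) x) g"
  by (intro Lim_null_comparison[OF _ l0] always_eventually allI; simp only: real_norm_def abs_of_nonneg[OF l2norm_nonneg])+
 have "\<forall>n. P (p n)" using p(1) by blast
 then show thesis by (rule that[OF w _ l])
qed

section \<open>Traces\<close>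

lemma C1_grad_diff:
 assumes "C1_grad U u G" "C1_grad U v H"
 shows "C1_grad U (%x. u x - v x) (%x. G x - H x)"
 unfolding C1_grad_def
proof (intro conjI ballI)
 fix x assume "x \<in> U"
 then show "((%x. u x - v x) has_derivative (%h. (G x - H x) \<bullet> h)) (at x)"
  unfolding inner_diff_left using assms by (intro has_derivative_diff) (auto simp: C1_grad_def)
qed (use assms in \<open>auto simp: C1_grad_def intro!: continuous_intros\<close>)

lemma wgrad_C1':
 assumes U: "open U" "bounded U" and u: "C1_grad U u G"
 shows "wgrad U (cut U u) (cut U G)"
 using wgrad_C1[OF assms] by simp

text \<open>By the trace inequality the boundary values of an approximating sequence are Cauchy, and
  two such sequences have the same limit; hence the \<open>THE\<close> of
  \<open>boundary_trace\<close> is the limit of the sequence at hand. The freedom in choosing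
  \<open>u\<close> is essential, since sequences of slices and of differences are used
  later.\<close>

lemma trace_limit:
 assumes U: "open U" "bounded U" "has_bcharts U" and w: "wgrad U f g"
  and u: "!!n. C1_grad U (u n) (G n)"
  and lim: "l2lim (%n. cut U (u n)) f" "l2lim (%n. cut U (G n)) g"
 defines "t \<equiv> tr U f"
 shows "square_int (boundary_measure U) t" "l2_tendsto (boundary_measure U) u t"
  "!!n. square_int (boundary_measure U) (u n)"
proof -
 let ?M = "boundary_measure U"
 obtain C where C: "C \<ge> 0" "!!u G. C1_grad U u G ==> square_int ?M u"
  "!!u G. C1_grad U u G ==> l2norm ?M u \<le> C * (norm2 (cut U u) + norm2 (cut U G))"
  using trace_inequality[OF U] by blast
 note a = wgradD[OF w]
 show us: "!!n. square_int ?M (u n)" by (rule C(2)[OF u])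
 have dist: "l2norm ?M (%x. v x - v' x) \<le> C * ((dist2 (cut U v) f + dist2 (cut U H) g)
   + (dist2 (cut U v') f + dist2 (cut U H') g))"
  if v: "C1_grad U v H" "C1_grad U v' H'" for v H v' H'
 proof -
  note w1 = wgradD[OF wgrad_C1'[OF U(1,2) v(1)]] and w2 = wgradD[OF wgrad_C1'[OF U(1,2) v(2)]]
  have 1: "l2norm ?M (%x. v x - v' x) \<le> C * (norm2 (cut U (%x. v x - v' x)) + norm2 (cut U (%x. H x - H' x)))"
   by (rule C(3)[OF C1_grad_diff[OF v]])
  have 2: "norm2 (cut U (%x. v x - v' x)) \<le> dist2 (cut U v) f + dist2 (cut U v') f"
   unfolding scaleR_diff_right
   using l2norm_diff_triangle[OF w1(1) a(1) w2(1)] l2norm_diff_commute[of lborel f "%x. cut U v' x"] by linarith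
  have 3: "norm2 (cut U (%x. H x - H' x)) \<le> dist2 (cut U H) g + dist2 (cut U H') g"
   unfolding scaleR_diff_right
   using l2norm_diff_triangle[OF w1(2) a(2) w2(2)] l2norm_diff_commute[of lborel g "%x. cut U H' x"] by linarith
  show ?thesis
   by (rule order_trans[OF 1], rule mult_left_mono[OF _ C(1)]) (use 2 3 in linarith)
 qed
 define r where "r n = dist2 (cut U (u n)) f + dist2 (cut U (G n)) g" for n
 have r0: "r \<longlonglongrightarrow> 0" unfolding r_def using tendsto_add[OF lim] by simp
 have rn: "r n \<ge> 0" for n by (simp add: r_def l2norm_nonneg)
 have d: "l2norm ?M (%x. u m x - u n x) \<le> C * (r m + r n)" for m n using dist[OF u u] unfolding r_def .
 have cau: "\<exists>N. \<forall>m\<ge>N. \<forall>n\<ge>N. l2norm ?M (%x. u m x - u n x) < e" if e: "e > 0" for e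
 proof -
  define e' where "e' = e / (2 * (C + 1))"
  have e': "e' > 0" using e C(1) by (simp add: e'_def)
  have "\<forall>\<^sub>F n in sequentially. r n < e'" using r0 e' by (intro order_tendstoD) auto
  then obtain N where N: "!!n. n \<ge> N ==> r n < e'" unfolding eventually_sequentially by blast
  have "l2norm ?M (%x. u m x - u n x) < e" if "m \<ge> N" "n \<ge> N" for m n
  proof -
   have "C * (r m + r n) \<le> C * (2 * e')" using N[OF that(1)] N[OF that(2)] C(1) by (intro mult_left_mono) auto
   also have "... < (C + 1) * (2 * e')" using e' by (intro mult_strict_right_mono) auto
   also have "... = e"
   proof -
    have "C + 1 \<noteq> 0" using C(1) by linarith
    then show ?thesis by (simp add: e'_def field_simps)
   qed
   finally show ?thesis using d[of m n] by linarith
  qed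
  then show ?thesis by blast
 qed
 obtain t0 where t0: "square_int ?M t0" "l2_tendsto ?M u t0"
  using square_int_complete[OF us cau] by blast
 note t0m = square_int_measurable[OF t0(1)] and um = square_int_measurable[OF us]
 have H1eq: "(%n. H1_dist U (cls U (v n)) (cls U f)) \<longlonglongrightarrow> 0 \<longleftrightarrow>
   l2lim (%n. cut U (v n)) f \<and> l2lim (%n. cut U (H n)) g"
  if "!!n. C1_grad U (v n) (H n)" for v H
  using H1_dist_tendsto[OF U(1) wgrad_C1'[OF U(1,2) that] w] cls_indicator[of U] by simp
 have "boundary_trace U (cls U f) = ae_class ?M t0"
  unfolding boundary_trace_def
 proof (rule the_equality)
  have "(%n. H1_dist U (cls U (u n)) (cls U f)) \<longlonglongrightarrow> 0" using H1eq[of u G, OF u] lim by blast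
  moreover have "C1_closure U (u n)" for n using u C1_closure_iff by blast
  moreover have "(%n. L2_dist ?M (ae_class ?M (u n)) (ae_class ?M t0)) \<longlonglongrightarrow> 0"
   using t0(2) by (simp add: L2_dist_ae_class um t0m)
  ultimately show "ae_class ?M t0 \<in> L2_of ?M \<and> (\<exists>\<phi>. (\<forall>n. C1_closure U (\<phi> n)) \<and>
   (%n. H1_dist U (cls U (\<phi> n)) (cls U f)) \<longlonglongrightarrow> 0 \<and> (%n. L2_dist ?M (ae_class ?M (\<phi> n)) (ae_class ?M t0)) \<longlonglongrightarrow> 0)"
   using L2_of_ae_class[OF t0(1)] by blast
 next
  fix k assume "k \<in> L2_of ?M \<and> (\<exists>\<phi>. (\<forall>n. C1_closure U (\<phi> n)) \<and>
   (%n. H1_dist U (cls U (\<phi> n)) (cls U f)) \<longlonglongrightarrow> 0 \<and> (%n. L2_dist ?M (ae_class ?M (\<phi> n)) k) \<longlonglongrightarrow> 0)"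
  then obtain v where k: "k \<in> L2_of ?M" and v: "!!n. C1_closure U (v n)"
   "(%n. H1_dist U (cls U (v n)) (cls U f)) \<longlonglongrightarrow> 0" "(%n. L2_dist ?M (ae_class ?M (v n)) k) \<longlonglongrightarrow> 0" by blast
  have "\<forall>n. \<exists>G. C1_grad U (v n) G" using v(1) C1_closure_iff by blast
  from choice[OF this] obtain H where H: "!!n. C1_grad U (v n) (H n)" by blast
  note k' = L2_of_rep[OF k]
  have vs: "!!n. square_int ?M (v n)" by (rule C(2)[OF H])
  have l1: "l2_tendsto ?M v (%x. rep k x)"
   using v(3) L2_dist_ae_class[OF square_int_measurable[OF vs] square_int_measurable[OF k'(1)]] by (simp add: k'(2))
  \<comment> \<open>A competing sequence \<open>v\<close> also converges to \<open>f\<close>, so the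
    trace inequality for \<open>u n - v n\<close> forces the two boundary limits to agree.\<close>
  define q where "q n = dist2 (cut U (v n)) f + dist2 (cut U (H n)) g" for n
  have q0: "q \<longlonglongrightarrow> 0"
   unfolding q_def using tendsto_add[OF conjunct1 conjunct2, OF iffD1[OF H1eq[of v H, OF H] v(2)] iffD1[OF H1eq[of v H, OF H] v(2)]] by simp
  have "(%n. C * (r n + q n)) \<longlonglongrightarrow> C * (0 + 0)" by (intro tendsto_intros r0 q0)
  then have s: "(%n. C * (r n + q n) + l2norm ?M (%x. v n x - rep k x)) \<longlonglongrightarrow> 0" using tendsto_add[OF _ l1] by fastforce
  have "l2_tendsto ?M u (%x. rep k x)"
  proof (rule l2norm_squeeze[OF _ s])
   fix n
   have "l2norm ?M (%x. u n x - rep k x) \<le> l2norm ?M (%x. u n x - v n x) + l2norm ?M (%x. v n x - rep k x)"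
    by (rule l2norm_diff_triangle[OF us vs k'(1)])
   also have "l2norm ?M (%x. u n x - v n x) \<le> C * (r n + q n)" unfolding r_def q_def by (rule dist[OF u H])
   finally show "l2norm ?M (%x. u n x - rep k x) \<le> C * (r n + q n) + l2norm ?M (%x. v n x - rep k x)"
    by (simp add: l2norm_nonneg)
  qed
  then have "AE x in ?M. rep k x = t0 x" by (rule l2norm_limit_unique[OF us k'(1) t0(1) _ t0(2)])
  then show "k = ae_class ?M t0"
   using ae_class_eq_iff[OF square_int_measurable[OF k'(1)] t0m] by (simp add: k'(2))
 qed
 then have t: "t = rep (ae_class ?M t0)" by (simp add: t_def)
 note rt = rep_ae_class[OF t0m]
 show "square_int ?M t"
  unfolding t using rt by (intro square_int_cong_AE[OF _ t0(1)]) (auto elim: eventually_mono)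
 have "l2norm ?M (%x. u n x - t x) = l2norm ?M (%x. u n x - t0 x)" for n
  unfolding t using rt um[of n] t0m by (intro l2norm_cong_AE) (auto elim: eventually_mono)
 then show "l2_tendsto ?M u t" using t0(2) by simp
qed

lemma wgrad_smooth_sequence:
 assumes U: "open U" "bounded U" "has_bcharts U" and w: "wgrad U f g"
 obtains u where "!!n::nat. smooth (u n)"
  "l2lim (%n. cut U (u n)) f" "l2lim (%n x. cut U (grad (u n)) x) g"
proof -
 have "\<forall>n::nat. \<exists>\<phi>. smooth \<phi> \<and> dist2 (cut U \<phi>) f \<le> 1 / real (Suc n) \<and>
  dist2 (cut U (grad \<phi>)) g \<le> 1 / real (Suc n)"
  by (intro allI, rule wgrad_approx_smooth[OF U w]) simp
 from choice[OF this] obtain u where u': "\<forall>n. smooth (u n) \<and> dist2 (cut U (u n)) f \<le> 1 / real (Suc n) \<and>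
  dist2 (cut U (grad (u n))) g \<le> 1 / real (Suc n)" by blast
 have u: "!!n. smooth (u n)" "!!n. dist2 (cut U (u n)) f \<le> 1 / real (Suc n)"
  "!!n. dist2 (cut U (grad (u n))) g \<le> 1 / real (Suc n)" using u' by blast+
 have l0: "(%n. 1 / real (Suc n)) \<longlonglongrightarrow> 0" by (rule lim_1_over_n[THEN LIMSEQ_Suc])
 show thesis
  by (rule that[OF u(1)]; intro Lim_null_comparison[OF _ l0] always_eventually allI)
   (use u in \<open>simp_all only: real_norm_def abs_of_nonneg[OF l2norm_nonneg]\<close>)
qed

lemma wgrad_test_sequence:
 assumes U: "open U" "bounded U" "has_bcharts U" and w: "wgrad UNIV f g"
  and f0: "!!x. x \<notin> U ==> f x = 0" and g0: "!!x. x \<notin> U ==> g x = 0"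
 obtains u where "!!n::nat. test_function U (u n)"
  "l2lim u f" "l2lim (%n x. grad (u n) x) g"
proof -
 have "\<forall>n::nat. \<exists>\<phi>. test_function U \<phi> \<and> dist2 \<phi> f \<le> 1 / real (Suc n) \<and>
  dist2 (grad \<phi>) g \<le> 1 / real (Suc n)"
  by (intro allI, rule wgrad_approx_H0[OF U w f0 g0]) simp_all
 from choice[OF this] obtain u where u': "\<forall>n. test_function U (u n) \<and> dist2 (u n) f \<le> 1 / real (Suc n) \<and>
  dist2 (grad (u n)) g \<le> 1 / real (Suc n)" by blast
 have u: "!!n. test_function U (u n)" "!!n. dist2 (u n) f \<le> 1 / real (Suc n)"
  "!!n. dist2 (grad (u n)) g \<le> 1 / real (Suc n)" using u' by blast+
 have l0: "(%n. 1 / real (Suc n)) \<longlonglongrightarrow> 0" by (rule lim_1_over_n[THEN LIMSEQ_Suc])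
 show thesis
  by (rule that[OF u(1)]; intro Lim_null_comparison[OF _ l0] always_eventually allI)
   (use u in \<open>simp_all only: real_norm_def abs_of_nonneg[OF l2norm_nonneg]\<close>)
qed

lemma test_function_wgrad:
 assumes "test_function U \<phi>" "open U"
 shows "wgrad U \<phi> (grad \<phi>)"
proof -
 note t = test_function_integrable[OF assms(1)] and sm = test_function_smooth[OF assms(1)]
 obtain K where K: "compact K" "K \<subseteq> U" "!!x. x \<notin> K ==> \<phi> x = 0" "!!x. x \<notin> K ==> grad \<phi> x = 0"
  using test_function_support[OF assms(1)] by metis
 show ?thesis
  unfolding wgrad_def
 proof (intro conjI allI impI)
  fix \<psi> v assume t': "test_function U \<psi>"
  note sm' = test_function_smooth[OF t']
  have "smooth (%x. \<phi> x * \<psi> x)" by (intro smooth_mult sm sm')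
  note sg = smooth_grad[OF this] smooth_grad_continuous[OF this]
  have "(LINT x|lborel. grad (%x. \<phi> x * \<psi> x) x \<bullet> v) = 0"
   by (rule integral_derivative_compact_support[OF sg(1) sg(3) K(1)]) (auto simp: K grad_mult[OF sm sm'])
  moreover have "integrable lborel (%x. \<phi> x * (grad \<psi> x \<bullet> v))" "integrable lborel (%x. (grad \<phi> x \<bullet> v) * \<psi> x)"
   by (intro wgrad_integrable[OF t(1,3) t'])+
  ultimately show "(LINT x|lborel. \<phi> x * (grad \<psi> x \<bullet> v)) = - (LINT x|lborel. (grad \<phi> x \<bullet> v) * \<psi> x)"
   unfolding grad_mult[OF sm sm'] by (simp add: inner_add_left mult.commute)
 qed (use t K in blast)+
qed

lemma H1_0_cls:
 assumes U: "open U" "bounded U" "has_bcharts U" and w: "wgrad UNIV f g"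
  and f0: "!!x. x \<notin> U ==> f x = 0" and g0: "!!x. x \<notin> U ==> g x = 0"
 shows "cls U f \<in> H1_0 U"
proof -
 obtain u where u: "!!n::nat. test_function U (u n)"
  "l2lim u f" "l2lim (%n x. grad (u n) x) g"
  using wgrad_test_sequence[OF assms] by blast
 have wU: "wgrad U f g"
  using wgradD[OF w] f0 g0 unfolding wgrad_def by (blast intro: test_function_mono)
 show ?thesis
  unfolding H1_0_def
  by (rule H1_closure_cls[OF U(1) wU, of u _ "%n. grad (u n)"]) (use u test_function_wgrad[OF u(1) U(1)] in auto)
qed

text \<open>Gluing with the zero function on the exterior \<open>- closure U\<close>: the boundary
  values of the approximants tend to zero, so no jump remains.\<close>

lemma zero_trace_extension:
 assumes U: "open U" "bounded U" "has_bcharts U" and w: "wgrad U f g"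
  and tr: "AE x in boundary_measure U. tr U f x = 0"
 shows "wgrad UNIV f g"
proof -
 obtain u where u: "!!n::nat. smooth (u n)"
  "l2lim (%n. cut U (u n)) f" "l2lim (%n x. cut U (grad (u n)) x) g"
  using wgrad_smooth_sequence[OF U w] by blast
 note C1 = smooth_C1_grad[OF u(1), where U = U]
 note T = trace_limit[OF U w C1 u(2,3)]
 have lim: "l2_tendsto (boundary_measure U) u (%x. 0)"
 proof -
  have "l2norm (boundary_measure U) (%x. u n x - tr U f x) = l2norm (boundary_measure U) (%x. u n x - 0)" for n
   using tr square_int_measurable[OF T(3)] square_int_measurable[OF T(1)]
   by (intro l2norm_cong_AE) (auto elim: eventually_mono)
  then show ?thesis using T(2) by simp
 qed
 have "wgrad UNIV (%x. f x + 0) (%x. g x + 0)"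
 proof (rule wgrad_glue[of U "- closure U" _ f g "%x. 0" "%x. 0" u "%n. grad (u n)" "%n x. 0" "%n x. 0"])
  show "U \<inter> - closure U = {}" using closure_subset by blast
  show "p \<in> U \<or> p \<in> - closure U \<or> (\<exists>r e n \<gamma> \<gamma>'. bchart U p r e n \<gamma> \<gamma>' \<and> bchart (- closure U) p r e (- n) (%s. - \<gamma> s) (%s. - \<gamma>' s))" for p
  proof (cases "p \<in> frontier U")
   case True
   from bspec[OF U(3)[unfolded has_bcharts_def] this] show ?thesis using bchart_complement by blast
  qed (use U(1) in \<open>auto simp: frontier_def interior_open\<close>)
  show "C1_grad (- closure U) (%x. 0) (%x. 0)" by (simp add: C1_grad_def)
  show "square_int (boundary_measure U) (%x. u k x - 0)" for k using T(3) by simp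
  show "wgrad (- closure U) (%x. 0) (%x. 0)" by (rule wgrad_zero)
  show "sqint (cut U (u k))" "sqint (cut U (grad (u k)))" for k
   using wgradD(1,2)[OF wgrad_C1'[OF U(1,2) C1]] by auto
 qed (use U w C1 u lim in \<open>auto simp: square_int_zero l2norm_zero\<close>)
 then show ?thesis by simp
qed

text \<open>Needed because \<open>frontier \<omega>2\<close> is contained in
  \<open>frontier \<omega>1\<close>, where the trace of the first component lives.\<close>

lemma boundary_measure_mono:
 assumes "frontier V \<subseteq> frontier U" "square_int (boundary_measure U) h"
 shows "square_int (boundary_measure V) h" "l2norm (boundary_measure V) h \<le> l2norm (boundary_measure U) h"
proof -
 have s: "sets (boundary_measure W) = sets (restrict_space borel (frontier W))" for W
  unfolding boundary_measure_def by (rule sets_restrict_space_cong) (simp add: sets_hausdorff1)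
 have "h \<in> borel_measurable (restrict_space borel (frontier U))"
  using square_int_measurable[OF assms(2)] measurable_cong_sets[OF s refl] by blast
 then have "h \<in> borel_measurable (restrict_space borel (frontier V))"
  by (rule measurable_restrict_mono) (rule assms(1))
 then have m: "h \<in> borel_measurable (boundary_measure V)" using measurable_cong_sets[OF s refl] by blast
 have "(\<integral>\<^sup>+x. ennreal ((norm (h x))^2) \<partial>boundary_measure V) \<le> (\<integral>\<^sup>+x. ennreal ((norm (h x))^2) \<partial>boundary_measure U)"
  unfolding nn_integral_boundary_measure using assms(1) by (intro nn_integral_mono) (auto simp: indicator_def)
 also have "... = ennreal ((l2norm (boundary_measure U) h)^2)" by (rule l2norm_nn_integral[OF assms(2)])
 finally show "square_int (boundary_measure V) h" "l2norm (boundary_measure V) h \<le> l2norm (boundary_measure U) h"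
  using l2norm_le_nn_integral[OF m _ l2norm_nonneg] by blast+
qed

section \<open>Functions on cylinders\<close>

lemma borel_measurable_fst: "fst \<in> borel_measurable (borel :: ('a::euclidean_space \<times> 'b::euclidean_space) measure)"
 and borel_measurable_snd: "snd \<in> borel_measurable (borel :: ('a::euclidean_space \<times> 'b::euclidean_space) measure)"
 by (intro borel_measurable_continuous_onI continuous_intros)+

lemma norm_fst_le_norm: "norm (fst p) \<le> norm p" and norm_snd_le_norm: "norm (snd p) \<le> norm p"
 using norm_fst_le[of "fst p" "snd p"] norm_snd_le[of "snd p" "fst p"] by simp_all

text \<open>The multiplier \<open>m\<close> covers indicators of sets in the slab and their products
  with a cut-off in \<open>y\<close>; Tonelli over the height gives the factor \<open>b - a\<close>
  for the squared norm.\<close>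

lemma square_int_cylinder:
 fixes f :: "'a::euclidean_space => 'b::euclidean_space" and m :: "'a \<times> real => real"
 assumes f: "sqint f" and m: "m \<in> Borel" "!!p. \<bar>m p\<bar> \<le> indicator {a..b} (snd p)" and ab: "a \<le> b"
 shows "sqint (%p. m p *\<^sub>R f (fst p))" "norm2 (%p. m p *\<^sub>R f (fst p)) \<le> sqrt (b - a) * norm2 f"
proof -
 have [measurable]: "f \<in> Borel" "m \<in> Borel" using square_int_measurable[OF f] m by auto
 have [measurable]: "m \<in> borel_measurable (borel \<Otimes>\<^sub>M borel)" using m(1) by (simp add: borel_prod)
 have "(\<integral>\<^sup>+p. ennreal ((norm (m p *\<^sub>R f (fst p)))^2) \<partial>lborel)
  \<le> (\<integral>\<^sup>+p. ennreal ((norm (f (fst p)))^2) * indicator {a..b} (snd p) \<partial>lborel)"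
 proof (rule nn_integral_mono)
  fix p :: "'a \<times> real"
  have "\<bar>m p\<bar> \<le> 1" using m(2)[of p] indicator_le_1[of "{a..b}" "snd p", where 'a = real] by linarith
  moreover have "snd p \<notin> {a..b} ==> m p = 0" using m(2)[of p] by simp
  ultimately show "ennreal ((norm (m p *\<^sub>R f (fst p)))^2) \<le> ennreal ((norm (f (fst p)))^2) * indicator {a..b} (snd p)"
   by (auto simp: indicator_def power_mult_distrib abs_square_le_1 intro!: ennreal_leI mult_left_le_one_le)
 qed
 also have "... = (\<integral>\<^sup>+x. \<integral>\<^sup>+y. ennreal ((norm (f x))^2) * indicator {a..b} y \<partial>lborel \<partial>lborel)"
  unfolding lborel_prod[symmetric] by (subst lborel.nn_integral_fst[symmetric]) auto
 also have "... = (\<integral>\<^sup>+x. ennreal ((norm (f x))^2) \<partial>lborel) * ennreal (b - a)"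
  using ab by (simp add: nn_integral_cmult nn_integral_multc)
 also have "... = ennreal ((sqrt (b - a) * norm2 f)^2)"
  unfolding l2norm_nn_integral[OF f] using ab by (simp add: power_mult_distrib ennreal_mult mult.commute)
 finally have n: "(\<integral>\<^sup>+p. ennreal ((norm (m p *\<^sub>R f (fst p)))^2) \<partial>lborel) \<le> ennreal ((sqrt (b - a) * norm2 f)^2)" .
 have "(%p. m p *\<^sub>R f (fst p)) \<in> borel_measurable (borel \<Otimes>\<^sub>M borel)" by measurable
 then have "(%p. m p *\<^sub>R f (fst p)) \<in> borel_measurable lborel" by (simp add: borel_prod)
 from l2norm_le_nn_integral[OF this n] show "sqint (%p. m p *\<^sub>R f (fst p))"
  "norm2 (%p. m p *\<^sub>R f (fst p)) \<le> sqrt (b - a) * norm2 f"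
  using ab l2norm_nonneg[of lborel f] by auto
qed

lemma AE_lborel_interval:
 fixes a b :: real
 assumes "AE y in lborel. P y" "a < b"
 obtains y where "a < y" "y < b" "P y"
proof (rule ccontr)
 assume *: "\<not> thesis"
 have "AE y::real in lborel. y \<notin> {a<..<b}" using assms(1) by eventually_elim (use * that in auto)
 then have "emeasure lborel {a<..<b} = 0" by (subst (asm) AE_iff_measurable[of "{a<..<b}"]) auto
 then show False using assms(2) by simp
qed

text \<open>An interval of positive length supplies an actual height at which an almost everywhere
  statement holds, and the condition on \<open>x\<close> does not depend on it.\<close>

lemma AE_cylinder:
 fixes V :: "'a::euclidean_space set"
 assumes V: "V \<in> sets borel" and Q: "{x. Q x} \<in> sets borel" and ab: "a < (b::real)"
 shows "(AE p in lborel. p \<in> V \<times> {a<..<b} --> Q (fst p)) \<longleftrightarrow> (AE x in lborel. x \<in> V --> Q x)"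
proof -
 have [measurable]: "Measurable.pred borel Q" using Q by (simp add: pred_def)
 note [measurable] = V
 have "(AE p in lborel. p \<in> V \<times> {a<..<b} --> Q (fst p)) \<longleftrightarrow> (AE p in lborel \<Otimes>\<^sub>M lborel. fst p \<in> V \<and> snd p \<in> {a<..<b} --> Q (fst p))"
  unfolding lborel_prod by (simp add: mem_Times_iff)
 also have "... \<longleftrightarrow> (AE x in lborel. AE y in lborel. x \<in> V \<and> y \<in> {a<..<b} --> Q x)"
  by (rule lborel_pair.AE_pair_iff[symmetric]) measurable
 also have "... \<longleftrightarrow> (AE x in lborel. x \<in> V --> Q x)"
 proof -
  have "(AE y in lborel. x \<in> V \<and> y \<in> {a<..<b} --> Q x) \<longleftrightarrow> (x \<in> V --> Q x)" for x
   using AE_lborel_interval[OF _ ab, of "%y. x \<in> V \<and> y \<in> {a<..<b} --> Q x"] by auto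
  then show ?thesis by presburger
 qed
 finally show ?thesis .
qed

lemma slice_square_int:
 fixes H :: "'a::euclidean_space \<times> real => 'b::euclidean_space"
 assumes H: "sqint H"
 shows "AE y in lborel. sqint (%x. H (x, y))"
  "integrable lborel (%y. (norm2 (%x. H (x, y)))^2)"
  "(LINT y|lborel. (norm2 (%x. H (x, y)))^2) = (norm2 H)^2"
proof -
 have i: "integrable (lborel \<Otimes>\<^sub>M lborel) (%(x, y). (norm (H (x, y)))^2)"
  using H by (simp add: square_int_def lborel_prod case_prod_unfold)
 have Hm [measurable]: "H \<in> borel_measurable (borel \<Otimes>\<^sub>M borel)" using square_int_measurable[OF H] by (simp add: borel_prod)
 have m: "(%x. H (x, y)) \<in> borel_measurable lborel" for y by measurable
 show "AE y in lborel. sqint (%x. H (x, y))"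
  using lborel_pair.AE_integrable_snd[OF i] unfolding square_int_def using m by simp
 show "integrable lborel (%y. (norm2 (%x. H (x, y)))^2)"
  unfolding l2norm_power2 by (rule lborel_pair.integrable_snd[OF i])
 show "(LINT y|lborel. (norm2 (%x. H (x, y)))^2) = (norm2 H)^2"
  unfolding l2norm_power2 lborel_pair.integral_snd[OF i] lborel_prod by (simp add: case_prod_unfold)
qed

text \<open>By Fubini the squared slice norms integrate to \<open>(norm2 (H n))^2\<close>, so they
  tend to zero in L^1 of the height, and a subsequence does so almost everywhere.\<close>

lemma slice_subsequence:
 fixes H :: "nat => 'a::euclidean_space \<times> real => 'b::euclidean_space"
 assumes H: "!!n. sqint (H n)" "(%n. norm2 (H n)) \<longlonglongrightarrow> 0"
 obtains r where "strict_mono r" "AE y in lborel. (%n. norm2 (%x. H (r n) (x, y))) \<longlonglongrightarrow> 0"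
proof -
 have "(%n. (norm2 (H n))^2) \<longlonglongrightarrow> 0" using tendsto_power[OF H(2), of 2] by simp
 then have "(%n. LINT y|lborel. norm ((norm2 (%x. H n (x, y)))^2)) \<longlonglongrightarrow> 0"
  using slice_square_int(3)[OF H(1)] by simp
 then obtain r where r: "strict_mono r" "AE y in lborel. (%n. (norm2 (%x. H (r n) (x, y)))^2) \<longlonglongrightarrow> 0"
  using tendsto_L1_AE_subseq[of lborel "%n y. (norm2 (%x. H n (x, y)))^2", OF slice_square_int(2)[OF H(1)]] by blast
 from r(2) have "AE y in lborel. (%n. norm2 (%x. H (r n) (x, y))) \<longlonglongrightarrow> 0"
 proof eventually_elim
  case (elim y)
  from tendsto_real_sqrt[OF elim] show ?case by (simp add: l2norm_nonneg)
 qed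
 with r(1) that show thesis by blast
qed

text \<open>Fundamental theorem and Cauchy-Schwarz. Stated in \<open>[0, \<infinity>]\<close> with
  the whole interval on the right, so that the bound may be infinite and does not involve
  \<open>y\<close> and \<open>z\<close>.\<close>

lemma increment_bound:
 fixes q s :: "real => real"
 assumes d: "!!t. t \<in> {a<..<b} ==> (q has_real_derivative s t) (at t)" and c: "continuous_on {a<..<b} s"
  and y: "y \<in> {a<..<b}" and z: "z \<in> {a<..<b}"
 shows "ennreal ((q z - q y)^2) \<le> ennreal (b - a) * (\<integral>\<^sup>+t. ennreal ((s t)^2) * indicator {a<..<b} t \<partial>lborel)"
proof -
 have *: "ennreal ((q z - q y)^2) \<le> ennreal (b - a) * (\<integral>\<^sup>+t. ennreal ((s t)^2) * indicator {a<..<b} t \<partial>lborel)"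
  if yz: "y \<le> z" "y \<in> {a<..<b}" "z \<in> {a<..<b}" for y z
 proof -
  have sub: "{y..z} \<subseteq> {a<..<b}" using yz by auto
  define S where "S t = indicator {y..z} t * s t" for t
  have cs: "continuous_on {y..z} s" using c sub continuous_on_subset by blast
  have "set_integrable lborel {y..z} s" by (rule borel_integrable_atLeastAtMost'[OF cs])
  then have Sm: "S \<in> borel_measurable lborel" unfolding S_def set_integrable_def using borel_measurable_integrable by simp
  have "set_integrable lborel {y..z} (%t. (s t)^2)"
   by (rule borel_integrable_atLeastAtMost') (intro continuous_intros cs)
  moreover have "(norm (S t))^2 = indicator {y..z} t *\<^sub>R (s t)^2" for t by (simp add: S_def indicator_def)
  ultimately have "integrable lborel (%t. (norm (S t))^2)"
   unfolding set_integrable_def by presburger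
  then have S: "sqint S" using Sm by (simp add: square_int_def)
  have nI: "(norm (indicator {y..z} t :: real))^2 = indicator {y..z} t" for t by (simp add: indicator_def)
  have i: "integrable lborel (%t. (norm (indicator {y..z} t :: real))^2)"
  proof -
   have "integrable lborel (indicator {y..z} :: real => real)" by (rule integrable_real_indicator) (use yz(1) in auto)
   then show ?thesis unfolding nI .
  qed
  have I: "sqint (%t. indicator {y..z} t :: real)" using i by (simp add: square_int_def)
  have I2: "(norm2 (%t. indicator {y..z} t :: real))^2 = z - y"
   unfolding l2norm_power2 nI using yz(1) by simp
  have isC: "isCont s t" if "y \<le> t" "t \<le> z" for t
   using c sub that continuous_on_eq_continuous_at[of "{a<..<b}" s] by auto
  have "(LINT t|lborel. S t \<bullet> indicator {y..z} t) = (LINT t|lborel. s t * indicator {y..z} t)"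
   by (rule Bochner_Integration.integral_cong) (auto simp: S_def indicator_def)
  also have "... = q z - q y"
   by (rule integral_FTC_Icc_real[OF yz(1)]) (use d sub isC in auto)
  finally have "\<bar>q z - q y\<bar> \<le> norm2 S * norm2 (%t. indicator {y..z} t :: real)"
   using l2norm_Cauchy_Schwarz[OF S I] by simp
  then have "\<bar>q z - q y\<bar>\<^sup>2 \<le> (norm2 S * norm2 (%t. indicator {y..z} t :: real))^2"
   by (rule power_mono) simp
  then have "(q z - q y)^2 \<le> (z - y) * (norm2 S)^2" by (simp add: power_mult_distrib I2 mult.commute)
  also have "... \<le> (b - a) * (norm2 S)^2" using yz by (intro mult_right_mono) auto
  finally have "ennreal ((q z - q y)^2) \<le> ennreal ((b - a) * (norm2 S)^2)" by (rule ennreal_leI)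
  also have "... = ennreal (b - a) * (\<integral>\<^sup>+t. ennreal ((norm (S t))^2) \<partial>lborel)"
   unfolding l2norm_nn_integral[OF S] using yz by (intro ennreal_mult) auto
  also have "... \<le> ennreal (b - a) * (\<integral>\<^sup>+t. ennreal ((s t)^2) * indicator {a<..<b} t \<partial>lborel)"
   using sub by (intro mult_left_mono nn_integral_mono) (auto simp: S_def indicator_def)
  finally show ?thesis .
 qed
 show ?thesis
 proof (cases "y \<le> z")
  case True then show ?thesis using *[OF _ y z] by simp
 next
  case False then show ?thesis using *[OF _ z y] by (simp add: power2_commute)
 qed
qed

lemma C1_grad_slice:
 fixes \<Omega> :: "('a::euclidean_space \<times> real) set"
 assumes \<phi>: "C1_grad \<Omega> \<phi> G" and V: "V \<times> {a<..<b} \<subseteq> \<Omega>" and y: "y \<in> {a<..<b}"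
 shows "C1_grad V (%x. \<phi> (x, y)) (%x. fst (G (x, y)))"
proof -
 have "(%x. (x, y)) ` closure V \<subseteq> closure ((%x. (x, y)) ` V)"
  by (rule image_closure_subset[OF _ closed_closure closure_subset]) (intro continuous_intros)
 also have "... \<subseteq> closure \<Omega>" using V y by (intro closure_mono) auto
 finally have im: "(%x. (x, y)) ` closure V \<subseteq> closure \<Omega>" .
 have c: "continuous_on (closure V) (%x. F (x, y))" if "continuous_on (closure \<Omega>) F" for F :: "'a \<times> real => 'c::topological_space"
  by (rule continuous_on_compose2[OF that _ im]) (intro continuous_intros)
 show ?thesis
  unfolding C1_grad_def
 proof (intro conjI ballI)
  fix x assume "x \<in> V"
  then have "(\<phi> has_derivative (%h. G (x, y) \<bullet> h)) (at (x, y))" using \<phi> V y unfolding C1_grad_def by blast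
  moreover have "((%x. (x, y)) has_derivative (%h. (h, 0))) (at x)" by (auto intro!: derivative_eq_intros)
  ultimately have "((%x. \<phi> (x, y)) has_derivative (%h. G (x, y) \<bullet> (h, 0))) (at x)"
   by (rule has_derivative_compose[rotated])
  then show "((%x. \<phi> (x, y)) has_derivative (%h. fst (G (x, y)) \<bullet> h)) (at x)"
   by (simp add: inner_prod_def)
 qed (use \<phi> c in \<open>auto simp: C1_grad_def intro!: continuous_intros\<close>)
qed

lemma C1_grad_vertical:
 fixes \<Omega> :: "('a::euclidean_space \<times> real) set"
 assumes \<phi>: "C1_grad \<Omega> \<phi> G" and V: "V \<times> {a<..<b} \<subseteq> \<Omega>" and x: "x \<in> V"
 shows "!!t. t \<in> {a<..<b} ==> ((%t. \<phi> (x, t)) has_real_derivative snd (G (x, t))) (at t)"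
  "continuous_on {a<..<b} (%t. snd (G (x, t)))"
proof -
 fix t assume "t \<in> {a<..<b}"
 then have "(\<phi> has_derivative (%h. G (x, t) \<bullet> h)) (at (x, t))" using \<phi> V x unfolding C1_grad_def by blast
 moreover have "((%t. (x, t)) has_derivative (%h. (0, h))) (at t)" by (auto intro!: derivative_eq_intros)
 ultimately have "((%t. \<phi> (x, t)) has_derivative (%h. G (x, t) \<bullet> (0, h))) (at t)"
  by (rule has_derivative_compose[rotated])
 then show "((%t. \<phi> (x, t)) has_real_derivative snd (G (x, t))) (at t)"
  by (simp add: inner_prod_def has_field_derivative_def)
next
 have "continuous_on (closure \<Omega>) (%p. snd (G p))" using \<phi> by (auto simp: C1_grad_def intro!: continuous_intros)
 moreover have "(%t. (x, t)) ` {a<..<b} \<subseteq> closure \<Omega>" using V x closure_subset by fastforce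
 ultimately show "continuous_on {a<..<b} (%t. snd (G (x, t)))"
  by (intro continuous_on_compose2[of "closure \<Omega>" "%p. snd (G p)" "{a<..<b}" "%t. (x, t)"] continuous_on_Pair continuous_on_const continuous_on_id)
qed

text \<open>The increment bound is integrated over base and height: for the squared norm one factor
  \<open>b - a\<close> comes from Cauchy-Schwarz and one from the height of the cylinder.\<close>

lemma vertical_oscillation:
 fixes \<Omega> :: "('a::euclidean_space \<times> real) set"
 assumes \<Omega>: "open \<Omega>" "bounded \<Omega>" and V: "open V" "V \<times> {a<..<b} \<subseteq> \<Omega>" and \<phi>: "C1_grad \<Omega> \<phi> G" and y: "y \<in> {a<..<b}"
 defines "F \<equiv> %p. cut \<Omega> \<phi> p" and "D \<equiv> %p. snd (cut \<Omega> G p)"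
 shows "sqint (cut (V \<times> {a<..<b}) (%p. F p - F (fst p, y)))"
  "norm2 (cut (V \<times> {a<..<b}) (%p. F p - F (fst p, y))) \<le> (b - a) * norm2 D"
proof -
 let ?I = "{a<..<b}"
 have ab: "a < b" using y by auto
 note w = wgradD[OF wgrad_C1'[OF \<Omega> \<phi>]]
 have [measurable]: "F \<in> borel_measurable (borel \<Otimes>\<^sub>M borel)" using w(6) by (simp add: F_def borel_prod)
 have "D \<in> Borel" unfolding D_def by (rule measurable_compose[OF w(7) borel_measurable_snd])
 then have [measurable]: "D \<in> borel_measurable (borel \<Otimes>\<^sub>M borel)" by (simp add: borel_prod)
 have "sqint D"
 proof (rule square_int_bound[OF _ w(2), where C = 1])
  show "AE p in lborel. norm (D p) \<le> 1 * norm (cut \<Omega> G p)"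
   unfolding D_def mult_1 by (rule AE_I2, rule norm_snd_le_norm)
 qed (use \<open>D \<in> Borel\<close> in simp)
 note [measurable] = borel_open[OF V(1)]
 define K where "K x = ennreal (b - a) * (\<integral>\<^sup>+t. ennreal ((D (x, t))^2) * indicator ?I t \<partial>lborel)" for x
 have [measurable]: "K \<in> Borel" unfolding K_def by measurable
 have "(\<integral>\<^sup>+p. ennreal ((norm (indicator (V \<times> ?I) p *\<^sub>R (F p - F (fst p, y))))^2) \<partial>lborel)
  \<le> (\<integral>\<^sup>+p. K (fst p) * indicator ?I (snd p) \<partial>lborel)"
 proof (rule nn_integral_mono)
  fix p :: "'a \<times> real"
  obtain x z where p: "p = (x, z)" by (cases p)
  show "ennreal ((norm (indicator (V \<times> ?I) p *\<^sub>R (F p - F (fst p, y))))^2) \<le> K (fst p) * indicator ?I (snd p)"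
  proof (cases "p \<in> V \<times> ?I")
   case True
   then have x: "x \<in> V" and z: "z \<in> ?I" using p by auto
   have \<Omega>t: "(x, t) \<in> \<Omega>" if "t \<in> ?I" for t using V(2) x that by blast
   have "ennreal ((\<phi> (x, z) - \<phi> (x, y))^2) \<le> ennreal (b - a) * (\<integral>\<^sup>+t. ennreal ((snd (G (x, t)))^2) * indicator ?I t \<partial>lborel)"
    by (rule increment_bound[OF C1_grad_vertical[OF \<phi> V(2) x] y z])
   also have "(\<integral>\<^sup>+t. ennreal ((snd (G (x, t)))^2) * indicator ?I t \<partial>lborel) = (\<integral>\<^sup>+t. ennreal ((D (x, t))^2) * indicator ?I t \<partial>lborel)"
    by (rule nn_integral_cong) (use \<Omega>t in \<open>auto simp: D_def indicator_def\<close>)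
   finally show ?thesis using True p \<Omega>t[OF z] \<Omega>t[OF y] z by (simp add: F_def K_def)
  qed simp
 qed
 also have "... = (\<integral>\<^sup>+x. \<integral>\<^sup>+z. K x * indicator ?I z \<partial>lborel \<partial>lborel)"
  unfolding lborel_prod[symmetric] by (subst lborel.nn_integral_fst[symmetric]) auto
 also have "... = (\<integral>\<^sup>+x. K x \<partial>lborel) * ennreal (b - a)"
  using ab by (simp add: nn_integral_cmult nn_integral_multc)
 also have "(\<integral>\<^sup>+x. K x \<partial>lborel) = ennreal (b - a) * (\<integral>\<^sup>+x. \<integral>\<^sup>+t. ennreal ((D (x, t))^2) * indicator ?I t \<partial>lborel \<partial>lborel)"
  unfolding K_def by (rule nn_integral_cmult) measurable
 also have "... \<le> ennreal (b - a) * (\<integral>\<^sup>+x. \<integral>\<^sup>+t. ennreal ((norm (D (x, t)))^2) \<partial>lborel \<partial>lborel)"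
  by (intro mult_left_mono nn_integral_mono) (auto simp: indicator_def)
 also have "(\<integral>\<^sup>+x. \<integral>\<^sup>+t. ennreal ((norm (D (x, t)))^2) \<partial>lborel \<partial>lborel) = (\<integral>\<^sup>+p. ennreal ((norm (D p))^2) \<partial>lborel)"
  unfolding lborel_prod[symmetric] by (rule lborel.nn_integral_fst) measurable
 also have "... = ennreal ((norm2 D)^2)" by (rule l2norm_nn_integral) fact
 also have "ennreal (b - a) * ennreal ((norm2 D)^2) * ennreal (b - a) = ennreal (((b - a) * norm2 D)^2)"
  using ab by (simp add: ennreal_mult[symmetric] power2_eq_square mult_ac)
 finally have n: "(\<integral>\<^sup>+p. ennreal ((norm (indicator (V \<times> ?I) p *\<^sub>R (F p - F (fst p, y))))^2) \<partial>lborel)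
  \<le> ennreal (((b - a) * norm2 D)^2)" by (simp add: mult_right_mono)
 have "(cut (V \<times> ?I) (%p. F p - F (fst p, y))) \<in> borel_measurable (borel \<Otimes>\<^sub>M borel)" by measurable
 then have "(cut (V \<times> ?I) (%p. F p - F (fst p, y))) \<in> borel_measurable lborel" by (simp add: borel_prod)
 from l2norm_le_nn_integral[OF this n]
 show "sqint (cut (V \<times> ?I) (%p. F p - F (fst p, y)))"
  "norm2 (cut (V \<times> ?I) (%p. F p - F (fst p, y))) \<le> (b - a) * norm2 D"
  using ab l2norm_nonneg[of lborel D] by auto
qed

text \<open>At a good height \<open>y\<close> the approximants are close, on the whole cylinder, to
  their own slices continued constantly in \<open>y\<close>, because their vertical derivatives tend
  to zero. One sequence converges to \<open>f\<close>, the other to the constant continuation of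
  \<open>v\<close>, so the limits agree.\<close>

lemma cylinder_slice:
 fixes \<Omega> :: "('a::euclidean_space \<times> real) set"
 assumes \<Omega>: "open \<Omega>" "bounded \<Omega>" and V: "open V" "bounded V" "V \<times> {a<..<b} \<subseteq> \<Omega>" and ab: "a < b"
  and w: "wgrad \<Omega> f g" and g0: "AE p in lborel. snd (g p) = 0"
  and \<phi>: "!!n::nat. C1_grad \<Omega> (\<phi> n) (G n)"
  and lim: "l2lim (%n. cut \<Omega> (\<phi> n)) f"
   "l2lim (%n. cut \<Omega> (G n)) g"
 obtains y v h r where "a < y" "y < b" "strict_mono (r :: nat => nat)" "wgrad V v h"
  "AE p in lborel. p \<in> V \<times> {a<..<b} --> f p = v (fst p)"
  "l2lim (%n x. indicator V x *\<^sub>R \<phi> (r n) (x, y)) v"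
  "l2lim (%n x. indicator V x *\<^sub>R fst (G (r n) (x, y))) h"
proof -
 let ?I = "{a<..<b}"
 note a = wgradD[OF w] and b = wgradD[OF wgrad_C1'[OF \<Omega> \<phi>]]
 define F where "F n p = cut \<Omega> (\<phi> n) p" for n p
 define D where "D n p = cut \<Omega> (G n) p" for n p
 have F: "sqint (F n)" and D: "sqint (D n)" for n using b(1,2)[of n] by (simp_all add: F_def[abs_def] D_def[abs_def])
 have dF: "sqint (%p. F n p - f p)" and dD: "sqint (%p. D n p - g p)" for n
  by (rule square_int_diff[OF F a(1)], rule square_int_diff[OF D a(2)])
 have limF: "l2lim F f" and limD: "l2lim D g"
  using lim by (simp_all add: F_def D_def)
 \<comment> \<open>Two extractions, the second inside the first, so that functions and gradients
   converge on almost every slice along one subsequence.\<close>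
 obtain r1 where r1: "strict_mono r1" "AE y in lborel. l2lim (%n x. F (r1 n) (x, y)) (%x. f (x, y))"
  using slice_subsequence[OF dF limF] by blast
 obtain r2 where r2: "strict_mono r2" "AE y in lborel. l2lim (%n x. D (r1 (r2 n)) (x, y)) (%x. g (x, y))"
  using slice_subsequence[OF dD LIMSEQ_subseq_LIMSEQ[OF limD r1(1), unfolded o_def]] by blast
 define r where "r n = r1 (r2 n)" for n
 have sr: "strict_mono r" using strict_mono_o[OF r1(1) r2(1)] by (simp add: r_def[abs_def] o_def)
 have "AE y in lborel. sqint (%x. f (x, y)) \<and> sqint (%x. g (x, y)) \<and>
  (\<forall>n. sqint (%x. F n (x, y)) \<and> sqint (%x. D n (x, y))) \<and>
  l2lim (%n x. F (r n) (x, y)) (%x. f (x, y)) \<and>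
  l2lim (%n x. D (r n) (x, y)) (%x. g (x, y))"
 proof -
  have "AE y in lborel. \<forall>n. sqint (%x. F n (x, y)) \<and> sqint (%x. D n (x, y))"
   unfolding AE_all_countable using slice_square_int(1)[OF F] slice_square_int(1)[OF D] by auto
  with slice_square_int(1)[OF a(1)] slice_square_int(1)[OF a(2)] r1(2) r2(2) show ?thesis
  proof eventually_elim
   case (elim y)
   from LIMSEQ_subseq_LIMSEQ[OF elim(3) r2(1), unfolded o_def] elim show ?case by (simp add: r_def)
  qed
 qed
 then obtain y where y: "a < y" "y < b" "sqint (%x. f (x, y))" "sqint (%x. g (x, y))"
  "!!n. sqint (%x. F n (x, y))" "!!n. sqint (%x. D n (x, y))"
  "l2lim (%n x. F (r n) (x, y)) (%x. f (x, y))"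
  "l2lim (%n x. D (r n) (x, y)) (%x. g (x, y))"
  using AE_lborel_interval[OF _ ab] by (smt (verit))
 have yI: "y \<in> ?I" using y by simp
 have V\<Omega>: "(x, y) \<in> \<Omega>" if "x \<in> V" for x using V(3) that yI by blast
 note [measurable] = borel_open[OF V(1)]
 define v where "v x = indicator V x *\<^sub>R f (x, y)" for x
 define h where "h x = indicator V x *\<^sub>R fst (g (x, y))" for x
 have vs: "sqint v"
  unfolding v_def by (rule square_int_bounded_mult[OF y(3), where C = 1]) (auto simp: indicator_def)
 have hb: "sqint (%x. fst (H (x, y)))" if "sqint (%x. H (x, y))" for H :: "'a \<times> real => 'a \<times> real"
 proof (rule square_int_bound[OF _ that, where C = 1])
  have [measurable]: "(%x. H (x, y)) \<in> Borel" using square_int_measurable[OF that] by simp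
  show "(%x. fst (H (x, y))) \<in> borel_measurable lborel"
   using measurable_compose[OF _ borel_measurable_fst, of "%x. H (x, y)"] by simp
 qed (simp add: norm_fst_le_norm)
 have hs: "sqint h"
  unfolding h_def by (rule square_int_bounded_mult[OF hb[OF y(4)], where C = 1]) (auto simp: indicator_def)
 have slice: "C1_grad V (%x. \<phi> n (x, y)) (%x. fst (G n (x, y)))" for n by (rule C1_grad_slice[OF \<phi> V(3) yI])
 note wn = wgrad_C1'[OF V(1,2) slice]
 have lv: "l2lim (%n x. indicator V x *\<^sub>R \<phi> (r n) (x, y)) v"
 proof (rule l2norm_squeeze[OF _ y(7)])
  fix n
  have "norm2 (%x. indicator V x *\<^sub>R \<phi> (r n) (x, y) - v x) \<le> norm2 (%x. F (r n) (x, y) - f (x, y))"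
   by (rule l2norm_mono[OF square_int_measurable[OF square_int_diff[OF wgradD(1)[OF wn] vs]] square_int_diff[OF y(5,3)]])
    (use V\<Omega> in \<open>auto simp: v_def F_def indicator_def\<close>)
  then show "norm2 (%x. indicator V x *\<^sub>R \<phi> (r n) (x, y) - v x) \<le> norm2 (%x. F (r n) (x, y) - f (x, y))"
   by (simp add: l2norm_nonneg)
 qed
 have lh: "l2lim (%n x. indicator V x *\<^sub>R fst (G (r n) (x, y))) h"
 proof (rule l2norm_squeeze[OF _ y(8)])
  fix n
  have "norm (indicator V x *\<^sub>R fst (G (r n) (x, y)) - h x) \<le> norm (D (r n) (x, y) - g (x, y))" for x
   using V\<Omega>[of x] norm_fst_le_norm[of "G (r n) (x, y) - g (x, y)"] by (simp add: h_def D_def indicator_def)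
  then have "norm2 (%x. indicator V x *\<^sub>R fst (G (r n) (x, y)) - h x) \<le> norm2 (%x. D (r n) (x, y) - g (x, y))"
   by (intro l2norm_mono[OF square_int_measurable[OF square_int_diff[OF wgradD(2)[OF wn] hs]] square_int_diff[OF y(6,4)]]) auto
  then show "norm2 (%x. indicator V x *\<^sub>R fst (G (r n) (x, y)) - h x) \<le> norm2 (%x. D (r n) (x, y) - g (x, y))"
   by (simp add: l2norm_nonneg)
 qed
 have wv: "wgrad V v h"
  by (rule wgrad_limit[OF wn vs _ hs _ lv lh]) (auto simp: v_def h_def)
 let ?C = "V \<times> ?I"
 have Cb [measurable]: "?C \<in> sets borel" using V(1) by (intro borel_open open_Times) auto
 have s1: "sqint (cut ?C (F n))" "sqint (cut ?C f)" for n
  by (rule square_int_bounded_mult[OF F, where C = 1] square_int_bounded_mult[OF a(1), where C = 1]; auto simp: indicator_def)+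
 have m: "(%p. indicator ?C p :: real) \<in> Borel" "\<bar>indicator ?C p :: real\<bar> \<le> indicator {a..b} (snd p)" for p
  by (measurable, auto simp: indicator_def)
 note cyl = square_int_cylinder[OF _ m less_imp_le[OF ab]]
 have "l2lim (%n p. cut ?C (F (r n)) p) (cut ?C f)"
 proof (rule l2norm_squeeze[OF _ LIMSEQ_subseq_LIMSEQ[OF limF sr, unfolded o_def]])
  fix n
  show "dist2 (cut ?C (F (r n))) (cut ?C f) \<le> dist2 (F (r n)) f"
   by (rule l2norm_mono[OF square_int_measurable[OF square_int_diff[OF s1]] dF]) (auto simp: indicator_def)
 qed
 moreover have "l2lim (%n p. cut ?C (F (r n)) p) (%p. indicator ?C p *\<^sub>R v (fst p))"
 proof (rule l2norm_squeeze)
  fix n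
  have s2: "sqint (cut ?C (%p. F (r n) (fst p, y)))"
   using cyl(1)[OF y(5)[of "r n"]] by simp
  have osc: "norm2 (cut ?C (%p. F (r n) p - F (r n) (fst p, y))) \<le> (b - a) * norm2 (%p. snd (D (r n) p))"
   using vertical_oscillation(2)[OF \<Omega> V(1,3) \<phi> yI, of "r n"] by (simp add: F_def D_def)
  have "snd (D (r n) p) = snd (D (r n) p - g p)" if "snd (g p) = 0" for p using that by simp
  then have "norm (snd (D (r n) p)) \<le> norm (D (r n) p - g p)" if "snd (g p) = 0" for p
   using norm_snd_le_norm[of "D (r n) p - g p"] that by metis
  moreover have "(%p. snd (D (r n) p)) \<in> borel_measurable lborel" by (rule measurable_compose[OF square_int_measurable[OF D] borel_measurable_snd])
  ultimately have "norm2 (%p. snd (D (r n) p)) \<le> dist2 (D (r n)) g"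
   using g0 by (intro l2norm_mono[OF _ dD]) (auto elim!: eventually_mono)
  then have 1: "norm2 (%p. cut ?C (F (r n)) p - indicator ?C p *\<^sub>R F (r n) (fst p, y)) \<le> (b - a) * dist2 (D (r n)) g"
   using osc mult_left_mono[of _ _ "b - a"] ab unfolding scaleR_diff_right by (meson diff_ge_0_iff_ge less_imp_le order_trans)
  have sd: "sqint (%x. F (r n) (x, y) - f (x, y))" by (rule square_int_diff[OF y(5,3)])
  have "(%p. indicator ?C p *\<^sub>R F (r n) (fst p, y) - indicator ?C p *\<^sub>R v (fst p)) = (cut ?C (%p. F (r n) (fst p, y) - f (fst p, y)))"
   by (auto simp: v_def indicator_def)
  then have 2: "norm2 (%p. indicator ?C p *\<^sub>R F (r n) (fst p, y) - indicator ?C p *\<^sub>R v (fst p))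
   \<le> sqrt (b - a) * norm2 (%x. F (r n) (x, y) - f (x, y))"
   using cyl(2)[OF sd] by simp
  show "norm2 (%p. cut ?C (F (r n)) p - indicator ?C p *\<^sub>R v (fst p))
   \<le> (b - a) * dist2 (D (r n)) g + sqrt (b - a) * norm2 (%x. F (r n) (x, y) - f (x, y))"
   using l2norm_diff_triangle[OF s1(1)[of "r n"] s2 cyl(1)[OF vs]] 1 2 by linarith
 next
  have "(%n. (b - a) * dist2 (D (r n)) g + sqrt (b - a) * norm2 (%x. F (r n) (x, y) - f (x, y)))
   \<longlonglongrightarrow> (b - a) * 0 + sqrt (b - a) * 0"
   by (intro tendsto_intros LIMSEQ_subseq_LIMSEQ[OF limD sr, unfolded o_def] y(7))
  then show "(%n. (b - a) * dist2 (D (r n)) g + sqrt (b - a) * norm2 (%x. F (r n) (x, y) - f (x, y))) \<longlonglongrightarrow> 0"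
   by simp
 qed
 ultimately have "AE p in lborel. cut ?C f p = indicator ?C p *\<^sub>R v (fst p)"
  by (rule l2norm_limit_unique[OF s1(1) s1(2) cyl(1)[OF vs]])
 then have "AE p in lborel. p \<in> ?C --> f p = v (fst p)" by eventually_elim (auto simp: indicator_def)
 then show thesis using that[OF y(1,2) sr wv _ lv lh] by blast
qed

section \<open>Evaluation of \<open>iota\<close> and lifting of planar functions\<close>

lemma AE_cylinderI:
 fixes V :: "'a::euclidean_space set"
 assumes V: "V \<in> sets borel" and Q: "AE x in lborel. x \<in> V --> Q x" and ab: "a < (b::real)"
 shows "AE p in lborel. p \<in> V \<times> {a<..<b} --> Q (fst p)"
proof -
 \<comment> \<open>The exceptional set of \<open>Q\<close> need not be Borel; it is enlarged to a
   Borel null set because \<open>AE_cylinder\<close> asks for measurability.\<close>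
 obtain N where N: "N \<in> null_sets lborel" "{x \<in> space lborel. \<not> (x \<in> V --> Q x)} \<subseteq> N"
  using Q unfolding eventually_ae_filter by blast
 have "AE x in lborel. x \<in> V --> x \<notin> N" using AE_not_in[OF N(1)] by eventually_elim blast
 moreover have "{x. x \<notin> N} \<in> sets borel" using N(1) borel_comp[of N] by (simp add: null_sets_def Collect_neg_eq)
 ultimately have "AE p in lborel. p \<in> V \<times> {a<..<b} --> fst p \<notin> N" using AE_cylinder[OF V _ ab] by blast
 then show ?thesis by eventually_elim (use N(2) in auto)
qed

lemma iota_cls:
 assumes V: "open V" and ab: "a < b" and v: "sqint v" and f: "f \<in> Borel"
  and eq: "AE p in lborel. p \<in> V \<times> {a<..<b} --> f p = v (fst p)"
 shows "iota V (V \<times> {a<..<b}) (cls (V \<times> {a<..<b}) f) = cls V v"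
 unfolding iota_def
proof (rule the_equality)
 let ?C = "V \<times> {a<..<b}"
 have Vb: "V \<in> sets borel" and Cb: "?C \<in> sets borel" using V by (auto intro!: borel_open open_Times)
 have vm: "v \<in> Borel" using square_int_measurable[OF v] by simp
 have rf: "AE p in lborel. p \<in> ?C --> rep (cls ?C f) p = f p"
  using rep_cls(2)[OF f, of ?C] by (subst (asm) AE_lebesgue_on_iff[OF Cb])
 have rv: "AE p in lborel. p \<in> ?C --> rep (cls V k) (fst p) = k (fst p)" if "k \<in> Borel" for k
  by (rule AE_cylinderI[OF Vb _ ab]) (rule rep_cls(2)[OF that, of V, unfolded AE_lebesgue_on_iff[OF Vb]])
 have "AE p in lborel. p \<in> ?C --> rep (cls ?C f) p = rep (cls V v) (fst p)"
  using eq rf rv[OF vm] by eventually_elim simp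
 then show "cls V v \<in> L2 V \<and> (AE p in lebesgue_on ?C. rep (cls ?C f) p = rep (cls V v) (fst p))"
  unfolding AE_lebesgue_on_iff[OF Cb] using cls_L2[OF Vb v] by blast
 fix k assume k: "k \<in> L2 V \<and> (AE p in lebesgue_on ?C. rep (cls ?C f) p = rep k (fst p))"
 obtain k' where k': "sqint k'" "k = cls V k'" using L2_borel_rep[OF Vb] k by blast
 have km [measurable]: "k' \<in> Borel" using square_int_measurable[OF k'(1)] by simp
 note [measurable] = vm
 have "AE p in lborel. p \<in> ?C --> rep (cls ?C f) p = rep k (fst p)" using k unfolding AE_lebesgue_on_iff[OF Cb] by blast
 then have "AE p in lborel. p \<in> ?C --> k' (fst p) = v (fst p)"
  using eq rf rv[OF km] unfolding k'(2) by eventually_elim simp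
 moreover have "{x. k' x = v x} \<in> sets borel" by measurable
 ultimately have "AE x in lborel. x \<in> V --> k' x = v x" using AE_cylinder[OF Vb _ ab, of "%x. k' x = v x"] by blast
 then show "k = cls V v" unfolding k'(2) using cls_eq_iff[OF Vb km vm] by blast
qed

lemma restrict_class_cls:
 assumes "W \<in> sets borel" "V \<in> sets borel" "V \<subseteq> W" "f \<in> Borel"
 shows "restrict_class V (cls W f) = cls V f"
proof -
 have "AE x in lborel. x \<in> V --> rep (cls W f) x = f x"
  using rep_cls(2)[OF assms(4), of W] unfolding AE_lebesgue_on_iff[OF assms(1)]
  by eventually_elim (use assms(3) in blast)
 then have A: "AE x in lebesgue_on V. rep (cls W f) x = f x" unfolding AE_lebesgue_on_iff[OF assms(2)] .
 have "(AE x in lebesgue_on V. g x = rep (cls W f) x) \<longleftrightarrow> (AE x in lebesgue_on V. g x = f x)" for g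
 proof
  assume "AE x in lebesgue_on V. g x = rep (cls W f) x"
  then show "AE x in lebesgue_on V. g x = f x" using A by eventually_elim simp
 next
  assume "AE x in lebesgue_on V. g x = f x"
  then show "AE x in lebesgue_on V. g x = rep (cls W f) x" using A by eventually_elim simp
 qed
 then show ?thesis unfolding restrict_class_def ae_class_def by simp
qed

text \<open>The lift is linear in the pair of planar functions, so one bound serves functions and
  gradients alike. \<open>B\<close> is square integrable only on \<open>W\<close>, as smooth
  approximants on the plane need not decay.\<close>

lemma lift_bound:
 fixes \<Omega> :: "('a::euclidean_space \<times> real) set" and B W' D E :: "'a => 'b::euclidean_space"
 assumes \<Omega>: "open \<Omega>" "\<Omega> \<subseteq> W \<times> {0..h}" and h: "h \<ge> 0"
  and \<theta>: "\<theta> \<in> Borel" "!!y. \<bar>\<theta> y\<bar> \<le> 1"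
  and sq: "sqint W'" "sqint E" "sqint (cut W B)" "sqint D"
 defines "L \<equiv> %B D p. indicator \<Omega> p *\<^sub>R (B (fst p) + \<theta> (snd p) *\<^sub>R D (fst p) :: 'b)"
 shows "sqint (L W' E)"
  "dist2 (L B D) (L W' E) \<le> sqrt h * (dist2 (cut W B) W' + dist2 D E)"
proof -
 have "indicator \<Omega> \<in> borel_measurable (borel :: ('a \<times> real) measure)" using \<Omega>(1) by simp
 moreover have "(%p :: 'a \<times> real. \<theta> (snd p)) \<in> Borel"
  by (rule measurable_compose[OF borel_measurable_snd \<theta>(1)])
 ultimately have m: "(%p. indicator \<Omega> p :: real) \<in> Borel" "(%p. indicator \<Omega> p * \<theta> (snd p)) \<in> Borel"
  by (simp, rule borel_measurable_times)
 have bd: "\<bar>indicator \<Omega> p :: real\<bar> \<le> indicator {0..h} (snd p)" "\<bar>indicator \<Omega> p * \<theta> (snd p)\<bar> \<le> indicator {0..h} (snd p)" for p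
  using \<Omega>(2) \<theta>(2)[of "snd p"] by (auto simp: indicator_def)
 note c1 = square_int_cylinder[OF _ m(1) bd(1) h] and c2 = square_int_cylinder[OF _ m(2) bd(2) h]
 have "L W' E = (%p. indicator \<Omega> p *\<^sub>R W' (fst p) + (indicator \<Omega> p * \<theta> (snd p)) *\<^sub>R E (fst p))"
  by (simp add: L_def scaleR_add_right fun_eq_iff)
 then show "sqint (L W' E)" using square_int_add[OF c1(1)[OF sq(1)] c2(1)[OF sq(2)]] by simp
 have sd: "sqint (%x. cut W B x - W' x)" "sqint (%x. D x - E x)"
  by (rule square_int_diff[OF sq(3,1)], rule square_int_diff[OF sq(4,2)])
 have "(%p. L B D p - L W' E p) = (%p. indicator \<Omega> p *\<^sub>R (indicator W (fst p) *\<^sub>R B (fst p) - W' (fst p))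
  + (indicator \<Omega> p * \<theta> (snd p)) *\<^sub>R (D (fst p) - E (fst p)))"
  using \<Omega>(2) by (auto simp: L_def fun_eq_iff algebra_simps indicator_def)
 then have "dist2 (L B D) (L W' E) \<le> norm2 (cut \<Omega> (%p. indicator W (fst p) *\<^sub>R B (fst p) - W' (fst p)))
  + norm2 (%p. (indicator \<Omega> p * \<theta> (snd p)) *\<^sub>R (D (fst p) - E (fst p)))"
  using l2norm_triangle[OF c1(1)[OF sd(1)] c2(1)[OF sd(2)]] by simp
 then show "dist2 (L B D) (L W' E) \<le> sqrt h * (dist2 (cut W B) W' + dist2 D E)"
  using c1(2)[OF sd(1)] c2(2)[OF sd(2)] by (simp add: distrib_left)
qed

text \<open>Assumption \<open>\<theta>0\<close> removes the vertical component from the gradients of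
  the approximants inside \<open>\<Omega>\<close>, so they converge to a purely horizontal gradient,
  while the approximants are C^1 up to the boundary and vanish on \<open>\<Gamma>\<close>.\<close>

lemma lift_H1_Gamma_s:
 fixes b d :: "nat => real^2 => real" and \<Omega> \<Gamma> :: "((real^2) \<times> real) set"
 assumes \<Omega>: "open \<Omega>" "bounded \<Omega>" "\<Omega> \<subseteq> W \<times> {0..h}" and W: "open W" "bounded W" and h: "h \<ge> 0"
  and \<theta>: "smooth \<theta>" "!!y. \<bar>\<theta> y\<bar> \<le> 1"
  and b: "!!n. smooth (b n)" "l2lim (%n. cut W (b n)) w"
   "l2lim (%n x. cut W (grad (b n)) x) w'"
  and w: "sqint w" "sqint w'"
  and d: "!!n. test_function V (d n)" "l2lim d e"
   "l2lim (%n x. grad (d n) x) e'"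
  and e: "sqint e" "sqint e'"
  and \<theta>0: "!!n p. p \<in> \<Omega> ==> grad \<theta> (snd p) * d n (fst p) = 0"
  and \<Gamma>: "!!n p. p \<in> \<Gamma> ==> b n (fst p) + \<theta> (snd p) * d n (fst p) = 0"
 shows "cls \<Omega> (%p. indicator \<Omega> p * (w (fst p) + \<theta> (snd p) * e (fst p))) \<in> H1_Gamma_s \<Gamma> \<Omega>"
proof -
 define \<phi> where "\<phi> n p = b n (fst p) + \<theta> (snd p) * d n (fst p)" for n and p :: "(real^2) \<times> real"
 define G where "G n p = (grad (b n) (fst p) + \<theta> (snd p) *\<^sub>R grad (d n) (fst p), grad \<theta> (snd p) * d n (fst p))" for n and p :: "(real^2) \<times> real"
 note sd = test_function_smooth[OF d(1)] and td = test_function_integrable[OF d(1)]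
 have C1: "C1_grad \<Omega> (\<phi> n) (G n)" for n
  unfolding C1_grad_def
 proof (intro conjI ballI)
  note c = smooth_imp_continuous[OF b(1)] smooth_imp_continuous[OF sd] smooth_imp_continuous[OF \<theta>(1)]
   smooth_grad_continuous[OF b(1)] smooth_grad_continuous[OF sd] smooth_grad_continuous[OF \<theta>(1)]
  have cf: "continuous_on S (%p :: (real^2) \<times> real. q (fst p))" if "continuous_on UNIV q" for S and q :: "real^2 => 'z::topological_space"
   by (rule continuous_on_compose2[OF that]) (auto intro!: continuous_intros)
  have cs: "continuous_on S (%p :: (real^2) \<times> real. q (snd p))" if "continuous_on UNIV q" for S and q :: "real => 'z::topological_space"
   by (rule continuous_on_compose2[OF that]) (auto intro!: continuous_intros)
  show "continuous_on (closure \<Omega>) (\<phi> n)" unfolding \<phi>_def by (intro continuous_intros cf cs c)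
  show "continuous_on (closure \<Omega>) (G n)" unfolding G_def by (intro continuous_intros cf cs c)
  fix p :: "(real^2) \<times> real"
  have 1: "((%p. q (fst p)) has_derivative (%k. grad q (fst p) \<bullet> fst k)) (at p)" if "smooth q" for q :: "real^2 => real"
   by (rule has_derivative_compose[OF _ smooth_grad(1)[OF that]]) (auto intro!: derivative_eq_intros)
  have 2: "((%p. \<theta> (snd p)) has_derivative (%k. grad \<theta> (snd p) \<bullet> snd k)) (at p)"
   by (rule has_derivative_compose[OF _ smooth_grad(1)[OF \<theta>(1)]]) (auto intro!: derivative_eq_intros)
  show "(\<phi> n has_derivative (\<bullet>) (G n p)) (at p)"
   unfolding \<phi>_def
   by (rule has_derivative_eq_rhs[OF has_derivative_add[OF 1[OF b(1)] has_derivative_mult[OF 2 1[OF sd]]]])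
    (simp add: fun_eq_iff G_def inner_prod_def inner_add_left algebra_simps)
 qed
 define F where "F p = indicator \<Omega> p *\<^sub>R (w (fst p) + \<theta> (snd p) *\<^sub>R e (fst p))" for p
 define g where "g p = indicator \<Omega> p *\<^sub>R (w' (fst p) + \<theta> (snd p) *\<^sub>R e' (fst p))" for p
 have \<theta>m: "\<theta> \<in> Borel" using smooth_imp_continuous[OF \<theta>(1)] by (rule borel_measurable_continuous_onI)
 note wb = wgrad_C1'[OF W smooth_C1_grad[OF b(1)]]
 note L1 = lift_bound[OF \<Omega>(1,3) h \<theta>m \<theta>(2) w(1) e(1) wgradD(1)[OF wb] td(1)]
 note L2 = lift_bound[OF \<Omega>(1,3) h \<theta>m \<theta>(2) w(2) e(2) wgradD(2)[OF wb] td(3)]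
 have Fs: "sqint F" and gs: "sqint g" using L1(1) L2(1) unfolding F_def g_def by blast+
 have z: "sqint (%p. (k p, 0::real))" "norm2 (%p. (k p, 0::real)) = norm2 k"
  if "sqint k" for k :: "(real^2) \<times> real => real^2"
 proof -
  have "(%p. (k p, 0::real)) \<in> borel_measurable lborel"
   using measurable_compose[OF square_int_measurable[OF that], of "%x. (x, 0::real)" borel]
   by (auto intro!: borel_measurable_continuous_onI continuous_intros)
  then show "sqint (%p. (k p, 0::real))" using that by (simp add: square_int_def norm_Pair)
 qed (simp add: l2norm_def norm_Pair)
 have lF: "l2lim (%n. cut \<Omega> (\<phi> n)) F"
 proof (rule l2norm_squeeze)
  show "dist2 (cut \<Omega> (\<phi> n)) F
   \<le> sqrt h * (dist2 (cut W (b n)) w + dist2 (d n) e)" for n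
   using L1(2)[of n n] by (simp add: F_def \<phi>_def l2norm_nonneg)
  show "(%n. sqrt h * (dist2 (cut W (b n)) w + dist2 (d n) e)) \<longlonglongrightarrow> 0"
   using tendsto_mult_left[OF tendsto_add[OF b(2) d(2)], of "sqrt h"] by simp
 qed
 have lg: "l2lim (%n. cut \<Omega> (G n)) (%p. (g p, 0))"
 proof (rule l2norm_squeeze)
  fix n
  define k where "k p = indicator \<Omega> p *\<^sub>R (grad (b n) (fst p) + \<theta> (snd p) *\<^sub>R grad (d n) (fst p)) - g p" for p
  have "(%p. cut \<Omega> (G n) p - (g p, 0)) = (%p. (k p, 0))"
   using \<theta>0 by (auto simp: k_def G_def fun_eq_iff indicator_def)
  then have "norm2 (%p. cut \<Omega> (G n) p - (g p, 0)) = norm2 k"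
   by (simp add: l2norm_def norm_Pair)
  also have "... \<le> sqrt h * (dist2 (cut W (grad (b n))) w' + dist2 (grad (d n)) e')"
   using L2(2)[of n n] unfolding k_def g_def .
  finally show "norm2 (%p. cut \<Omega> (G n) p - (g p, 0))
   \<le> sqrt h * (dist2 (cut W (grad (b n))) w' + dist2 (grad (d n)) e')"
   by (simp add: l2norm_nonneg)
 next
  show "(%n. sqrt h * (dist2 (cut W (grad (b n))) w' + dist2 (grad (d n)) e')) \<longlonglongrightarrow> 0"
   using tendsto_mult_left[OF tendsto_add[OF b(3) d(3)], of "sqrt h"] by simp
 qed
 note wn = wgrad_C1'[OF \<Omega>(1,2) C1]
 have wF: "wgrad \<Omega> F (%p. (g p, 0))"
  by (rule wgrad_limit[OF wn Fs _ z(1)[OF gs] _ lF lg]) (auto simp: F_def g_def zero_prod_def)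
 have "C1_closure \<Omega> (\<phi> n)" for n using C1 C1_closure_iff by blast
 then have S: "cls \<Omega> (cut \<Omega> (\<phi> n)) \<in> {cls \<Omega> u |u. C1_closure \<Omega> u \<and> (\<forall>p\<in>\<Gamma>. u p = 0)}" for n
  using cls_indicator[of \<Omega> "\<phi> n"] \<Gamma> by (auto simp: \<phi>_def)
 have "cls \<Omega> F \<in> H1_Gamma \<Gamma> \<Omega>"
  unfolding H1_Gamma_def by (rule H1_closure_cls[OF \<Omega>(1) wF S wn lF lg])
 moreover have "weak_partial \<Omega> (0, 1) (cls \<Omega> F) = cls \<Omega> (%_. 0)"
  using weak_partial_cls[OF \<Omega>(1) wF, of "(0, 1)"] by (simp add: inner_prod_def)
 ultimately have "cls \<Omega> F \<in> H1_Gamma_s \<Gamma> \<Omega>" by (simp add: H1_Gamma_s_def)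
 then show ?thesis by (simp add: F_def[abs_def])
qed

text \<open>An identity and not only a bound: \<open>cylinder_limit\<close> reads it from the
  cylinder back to the base.\<close>

lemma l2norm_cylinder:
 fixes g :: "'a::euclidean_space => 'b::euclidean_space"
 assumes V: "V \<in> sets borel" and g: "sqint g" "!!x. x \<notin> V ==> g x = 0" and ab: "a \<le> (b::real)"
 shows "norm2 (%p. indicator (V \<times> {a<..<b}) p *\<^sub>R g (fst p)) = sqrt (b - a) * norm2 g"
proof -
 have [measurable]: "g \<in> Borel" using square_int_measurable[OF g(1)] by simp
 have Cb: "V \<times> {a<..<b} \<in> sets borel" unfolding borel_prod[symmetric] using V by auto
 have m: "(%p. indicator (V \<times> {a<..<b}) p :: real) \<in> Borel"
  "\<bar>indicator (V \<times> {a<..<b}) p :: real\<bar> \<le> indicator {a..b} (snd p)" for p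
  using Cb by (simp, simp add: indicator_def mem_Times_iff)
 note s = square_int_cylinder[OF g(1) m ab]
 have "ennreal ((norm2 (%p. indicator (V \<times> {a<..<b}) p *\<^sub>R g (fst p)))^2)
  = (\<integral>\<^sup>+p. ennreal ((norm (indicator (V \<times> {a<..<b}) p *\<^sub>R g (fst p)))^2) \<partial>lborel)"
  by (rule l2norm_nn_integral[OF s(1), symmetric])
 also have "... = (\<integral>\<^sup>+p. ennreal ((norm (g (fst p)))^2) * indicator {a<..<b} (snd p) \<partial>lborel)"
 proof (rule nn_integral_cong)
  fix p :: "'a \<times> real"
  show "ennreal ((norm (indicator (V \<times> {a<..<b}) p *\<^sub>R g (fst p)))^2) = ennreal ((norm (g (fst p)))^2) * indicator {a<..<b} (snd p)"
   by (cases "fst p \<in> V") (simp_all add: g(2) indicator_def mem_Times_iff)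
 qed
 also have "... = (\<integral>\<^sup>+x. \<integral>\<^sup>+y. ennreal ((norm (g x))^2) * indicator {a<..<b} y \<partial>lborel \<partial>lborel)"
  unfolding lborel_prod[symmetric] by (subst lborel.nn_integral_fst[symmetric]) auto
 also have "... = (\<integral>\<^sup>+x. ennreal ((norm (g x))^2) \<partial>lborel) * ennreal (b - a)"
  using ab by (simp add: nn_integral_cmult nn_integral_multc)
 also have "... = ennreal ((sqrt (b - a) * norm2 g)^2)"
  unfolding l2norm_nn_integral[OF g(1)] using ab by (simp add: power_mult_distrib ennreal_mult mult.commute)
 finally have "(norm2 (%p. indicator (V \<times> {a<..<b}) p *\<^sub>R g (fst p)))^2 = (sqrt (b - a) * norm2 g)^2"
  by simp
 then show ?thesis
  by (rule power2_eq_imp_eq[OF _ l2norm_nonneg mult_nonneg_nonneg[OF _ l2norm_nonneg]]) (simp add: ab)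
qed

text \<open>The norm on the cylinder is a fixed positive multiple of the norm on the base, so the
  base functions are Cauchy and completeness supplies \<open>v'\<close>.\<close>

lemma cylinder_limit:
 fixes f :: "'a::euclidean_space \<times> real => real"
 assumes V: "V \<in> sets borel" and ab: "a < b"
  and F: "!!n::nat. sqint (F n)" "sqint f" "l2lim F f"
  and v: "!!n. sqint (v n)" "!!n x. x \<notin> V ==> v n x = 0"
  and eq: "!!n. AE p in lborel. p \<in> V \<times> {a<..<b} --> F n p = v n (fst p)"
 obtains v' where "sqint v'" "AE p in lborel. p \<in> V \<times> {a<..<b} --> f p = v' (fst p)"
proof -
 let ?C = "V \<times> {a<..<b}"
 have Cb: "?C \<in> sets borel" unfolding borel_prod[symmetric] using V by auto
 have m: "(%p. indicator ?C p :: real) \<in> Borel" "\<bar>indicator ?C p :: real\<bar> \<le> indicator {a..b} (snd p)" for p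
  using Cb by (simp, simp add: indicator_def mem_Times_iff)
 note cyl = square_int_cylinder[OF _ m less_imp_le[OF ab]]
 have m': "(%p. indicator ?C p :: real) \<in> borel_measurable lborel" "\<bar>indicator ?C p :: real\<bar> \<le> 1" for p
  using m(1) by (simp_all add: indicator_def)
 have s: "sqint (cut ?C f)" "!!n. sqint (%p. indicator ?C p *\<^sub>R v n (fst p))"
  by (rule square_int_bounded_mult[OF F(2) m'], rule cyl(1)[OF v(1)])
 have lim: "l2lim (%n p. indicator ?C p *\<^sub>R v n (fst p)) (cut ?C f)"
 proof (rule l2norm_squeeze[OF _ F(3)])
  fix n
  show "norm2 (%p. indicator ?C p *\<^sub>R v n (fst p) - cut ?C f p) \<le> dist2 (F n) f"
  proof (rule l2norm_mono[OF square_int_measurable[OF square_int_diff[OF s(2,1)]] square_int_diff[OF F(1,2)]])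
   show "AE p in lborel. norm (indicator ?C p *\<^sub>R v n (fst p) - cut ?C f p) \<le> norm (F n p - f p)"
    using eq[of n] by eventually_elim (auto simp: indicator_def)
  qed
 qed
 have cau: "\<exists>N. \<forall>m\<ge>N. \<forall>n\<ge>N. dist2 (v m) (v n) < \<epsilon>" if "\<epsilon> > 0" for \<epsilon>
 proof -
  let ?d = "%n. norm2 (%p. indicator ?C p *\<^sub>R v n (fst p) - cut ?C f p)"
  have "\<forall>\<^sub>F n in sequentially. ?d n < sqrt (b - a) * \<epsilon> / 2" using lim that ab by (intro order_tendstoD) auto
  then obtain N where N: "!!n. n \<ge> N ==> ?d n < sqrt (b - a) * \<epsilon> / 2" unfolding eventually_sequentially by blast
  have "dist2 (v m) (v n) < \<epsilon>" if mn: "m \<ge> N" "n \<ge> N" for m n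
  proof -
   have "sqrt (b - a) * dist2 (v m) (v n) = norm2 (cut ?C (%p. v m (fst p) - v n (fst p)))"
    by (rule l2norm_cylinder[OF V square_int_diff[OF v(1) v(1)] _ less_imp_le[OF ab], symmetric]) (simp add: v(2))
   also have "... \<le> ?d m + norm2 (%p. cut ?C f p - indicator ?C p *\<^sub>R v n (fst p))"
    unfolding scaleR_diff_right by (rule l2norm_diff_triangle[OF s(2,1,2)])
   also have "... = ?d m + ?d n" by (subst (2) l2norm_diff_commute) (rule refl)
   also have "... < sqrt (b - a) * \<epsilon>" using N[OF mn(1)] N[OF mn(2)] by linarith
   finally show ?thesis using ab by simp
  qed
  then show ?thesis by blast
 qed
 obtain v' where v': "sqint v'" "l2lim v v'"
  using square_int_complete[OF v(1) cau] by blast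
 have "l2lim (%n p. indicator ?C p *\<^sub>R v n (fst p)) (%p. indicator ?C p *\<^sub>R v' (fst p))"
 proof (rule l2norm_squeeze)
  show "norm2 (%p. indicator ?C p *\<^sub>R v n (fst p) - indicator ?C p *\<^sub>R v' (fst p)) \<le> sqrt (b - a) * dist2 (v n) v'" for n
   using cyl(2)[OF square_int_diff[OF v(1) v'(1)], of n] unfolding scaleR_diff_right by (simp add: l2norm_nonneg)
  show "(%n. sqrt (b - a) * dist2 (v n) v') \<longlonglongrightarrow> 0"
   using tendsto_mult_left[OF v'(2), of "sqrt (b - a)"] by simp
 qed
 from l2norm_limit_unique[OF s(2) s(1) cyl(1)[OF v'(1)] lim this]
 have "AE p in lborel. p \<in> ?C --> f p = v' (fst p)" by eventually_elim (auto simp: indicator_def)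
 with v'(1) that show thesis by blast
qed

lemma cls_cong:
 assumes "!!x. x \<in> U ==> f x = g x"
 shows "cls U f = cls U g"
proof -
 have "(AE x in lebesgue_on U. k x = f x) \<longleftrightarrow> (AE x in lebesgue_on U. k x = g x)" for k
  by (rule AE_cong) (simp add: assms)
 then show ?thesis by (simp add: ae_class_def)
qed

lemma l2norm_diff_tendsto:
 assumes f: "!!n::nat. square_int M (f n)" "square_int M s" "l2_tendsto M f s"
  and g: "!!n. square_int M (g n)" "square_int M t" "l2_tendsto M g t"
  and eq: "AE x in M. s x = t x"
 shows "(%n. l2norm M (%x. f n x - g n x)) \<longlonglongrightarrow> 0"
proof (rule l2norm_squeeze)
 fix n
 have "l2norm M (%x. f n x - t x) = l2norm M (%x. f n x - s x)"
  by (rule l2norm_cong_AE[OF square_int_measurable[OF square_int_diff[OF f(1) g(2)]] square_int_measurable[OF square_int_diff[OF f(1,2)]]])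
   (use eq in \<open>auto elim!: eventually_mono\<close>)
 moreover have "l2norm M (%x. t x - g n x) = l2norm M (%x. g n x - t x)" by (rule l2norm_diff_commute)
 ultimately show "l2norm M (%x. f n x - g n x) \<le> l2norm M (%x. f n x - s x) + l2norm M (%x. g n x - t x)"
  using l2norm_diff_triangle[OF f(1) g(2) g(1), of n n] by (simp add: l2norm_nonneg)
qed (use tendsto_add[OF f(3) g(3)] in simp)

lemma l2norm_tendsto_add:
 assumes "!!n::nat. square_int M (f n)" "!!n. square_int M (g n)" "square_int M s" "square_int M t"
  and "l2_tendsto M f s" "l2_tendsto M g t"
 shows "l2_tendsto M (%n x. (f n x + g n x)) (%x. (s x + t x))"
proof (rule l2norm_squeeze)
 show "l2norm M (%x. (f n x + g n x) - (s x + t x)) \<le> l2norm M (%x. f n x - s x) + l2norm M (%x. g n x - t x)" for n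
  using l2norm_triangle[OF square_int_diff[OF assms(1,3)] square_int_diff[OF assms(2,4)], of n n] by (simp add: add_diff_add l2norm_nonneg)
qed (use tendsto_add[OF assms(5,6)] in simp)

lemma l2norm_tendsto_diff:
 assumes "!!n::nat. square_int M (f n)" "!!n. square_int M (g n)" "square_int M s" "square_int M t"
  and "l2_tendsto M f s" "l2_tendsto M g t"
 shows "l2_tendsto M (%n x. (f n x - g n x)) (%x. (s x - t x))"
proof -
 have "l2norm M (%x. - g n x - - t x) = l2norm M (%x. g n x - t x)" for n
  using l2norm_minus[of M "%x. g n x - t x"] by simp
 then have "(%n. l2norm M (%x. - g n x - - t x)) \<longlonglongrightarrow> 0" using assms(6) by presburger
 from l2norm_tendsto_add[OF assms(1) square_int_minus[OF assms(2)] assms(3) square_int_minus[OF assms(4)] assms(5) this]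
 show ?thesis by simp
qed

lemma grad_add: "grad (%x. p x + r x) x = grad p x + grad r x"
 and grad_diff: "grad (%x. p x - r x) x = grad p x - grad r x"
 if "smooth p" "smooth r"
 using has_derivative_add[OF smooth_grad(1)[OF that(1)] smooth_grad(1)[OF that(2)]]
  has_derivative_diff[OF smooth_grad(1)[OF that(1)] smooth_grad(1)[OF that(2)]]
 by (intro grad_eqI; simp add: inner_add_left inner_diff_left)+

section \<open>The perforated domain\<close>

locale perforated_domain =
 fixes \<omega> \<omega>1 \<omega>2 :: "(real^2) set" and \<Omega> \<Omega>1 \<Omega>2 \<Omega>3 \<Gamma>L :: "((real^2) \<times> real) set" and h1 h2 h3 :: real
 assumes \<omega>: "open \<omega>" "bounded \<omega>" "C2_boundary \<omega>" and \<omega>2: "open \<omega>2" "C2_boundary \<omega>2" "closure \<omega>2 \<subseteq> \<omega>"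
  and \<omega>1: "\<omega>1 = \<omega> - closure \<omega>2" and h: "h1 > 0" "h2 > 0" "h3 > 0" "h1 > h2 + h3"
  and \<Omega>_def: "\<Omega> = (\<omega> \<times> {0<..<h1}) - closure (\<omega>2 \<times> {h3<..<h1 - h2})"
  and cyl: "\<Omega>1 = \<omega>1 \<times> {0<..<h1}" "\<Omega>2 = \<omega>2 \<times> {h1 - h2<..<h1}" "\<Omega>3 = \<omega>2 \<times> {0<..<h3}"
  and \<Gamma>L: "\<Gamma>L = (frontier \<omega> \<times> {0..h1}) \<union> (frontier \<omega>2 \<times> {h3..h1 - h2})"
begin

section \<open>Geometry of the perforated domain and its boundary charts\<close>

lemma \<Omega>_eq: "\<Omega> = (\<omega> \<times> {0<..<h1}) - closure \<omega>2 \<times> {h3..h1 - h2}"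
 using h by (simp add: \<Omega>_def closure_Times)

lemma sets: "\<omega>2 \<subseteq> \<omega>" "\<omega>1 \<subseteq> \<omega>" "bounded \<omega>2" "open \<omega>1" "bounded \<omega>1" "\<omega>1 \<inter> \<omega>2 = {}"
proof -
 show s: "\<omega>2 \<subseteq> \<omega>" "\<omega>1 \<subseteq> \<omega>" unfolding \<omega>1 using \<omega>2(3) closure_subset[of \<omega>2] by blast+
 show "bounded \<omega>2" "bounded \<omega>1" using s \<omega>(2) bounded_subset by blast+
 show "open \<omega>1" unfolding \<omega>1 using \<omega>(1) by (intro open_Diff) auto
 show "\<omega>1 \<inter> \<omega>2 = {}" unfolding \<omega>1 using closure_subset[of \<omega>2] by blast
qed

lemma \<Omega>: "open \<Omega>" "bounded \<Omega>" "\<Omega> \<subseteq> \<omega> \<times> {0..h1}"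
proof -
 show "open \<Omega>" unfolding \<Omega>_def using \<omega>(1) by (intro open_Diff open_Times) auto
 show sub: "\<Omega> \<subseteq> \<omega> \<times> {0..h1}" unfolding \<Omega>_def by auto
 show "bounded \<Omega>" by (rule bounded_subset[OF bounded_Times[OF \<omega>(2)] sub]) simp
qed

lemma cylinders:
 "\<omega>1 \<times> {0<..<h1} \<subseteq> \<Omega>" "\<omega> \<times> {h1 - h2<..<h1} \<subseteq> \<Omega>" "\<omega> \<times> {0<..<h3} \<subseteq> \<Omega>" "\<omega>1 \<times> {h3<..<h1 - h2} \<subseteq> \<Omega>"
 using h by (auto simp: \<Omega>_eq \<omega>1)

lemma bcharts_\<omega>: "has_bcharts \<omega>" "has_bcharts \<omega>2"
 using C2_boundary_has_bcharts \<omega>(3) \<omega>2(2) by auto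

text \<open>Once the ball is shrunk into \<open>\<omega>\<close>, the set \<open>\<omega>1\<close>
  coincides there with the exterior of \<open>\<omega>2\<close>, so one graph serves both sides with
  reversed normal.\<close>

lemma interface_chart:
 assumes p: "p \<in> frontier \<omega>2"
 shows "\<exists>r e n \<gamma> \<gamma>'. bchart \<omega>2 p r e n \<gamma> \<gamma>' \<and> bchart \<omega>1 p r e (- n) (%s. - \<gamma> s) (%s. - \<gamma>' s)"
proof -
 obtain r e n \<gamma> \<gamma>' where c: "bchart \<omega>2 p r e n \<gamma> \<gamma>'" using bcharts_\<omega>(2) p unfolding has_bcharts_def by blast
 have "p \<in> \<omega>" using p \<omega>2(3) by (auto simp: frontier_def)
 then obtain r' where r': "r' > 0" "ball p r' \<subseteq> \<omega>" using \<omega>(1) open_contains_ball by blast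
 define \<rho> where "\<rho> = min r r'"
 have "\<rho> > 0" "\<rho> \<le> r" using r'(1) bchartD(1)[OF c] by (auto simp: \<rho>_def)
 then have c': "bchart \<omega>2 p \<rho> e n \<gamma> \<gamma>'" by (rule bchart_shrink[OF c])
 have "ball p \<rho> \<subseteq> \<omega>" using r'(2) by (auto simp: \<rho>_def)
 then have "bchart \<omega>1 p \<rho> e (- n) (%s. - \<gamma> s) (%s. - \<gamma>' s)"
  by (intro bchart_cong[OF bchart_complement[OF c']]) (auto simp: \<omega>1)
 with c' show ?thesis by blast
qed

lemma frontier_\<omega>1: "frontier \<omega>2 \<subseteq> frontier \<omega>1" "frontier \<omega>1 \<subseteq> frontier \<omega> \<union> frontier \<omega>2"
proof
 fix p assume p: "p \<in> frontier \<omega>2"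
 then obtain r e n \<gamma> \<gamma>' where c: "bchart \<omega>2 p r e n \<gamma> \<gamma>'" "bchart \<omega>1 p r e (- n) (%s. - \<gamma> s) (%s. - \<gamma>' s)"
  using interface_chart by blast
 have b: "p \<in> ball p r" using bchartD(1)[OF c(1)] by simp
 then have "\<gamma> (p \<bullet> e) = p \<bullet> n" using bchart_frontier[OF c(1) \<omega>2(1)] p by blast
 then have "- \<gamma> (p \<bullet> e) = p \<bullet> - n" by simp
 then show "p \<in> frontier \<omega>1" using bchart_frontier[OF c(2) sets(4)] b by blast
next
 show "frontier \<omega>1 \<subseteq> frontier \<omega> \<union> frontier \<omega>2"
 proof
  fix p assume p: "p \<in> frontier \<omega>1"
  have "p \<notin> \<omega>1" "p \<in> closure \<omega>1" using p sets(4) by (auto simp: frontier_def interior_open)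
  moreover have "closure \<omega>1 \<inter> \<omega>2 = {}" using \<omega>2(1) sets(6) by (simp add: open_Int_closure_eq_empty inf_commute)
  moreover have "closure \<omega>1 \<subseteq> closure \<omega>" using sets(2) by (rule closure_mono)
  ultimately show "p \<in> frontier \<omega> \<union> frontier \<omega>2"
   using \<omega>(1) \<omega>2(1) by (auto simp: frontier_def interior_open \<omega>1)
 qed
qed

lemma frontier_disjoint: "frontier \<omega> \<inter> closure \<omega>2 = {}" "frontier \<omega> \<inter> \<omega> = {}" "frontier \<omega>2 \<inter> \<omega>1 = {}" "frontier \<omega>2 \<inter> \<omega>2 = {}"
 using \<omega>(1) \<omega>2 by (auto simp: frontier_def interior_open \<omega>1)

text \<open>The two parts of the boundary of \<open>\<omega>1\<close> are disjoint and closed: a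
  chart of \<open>\<omega>\<close> can be shrunk away from \<open>closure \<omega>2\<close>, and at
  \<open>frontier \<omega>2\<close> the interface charts apply.\<close>

lemma bcharts_\<omega>1: "has_bcharts \<omega>1"
 unfolding has_bcharts_def
proof
 fix p assume "p \<in> frontier \<omega>1"
 then consider "p \<in> frontier \<omega>2" | "p \<in> frontier \<omega>" using frontier_\<omega>1(2) by blast
 then show "\<exists>r e n \<gamma> \<gamma>'. bchart \<omega>1 p r e n \<gamma> \<gamma>'"
 proof cases
  case 1 then show ?thesis using interface_chart by blast
 next
  case 2
  obtain r e n \<gamma> \<gamma>' where c: "bchart \<omega> p r e n \<gamma> \<gamma>'" using bcharts_\<omega>(1) 2 unfolding has_bcharts_def by blast
  have "p \<in> - closure \<omega>2" using 2 frontier_disjoint(1) by blast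
  then obtain r' where r': "r' > 0" "ball p r' \<subseteq> - closure \<omega>2" using open_contains_ball[of "- closure \<omega>2"] by auto
  define \<rho> where "\<rho> = min r r'"
  have "\<rho> > 0" "\<rho> \<le> r" using r'(1) bchartD(1)[OF c] by (auto simp: \<rho>_def)
  then have c': "bchart \<omega> p \<rho> e n \<gamma> \<gamma>'" by (rule bchart_shrink[OF c])
  have "ball p \<rho> \<subseteq> - closure \<omega>2" using r'(2) by (auto simp: \<rho>_def)
  then have "bchart \<omega>1 p \<rho> e n \<gamma> \<gamma>'" by (intro bchart_cong[OF c']) (auto simp: \<omega>1)
  then show ?thesis by blast
 qed
qed

section \<open>From functions on the domain to triples\<close>

abbreviation "\<iota> \<equiv> iota_oplus \<omega>1 \<omega>2 \<omega>2 \<Omega>1 \<Omega>2 \<Omega>3"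

lemma iota_triple:
 assumes f: "f \<in> Borel" and v: "sqint v1" "sqint v2" "sqint v3"
  and eq: "AE p in lborel. p \<in> \<Omega>1 --> f p = v1 (fst p)" "AE p in lborel. p \<in> \<Omega>2 --> f p = v2 (fst p)"
   "AE p in lborel. p \<in> \<Omega>3 --> f p = v3 (fst p)"
 shows "\<iota> (cls \<Omega> f) = (cls \<omega>1 v1, cls \<omega>2 v2, cls \<omega>2 v3)"
proof -
 have b: "\<Omega> \<in> sets borel" "\<Omega>1 \<in> sets borel" "\<Omega>2 \<in> sets borel" "\<Omega>3 \<in> sets borel"
  unfolding cyl using \<Omega>(1) sets(4) \<omega>2(1) by (auto intro!: borel_open open_Times)
 have s: "\<Omega>1 \<subseteq> \<Omega>" "\<Omega>2 \<subseteq> \<Omega>" "\<Omega>3 \<subseteq> \<Omega>" using cylinders sets(1) unfolding cyl by blast+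
 show ?thesis
  unfolding iota_oplus_def restrict_class_cls[OF b(1,2) s(1) f] restrict_class_cls[OF b(1,3) s(2) f] restrict_class_cls[OF b(1,4) s(3) f]
  using iota_cls[OF sets(4) _ v(1) f eq(1)[unfolded cyl]] iota_cls[OF \<omega>2(1) _ v(2) f eq(2)[unfolded cyl]]
   iota_cls[OF \<omega>2(1) _ v(3) f eq(3)[unfolded cyl]] h by (simp add: cyl)
qed

lemma H1_Gamma_s_mono: "H1_Gamma_s \<Gamma> \<Omega> \<subseteq> H1_Gamma_s {} \<Omega>"
 unfolding H1_Gamma_s_def H1_Gamma_def H1_closure_def by blast

text \<open>The slices of a cylinder with full base form one sequence, C^1 on all of
  \<open>\<omega>\<close>, whose restrictions approximate \<open>u\<close> on
  \<open>\<omega>1\<close> and on \<open>\<omega>2\<close>; on the interface both traces are limits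
  of the same functions. On \<open>\<omega>1\<close>, \<open>u\<close> equals \<open>v1\<close>
  because both describe \<open>f\<close> over \<open>\<omega>1 \<times> {a<..<b}\<close>.\<close>

lemma cylinder_trace:
 assumes w: "wgrad \<Omega> f g" and g0: "AE p in lborel. snd (g p) = 0" and \<phi>: "!!n::nat. C1_grad \<Omega> (\<phi> n) (G n)"
  and lim: "l2lim (%n. cut \<Omega> (\<phi> n)) f"
   "l2lim (%n. cut \<Omega> (G n)) g"
  and ab: "\<omega> \<times> {a<..<b} \<subseteq> \<Omega>" "a < b" "0 \<le> a" "b \<le> h1"
  and v1: "wgrad \<omega>1 v1 g1" "AE p in lborel. p \<in> \<Omega>1 --> f p = v1 (fst p)"
 obtains v k where "wgrad \<omega>2 v k" "AE p in lborel. p \<in> \<omega>2 \<times> {a<..<b} --> f p = v (fst p)"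
  "AE x in boundary_measure \<omega>2. tr \<omega>1 v1 x = tr \<omega>2 v x"
proof -
 obtain y u k r where y: "a < y" "y < b" and r: "strict_mono (r :: nat => nat)" and u: "wgrad \<omega> u k"
  and fu: "AE p in lborel. p \<in> \<omega> \<times> {a<..<b} --> f p = u (fst p)"
  and lu: "l2lim (%n x. indicator \<omega> x *\<^sub>R \<phi> (r n) (x, y)) u"
   "l2lim (%n x. indicator \<omega> x *\<^sub>R fst (G (r n) (x, y))) k"
  by (rule cylinder_slice[where \<phi> = \<phi> and G = G, OF \<Omega>(1,2) \<omega>(1,2) ab(1,2) w g0 \<phi> lim])
 have yI: "y \<in> {a<..<b}" using y by simp
 have restr: "wgrad V (%x. indicator V x * u x) (cut V k) \<and> C1_grad V (%x. \<phi> n (x, y)) (%x. fst (G n (x, y))) \<and>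
   l2lim (%n x. indicator V x *\<^sub>R \<phi> (r n) (x, y)) (%x. indicator V x * u x) \<and>
   l2lim (%n x. indicator V x *\<^sub>R fst (G (r n) (x, y))) (cut V k)"
  if V: "open V" "bounded V" "V \<subseteq> \<omega>" for V n
 proof (intro conjI)
  have Vb: "V \<in> sets borel" using V(1) by simp
  show wV: "wgrad V (%x. indicator V x * u x) (cut V k)" by (rule wgrad_restrict[OF u V(3) Vb])
  have C: "C1_grad V (%x. \<phi> n (x, y)) (%x. fst (G n (x, y)))" for n
   by (rule C1_grad_slice[OF \<phi> _ yI]) (use V(3) ab(1) in blast)
  show "C1_grad V (%x. \<phi> n (x, y)) (%x. fst (G n (x, y)))" by (rule C)
  have C\<omega>: "C1_grad \<omega> (%x. \<phi> n (x, y)) (%x. fst (G n (x, y)))" for n by (rule C1_grad_slice[OF \<phi> ab(1) yI])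
  note d = wgrad_diff[OF wgrad_C1'[OF V(1,2) C] wV] wgrad_diff[OF wgrad_C1'[OF \<omega>(1,2) C\<omega>] u]
  show "l2lim (%n x. indicator V x *\<^sub>R \<phi> (r n) (x, y)) (%x. indicator V x * u x)"
  proof (rule l2norm_squeeze[OF _ lu(1)])
   show "norm2 (%x. indicator V x *\<^sub>R \<phi> (r n) (x, y) - indicator V x * u x) \<le> norm2 (%x. indicator \<omega> x *\<^sub>R \<phi> (r n) (x, y) - u x)" for n
    by (rule l2norm_mono[OF square_int_measurable[OF wgradD(1)[OF d(1)]] wgradD(1)[OF d(2)]])
     (use V(3) in \<open>auto simp: indicator_def\<close>)
  qed
  show "l2lim (%n x. indicator V x *\<^sub>R fst (G (r n) (x, y))) (cut V k)"
  proof (rule l2norm_squeeze[OF _ lu(2)])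
   show "norm2 (%x. indicator V x *\<^sub>R fst (G (r n) (x, y)) - cut V k x) \<le> norm2 (%x. indicator \<omega> x *\<^sub>R fst (G (r n) (x, y)) - k x)" for n
    by (rule l2norm_mono[OF square_int_measurable[OF wgradD(2)[OF d(1)]] wgradD(2)[OF d(2)]])
     (use V(3) in \<open>auto simp: indicator_def\<close>)
  qed
 qed
 note r1 = restr[OF sets(4,5,2)] and r2 = restr[OF \<omega>2(1) sets(3,1)]
 note T1 = trace_limit[OF sets(4,5) bcharts_\<omega>1 conjunct1[OF r1], of "%n x. \<phi> (r n) (x, y)" "%n x. fst (G (r n) (x, y))"]
 note T2 = trace_limit[OF \<omega>2(1) sets(3) bcharts_\<omega>(2) conjunct1[OF r2], of "%n x. \<phi> (r n) (x, y)" "%n x. fst (G (r n) (x, y))"]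
 let ?t1 = "tr \<omega>1 (%x. indicator \<omega>1 x * u x)" and ?t2 = "tr \<omega>2 (%x. indicator \<omega>2 x * u x)"
 have t1: "square_int (boundary_measure \<omega>1) ?t1" "l2_tendsto (boundary_measure \<omega>1) (%n x. \<phi> (r n) (x, y)) ?t1"
  "!!n. square_int (boundary_measure \<omega>1) (%x. \<phi> (r n) (x, y))" using T1 r1 by blast+
 have t2: "square_int (boundary_measure \<omega>2) ?t2" "l2_tendsto (boundary_measure \<omega>2) (%n x. \<phi> (r n) (x, y)) ?t2"
  "!!n. square_int (boundary_measure \<omega>2) (%x. \<phi> (r n) (x, y))" using T2 r2 by blast+
 have t1': "l2_tendsto (boundary_measure \<omega>2) (%n x. \<phi> (r n) (x, y)) ?t1"
  by (rule l2norm_squeeze[OF _ t1(2)])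
   (use boundary_measure_mono(2)[OF frontier_\<omega>1(1) square_int_diff[OF t1(3,1)]] in \<open>simp add: l2norm_nonneg\<close>)
 have tr: "AE x in boundary_measure \<omega>2. ?t1 x = ?t2 x"
  by (rule l2norm_limit_unique[OF t2(3) boundary_measure_mono(1)[OF frontier_\<omega>1(1) t1(1)] t2(1) t1' t2(2)])
 have ub [measurable]: "u \<in> Borel" "v1 \<in> Borel" using wgradD(6) u v1(1) by blast+
 have b1: "\<omega>1 \<in> sets borel" using sets(4) by simp
 have "AE p in lborel. p \<in> \<omega>1 \<times> {a<..<b} --> u (fst p) = v1 (fst p)"
  using fu v1(2) by eventually_elim (use sets(2) ab(3,4) in \<open>auto simp: cyl\<close>)
 moreover have "{x. u x = v1 x} \<in> sets borel" by measurable
 ultimately have "AE x in lborel. x \<in> \<omega>1 --> u x = v1 x" using AE_cylinder[OF b1 _ ab(2), of "%x. u x = v1 x"] by blast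
 then have "cls \<omega>1 u = cls \<omega>1 v1" using cls_eq_iff[OF b1 ub] by blast
 then have c1: "cls \<omega>1 (%x. indicator \<omega>1 x * u x) = cls \<omega>1 v1" by (simp add: cls_indicator)
 have "AE p in lborel. p \<in> \<omega>2 \<times> {a<..<b} --> f p = indicator \<omega>2 (fst p) * u (fst p)"
  using fu by eventually_elim (use sets(1) in auto)
 then show thesis using that[OF conjunct1[OF r2]] tr unfolding c1 by blast
qed

text \<open>Four slicings of one approximating sequence: over \<open>\<omega>1\<close> at full
  height to define \<open>v1\<close>, over \<open>\<omega>\<close> above and below the hole for the
  other components and their traces, and over \<open>\<omega>1\<close> at the height of the hole for
  the vanishing trace.\<close>

lemma iota_H1:
 assumes u: "u \<in> H1_Gamma_s \<Gamma> \<Omega>"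
 obtains f v1 v2 v3 g1 g2 g3 where "sqint f" "!!p. p \<notin> \<Omega> ==> f p = 0" "u = cls \<Omega> f" "wgrad \<omega>1 v1 g1" "wgrad \<omega>2 v2 g2" "wgrad \<omega>2 v3 g3"
  "AE p in lborel. p \<in> \<Omega>1 --> f p = v1 (fst p)" "AE p in lborel. p \<in> \<Omega>2 --> f p = v2 (fst p)"
  "AE p in lborel. p \<in> \<Omega>3 --> f p = v3 (fst p)"
  "AE x in boundary_measure \<omega>2. tr \<omega>1 v1 x = tr \<omega>2 v2 x"
  "AE x in boundary_measure \<omega>2. tr \<omega>1 v1 x = tr \<omega>2 v3 x"
  "square_int (boundary_measure \<omega>1) (tr \<omega>1 v1)"
  "\<Gamma> = \<Gamma>L ==> AE x in boundary_measure \<omega>1. tr \<omega>1 v1 x = 0"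
proof -
 let ?P = "%q. C1_grad \<Omega> (fst q) (snd q) \<and> (\<forall>p\<in>\<Gamma>. fst q p = 0)"
 have uH: "u \<in> H1_closure \<Omega> {cls \<Omega> u |u. C1_closure \<Omega> u \<and> (\<forall>p\<in>\<Gamma>. u p = 0)}"
  and u0: "weak_partial \<Omega> (0, 1) u = cls \<Omega> (%_. 0)"
  using u unfolding H1_Gamma_s_def H1_Gamma_def by auto
 have S: "\<exists>q. ?P q \<and> wgrad \<Omega> (cut \<Omega> (fst q)) (cut \<Omega> (snd q)) \<and> v = cls \<Omega> (cut \<Omega> (fst q))"
  if v: "v \<in> {cls \<Omega> u |u. C1_closure \<Omega> u \<and> (\<forall>p\<in>\<Gamma>. u p = 0)}" for v
 proof -
  obtain w where w: "v = cls \<Omega> w" "C1_closure \<Omega> w" "\<forall>p\<in>\<Gamma>. w p = 0" using v by blast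
  then obtain G where G: "C1_grad \<Omega> w G" using C1_closure_iff by blast
  show ?thesis
   by (rule exI[of _ "(w, G)"]) (use w(1,3) G wgrad_C1'[OF \<Omega>(1,2) G] cls_indicator[of \<Omega> w] in simp)
 qed
 obtain f g q where fg: "wgrad \<Omega> f g" "u = cls \<Omega> f" and q: "\<forall>n::nat. ?P (q n)"
  and lim: "l2lim (%n p. cut \<Omega> (fst (q n)) p) f"
   "l2lim (%n p. cut \<Omega> (snd (q n)) p) g"
  by (rule H1_closure_sequence[OF \<Omega>(1) uH, of ?P "%q p. cut \<Omega> (fst q) p" "%q p. cut \<Omega> (snd q) p", OF S])
 have \<phi>: "!!n. C1_grad \<Omega> (fst (q n)) (snd (q n))" and \<phi>0: "!!n p. p \<in> \<Gamma> ==> fst (q n) p = 0" using q by blast+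
 note fD = wgradD[OF fg(1)]
 have g0: "AE p in lborel. snd (g p) = 0"
 proof -
  have "cls \<Omega> (%p. g p \<bullet> (0, 1)) = cls \<Omega> (%_. 0)" using weak_partial_cls[OF \<Omega>(1) fg(1), of "(0, 1)"] u0 fg(2) by simp
  moreover have "(%p. g p \<bullet> (0, 1)) \<in> Borel" using fD(7) by (rule borel_measurable_inner) simp
  ultimately have "AE p in lborel. p \<in> \<Omega> --> g p \<bullet> (0, 1) = 0" using cls_eq_iff[of \<Omega> "%p. g p \<bullet> (0, 1)" "%_. 0"] \<Omega>(1) by simp
  then show ?thesis
  proof eventually_elim
   case (elim p)
   then show ?case by (cases "p \<in> \<Omega>") (simp_all add: inner_prod_def fD(4) zero_prod_def)
  qed
 qed
 obtain v1 g1 where v1: "wgrad \<omega>1 v1 g1" "AE p in lborel. p \<in> \<Omega>1 --> f p = v1 (fst p)"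
  unfolding cyl
  by (rule cylinder_slice[where \<phi> = "%n. fst (q n)" and G = "%n. snd (q n)", OF \<Omega>(1,2) sets(4,5) cylinders(1) h(1) fg(1) g0 \<phi> lim]) blast
 have hh: "h1 - h2 < h1" "0 \<le> h1 - h2" "h3 \<le> h1" "0 < h3" "h3 < h1 - h2" using h by auto
 obtain v2 g2 where v2: "wgrad \<omega>2 v2 g2" "AE p in lborel. p \<in> \<Omega>2 --> f p = v2 (fst p)"
  "AE x in boundary_measure \<omega>2. tr \<omega>1 v1 x = tr \<omega>2 v2 x"
  unfolding cyl
  by (rule cylinder_trace[where \<phi> = "%n. fst (q n)" and G = "%n. snd (q n)", OF fg(1) g0 \<phi> lim cylinders(2) hh(1,2) order_refl v1])
   (use sets(1) in blast)
 obtain v3 g3 where v3: "wgrad \<omega>2 v3 g3" "AE p in lborel. p \<in> \<Omega>3 --> f p = v3 (fst p)"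
  "AE x in boundary_measure \<omega>2. tr \<omega>1 v1 x = tr \<omega>2 v3 x"
  unfolding cyl
  by (rule cylinder_trace[where \<phi> = "%n. fst (q n)" and G = "%n. snd (q n)", OF fg(1) g0 \<phi> lim cylinders(3) hh(4) order_refl hh(3) v1])
   (use sets(1) in blast)
 \<comment> \<open>The height lies strictly between the ends of the hole, so \<open>(x, y)\<close>
   belongs to \<open>\<Gamma>L\<close> for every boundary point \<open>x\<close> of
   \<open>\<omega>1\<close>, those on the interface included.\<close>
 obtain y v k r where y: "h3 < y" "y < h1 - h2" and v: "wgrad \<omega>1 v k"
  and fv: "AE p in lborel. p \<in> \<omega>1 \<times> {h3<..<h1 - h2} --> f p = v (fst p)"
  and lv: "l2lim (%n x. indicator \<omega>1 x *\<^sub>R fst (q (r n)) (x, y)) v"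
   "l2lim (%n x. indicator \<omega>1 x *\<^sub>R fst (snd (q (r n)) (x, y))) k"
  by (rule cylinder_slice[where \<phi> = "%n. fst (q n)" and G = "%n. snd (q n)", OF \<Omega>(1,2) sets(4,5) cylinders(4) hh(5) fg(1) g0 \<phi> lim])
 have yI: "y \<in> {h3<..<h1 - h2}" using y by simp
 have b1: "\<omega>1 \<in> sets borel" using sets(4) by simp
 have vb [measurable]: "v \<in> Borel" "v1 \<in> Borel" using wgradD(6) v v1(1) by blast+
 have "AE p in lborel. p \<in> \<omega>1 \<times> {h3<..<h1 - h2} --> v (fst p) = v1 (fst p)"
  using fv v1(2) by eventually_elim (use h in \<open>auto simp: cyl\<close>)
 moreover have "{x. v x = v1 x} \<in> sets borel" by measurable
 ultimately have "AE x in lborel. x \<in> \<omega>1 --> v x = v1 x" using AE_cylinder[OF b1 _ hh(5), of "%x. v x = v1 x"] by blast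
 then have c1: "cls \<omega>1 v = cls \<omega>1 v1" using cls_eq_iff[OF b1 vb] by blast
 note T = trace_limit[where u = "%n x. fst (q (r n)) (x, y)" and G = "%n x. fst (snd (q (r n)) (x, y))",
  OF sets(4,5) bcharts_\<omega>1 v C1_grad_slice[OF \<phi> cylinders(4) yI] lv, unfolded c1]
 let ?t = "tr \<omega>1 v1"
 have z: "AE x in boundary_measure \<omega>1. ?t x = 0" if "\<Gamma> = \<Gamma>L"
 proof (rule l2norm_limit_unique[OF T(3,1) square_int_zero T(2)])
  have "fst (q (r n)) (x, y) = 0" if "x \<in> frontier \<omega>1" for n x
  proof (rule \<phi>0)
   have "x \<in> frontier \<omega> \<or> x \<in> frontier \<omega>2" using frontier_\<omega>1(2) that by blast
   then show "(x, y) \<in> \<Gamma>" unfolding \<open>\<Gamma> = \<Gamma>L\<close> \<Gamma>L using y h by auto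
  qed
  then have "l2norm (boundary_measure \<omega>1) (%x. fst (q (r n)) (x, y) - 0) = l2norm (boundary_measure \<omega>1) (%x. 0 :: real)" for n
   by (intro l2norm_cong_AE) (use square_int_measurable[OF T(3)] in \<open>auto intro!: AE_I2 simp: boundary_measure_def space_restrict_space\<close>)
  then show "l2_tendsto (boundary_measure \<omega>1) (%n x. fst (q (r n)) (x, y)) (%x. 0)" by (simp add: l2norm_zero)
 qed
 show thesis by (rule that[OF fD(1,3) fg(2) v1(1) v2(1) v3(1) v1(2) v2(2) v3(2) v2(3) v3(3) T(1) z])
qed

section \<open>From triples to functions on the domain\<close>

definition cutoff :: "(real => real) => bool" where
 "cutoff \<theta> \<longleftrightarrow> smooth \<theta> \<and> (\<forall>y. \<bar>\<theta> y\<bar> \<le> 1) \<and> (\<forall>y\<in>{h1 - h2..h1}. \<theta> y = 1) \<and> (\<forall>y\<le>h3. \<theta> y = 0) \<and>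
   (\<forall>y. y \<in> {h1 - h2..h1} \<or> y \<le> h3 --> grad \<theta> y = 0)"

lemma cutoffD:
 assumes "cutoff \<theta>"
 shows "smooth \<theta>" "!!y. \<bar>\<theta> y\<bar> \<le> 1" "!!y. y \<in> {h1 - h2..h1} ==> \<theta> y = 1" "!!y. y \<le> h3 ==> \<theta> y = 0"
  "!!y. y \<in> {h1 - h2..h1} \<or> y \<le> h3 ==> grad \<theta> y = 0"
 using assms unfolding cutoff_def by blast+

text \<open>A smooth cut-off for the compact interval \<open>{h1 - h2..h1}\<close> inside the open
  half-line above \<open>h3\<close>; the inequality \<open>h1 > h2 + h3\<close> separates the two
  ranges.\<close>

lemma cutoff_exists:
 obtains \<theta> where "cutoff \<theta>"
proof -
 have sub: "{h1 - h2..h1} \<subseteq> {h3<..}" using h by auto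
 obtain \<theta> V where \<theta>: "test_function {h3<..} \<theta>" "!!x. 0 \<le> \<theta> x" "!!x. \<theta> x \<le> 1" "open V" "{h1 - h2..h1} \<subseteq> V" "!!x. x \<in> V ==> \<theta> x = 1"
  by (rule smooth_cutoff[OF compact_Icc open_greaterThan sub]) blast
 obtain K where K: "K \<subseteq> {h3<..}" "!!x. x \<notin> K ==> \<theta> x = 0" "!!x. x \<notin> K ==> grad \<theta> x = 0"
  by (rule test_function_support[OF \<theta>(1)]) blast
 have 1: "y \<notin> K" if "y \<le> h3" for y using K(1) that by auto
 have "\<bar>\<theta> y\<bar> \<le> 1" for y using \<theta>(2,3)[of y] by simp
 moreover have "grad \<theta> y = 0" if "y \<in> {h1 - h2..h1}" for y
  by (rule grad_locally_zero[OF \<theta>(4) _ \<theta>(6)]) (use that \<theta>(5) in blast)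
 ultimately have "cutoff \<theta>"
  unfolding cutoff_def using test_function_smooth[OF \<theta>(1)] \<theta>(5,6) K(2,3) 1 by blast
 then show thesis by (rule that)
qed

lemma cutoff_vanishes:
 assumes "cutoff \<theta>" "!!x. x \<notin> \<omega>2 ==> d x = 0" "p \<in> \<Omega>"
 shows "grad \<theta> (snd p) * d (fst p) = 0"
proof (cases "fst p \<in> \<omega>2")
 case True
 then have "fst p \<in> closure \<omega>2" using closure_subset by blast
 then have "snd p \<in> {h1 - h2..h1} \<or> snd p \<le> h3" using assms(3) by (cases p) (auto simp: \<Omega>_eq)
 then show ?thesis using cutoffD(5)[OF assms(1)] by simp
qed (simp add: assms(2))

text \<open>Above the hole \<open>\<theta>\<close> is 1 and below it 0, so the second component is
  \<open>w + e\<close> and the third is \<open>w\<close>; over \<open>\<omega>1\<close> the function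
  \<open>e\<close> vanishes.\<close>

lemma lift:
 fixes b d :: "nat => real^2 => real"
 assumes cut: "cutoff \<theta>"
  and b: "!!n. smooth (b n)" "l2lim (%n. cut \<omega> (b n)) w"
   "l2lim (%n x. cut \<omega> (grad (b n)) x) w'"
  and w: "sqint w" "sqint w'"
  and d: "!!n. test_function \<omega>2 (d n)" "l2lim d e"
   "l2lim (%n x. grad (d n) x) e'"
  and e: "sqint e" "sqint e'" "!!x. x \<notin> \<omega>2 ==> e x = 0"
  and \<Gamma>: "!!n p. p \<in> \<Gamma> ==> b n (fst p) + \<theta> (snd p) * d n (fst p) = 0"
 defines "u \<equiv> %p. indicator \<Omega> p * (w (fst p) + \<theta> (snd p) * e (fst p))"
 shows "cls \<Omega> u \<in> H1_Gamma_s \<Gamma> \<Omega>" "\<iota> (cls \<Omega> u) = (cls \<omega>1 w, cls \<omega>2 (%x. w x + e x), cls \<omega>2 w)"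
proof -
 note \<theta> = cutoffD[OF cut]
 have d0: "grad \<theta> (snd p) * d n (fst p) = 0" if "p \<in> \<Omega>" for n p
  by (rule cutoff_vanishes[OF cut _ that]) (simp_all add: test_function_outside[OF d(1)])
 show "cls \<Omega> u \<in> H1_Gamma_s \<Gamma> \<Omega>"
  unfolding u_def
  by (rule lift_H1_Gamma_s[where b = b and d = d, OF \<Omega> \<omega>(1,2) less_imp_le[OF h(1)] \<theta>(1,2) b w d e(1,2) d0 \<Gamma>])
 have [measurable]: "w \<in> Borel" "e \<in> Borel" "\<theta> \<in> Borel"
  using square_int_measurable w(1) e(1) borel_measurable_continuous_onI[OF smooth_imp_continuous[OF \<theta>(1)]] by force+
 have "(%p. w (fst p) + \<theta> (snd p) * e (fst p)) \<in> borel_measurable (borel \<Otimes>\<^sub>M borel)" by measurable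
 then have um: "u \<in> Borel" unfolding u_def using \<Omega>(1) by (intro borel_measurable_times) (auto simp: borel_prod)
 show "\<iota> (cls \<Omega> u) = (cls \<omega>1 w, cls \<omega>2 (%x. w x + e x), cls \<omega>2 w)"
 proof (rule iota_triple[OF um w(1) square_int_add[OF w(1) e(1)] w(1)]; rule AE_I2; rule impI)
  fix p assume p: "p \<in> \<Omega>1"
  then have "p \<in> \<Omega>" "fst p \<notin> \<omega>2" using cylinders(1) sets(6) by (auto simp: cyl)
  then show "u p = w (fst p)" by (simp add: u_def e(3))
 next
  fix p assume p: "p \<in> \<Omega>2"
  then have "p \<in> \<Omega>" "snd p \<in> {h1 - h2..h1}" using cylinders(2) sets(1) by (auto simp: cyl)
  then show "u p = w (fst p) + e (fst p)" by (simp add: u_def \<theta>(3))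
 next
  fix p assume p: "p \<in> \<Omega>3"
  then have "p \<in> \<Omega>" "snd p \<le> h3" using cylinders(3) sets(1) by (auto simp: cyl)
  then show "u p = w (fst p)" by (simp add: u_def \<theta>(4))
 qed
qed

text \<open>A point of \<open>\<Gamma>L\<close> projects to \<open>frontier \<omega>\<close> or
  \<open>frontier \<omega>2\<close>, hence outside both \<open>\<omega>1\<close> and
  \<open>\<omega>2\<close>.\<close>

lemma lateral_zero:
 assumes p: "p \<in> \<Gamma>L" and a: "test_function \<omega>1 a" and c: "test_function \<omega>2 c" and d: "test_function \<omega>2 d"
 shows "(a (fst p) + c (fst p)) + t * d (fst p) = 0"
proof -
 have "fst p \<notin> \<omega>1" "fst p \<notin> \<omega>2"
  using p frontier_disjoint sets(1,2) unfolding \<Gamma>L by auto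
 then show ?thesis using test_function_outside[OF a] test_function_outside[OF c] test_function_outside[OF d] by simp
qed

lemma H1_0_sequence:
 fixes V :: "(real^2) set"
 assumes V: "open V" and u: "u \<in> H1_0 V"
 obtains f g a where "wgrad V f g" "u = cls V f" "\<forall>n::nat. test_function V (a n)"
  "l2lim a f" "l2lim (%n x. grad (a n) x) g"
proof -
 have u': "u \<in> H1_closure V {cls V \<phi> |\<phi>. test_function V \<phi>}" using u by (simp only: H1_0_def)
 have S: "\<exists>\<phi>. test_function V \<phi> \<and> wgrad V \<phi> (grad \<phi>) \<and> v = cls V \<phi>" if "v \<in> {cls V \<phi> |\<phi>. test_function V \<phi>}" for v
  using that test_function_wgrad[OF _ V] by blast
 obtain f g a where "wgrad V f g" "u = cls V f" "\<forall>n::nat. test_function V (a n)"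
  "l2lim a f" "l2lim (%n x. grad (a n) x) g"
  by (rule H1_closure_sequence[OF V u', of "test_function V" "%\<phi>. \<phi>" grad, OF S])
 then show thesis by (rule that)
qed

text \<open>Each component is a limit of test functions of its own base. Extended by zero these may
  simply be added, with \<open>w = f1 + f3\<close> and \<open>e = f2 - f3\<close>, and the resulting
  approximants vanish on \<open>\<Gamma>L\<close>.\<close>

lemma H0_lift:
 assumes "t \<in> H0_oplus \<omega>1 \<omega>2 \<omega>2"
 shows "t \<in> \<iota> ` H1_Gamma_s \<Gamma>L \<Omega>"
proof -
 obtain u1 u2 u3 where t: "t = (u1, u2, u3)" and u: "u1 \<in> H1_0 \<omega>1" "u2 \<in> H1_0 \<omega>2" "u3 \<in> H1_0 \<omega>2"
  using assms unfolding H0_oplus_def by auto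
 obtain f1 g1 a where 1: "wgrad \<omega>1 f1 g1" "u1 = cls \<omega>1 f1" "\<forall>n::nat. test_function \<omega>1 (a n)"
  "l2lim a f1" "l2lim (%n x. grad (a n) x) g1"
  by (rule H1_0_sequence[OF sets(4) u(1)])
 obtain f2 g2 b where 2: "wgrad \<omega>2 f2 g2" "u2 = cls \<omega>2 f2" "\<forall>n::nat. test_function \<omega>2 (b n)"
  "l2lim b f2" "l2lim (%n x. grad (b n) x) g2"
  by (rule H1_0_sequence[OF \<omega>2(1) u(2)])
 obtain f3 g3 c where 3: "wgrad \<omega>2 f3 g3" "u3 = cls \<omega>2 f3" "\<forall>n::nat. test_function \<omega>2 (c n)"
  "l2lim c f3" "l2lim (%n x. grad (c n) x) g3"
  by (rule H1_0_sequence[OF \<omega>2(1) u(3)])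
 obtain \<theta> where \<theta>: "cutoff \<theta>" by (rule cutoff_exists)
 note ta = spec[OF 1(3)] and tb = spec[OF 2(3)] and tc = spec[OF 3(3)]
 note s = test_function_smooth[OF ta] test_function_smooth[OF tb] test_function_smooth[OF tc]
 note q1 = test_function_integrable[OF ta] and q2 = test_function_integrable[OF tb] and q3 = test_function_integrable[OF tc]
 note D1 = wgradD[OF 1(1)] and D2 = wgradD[OF 2(1)] and D3 = wgradD[OF 3(1)]
 have in\<omega>: "indicator \<omega> x *\<^sub>R (a n x + c n x) = a n x + c n x" "indicator \<omega> x *\<^sub>R grad (%x. a n x + c n x) x = grad (a n) x + grad (c n) x" for n x
 proof -
  have z: "a n x = 0" "c n x = 0" "grad (a n) x = 0" "grad (c n) x = 0" if "x \<notin> \<omega>"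
  proof -
   have "x \<notin> \<omega>1" "x \<notin> \<omega>2" using that sets(1,2) by blast+
   then show "a n x = 0" "c n x = 0" "grad (a n) x = 0" "grad (c n) x = 0"
    using test_function_outside[OF ta] test_function_outside[OF tc] by simp_all
  qed
  show "indicator \<omega> x *\<^sub>R (a n x + c n x) = a n x + c n x" by (cases "x \<in> \<omega>") (simp_all add: z)
  show "indicator \<omega> x *\<^sub>R grad (%x. a n x + c n x) x = grad (a n) x + grad (c n) x"
   unfolding grad_add[OF s(1,3)] by (cases "x \<in> \<omega>") (simp_all add: z)
 qed
 have d: "test_function \<omega>2 (%x. b n x - c n x)" for n
  using test_function_add[OF tb[of n] test_function_mult[OF tc[of n] smooth_const[of "- 1"]]] by simp
 note L = lift[where b = "%n x. a n x + c n x" and d = "%n x. b n x - c n x" and w = "%x. f1 x + f3 x" and w' = "%x. g1 x + g3 x"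
   and e = "%x. f2 x - f3 x" and e' = "%x. g2 x - g3 x" and \<Gamma> = \<Gamma>L and \<theta> = \<theta>, OF \<theta>]
 define U where "U p = indicator \<Omega> p * ((f1 (fst p) + f3 (fst p)) + \<theta> (snd p) * (f2 (fst p) - f3 (fst p)))" for p
 have l1: "l2lim (%n x. indicator \<omega> x *\<^sub>R (a n x + c n x)) (%x. (f1 x + f3 x))"
  unfolding in\<omega> by (rule l2norm_tendsto_add[OF q1(1) q3(1) D1(1) D3(1) 1(4) 3(4)])
 have l2: "l2lim (%n x. indicator \<omega> x *\<^sub>R grad (%x. a n x + c n x) x) (%x. (g1 x + g3 x))"
  unfolding in\<omega> by (rule l2norm_tendsto_add[OF q1(3) q3(3) D1(2) D3(2) 1(5) 3(5)])
 have l3: "l2lim (%n x. (b n x - c n x)) (%x. (f2 x - f3 x))"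
  by (rule l2norm_tendsto_diff[OF q2(1) q3(1) D2(1) D3(1) 2(4) 3(4)])
 have l4: "l2lim (%n x. grad (%x. b n x - c n x) x) (%x. (g2 x - g3 x))"
  unfolding grad_diff[OF s(2,3)] by (rule l2norm_tendsto_diff[OF q2(3) q3(3) D2(2) D3(2) 2(5) 3(5)])
 have M: "cls \<Omega> U \<in> H1_Gamma_s \<Gamma>L \<Omega>"
  "\<iota> (cls \<Omega> U) = (cls \<omega>1 (%x. f1 x + f3 x), cls \<omega>2 (%x. (f1 x + f3 x) + (f2 x - f3 x)), cls \<omega>2 (%x. f1 x + f3 x))"
  unfolding U_def
  by (rule L[OF smooth_add[OF s(1,3)] l1 l2 square_int_add[OF D1(1) D3(1)] square_int_add[OF D1(2) D3(2)]
    d l3 l4 square_int_diff[OF D2(1) D3(1)] square_int_diff[OF D2(2) D3(2)] _ lateral_zero[OF _ ta tc d]]; simp add: D2(3) D3(3))+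
 have d12: "x \<in> \<omega>1 ==> x \<notin> \<omega>2" "x \<in> \<omega>2 ==> x \<notin> \<omega>1" for x using sets(6) by auto
 have "cls \<omega>1 (%x. f1 x + f3 x) = u1" unfolding 1(2) by (rule cls_cong) (simp add: D3(3) d12)
 moreover have "cls \<omega>2 (%x. (f1 x + f3 x) + (f2 x - f3 x)) = u2" unfolding 2(2) by (rule cls_cong) (simp add: D1(3) d12)
 moreover have "cls \<omega>2 (%x. f1 x + f3 x) = u3" unfolding 3(2) by (rule cls_cong) (simp add: D1(3) d12)
 ultimately have "t = \<iota> (cls \<Omega> U)" unfolding t M(2) by simp
 then show ?thesis using M(1) by (rule image_eqI)
qed

text \<open>Equality of the first and third traces makes \<open>w = v3 + v1\<close> weakly
  differentiable on \<open>\<omega>\<close>; each summand vanishes off its own base. Equality of the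
  second and third gives \<open>e = v2 - v3\<close> zero trace, so \<open>e\<close> is a limit of
  test functions of \<open>\<omega>2\<close>.\<close>

lemma HC_lift:
 assumes "t \<in> HC_oplus \<omega>1 \<omega>2 \<omega>2"
 shows "t \<in> \<iota> ` H1_Gamma_s {} \<Omega>"
proof -
 obtain u1 u2 u3 where t: "t = (u1, u2, u3)" and u: "u1 \<in> H1 \<omega>1" "u2 \<in> H1 \<omega>2" "u3 \<in> H1 \<omega>2"
  and tr: "AE x in boundary_measure \<omega>2. rep (boundary_trace \<omega>1 u1) x = rep (boundary_trace \<omega>2 u2) x \<and>
   rep (boundary_trace \<omega>2 u2) x = rep (boundary_trace \<omega>2 u3) x"
  using assms unfolding HC_oplus_def H_oplus_def by auto
 obtain v1 g1 where 1: "wgrad \<omega>1 v1 g1" "u1 = cls \<omega>1 v1" by (rule H1_borel_rep[OF sets(4) u(1)])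
 obtain v2 g2 where 2: "wgrad \<omega>2 v2 g2" "u2 = cls \<omega>2 v2" by (rule H1_borel_rep[OF \<omega>2(1) u(2)])
 obtain v3 g3 where 3: "wgrad \<omega>2 v3 g3" "u3 = cls \<omega>2 v3" by (rule H1_borel_rep[OF \<omega>2(1) u(3)])
 note D1 = wgradD[OF 1(1)] and D2 = wgradD[OF 2(1)] and D3 = wgradD[OF 3(1)]
 obtain p where p: "!!n::nat. smooth (p n)" "l2lim (%n. cut \<omega>1 (p n)) v1"
  "l2lim (%n x. cut \<omega>1 (grad (p n)) x) g1"
  using wgrad_smooth_sequence[OF sets(4,5) bcharts_\<omega>1 1(1)] by blast
 obtain q where q: "!!n::nat. smooth (q n)" "l2lim (%n. cut \<omega>2 (q n)) v2"
  "l2lim (%n x. cut \<omega>2 (grad (q n)) x) g2"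
  using wgrad_smooth_sequence[OF \<omega>2(1) sets(3) bcharts_\<omega>(2) 2(1)] by blast
 obtain s where s: "!!n::nat. smooth (s n)" "l2lim (%n. cut \<omega>2 (s n)) v3"
  "l2lim (%n x. cut \<omega>2 (grad (s n)) x) g3"
  using wgrad_smooth_sequence[OF \<omega>2(1) sets(3) bcharts_\<omega>(2) 3(1)] by blast
 note Cp = smooth_C1_grad[OF p(1), where U = \<omega>1] and Cq = smooth_C1_grad[OF q(1), where U = \<omega>2] and Cs = smooth_C1_grad[OF s(1), where U = \<omega>2]
 note Wp = wgradD[OF wgrad_C1'[OF sets(4,5) Cp]] and Wq = wgradD[OF wgrad_C1'[OF \<omega>2(1) sets(3) Cq]] and Ws = wgradD[OF wgrad_C1'[OF \<omega>2(1) sets(3) Cs]]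
 note T1 = trace_limit[where u = p and G = "%n. grad (p n)", OF sets(4,5) bcharts_\<omega>1 1(1) Cp p(2,3)]
 note T2 = trace_limit[where u = q and G = "%n. grad (q n)", OF \<omega>2(1) sets(3) bcharts_\<omega>(2) 2(1) Cq q(2,3)]
 note T3 = trace_limit[where u = s and G = "%n. grad (s n)", OF \<omega>2(1) sets(3) bcharts_\<omega>(2) 3(1) Cs s(2,3)]
 let ?M = "boundary_measure \<omega>2"
 let ?t1 = "tr \<omega>1 v1" and ?t2 = "tr \<omega>2 v2" and ?t3 = "tr \<omega>2 v3"
 have tr': "AE x in ?M. ?t3 x = ?t1 x" "AE x in ?M. ?t2 x = ?t3 x"
  using tr unfolding 1(2) 2(2) 3(2) by (eventually_elim, simp)+
 note mono = boundary_measure_mono[OF frontier_\<omega>1(1)]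
 have l1: "l2_tendsto ?M p ?t1"
  by (rule l2norm_squeeze[OF _ T1(2)])
   (use mono(2)[OF square_int_diff[OF T1(3,1)]] in \<open>simp add: l2norm_nonneg\<close>)
 have glue: "wgrad \<omega> (%x. v3 x + v1 x) (%x. g3 x + g1 x)"
 proof (rule wgrad_glue[where ?u1.0 = s and ?G1.0 = "%n. grad (s n)" and ?u2.0 = p and ?G2.0 = "%n. grad (p n)",
    OF \<omega>2(1) sets(4) _ sets(1,2) _ 3(1) 1(1) Cs Ws(1,2) s(2,3) Cp Wp(1,2) p(2,3)])
  show "\<omega>2 \<inter> \<omega>1 = {}" using sets(6) by blast
  show "x \<in> \<omega>2 \<or> x \<in> \<omega>1 \<or> (\<exists>r e n \<gamma> \<gamma>'. bchart \<omega>2 x r e n \<gamma> \<gamma>' \<and> bchart \<omega>1 x r e (- n) (%s. - \<gamma> s) (%s. - \<gamma>' s))"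
   if "x \<in> \<omega>" for x
  proof (cases "x \<in> frontier \<omega>2")
   case True
   from interface_chart[OF this] show ?thesis by blast
  next
   case False
   then show ?thesis using that \<omega>2(1) by (auto simp: \<omega>1 frontier_def interior_open)
  qed
  show "square_int ?M (%x. s k x - p k x)" for k by (rule square_int_diff[OF T3(3) mono(1)[OF T1(3)]])
  show "(%k. l2norm ?M (%x. s k x - p k x)) \<longlonglongrightarrow> 0"
   by (rule l2norm_diff_tendsto[OF T3(3,1,2) mono(1)[OF T1(3)] mono(1)[OF T1(1)] l1 tr'(1)])
 qed
 note Dg = wgradD[OF glue]
 note wE = wgrad_diff[OF 2(1) 3(1)]
 have E: "l2lim (%n x. indicator \<omega>2 x *\<^sub>R (q n x - s n x)) (%x. (v2 x - v3 x))"
  "l2lim (%n x. indicator \<omega>2 x *\<^sub>R grad (%x. q n x - s n x) x) (%x. (g2 x - g3 x))"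
  unfolding grad_diff[OF q(1) s(1)] scaleR_diff_right
  by (rule l2norm_tendsto_diff[OF Wq(1) Ws(1) D2(1) D3(1) q(2) s(2)], rule l2norm_tendsto_diff[OF Wq(2) Ws(2) D2(2) D3(2) q(3) s(3)])
 \<comment> \<open>The trace of \<open>v2 - v3\<close> is read off from the differences of the two
   approximating sequences.\<close>
 note TE = trace_limit[where u = "%n x. q n x - s n x" and G = "%n. grad (%x. q n x - s n x)", OF \<omega>2(1) sets(3) bcharts_\<omega>(2) wE
   smooth_C1_grad[OF smooth_diff[OF q(1) s(1)]] E]
 have "l2_tendsto ?M (%n x. q n x - s n x) (%x. 0)"
  using l2norm_diff_tendsto[OF T2(3,1,2) T3(3,1,2) tr'(2)] by simp
 then have "AE x in ?M. tr \<omega>2 (%x. v2 x - v3 x) x = 0"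
  by (rule l2norm_limit_unique[OF TE(3,1) square_int_zero TE(2)])
 then have wE': "wgrad UNIV (%x. v2 x - v3 x) (%x. g2 x - g3 x)"
  by (rule zero_trace_extension[OF \<omega>2(1) sets(3) bcharts_\<omega>(2) wE])
 have z: "v2 x - v3 x = 0" "g2 x - g3 x = 0" if "x \<notin> \<omega>2" for x using that by (simp_all add: D2(3,4) D3(3,4))
 obtain d where d: "!!n::nat. test_function \<omega>2 (d n)" "l2lim d (%x. (v2 x - v3 x))"
  "l2lim (%n x. grad (d n) x) (%x. (g2 x - g3 x))"
  using wgrad_test_sequence[OF \<omega>2(1) sets(3) bcharts_\<omega>(2) wE' z] by blast
 obtain b where b: "!!n::nat. smooth (b n)" "l2lim (%n. cut \<omega> (b n)) (%x. (v3 x + v1 x))"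
  "l2lim (%n x. cut \<omega> (grad (b n)) x) (%x. (g3 x + g1 x))"
  using wgrad_smooth_sequence[OF \<omega>(1,2) bcharts_\<omega>(1) glue] by blast
 obtain \<theta> where \<theta>: "cutoff \<theta>" by (rule cutoff_exists)
 define U where "U p = indicator \<Omega> p * ((v3 (fst p) + v1 (fst p)) + \<theta> (snd p) * (v2 (fst p) - v3 (fst p)))" for p
 note L = lift[where b = b and d = d and \<Gamma> = "{}" and w = "%x. v3 x + v1 x" and e = "%x. v2 x - v3 x",
   OF \<theta> b Dg(1,2) d wgradD(1,2)[OF wE] z(1) FalseE[OF emptyE]]
 have M: "cls \<Omega> U \<in> H1_Gamma_s {} \<Omega>"
  "\<iota> (cls \<Omega> U) = (cls \<omega>1 (%x. v3 x + v1 x), cls \<omega>2 (%x. (v3 x + v1 x) + (v2 x - v3 x)), cls \<omega>2 (%x. v3 x + v1 x))"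
  unfolding U_def by (rule L; simp)+
 have d12: "x \<in> \<omega>1 ==> x \<notin> \<omega>2" "x \<in> \<omega>2 ==> x \<notin> \<omega>1" for x using sets(6) by auto
 have "cls \<omega>1 (%x. v3 x + v1 x) = u1" unfolding 1(2) by (rule cls_cong) (simp add: D3(3) d12)
 moreover have "cls \<omega>2 (%x. (v3 x + v1 x) + (v2 x - v3 x)) = u2" unfolding 2(2) by (rule cls_cong) (simp add: D1(3) d12)
 moreover have "cls \<omega>2 (%x. v3 x + v1 x) = u3" unfolding 3(2) by (rule cls_cong) (simp add: D1(3) d12)
 ultimately have "t = \<iota> (cls \<Omega> U)" unfolding t M(2) by simp
 then show ?thesis using M(1) by (rule image_eqI)
qed

section \<open>Inclusions between ranges and direct sums\<close>

lemma iota_range: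
 assumes "u \<in> H1_Gamma_s \<Gamma> \<Omega>"
 shows "\<iota> u \<in> HC_oplus \<omega>1 \<omega>2 \<omega>2" "\<Gamma> = \<Gamma>L ==> \<iota> u \<in> H0_oplus \<omega>1 \<omega>2 \<omega>2"
proof -
 obtain f v1 v2 v3 g1 g2 g3 where f: "sqint f" "u = cls \<Omega> f" and v: "wgrad \<omega>1 v1 g1" "wgrad \<omega>2 v2 g2" "wgrad \<omega>2 v3 g3"
  and eq: "AE p in lborel. p \<in> \<Omega>1 --> f p = v1 (fst p)" "AE p in lborel. p \<in> \<Omega>2 --> f p = v2 (fst p)"
  "AE p in lborel. p \<in> \<Omega>3 --> f p = v3 (fst p)"
  and tr: "AE x in boundary_measure \<omega>2. tr \<omega>1 v1 x = tr \<omega>2 v2 x"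
  "AE x in boundary_measure \<omega>2. tr \<omega>1 v1 x = tr \<omega>2 v3 x"
  and t1: "square_int (boundary_measure \<omega>1) (tr \<omega>1 v1)"
  and z: "\<Gamma> = \<Gamma>L ==> AE x in boundary_measure \<omega>1. tr \<omega>1 v1 x = 0"
  by (rule iota_H1[OF assms]) blast
 have fm: "f \<in> Borel" using square_int_measurable[OF f(1)] by simp
 have i: "\<iota> u = (cls \<omega>1 v1, cls \<omega>2 v2, cls \<omega>2 v3)"
  unfolding f(2) by (rule iota_triple[OF fm wgradD(1)[OF v(1)] wgradD(1)[OF v(2)] wgradD(1)[OF v(3)] eq])
 have H: "(cls \<omega>1 v1, cls \<omega>2 v2, cls \<omega>2 v3) \<in> H_oplus \<omega>1 \<omega>2 \<omega>2"
  unfolding H_oplus_def using H1_cls[OF sets(4) v(1)] H1_cls[OF \<omega>2(1) v(2)] H1_cls[OF \<omega>2(1) v(3)] by blast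
 have "AE x in boundary_measure \<omega>2. tr \<omega>1 v1 x = tr \<omega>2 v2 x \<and>
   tr \<omega>2 v2 x = tr \<omega>2 v3 x"
  using tr by eventually_elim simp
 then show "\<iota> u \<in> HC_oplus \<omega>1 \<omega>2 \<omega>2" unfolding i HC_oplus_def using H by simp
 assume G: "\<Gamma> = \<Gamma>L"
 let ?t = "tr \<omega>1 v1"
 note m = boundary_measure_mono[OF frontier_\<omega>1(1) t1]
 \<comment> \<open>The zero trace of the first component is restricted to the interface and passed
   on to the other two components by the matching conditions.\<close>
 have "l2norm (boundary_measure \<omega>2) ?t = 0"
  using m(2) l2norm_eq_0[OF t1] z[OF G] l2norm_nonneg[of "boundary_measure \<omega>2" ?t] by linarith
 then have z2: "AE x in boundary_measure \<omega>2. ?t x = 0" using l2norm_eq_0[OF m(1)] by blast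
 have "AE x in boundary_measure \<omega>2. tr \<omega>2 v2 x = 0"
  "AE x in boundary_measure \<omega>2. tr \<omega>2 v3 x = 0"
  using z2 tr by (eventually_elim, simp)+
 note e = zero_trace_extension[OF sets(4,5) bcharts_\<omega>1 v(1) z[OF G]]
  zero_trace_extension[OF \<omega>2(1) sets(3) bcharts_\<omega>(2) v(2) this(1)] zero_trace_extension[OF \<omega>2(1) sets(3) bcharts_\<omega>(2) v(3) this(2)]
 have "cls \<omega>1 v1 \<in> H1_0 \<omega>1" by (rule H1_0_cls[OF sets(4,5) bcharts_\<omega>1 e(1) wgradD(3,4)[OF v(1)]])
 moreover have "cls \<omega>2 v2 \<in> H1_0 \<omega>2" by (rule H1_0_cls[OF \<omega>2(1) sets(3) bcharts_\<omega>(2) e(2) wgradD(3,4)[OF v(2)]])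
 moreover have "cls \<omega>2 v3 \<in> H1_0 \<omega>2" by (rule H1_0_cls[OF \<omega>2(1) sets(3) bcharts_\<omega>(2) e(3) wgradD(3,4)[OF v(3)]])
 ultimately show "\<iota> u \<in> H0_oplus \<omega>1 \<omega>2 \<omega>2" unfolding i H0_oplus_def using H by simp
qed

lemma L2_Gamma_s_mono: "L2_Gamma_s \<Gamma> \<Omega> \<subseteq> L2_Gamma_s {} \<Omega>"
 unfolding L2_Gamma_s_def L2_closure_def using H1_Gamma_s_mono[of \<Gamma>] by blast

text \<open>Elements of the closure are L^2 limits of functions that are independent of
  \<open>y\<close> on each cylinder, and this property survives the limit by
  \<open>cylinder_limit\<close>.\<close>

lemma L2_range:
 assumes u: "u \<in> L2_Gamma_s \<Gamma> \<Omega>"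
 shows "\<iota> u \<in> L_oplus \<omega>1 \<omega>2 \<omega>2"
proof -
 have \<Omega>b: "\<Omega> \<in> sets borel" and b1: "\<omega>1 \<in> sets borel" and b2: "\<omega>2 \<in> sets borel" using \<Omega>(1) sets(4) \<omega>2(1) by auto
 have uL: "u \<in> L2 \<Omega>" and appr: "!!e. e > 0 ==> \<exists>v\<in>H1_Gamma_s \<Gamma> \<Omega>. L2_dist (lebesgue_on \<Omega>) u v < e"
  using u unfolding L2_Gamma_s_def L2_closure_def by auto
 obtain f where f: "sqint f" "!!x. x \<notin> \<Omega> ==> f x = 0" "u = cls \<Omega> f" using L2_borel_rep[OF \<Omega>b uL] by blast
 have fm: "f \<in> Borel" using square_int_measurable[OF f(1)] by simp
 \<comment> \<open>All data of the n-th approximant are bundled in one predicate, so that a single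
   choice yields compatible sequences.\<close>
 define R where "R n F v1 v2 v3 \<longleftrightarrow> sqint F \<and> dist2 F f < 1 / real (Suc n) \<and>
  (sqint v1 \<and> (\<forall>x. x \<notin> \<omega>1 --> v1 x = 0) \<and> (AE p in lborel. p \<in> \<Omega>1 --> F p = v1 (fst p))) \<and>
  (sqint v2 \<and> (\<forall>x. x \<notin> \<omega>2 --> v2 x = 0) \<and> (AE p in lborel. p \<in> \<Omega>2 --> F p = v2 (fst p))) \<and>
  (sqint v3 \<and> (\<forall>x. x \<notin> \<omega>2 --> v3 x = 0) \<and> (AE p in lborel. p \<in> \<Omega>3 --> F p = v3 (fst p)))" for n :: nat and F v1 v2 v3
 have "\<exists>F v1 v2 v3. R n F v1 v2 v3" for n
 proof -
  obtain v where v: "v \<in> H1_Gamma_s \<Gamma> \<Omega>" "L2_dist (lebesgue_on \<Omega>) u v < 1 / real (Suc n)" using appr[of "1 / real (Suc n)"] by auto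
  obtain F v1 v2 v3 g1 g2 g3 where F: "sqint F" "\<forall>p. p \<notin> \<Omega> --> F p = 0" "v = cls \<Omega> F" and w: "wgrad \<omega>1 v1 g1" "wgrad \<omega>2 v2 g2" "wgrad \<omega>2 v3 g3"
   and eq: "AE p in lborel. p \<in> \<Omega>1 --> F p = v1 (fst p)" "AE p in lborel. p \<in> \<Omega>2 --> F p = v2 (fst p)"
   "AE p in lborel. p \<in> \<Omega>3 --> F p = v3 (fst p)"
   by (rule iota_H1[OF v(1)]) blast
  have Fm: "F \<in> Borel" using square_int_measurable[OF F(1)] by simp
  have "L2_dist (lebesgue_on \<Omega>) u v = dist2 f F"
   unfolding f(3) F(3) by (rule L2_dist_cls[OF \<Omega>b fm Fm]) (simp add: f(2) F(2))
  then have "dist2 F f < 1 / real (Suc n)" using v(2) l2norm_diff_commute[of lborel f F] by simp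
  then have "R n F v1 v2 v3" unfolding R_def using F(1) eq wgradD(1,3)[OF w(1)] wgradD(1,3)[OF w(2)] wgradD(1,3)[OF w(3)] by blast
  then show ?thesis by blast
 qed
 then obtain F v1 v2 v3 where R: "!!n. R n (F n) (v1 n) (v2 n) (v3 n)" by metis
 have F: "!!n. sqint (F n)" "!!n. dist2 (F n) f < 1 / real (Suc n)" using R unfolding R_def by blast+
 have l0: "(%n. 1 / real (Suc n)) \<longlonglongrightarrow> 0" by (rule lim_1_over_n[THEN LIMSEQ_Suc])
 have lim: "l2lim F f"
  by (rule l2norm_squeeze[OF _ l0]) (use F(2) in \<open>simp add: l2norm_nonneg less_imp_le\<close>)
 have r1: "!!n. sqint (v1 n)" "!!n x. x \<notin> \<omega>1 ==> v1 n x = 0" "!!n. AE p in lborel. p \<in> \<Omega>1 --> F n p = v1 n (fst p)"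
  using R unfolding R_def by blast+
 have r2: "!!n. sqint (v2 n)" "!!n x. x \<notin> \<omega>2 ==> v2 n x = 0" "!!n. AE p in lborel. p \<in> \<Omega>2 --> F n p = v2 n (fst p)"
  using R unfolding R_def by blast+
 have r3: "!!n. sqint (v3 n)" "!!n x. x \<notin> \<omega>2 ==> v3 n x = 0" "!!n. AE p in lborel. p \<in> \<Omega>3 --> F n p = v3 n (fst p)"
  using R unfolding R_def by blast+
 have hh: "0 < h1" "h1 - h2 < h1" "0 < h3" using h by auto
 obtain w1 where w1: "sqint w1" "AE p in lborel. p \<in> \<Omega>1 --> f p = w1 (fst p)"
  unfolding cyl by (rule cylinder_limit[where F = F and v = v1, OF b1 hh(1) F(1) f(1) lim r1[unfolded cyl]])
 obtain w2 where w2: "sqint w2" "AE p in lborel. p \<in> \<Omega>2 --> f p = w2 (fst p)"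
  unfolding cyl by (rule cylinder_limit[where F = F and v = v2, OF b2 hh(2) F(1) f(1) lim r2[unfolded cyl]])
 obtain w3 where w3: "sqint w3" "AE p in lborel. p \<in> \<Omega>3 --> f p = w3 (fst p)"
  unfolding cyl by (rule cylinder_limit[where F = F and v = v3, OF b2 hh(3) F(1) f(1) lim r3[unfolded cyl]])
 have "\<iota> u = (cls \<omega>1 w1, cls \<omega>2 w2, cls \<omega>2 w3)"
  unfolding f(3) by (rule iota_triple[OF fm w1(1) w2(1) w3(1) w1(2) w2(2) w3(2)])
 then show ?thesis unfolding L_oplus_def using cls_L2[OF b1 w1(1)] cls_L2[OF b2 w2(1)] cls_L2[OF b2 w3(1)] by simp
qed

text \<open>Test functions are dense in L^2 of each base, and a triple of them lifts with zero
  values on \<open>\<Gamma>L\<close>. Only L^2 distances are controlled, so the components of the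
  given triple may be unrelated on the interface.\<close>

lemma L2_lift:
 assumes "t \<in> L_oplus \<omega>1 \<omega>2 \<omega>2"
 shows "t \<in> \<iota> ` L2_Gamma_s \<Gamma>L \<Omega>"
proof -
 have b: "\<Omega> \<in> sets borel" "\<omega>1 \<in> sets borel" "\<omega>2 \<in> sets borel" using \<Omega>(1) sets(4) \<omega>2(1) by auto
 obtain u1 u2 u3 where t: "t = (u1, u2, u3)" and u: "u1 \<in> L2 \<omega>1" "u2 \<in> L2 \<omega>2" "u3 \<in> L2 \<omega>2"
  using assms unfolding L_oplus_def by auto
 obtain f1 where f1: "sqint f1" "!!x. x \<notin> \<omega>1 ==> f1 x = 0" "u1 = cls \<omega>1 f1" using L2_borel_rep[OF b(2) u(1)] by blast
 obtain f2 where f2: "sqint f2" "!!x. x \<notin> \<omega>2 ==> f2 x = 0" "u2 = cls \<omega>2 f2" using L2_borel_rep[OF b(3) u(2)] by blast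
 obtain f3 where f3: "sqint f3" "!!x. x \<notin> \<omega>2 ==> f3 x = 0" "u3 = cls \<omega>2 f3" using L2_borel_rep[OF b(3) u(3)] by blast
 have \<Omega>k: "open \<Omega>1" "open \<Omega>2" "open \<Omega>3" unfolding cyl using sets(4) \<omega>2(1) by (auto intro: open_Times)
 have sub: "\<Omega>1 \<subseteq> \<Omega>" "\<Omega>2 \<subseteq> \<Omega>" "\<Omega>3 \<subseteq> \<Omega>" using cylinders sets(1) unfolding cyl by blast+
 have m: "(%p. indicator V p :: real) \<in> Borel" "\<bar>indicator V p :: real\<bar> \<le> indicator {0..h1} (snd p)"
  if "open V" "V \<subseteq> \<Omega>" for V :: "((real^2) \<times> real) set" and p
  by (rule borel_measurable_indicator[OF borel_open[OF that(1)]], use that(2) \<Omega>(3) in \<open>auto simp: indicator_def\<close>)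
 note c1 = square_int_cylinder[OF _ m[OF \<Omega>k(1) sub(1)] less_imp_le[OF h(1)]]
  and c2 = square_int_cylinder[OF _ m[OF \<Omega>k(2) sub(2)] less_imp_le[OF h(1)]]
  and c3 = square_int_cylinder[OF _ m[OF \<Omega>k(3) sub(3)] less_imp_le[OF h(1)]]
 define F where "F p = indicator \<Omega>1 p *\<^sub>R f1 (fst p) + (indicator \<Omega>2 p *\<^sub>R f2 (fst p) + indicator \<Omega>3 p *\<^sub>R f3 (fst p))" for p
 have F: "sqint F"
  unfolding F_def by (rule square_int_add[OF c1(1)[OF f1(1)] square_int_add[OF c2(1)[OF f2(1)] c3(1)[OF f3(1)]]])
 have Fm: "F \<in> Borel" using square_int_measurable[OF F] by simp
 have disj: "\<Omega>1 \<inter> \<Omega>2 = {}" "\<Omega>1 \<inter> \<Omega>3 = {}" "\<Omega>2 \<inter> \<Omega>3 = {}" using sets(6) h by (auto simp: cyl)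
 have "\<iota> (cls \<Omega> F) = (cls \<omega>1 f1, cls \<omega>2 f2, cls \<omega>2 f3)"
  by (rule iota_triple[OF Fm f1(1) f2(1) f3(1)]; rule AE_I2) (use disj in \<open>auto simp: F_def indicator_def\<close>)
 then have i: "t = \<iota> (cls \<Omega> F)" by (simp add: t f1(3) f2(3) f3(3))
 have "cls \<Omega> F \<in> L2_Gamma_s \<Gamma>L \<Omega>"
  unfolding L2_Gamma_s_def L2_closure_def
 proof (intro CollectI conjI allI impI cls_L2[OF b(1) F])
  fix \<epsilon> :: real assume \<epsilon>: "\<epsilon> > 0"
  \<comment> \<open>Each of the three cylinders contributes less than
    \<open>sqrt h1 * \<delta> = \<epsilon> / 3\<close>.\<close>
  define \<delta> where "\<delta> = \<epsilon> / (3 * sqrt h1)"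
  have \<delta>: "\<delta> > 0" "sqrt h1 * \<delta> = \<epsilon> / 3" using \<epsilon> h(1) by (simp_all add: \<delta>_def)
  obtain a1 where a1: "test_function \<omega>1 a1" "dist2 a1 f1 < \<delta>" by (rule test_function_dense[OF sets(4) f1(1,2) \<delta>(1)])
  obtain a2 where a2: "test_function \<omega>2 a2" "dist2 a2 f2 < \<delta>" by (rule test_function_dense[OF \<omega>2(1) f2(1,2) \<delta>(1)])
  obtain a3 where a3: "test_function \<omega>2 a3" "dist2 a3 f3 < \<delta>" by (rule test_function_dense[OF \<omega>2(1) f3(1,2) \<delta>(1)])
  have out: "a1 x = 0" "grad a1 x = 0" if "x \<notin> \<omega>1" for x using test_function_outside[OF a1(1) that] by simp_all
  have out2: "a2 x = 0" "a3 x = 0" "grad a2 x = 0" "grad a3 x = 0" if "x \<notin> \<omega>2" for x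
   using test_function_outside[OF a2(1) that] test_function_outside[OF a3(1) that] by simp_all
  have z: "a2 x - a3 x = 0" if "x \<notin> \<omega>2" for x by (simp add: out2 that)
  have out\<omega>: "x \<notin> \<omega>1 \<and> x \<notin> \<omega>2" if "x \<notin> \<omega>" for x using that sets(1,2) by blast
  note s1 = test_function_smooth[OF a1(1)] and s2 = test_function_smooth[OF a2(1)] and s3 = test_function_smooth[OF a3(1)]
  note q1 = test_function_integrable[OF a1(1)] and q2 = test_function_integrable[OF a2(1)] and q3 = test_function_integrable[OF a3(1)]
  obtain \<theta> where \<theta>: "cutoff \<theta>" by (rule cutoff_exists)
  have d: "test_function \<omega>2 (%x. a2 x - a3 x)"
   using test_function_add[OF a2(1) test_function_mult[OF a3(1) smooth_const[of "- 1"]]] by simp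
  have in\<omega>: "indicator \<omega> x *\<^sub>R (a1 x + a3 x) = a1 x + a3 x" "indicator \<omega> x *\<^sub>R grad (%x. a1 x + a3 x) x = grad a1 x + grad a3 x" for x
   unfolding grad_add[OF s1 s3] using out\<omega>[of x] by (cases "x \<in> \<omega>"; simp add: out out2)+
  define E where "E p = indicator \<Omega> p * ((a1 (fst p) + a3 (fst p)) + \<theta> (snd p) * (a2 (fst p) - a3 (fst p)))" for p
  have E: "cls \<Omega> E \<in> H1_Gamma_s \<Gamma>L \<Omega>"
   unfolding E_def
   by (rule lift(1)[where b = "%n x. a1 x + a3 x" and d = "%n x. a2 x - a3 x" and w = "%x. a1 x + a3 x" and w' = "%x. grad a1 x + grad a3 x"
      and e = "%x. a2 x - a3 x" and e' = "%x. grad a2 x - grad a3 x", OF \<theta> smooth_add[OF s1 s3] _ _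
      square_int_add[OF q1(1) q3(1)] square_int_add[OF q1(3) q3(3)] d _ _ square_int_diff[OF q2(1) q3(1)] square_int_diff[OF q2(3) q3(3)]
      z lateral_zero[OF _ a1(1) a3(1) d]])
    (simp_all only: in\<omega> grad_diff[OF s2 s3] diff_self l2norm_zero tendsto_const not_False_eq_True)
  have [measurable]: "a1 \<in> Borel" "a2 \<in> Borel" "a3 \<in> Borel" "\<theta> \<in> Borel"
   using square_int_measurable q1(1) q2(1) q3(1) borel_measurable_continuous_onI[OF smooth_imp_continuous[OF cutoffD(1)[OF \<theta>]]] by force+
  have "(%p. (a1 (fst p) + a3 (fst p)) + \<theta> (snd p) * (a2 (fst p) - a3 (fst p))) \<in> borel_measurable (borel \<Otimes>\<^sub>M borel)" by measurable
  then have Em: "E \<in> Borel" unfolding E_def using \<Omega>(1) by (intro borel_measurable_times) (auto simp: borel_prod)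
  have FE: "E p - F p = indicator \<Omega>1 p *\<^sub>R (a1 (fst p) - f1 (fst p)) + (indicator \<Omega>2 p *\<^sub>R (a2 (fst p) - f2 (fst p)) + indicator \<Omega>3 p *\<^sub>R (a3 (fst p) - f3 (fst p)))" for p
  proof -
   consider "p \<in> \<Omega>1" | "p \<in> \<Omega>2" | "p \<in> \<Omega>3" | "p \<notin> \<Omega>1" "p \<notin> \<Omega>2" "p \<notin> \<Omega>3" by blast
   then show ?thesis
   proof cases
    case 1
    then have "p \<notin> \<Omega>2" "p \<notin> \<Omega>3" "p \<in> \<Omega>" "fst p \<notin> \<omega>2" using disj sub sets(6) by (auto simp: cyl)
    with 1 show ?thesis by (simp add: E_def F_def out2)
   next
    case 2
    then have "p \<notin> \<Omega>1" "p \<notin> \<Omega>3" "p \<in> \<Omega>" "fst p \<notin> \<omega>1" "\<theta> (snd p) = 1" using disj sub sets(6) cutoffD(3)[OF \<theta>, of "snd p"] by (auto simp: cyl)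
    with 2 show ?thesis by (simp add: E_def F_def out)
   next
    case 3
    then have "p \<notin> \<Omega>1" "p \<notin> \<Omega>2" "p \<in> \<Omega>" "fst p \<notin> \<omega>1" "\<theta> (snd p) = 0" using disj sub sets(6) cutoffD(4)[OF \<theta>, of "snd p"] by (auto simp: cyl)
    with 3 show ?thesis by (simp add: E_def F_def out)
   next
    case 4
    \<comment> \<open>The points of \<open>\<Omega>\<close> outside the three cylinders project to
      neither \<open>\<omega>1\<close> nor \<open>\<omega>2\<close>, where all planar functions
      vanish.\<close>
    have "p \<notin> \<Omega> \<or> (fst p \<notin> \<omega>1 \<and> fst p \<notin> \<omega>2)"
     using 4 closure_subset[of \<omega>2] by (cases p) (auto simp: \<Omega>_eq cyl \<omega>1)
    with 4 show ?thesis by (auto simp: E_def F_def out out2)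
   qed
  qed
  have d1: "sqint (%x. a1 x - f1 x)" and d2: "sqint (%x. a2 x - f2 x)" and d3: "sqint (%x. a3 x - f3 x)"
   by (rule square_int_diff[OF q1(1) f1(1)], rule square_int_diff[OF q2(1) f2(1)], rule square_int_diff[OF q3(1) f3(1)])
  have lt: "sqrt (h1 - 0) * x < \<epsilon> / 3" if "x < \<delta>" for x using that h(1) unfolding \<delta>(2)[symmetric] by simp
  have "L2_dist (lebesgue_on \<Omega>) (cls \<Omega> F) (cls \<Omega> E) = dist2 F E"
   by (rule L2_dist_cls[OF b(1) Fm Em]) (use sub in \<open>auto simp: F_def E_def indicator_def\<close>)
  also have "... = dist2 E F" by (rule l2norm_diff_commute)
  also have "... \<le> norm2 (cut \<Omega>1 (%p. a1 (fst p) - f1 (fst p)))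
   + (norm2 (cut \<Omega>2 (%p. a2 (fst p) - f2 (fst p))) + norm2 (cut \<Omega>3 (%p. a3 (fst p) - f3 (fst p))))"
   unfolding FE
   by (rule order_trans[OF l2norm_triangle[OF c1(1)[OF d1] square_int_add[OF c2(1)[OF d2] c3(1)[OF d3]]]
      add_left_mono[OF l2norm_triangle[OF c2(1)[OF d2] c3(1)[OF d3]]]])
  also have "... < \<epsilon>"
   using c1(2)[OF d1] c2(2)[OF d2] c3(2)[OF d3] lt[OF a1(2)] lt[OF a2(2)] lt[OF a3(2)] by linarith
  finally show "\<exists>v\<in>H1_Gamma_s \<Gamma>L \<Omega>. L2_dist (lebesgue_on \<Omega>) (cls \<Omega> F) v < \<epsilon>" using E by blast
 qed
 then show ?thesis unfolding i by (rule imageI)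
qed

end

theorem theorem2p3:
  fixes \<omega> \<omega>1 \<omega>2 \<omega>3 :: "(real^2) set"
    and \<Omega> \<Omega>1 \<Omega>2 \<Omega>3 \<Gamma>L :: "((real^2) \<times> real) set"
    and h1 h2 h3 :: real
  assumes "open \<omega>" "bounded \<omega>" "connected \<omega>" "C2_boundary \<omega>"
    and "open \<omega>2" "C2_boundary \<omega>2" "compact (closure \<omega>2)" "closure \<omega>2 \<subseteq> \<omega>"
    and "\<omega>3 = \<omega>2"
    and "\<omega>1 = \<omega> - closure \<omega>2"
    and "h1 > 0" "h2 > 0" "h3 > 0" "h1 > h2 + h3"
    and "\<Omega> = (\<omega> \<times> {0<..<h1}) - closure (\<omega>2 \<times> {h3<..<h1 - h2})"
    and "\<Omega>1 = \<omega>1 \<times> {0<..<h1}"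
    and "\<Omega>2 = \<omega>2 \<times> {h1 - h2<..<h1}"
    and "\<Omega>3 = \<omega>3 \<times> {0<..<h3}"
    and "\<Gamma>L = (frontier \<omega> \<times> {0..h1}) \<union> (frontier \<omega>2 \<times> {h3..h1 - h2})"
  shows "(\<forall>\<Gamma>\<in>{{}, \<Gamma>L}.
            iota_oplus \<omega>1 \<omega>2 \<omega>3 \<Omega>1 \<Omega>2 \<Omega>3 ` L2_Gamma_s \<Gamma> \<Omega> = L_oplus \<omega>1 \<omega>2 \<omega>3) \<and>
         iota_oplus \<omega>1 \<omega>2 \<omega>3 \<Omega>1 \<Omega>2 \<Omega>3 ` H1_Gamma_s {} \<Omega> = HC_oplus \<omega>1 \<omega>2 \<omega>3 \<and>
         iota_oplus \<omega>1 \<omega>2 \<omega>3 \<Omega>1 \<Omega>2 \<Omega>3 ` H1_Gamma_s \<Gamma>L \<Omega> = H0_oplus \<omega>1 \<omega>2 \<omega>3"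
proof -
 interpret perforated_domain \<omega> \<omega>1 \<omega>2 \<Omega> \<Omega>1 \<Omega>2 \<Omega>3 \<Gamma>L h1 h2 h3
  by unfold_locales (use assms in auto)
 \<comment> \<open>Both choices of \<open>\<Gamma>\<close> at once: the range bound holds for every
   \<open>\<Gamma>\<close>, and a preimage found for \<open>\<Gamma>L\<close> also lies in the
   larger space belonging to the empty set.\<close>
 have "\<iota> ` L2_Gamma_s \<Gamma> \<Omega> = L_oplus \<omega>1 \<omega>2 \<omega>2" if "\<Gamma> \<in> {{}, \<Gamma>L}" for \<Gamma>
  using that L2_range L2_lift L2_Gamma_s_mono[of \<Gamma>L] by blast
 moreover have "\<iota> ` H1_Gamma_s {} \<Omega> = HC_oplus \<omega>1 \<omega>2 \<omega>2" using iota_range(1) HC_lift by blast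
 moreover have "\<iota> ` H1_Gamma_s \<Gamma>L \<Omega> = H0_oplus \<omega>1 \<omega>2 \<omega>2" using iota_range(2)[OF _ refl] H0_lift by blast
 ultimately show ?thesis unfolding \<open>\<omega>3 = \<omega>2\<close> by blast
qed

end
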